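(* Let $\mathcal G$ be an $S^1$-bundle gerbe over a smooth manifold $M$, given by $P\rightrightarrows X$ and $\pi:X\to M$, with connection $\gamma$ and curving $B$, and resulting 3-curvature $\chi\in\Omega^3(M)$. Let $$G=\{(\mathbf x,\mathbf p,g)\in\mathbb X(\mathcal G)_0\times C^\infty(X)\ :\ \delta g=\iota_{\mathbf p}\gamma\},$$ with bracket $$[(\mathbf x,\mathbf p,g),(\mathbf z,\mathbf r,h)]=\big([\mathbf x,\mathbf z],[\mathbf p,\mathbf r],\ L_{\mathbf x}h-L_{\mathbf z}g-\iota_{\mathbf z}\iota_{\mathbf x}B\big)$$ and structure maps - $\sigma:G\to\mathbb X(\mathcal G)_0$, $\sigma(\mathbf x,\mathbf p,g)=(\mathbf x,\mathbf p)$; - $\rho:G\to\mathfrak X(M)$, $\rho(\mathbf x,\mathbf p,g)=x$, the vector field on $M$ to which $\mathbf x$ projects; - $\lambda:C^\infty(M)\to G$, $\lambda(f)=(0,0,\pi^*f)$; - $\kappa:\Gamma(A_P)\to G$, $\kappa(a)=(\mathbf a,\bar{\mathbf a},-\mathsf v_a)$. Then $G$, with this bracket and these maps, defines an invertible butterfly $\mathsf G:\mathbb X(\mathcal G)\dashrightarrow\mathbb A(M,\chi)$.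
   Context: **Lie 2-algebras.** A Lie 2-algebra $V$ consists of a linear map $\partial:V_1\to V_0$ of real vector spaces, a skew bilinear bracket $V_0\times V_0\to V_0$, a bilinear bracket $V_0\times V_1\to V_1$ (with $[a,x]:=-[x,a]$), and an alternating trilinear Jacobiator $J:V_0^3\to V_1$, such that $\partial[x,a]=[x,\partial a]$, $[\partial a,b]=[a,\partial b]$, $\partial J(x,y,z)=[x,[y,z]]+[y,[z,x]]+[z,[x,y]]$, $J(x,y,\partial a)=[x,[y,a]]+[y,[a,x]]+[a,[x,y]]$, and $\sum_i(-1)^{i+1}[x_i,J(\dots\widehat{x_i}\dots)]+\sum_{i<j}(-1)^{i+j}J([x_i,x_j],\dots\widehat{x_i}\dots\widehat{x_j}\dots)=0$ for $x_1,\dots,x_4\in V_0$. It is strict if $J=0$. **Butterflies.** A butterfly $V\dashrightarrow W$ is a vector space $E$ with a skew bilinear bracket and linear maps $\kappa:V_1\to E$, $\lambda:W_1\to E$, $\sigma:E\to V_0$, $\rho:E\to W_0$ such that $\sigma\kappa=\partial_V$, $\rho\lambda=\partial_W$, $\rho\kappa=0$, $\sigma\lambda=0$; the sequence $0\to W_1\xrightarrow{\lambda}E\xrightarrow{\sigma}V_0\to0$ is exact; $\sigma$ and $\rho$ preserve brackets; $[e,\lambda(w)]=\lambda[\rho(e),w]$ and $[e,\kappa(v)]=\kappa[\sigma(e),v]$; and $[e_1,[e_2,e_3]]+[e_2,[e_3,e_1]]+[e_3,[e_1,e_2]]=\lambda J_W(\rho e_1,\rho e_2,\rho e_3)+\kappa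 J_V(\sigma e_1,\sigma e_2,\sigma e_3)$. It is invertible if also $0\to V_1\xrightarrow{\kappa}E\xrightarrow{\rho}W_0\to0$ is exact. **Bundle gerbes.** An $S^1$-bundle gerbe $\mathcal G$ over $M$ consists of a surjective submersion $\pi:X\to M$, a Lie groupoid $P\rightrightarrows X$ (source $s$, target $t$; product $p\cdot q$ defined when $s(p)=t(q)$; unit map $\epsilon:X\to P$), a morphism of Lie groupoids over $\mathrm{id}_X$ from $P$ to the submersion groupoid $X\times_MX\rightrightarrows X$, and a left $S^1$-action on $P$ making $P\to X\times_MX$ a principal $S^1$-bundle with $(zp)\cdot(wq)=(zw)(p\cdot q)$. The simplicial differential is $\delta\omega=s^*\omega-t^*\omega$ for $\omega\in\Omega^\bullet(X)$ and $\delta\omega=\mathrm{pr}_1^*\omega-m^*\omega+\mathrm{pr}_2^*\omega$ for $\omega\in\Omega^\bullet(P)$, $m$ the multiplication. A connection on $\mathcal G$ is a principal connection 1-form $\gamma\in\Omega^1(P)$ (real-valued) with $\delta\gamma=0$. A curving for $\gamma$ is $B\in\Omega^2(X)$ with $\delta B=d\gamma$. The 3-curvature is the $\chi\in\Omega^3(M)$ with $\pi^*\chi=dB$. **The Lie 2-algebra $\mathbb X(\mathcal G)$ of multiplicative vector fields.** A multiplicative vector field on $P\rightrightarrows X$ is a pair $(\mathbf x,\mathbf p)\in\mathfrak X(X)\times\mathfrak X(P)$ forming a functor from $P\rightrightarrows X$ to $TP\rightrightarrows TX$; such an $\mathbf x$ projects to a vector field $x$ on $M$. Let $A_P=\ker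 ds|_X$ be the Lie algebroid. For $a\in\Gamma(A_P)$ put $\mathbf a=dt(a)\in\mathfrak X(X)$, $\overrightarrow a(p)=dR_p(a(t(p)))$, $\overleftarrow a(p)=d(L_p\circ i)(a(s(p)))$ ($i$ = inversion), $\bar{\mathbf a}=\overrightarrow a+\overleftarrow a$, and $\mathsf v_a=\epsilon^*(\iota_{\overrightarrow a}\gamma)\in C^\infty(X)$. $\mathbb X(\mathcal G)$ is the strict Lie 2-algebra with degree-1 part $\Gamma(A_P)$, degree-0 part $\mathbb X(\mathcal G)_0$ the multiplicative vector fields, differential $\mathsf d a=(\mathbf a,\bar{\mathbf a})$, componentwise Lie bracket in degree 0, and $[(\mathbf x,\mathbf p),a]=[\mathbf p,\overrightarrow a]|_X$. **The Atiyah Lie 2-algebra $\mathbb A(M,\chi)$.** It has complex $C^\infty(M)\to\mathfrak X(M)$ with zero differential, Lie bracket of vector fields in degree 0, $[x,f]=L_xf$, and $J(x_1,x_2,x_3)=-\iota_{x_3}\iota_{x_2}\iota_{x_1}\chi$. *)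

theory Defs
  imports "HOL-Analysis.Analysis" "HOL-Library.Function_Algebras"
begin

section \<open>Functions into a real vector space\<close>

instantiation "fun" :: (type, real_vector) real_vector
begin

definition scaleR_fun :: "real \<Rightarrow> ('a \<Rightarrow> 'b) \<Rightarrow> 'a \<Rightarrow> 'b"
  where "scaleR_fun c f = (\<lambda>x. c *\<^sub>R f x)"

instance
  by standard (simp_all add: scaleR_fun_def fun_eq_iff scaleR_add_right scaleR_add_left)

end


section \<open>Lie 2-algebras and butterflies\<close>

text \<open>The vector spaces involved are linear subspaces of ambient real vector spaces; all structure
  maps are total functions of which only the values on these subspaces matter.\<close>

definition linear_on :: "'a::real_vector set \<Rightarrow> 'b::real_vector set \<Rightarrow> ('a \<Rightarrow> 'b) \<Rightarrow> bool"
  where "linear_on U W f \<longleftrightarrow> f ` U \<subseteq> W \<and>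
    (\<forall>u\<in>U. \<forall>v\<in>U. \<forall>a b. f (a *\<^sub>R u + b *\<^sub>R v) = a *\<^sub>R f u + b *\<^sub>R f v)"

definition bilinear_on ::
  "'a::real_vector set \<Rightarrow> 'b::real_vector set \<Rightarrow> 'c::real_vector set \<Rightarrow> ('a \<Rightarrow> 'b \<Rightarrow> 'c) \<Rightarrow> bool"
  where "bilinear_on U V W f \<longleftrightarrow>
    (\<forall>u\<in>U. linear_on V W (f u)) \<and> (\<forall>v\<in>V. linear_on U W (\<lambda>u. f u v))"

definition skew_bilinear_on :: "'a::real_vector set \<Rightarrow> ('a \<Rightarrow> 'a \<Rightarrow> 'a) \<Rightarrow> bool"
  where "skew_bilinear_on V f \<longleftrightarrow> bilinear_on V V V f \<and> (\<forall>x\<in>V. \<forall>y\<in>V. f x y = - f y x)"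

definition alternating_trilinear_on ::
  "'a::real_vector set \<Rightarrow> 'b::real_vector set \<Rightarrow> ('a \<Rightarrow> 'a \<Rightarrow> 'a \<Rightarrow> 'b) \<Rightarrow> bool"
  where "alternating_trilinear_on V W J \<longleftrightarrow>
    (\<forall>x\<in>V. \<forall>y\<in>V. linear_on V W (\<lambda>z. J x y z) \<and> linear_on V W (\<lambda>z. J x z y)
        \<and> linear_on V W (\<lambda>z. J z x y)) \<and>
    (\<forall>x\<in>V. \<forall>y\<in>V. J x x y = 0 \<and> J x y x = 0 \<and> J y x x = 0)"

text \<open>\<open>bra x a\<close> is the bracket \<open>[x, a]\<close> of \<open>x\<close> in degree 0 with \<open>a\<close> in degree 1;
  the bracket \<open>[a, x]\<close> is written out as \<open>- bra x a\<close>.\<close>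

record ('a, 'b) lie2 =
  V0 :: "'a set"
  V1 :: "'b set"
  dd :: "'b \<Rightarrow> 'a"
  br :: "'a \<Rightarrow> 'a \<Rightarrow> 'a"
  bra :: "'a \<Rightarrow> 'b \<Rightarrow> 'b"
  jac :: "'a \<Rightarrow> 'a \<Rightarrow> 'a \<Rightarrow> 'b"

definition lie_2_algebra :: "('a::real_vector, 'b::real_vector) lie2 \<Rightarrow> bool"
  where "lie_2_algebra L \<longleftrightarrow>
    subspace (V0 L) \<and> subspace (V1 L) \<and>
    linear_on (V1 L) (V0 L) (dd L) \<and>
    skew_bilinear_on (V0 L) (br L) \<and>
    bilinear_on (V0 L) (V1 L) (V1 L) (bra L) \<and>
    alternating_trilinear_on (V0 L) (V1 L) (jac L) \<and>
    (\<forall>x\<in>V0 L. \<forall>a\<in>V1 L. dd L (bra L x a) = br L x (dd L a)) \<and>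
    (\<forall>a\<in>V1 L. \<forall>b\<in>V1 L. bra L (dd L a) b = - bra L (dd L b) a) \<and>
    (\<forall>x\<in>V0 L. \<forall>y\<in>V0 L. \<forall>z\<in>V0 L.
       dd L (jac L x y z) = br L x (br L y z) + br L y (br L z x) + br L z (br L x y)) \<and>
    (\<forall>x\<in>V0 L. \<forall>y\<in>V0 L. \<forall>a\<in>V1 L.
       jac L x y (dd L a) = bra L x (bra L y a) + bra L y (- bra L x a) + (- bra L (br L x y) a)) \<and>
    (\<forall>x1\<in>V0 L. \<forall>x2\<in>V0 L. \<forall>x3\<in>V0 L. \<forall>x4\<in>V0 L.
       bra L x1 (jac L x2 x3 x4) - bra L x2 (jac L x1 x3 x4)
       + bra L x3 (jac L x1 x2 x4) - bra L x4 (jac L x1 x2 x3)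
       - jac L (br L x1 x2) x3 x4 + jac L (br L x1 x3) x2 x4 - jac L (br L x1 x4) x2 x3
       - jac L (br L x2 x3) x1 x4 + jac L (br L x2 x4) x1 x3 - jac L (br L x3 x4) x1 x2 = 0)"

text \<open>\<open>short_exact i U E p W\<close>: the sequence \<open>0 \<rightarrow> U \<rightarrow> E \<rightarrow> W \<rightarrow> 0\<close> with maps \<open>i\<close>, \<open>p\<close> is exact.\<close>

definition short_exact ::
  "('u \<Rightarrow> 'e) \<Rightarrow> 'u set \<Rightarrow> 'e set \<Rightarrow> ('e \<Rightarrow> 'w::zero) \<Rightarrow> 'w set \<Rightarrow> bool"
  where "short_exact i U E p W \<longleftrightarrow> inj_on i U \<and> i ` U = {e\<in>E. p e = 0} \<and> p ` E = W"

definition butterfly ::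
  "('v0::real_vector, 'v1::real_vector) lie2 \<Rightarrow> ('w0::real_vector, 'w1::real_vector) lie2 \<Rightarrow>
   'e::real_vector set \<Rightarrow> ('e \<Rightarrow> 'e \<Rightarrow> 'e) \<Rightarrow>
   ('v1 \<Rightarrow> 'e) \<Rightarrow> ('w1 \<Rightarrow> 'e) \<Rightarrow> ('e \<Rightarrow> 'v0) \<Rightarrow> ('e \<Rightarrow> 'w0) \<Rightarrow> bool"
  where "butterfly V W E brE \<kappa> \<Lambda> \<sigma> \<rho> \<longleftrightarrow>
    lie_2_algebra V \<and> lie_2_algebra W \<and>
    subspace E \<and> skew_bilinear_on E brE \<and>
    linear_on (V1 V) E \<kappa> \<and> linear_on (V1 W) E \<Lambda> \<and>
    linear_on E (V0 V) \<sigma> \<and> linear_on E (V0 W) \<rho> \<and>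
    (\<forall>v\<in>V1 V. \<sigma> (\<kappa> v) = dd V v) \<and> (\<forall>w\<in>V1 W. \<rho> (\<Lambda> w) = dd W w) \<and>
    (\<forall>v\<in>V1 V. \<rho> (\<kappa> v) = 0) \<and> (\<forall>w\<in>V1 W. \<sigma> (\<Lambda> w) = 0) \<and>
    short_exact \<Lambda> (V1 W) E \<sigma> (V0 V) \<and>
    (\<forall>e\<in>E. \<forall>e'\<in>E. \<sigma> (brE e e') = br V (\<sigma> e) (\<sigma> e') \<and> \<rho> (brE e e') = br W (\<rho> e) (\<rho> e')) \<and>
    (\<forall>e\<in>E. \<forall>w\<in>V1 W. brE e (\<Lambda> w) = \<Lambda> (bra W (\<rho> e) w)) \<and>
    (\<forall>e\<in>E. \<forall>v\<in>V1 V. brE e (\<kappa> v) = \<kappa> (bra V (\<sigma> e) v)) \<and>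
    (\<forall>e1\<in>E. \<forall>e2\<in>E. \<forall>e3\<in>E.
       brE e1 (brE e2 e3) + brE e2 (brE e3 e1) + brE e3 (brE e1 e2)
       = \<Lambda> (jac W (\<rho> e1) (\<rho> e2) (\<rho> e3)) + \<kappa> (jac V (\<sigma> e1) (\<sigma> e2) (\<sigma> e3)))"

definition invertible_butterfly ::
  "('v0::real_vector, 'v1::real_vector) lie2 \<Rightarrow> ('w0::real_vector, 'w1::real_vector) lie2 \<Rightarrow>
   'e::real_vector set \<Rightarrow> ('e \<Rightarrow> 'e \<Rightarrow> 'e) \<Rightarrow>
   ('v1 \<Rightarrow> 'e) \<Rightarrow> ('w1 \<Rightarrow> 'e) \<Rightarrow> ('e \<Rightarrow> 'v0) \<Rightarrow> ('e \<Rightarrow> 'w0) \<Rightarrow> bool"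
  where "invertible_butterfly V W E brE \<kappa> \<Lambda> \<sigma> \<rho> \<longleftrightarrow>
    butterfly V W E brE \<kappa> \<Lambda> \<sigma> \<rho> \<and> short_exact \<kappa> (V1 V) E \<rho> (V0 W)"


section \<open>Smooth manifolds and smooth maps\<close>

primrec Ck_on :: "nat \<Rightarrow> ('e::real_normed_vector \<Rightarrow> 'f::real_normed_vector) \<Rightarrow> 'e set \<Rightarrow> bool"
  where
    "Ck_on 0 f U \<longleftrightarrow> continuous_on U f"
  | "Ck_on (Suc k) f U \<longleftrightarrow> (\<forall>x\<in>U. f differentiable (at x)) \<and>
       (\<forall>v. Ck_on k (\<lambda>x. frechet_derivative f (at x) v) U)"

text \<open>Smoothness on an arbitrary subset means local extendability to smooth functions on open sets.\<close>

definition smooth_on :: "('e::real_normed_vector \<Rightarrow> 'f::real_normed_vector) \<Rightarrow> 'e set \<Rightarrow> bool"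
  where "smooth_on f S \<longleftrightarrow>
    (\<forall>x\<in>S. \<exists>U g. open U \<and> x \<in> U \<and> (\<forall>k. Ck_on k g U) \<and> (\<forall>y\<in>U \<inter> S. g y = f y))"

text \<open>A \<open>space\<close> is a set of points \<open>pts\<close> inside a type carrying an atlas. Manifolds have
  \<open>pts = UNIV\<close>; embedded submanifolds of them (fibre products, the circle, source fibres, open
  subsets) are obtained by shrinking \<open>pts\<close>, keeping the ambient atlas.\<close>

record ('a, 'e) space =
  charts :: "('a set \<times> ('a \<Rightarrow> 'e)) set"
  pts :: "'a set"

text \<open>The dimension of a manifold with charts in the type \<open>'e\<close> is \<open>DIM('e)\<close> (case \<open>H = UNIV\<close>), or 0
  (case \<open>H = {0}\<close>); the second case is needed because \<open>DIM('e) \<ge> 1\<close> for every type \<open>'e\<close>.\<close>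

definition manifold ::
  "('a::{t2_space, second_countable_topology}, 'e::euclidean_space) space \<Rightarrow> bool"
  where "manifold X \<longleftrightarrow>
    pts X = UNIV \<and> (\<Union>(U, \<phi>)\<in>charts X. U) = UNIV \<and>
    (\<exists>H\<in>{UNIV, {0}}. \<forall>(U, \<phi>)\<in>charts X.
        open U \<and> openin (top_of_set H) (\<phi> ` U) \<and> homeomorphism U (\<phi> ` U) \<phi> (inv_into U \<phi>)) \<and>
    (\<forall>(U, \<phi>)\<in>charts X. \<forall>(V, \<psi>)\<in>charts X. smooth_on (\<psi> \<circ> inv_into U \<phi>) (\<phi> ` (U \<inter> V)))"

definition smooth_map ::
  "('a::topological_space, 'e::euclidean_space) space \<Rightarrow>
   ('b::topological_space, 'f::euclidean_space) space \<Rightarrow> ('a \<Rightarrow> 'b) \<Rightarrow> bool"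
  where "smooth_map X Y f \<longleftrightarrow> f ` pts X \<subseteq> pts Y \<and>
    (\<forall>x\<in>pts X. \<exists>W g. open W \<and> x \<in> W \<and> (\<forall>y\<in>W \<inter> pts X. g y = f y) \<and> continuous_on W g \<and>
       (\<forall>(U, \<phi>)\<in>charts X. \<forall>(V, \<psi>)\<in>charts Y.
          smooth_on (\<psi> \<circ> g \<circ> inv_into U \<phi>) (\<phi> ` (U \<inter> W \<inter> g -` V))))"

definition diffeo ::
  "('a::topological_space, 'e::euclidean_space) space \<Rightarrow>
   ('b::topological_space, 'f::euclidean_space) space \<Rightarrow> ('a \<Rightarrow> 'b) \<Rightarrow> bool"
  where "diffeo X Y f \<longleftrightarrow>
    bij_betw f (pts X) (pts Y) \<and> smooth_map X Y f \<and> smooth_map Y X (inv_into (pts X) f)"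

definition eucl :: "('e::euclidean_space, 'e) space"
  where "eucl = \<lparr>charts = {(UNIV, id)}, pts = UNIV\<rparr>"

definition circle :: "(complex, complex) space"
  where "circle = eucl\<lparr>pts := {z. norm z = 1}\<rparr>"

definition prod_space :: "('a, 'e) space \<Rightarrow> ('b, 'f) space \<Rightarrow> ('a \<times> 'b, 'e \<times> 'f) space"
  where "prod_space X Y =
    \<lparr>charts = {(U \<times> V, map_prod \<phi> \<psi>) | U \<phi> V \<psi>. (U, \<phi>) \<in> charts X \<and> (V, \<psi>) \<in> charts Y},
     pts = pts X \<times> pts Y\<rparr>"

definition fibre_prod ::
  "('a, 'e) space \<Rightarrow> ('b, 'f) space \<Rightarrow> ('a \<Rightarrow> 'c) \<Rightarrow> ('b \<Rightarrow> 'c) \<Rightarrow> ('a \<times> 'b, 'e \<times> 'f) space"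
  where "fibre_prod X Y f g =
    (prod_space X Y)\<lparr>pts := {(x, y). x \<in> pts X \<and> y \<in> pts Y \<and> f x = g y}\<rparr>"


section \<open>Tangent vectors, vector fields and differential forms\<close>

definition cinf :: "('a::topological_space, 'e::euclidean_space) space \<Rightarrow> ('a \<Rightarrow> real) set"
  where "cinf X = {f. smooth_map X eucl f}"

type_synonym 'a tvec = "('a \<Rightarrow> real) \<Rightarrow> real"

text \<open>Tangent vectors are point derivations of the algebra of smooth functions. They vanish
  on non-smooth functions, so that equality of tangent vectors is equality of functions.\<close>

definition tangent_space ::
  "('a::topological_space, 'e::euclidean_space) space \<Rightarrow> 'a \<Rightarrow> 'a tvec set"
  where "tangent_space X p = {v.
    (\<forall>f\<in>cinf X. \<forall>g\<in>cinf X. \<forall>a b. v (\<lambda>y. a * f y + b * g y) = a * v f + b * v g) \<and>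
    (\<forall>f\<in>cinf X. \<forall>g\<in>cinf X. v (\<lambda>y. f y * g y) = f p * v g + g p * v f) \<and>
    (\<forall>f. f \<notin> cinf X \<longrightarrow> v f = 0)}"

text \<open>\<open>tmap Y f v\<close> is the push-forward of \<open>v\<close> under a smooth map \<open>f\<close> with target \<open>Y\<close>.\<close>

definition tmap ::
  "('b::topological_space, 'f::euclidean_space) space \<Rightarrow> ('a \<Rightarrow> 'b) \<Rightarrow> 'a tvec \<Rightarrow> 'b tvec"
  where "tmap Y f v = (\<lambda>g. if g \<in> cinf Y then v (g \<circ> f) else 0)"

text \<open>For a submanifold \<open>S\<close> and a vector \<open>v\<close> of the ambient manifold which is tangent to \<open>S\<close> at \<open>p\<close>,
  \<open>tangent_to S p v\<close> is \<open>v\<close> regarded as an element of the tangent space of \<open>S\<close>.\<close>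

definition tangent_to ::
  "('a::topological_space, 'e::euclidean_space) space \<Rightarrow> 'a \<Rightarrow> 'a tvec \<Rightarrow> 'a tvec"
  where "tangent_to S p v =
    (THE w. w \<in> tangent_space S p \<and> (\<forall>f\<in>cinf (S\<lparr>pts := UNIV\<rparr>). w f = v f))"

definition surjective_submersion ::
  "('a::topological_space, 'e::euclidean_space) space \<Rightarrow>
   ('b::topological_space, 'f::euclidean_space) space \<Rightarrow> ('a \<Rightarrow> 'b) \<Rightarrow> bool"
  where "surjective_submersion X Y f \<longleftrightarrow> smooth_map X Y f \<and> f ` pts X = pts Y \<and>
    (\<forall>p\<in>pts X. tmap Y f ` tangent_space X p = tangent_space Y (f p))"

definition vector_fields ::
  "('a::topological_space, 'e::euclidean_space) space \<Rightarrow> ('a \<Rightarrow> 'a tvec) set"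
  where "vector_fields X =
    {x. (\<forall>p\<in>pts X. x p \<in> tangent_space X p) \<and> (\<forall>f\<in>cinf X. (\<lambda>p. x p f) \<in> cinf X)}"

definition lie_deriv :: "('a \<Rightarrow> 'a tvec) \<Rightarrow> ('a \<Rightarrow> real) \<Rightarrow> 'a \<Rightarrow> real"
  where "lie_deriv x f = (\<lambda>p. x p f)"

definition lie_bracket :: "('a \<Rightarrow> 'a tvec) \<Rightarrow> ('a \<Rightarrow> 'a tvec) \<Rightarrow> 'a \<Rightarrow> 'a tvec"
  where "lie_bracket x y = (\<lambda>p f. x p (lie_deriv y f) - y p (lie_deriv x f))"

text \<open>A \<open>k\<close>-form takes a point and a list of \<open>k\<close> tangent vectors at that point; its values on
  other arguments are irrelevant. Smoothness is tested on smooth vector fields.\<close>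

type_synonym 'a form = "'a \<Rightarrow> 'a tvec list \<Rightarrow> real"

definition forms ::
  "('a::topological_space, 'e::euclidean_space) space \<Rightarrow> nat \<Rightarrow> 'a form set"
  where "forms X k = {\<omega>.
    (\<forall>p\<in>pts X. \<forall>vs. length vs = k \<and> set vs \<subseteq> tangent_space X p \<longrightarrow>
       (\<forall>i<k. \<forall>v\<in>tangent_space X p. \<forall>w\<in>tangent_space X p. \<forall>a b.
          \<omega> p (vs[i := a *\<^sub>R v + b *\<^sub>R w]) = a * \<omega> p (vs[i := v]) + b * \<omega> p (vs[i := w])) \<and>
       (\<not> distinct vs \<longrightarrow> \<omega> p vs = 0)) \<and>
    (\<forall>xs. length xs = k \<and> set xs \<subseteq> vector_fields X \<longrightarrow> (\<lambda>p. \<omega> p (map (\<lambda>x. x p) xs)) \<in> cinf X)}"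

definition pullback ::
  "('b::topological_space, 'f::euclidean_space) space \<Rightarrow> ('a \<Rightarrow> 'b) \<Rightarrow> 'b form \<Rightarrow> 'a form"
  where "pullback Y f \<omega> = (\<lambda>p vs. \<omega> (f p) (map (tmap Y f) vs))"

definition interior_prod :: "('a \<Rightarrow> 'a tvec) \<Rightarrow> 'a form \<Rightarrow> 'a form"
  where "interior_prod x \<omega> = (\<lambda>p vs. \<omega> p (x p # vs))"

definition form_fun :: "'a form \<Rightarrow> 'a \<Rightarrow> real"
  where "form_fun \<omega> = (\<lambda>p. \<omega> p [])"

text \<open>\<open>ext_deriv X k \<omega> \<eta>\<close> says \<open>\<eta> = d\<omega>\<close> for a \<open>k\<close>-form \<open>\<omega>\<close>, through the invariant (Koszul) formula
  (normalised such that \<open>d\<omega>(x, y) = x(\<omega>(y)) - y(\<omega>(x)) - \<omega>([x, y])\<close> for 1-forms).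
  \<open>nths xs (- {i, j})\<close> is the list \<open>xs\<close> without its \<open>i\<close>-th and \<open>j\<close>-th entries.\<close>

definition ext_deriv ::
  "('a::topological_space, 'e::euclidean_space) space \<Rightarrow> nat \<Rightarrow> 'a form \<Rightarrow> 'a form \<Rightarrow> bool"
  where "ext_deriv X k \<omega> \<eta> \<longleftrightarrow> \<omega> \<in> forms X k \<and> \<eta> \<in> forms X (Suc k) \<and>
    (\<forall>xs. length xs = Suc k \<and> set xs \<subseteq> vector_fields X \<longrightarrow> (\<forall>p\<in>pts X.
       \<eta> p (map (\<lambda>x. x p) xs) =
         (\<Sum>i\<le>k. (-1) ^ i * (xs ! i) p (\<lambda>q. \<omega> q (map (\<lambda>x. x q) (nths xs (- {i}))))) +
         (\<Sum>j\<le>k. \<Sum>i<j. (-1) ^ (i + j) *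
            \<omega> p (lie_bracket (xs ! i) (xs ! j) p # map (\<lambda>x. x p) (nths xs (- {i, j}))))))"


section \<open>Lie groupoids\<close>

text \<open>\<open>mul p q\<close> is defined when \<open>src p = tgt q\<close>.\<close>

record ('p, 'e, 'x, 'f) groupoid =
  arr :: "('p, 'e) space"
  obj :: "('x, 'f) space"
  src :: "'p \<Rightarrow> 'x"
  tgt :: "'p \<Rightarrow> 'x"
  mul :: "'p \<Rightarrow> 'p \<Rightarrow> 'p"
  unt :: "'x \<Rightarrow> 'p"
  ivs :: "'p \<Rightarrow> 'p"

definition composable :: "('p, 'e, 'x, 'f) groupoid \<Rightarrow> ('p \<times> 'p, 'e \<times> 'e) space"
  where "composable P = fibre_prod (arr P) (arr P) (src P) (tgt P)"

definition lie_groupoid ::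
  "('p::{t2_space, second_countable_topology}, 'e::euclidean_space,
    'x::{t2_space, second_countable_topology}, 'f::euclidean_space) groupoid \<Rightarrow> bool"
  where "lie_groupoid P \<longleftrightarrow>
    manifold (arr P) \<and> manifold (obj P) \<and>
    surjective_submersion (arr P) (obj P) (src P) \<and>
    surjective_submersion (arr P) (obj P) (tgt P) \<and>
    smooth_map (composable P) (arr P) (\<lambda>(p, q). mul P p q) \<and>
    smooth_map (obj P) (arr P) (unt P) \<and>
    smooth_map (arr P) (arr P) (ivs P) \<and>
    (\<forall>p q. src P p = tgt P q \<longrightarrow>
       src P (mul P p q) = src P q \<and> tgt P (mul P p q) = tgt P p) \<and>
    (\<forall>p q r. src P p = tgt P q \<and> src P q = tgt P r \<longrightarrow>
       mul P (mul P p q) r = mul P p (mul P q r)) \<and>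
    (\<forall>x. src P (unt P x) = x \<and> tgt P (unt P x) = x) \<and>
    (\<forall>p. mul P (unt P (tgt P p)) p = p \<and> mul P p (unt P (src P p)) = p) \<and>
    (\<forall>p. src P (ivs P p) = tgt P p \<and> tgt P (ivs P p) = src P p \<and>
       mul P p (ivs P p) = unt P (tgt P p) \<and> mul P (ivs P p) p = unt P (src P p))"

text \<open>The submersion groupoid of \<open>\<pi>\<close>, with \<open>(x, y) \<cdot> (y, z) = (x, z)\<close>. Its arrow space is the
  submanifold \<open>X \<times>\<^sub>M X\<close> of \<open>X \<times> X\<close>; it only occurs as the target of a morphism.\<close>

definition submersion_groupoid ::
  "('x, 'f) space \<Rightarrow> ('x \<Rightarrow> 'm) \<Rightarrow> ('x \<times> 'x, 'f \<times> 'f, 'x, 'f) groupoid"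
  where "submersion_groupoid X \<pi> =
    \<lparr>arr = fibre_prod X X \<pi> \<pi>, obj = X, src = snd, tgt = fst,
     mul = (\<lambda>p q. (fst p, snd q)), unt = (\<lambda>x. (x, x)), ivs = prod.swap\<rparr>"

definition groupoid_morphism_over_id ::
  "('p::topological_space, 'e::euclidean_space, 'x, 'f) groupoid \<Rightarrow>
   ('q::topological_space, 'g::euclidean_space, 'x, 'f) groupoid \<Rightarrow> ('p \<Rightarrow> 'q) \<Rightarrow> bool"
  where "groupoid_morphism_over_id P Q \<Phi> \<longleftrightarrow>
    smooth_map (arr P) (arr Q) \<Phi> \<and>
    (\<forall>p. src Q (\<Phi> p) = src P p \<and> tgt Q (\<Phi> p) = tgt P p) \<and>
    (\<forall>p q. src P p = tgt P q \<longrightarrow> \<Phi> (mul P p q) = mul Q (\<Phi> p) (\<Phi> q)) \<and>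
    (\<forall>x. \<Phi> (unt P x) = unt Q x)"

text \<open>The multiplication of the tangent groupoid: the differential of the multiplication, applied to
  the vector tangent to the manifold of composable pairs that has components \<open>v\<close> and \<open>w\<close>.\<close>

definition tangent_mul ::
  "('p::topological_space, 'e::euclidean_space, 'x, 'f) groupoid \<Rightarrow> 'p \<Rightarrow> 'p \<Rightarrow>
   'p tvec \<Rightarrow> 'p tvec \<Rightarrow> 'p tvec"
  where "tangent_mul P p q v w = tmap (arr P) (\<lambda>(p, q). mul P p q)
    (THE u. u \<in> tangent_space (composable P) (p, q) \<and> tmap (arr P) fst u = v \<and> tmap (arr P) snd u = w)"

definition multiplicative_vfs ::
  "('p::topological_space, 'e::euclidean_space, 'x::topological_space, 'f::euclidean_space) groupoid \<Rightarrow>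
   (('x \<Rightarrow> 'x tvec) \<times> ('p \<Rightarrow> 'p tvec)) set"
  where "multiplicative_vfs P = {(x, pv).
    x \<in> vector_fields (obj P) \<and> pv \<in> vector_fields (arr P) \<and>
    (\<forall>q. tmap (obj P) (src P) (pv q) = x (src P q) \<and> tmap (obj P) (tgt P) (pv q) = x (tgt P q)) \<and>
    (\<forall>y. tmap (arr P) (unt P) (x y) = pv (unt P y)) \<and>
    (\<forall>q r. src P q = tgt P r \<longrightarrow> tangent_mul P q r (pv q) (pv r) = pv (mul P q r))}"

text \<open>Sections of the Lie algebroid \<open>ker ds|\<^sub>X\<close>, a subbundle of the restriction of the tangent bundle
  of the arrow manifold along the unit map.\<close>

definition algebroid_sections ::
  "('p::topological_space, 'e::euclidean_space, 'x::topological_space, 'f::euclidean_space) groupoid \<Rightarrow>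
   ('x \<Rightarrow> 'p tvec) set"
  where "algebroid_sections P = {a.
    (\<forall>y. a y \<in> tangent_space (arr P) (unt P y) \<and> tmap (obj P) (src P) (a y) = 0) \<and>
    (\<forall>f\<in>cinf (arr P). (\<lambda>y. a y f) \<in> cinf (obj P))}"

definition anchor ::
  "('p, 'e, 'x::topological_space, 'f::euclidean_space) groupoid \<Rightarrow> ('x \<Rightarrow> 'p tvec) \<Rightarrow> 'x \<Rightarrow> 'x tvec"
  where "anchor P a = (\<lambda>y. tmap (obj P) (tgt P) (a y))"

definition source_fibre :: "('p, 'e, 'x, 'f) groupoid \<Rightarrow> 'x \<Rightarrow> ('p, 'e) space"
  where "source_fibre P y = (arr P)\<lparr>pts := {q \<in> pts (arr P). src P q = y}\<rparr>"

definition right_vf ::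
  "('p::topological_space, 'e::euclidean_space, 'x, 'f) groupoid \<Rightarrow> ('x \<Rightarrow> 'p tvec) \<Rightarrow> 'p \<Rightarrow> 'p tvec"
  where "right_vf P a = (\<lambda>p. tmap (arr P) (\<lambda>q. mul P q p)
    (tangent_to (source_fibre P (tgt P p)) (unt P (tgt P p)) (a (tgt P p))))"

definition left_vf ::
  "('p::topological_space, 'e::euclidean_space, 'x, 'f) groupoid \<Rightarrow> ('x \<Rightarrow> 'p tvec) \<Rightarrow> 'p \<Rightarrow> 'p tvec"
  where "left_vf P a = (\<lambda>p. tmap (arr P) (\<lambda>q. mul P p (ivs P q))
    (tangent_to (source_fibre P (src P p)) (unt P (src P p)) (a (src P p))))"

definition bar_vf ::
  "('p::topological_space, 'e::euclidean_space, 'x, 'f) groupoid \<Rightarrow> ('x \<Rightarrow> 'p tvec) \<Rightarrow> 'p \<Rightarrow> 'p tvec"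
  where "bar_vf P a = right_vf P a + left_vf P a"

definition mult_vf_lie2 ::
  "('p::topological_space, 'e::euclidean_space, 'x::topological_space, 'f::euclidean_space) groupoid \<Rightarrow>
   (('x \<Rightarrow> 'x tvec) \<times> ('p \<Rightarrow> 'p tvec), 'x \<Rightarrow> 'p tvec) lie2"
  where "mult_vf_lie2 P =
    \<lparr>V0 = multiplicative_vfs P,
     V1 = algebroid_sections P,
     dd = (\<lambda>a. (anchor P a, bar_vf P a)),
     br = (\<lambda>(x, pv) (z, rv). (lie_bracket x z, lie_bracket pv rv)),
     bra = (\<lambda>(x, pv) a. (\<lambda>y. lie_bracket pv (right_vf P a) (unt P y))),
     jac = (\<lambda>_ _ _. 0)\<rparr>"


section \<open>Bundle gerbes with connection\<close>

text \<open>\<open>Y\<close> may be a submanifold; a local trivialisation over \<open>pts Y \<inter> U\<close> is a diffeomorphism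
  \<open>\<tau>\<close> from its preimage to \<open>(Y \<inter> U) \<times> S\<^sup>1\<close>, commuting with the projections and equivariant.\<close>

definition principal_circle_bundle ::
  "('p::topological_space, 'e::euclidean_space) space \<Rightarrow>
   ('y::topological_space, 'g::euclidean_space) space \<Rightarrow> ('p \<Rightarrow> 'y) \<Rightarrow> (complex \<Rightarrow> 'p \<Rightarrow> 'p) \<Rightarrow> bool"
  where "principal_circle_bundle P Y \<Phi> act \<longleftrightarrow>
    smooth_map P Y \<Phi> \<and>
    smooth_map (prod_space circle P) P (\<lambda>(z, p). act z p) \<and>
    (\<forall>p\<in>pts P. act 1 p = p) \<and>
    (\<forall>z\<in>pts circle. \<forall>w\<in>pts circle. \<forall>p\<in>pts P. act z (act w p) = act (z * w) p) \<and>
    (\<forall>z\<in>pts circle. \<forall>p\<in>pts P. \<Phi> (act z p) = \<Phi> p) \<and>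
    (\<forall>y\<in>pts Y. \<exists>U \<tau>. open U \<and> y \<in> U \<and>
       diffeo (P\<lparr>pts := {p \<in> pts P. \<Phi> p \<in> U}\<rparr>) (prod_space (Y\<lparr>pts := pts Y \<inter> U\<rparr>) circle) \<tau> \<and>
       (\<forall>p\<in>pts P. \<Phi> p \<in> U \<longrightarrow> fst (\<tau> p) = \<Phi> p \<and>
          (\<forall>z\<in>pts circle. snd (\<tau> (act z p)) = z * snd (\<tau> p))))"

text \<open>The manifold \<open>X\<close> is \<open>obj P\<close>.\<close>

definition bundle_gerbe ::
  "('m::{t2_space, second_countable_topology}, 'd::euclidean_space) space \<Rightarrow>
   ('p::{t2_space, second_countable_topology}, 'e::euclidean_space,
    'x::{t2_space, second_countable_topology}, 'f::euclidean_space) groupoid \<Rightarrow>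
   ('x \<Rightarrow> 'm) \<Rightarrow> ('p \<Rightarrow> 'x \<times> 'x) \<Rightarrow> (complex \<Rightarrow> 'p \<Rightarrow> 'p) \<Rightarrow> bool"
  where "bundle_gerbe M P \<pi> \<Phi> act \<longleftrightarrow>
    manifold M \<and> lie_groupoid P \<and>
    surjective_submersion (obj P) M \<pi> \<and>
    groupoid_morphism_over_id P (submersion_groupoid (obj P) \<pi>) \<Phi> \<and>
    principal_circle_bundle (arr P) (fibre_prod (obj P) (obj P) \<pi> \<pi>) \<Phi> act \<and>
    (\<forall>z\<in>pts circle. \<forall>w\<in>pts circle. \<forall>p q. src P p = tgt P q \<longrightarrow>
       mul P (act z p) (act w q) = act (z * w) (mul P p q))"

text \<open>The Lie algebra of the circle is identified with the real line such that 1 generates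
  \<open>\<theta> \<mapsto> cis \<theta>\<close>; this normalises real-valued principal connections.\<close>

definition circle_generator ::
  "('p::topological_space, 'e::euclidean_space) space \<Rightarrow> (complex \<Rightarrow> 'p \<Rightarrow> 'p) \<Rightarrow> 'p \<Rightarrow> 'p tvec"
  where "circle_generator P act p =
    (\<lambda>f. if f \<in> cinf P then deriv (\<lambda>\<theta>. f (act (cis \<theta>) p)) 0 else 0)"

definition principal_connection ::
  "('p::topological_space, 'e::euclidean_space) space \<Rightarrow> (complex \<Rightarrow> 'p \<Rightarrow> 'p) \<Rightarrow> 'p form \<Rightarrow> bool"
  where "principal_connection P act \<gamma> \<longleftrightarrow> \<gamma> \<in> forms P 1 \<and>
    (\<forall>p\<in>pts P. \<gamma> p [circle_generator P act p] = 1) \<and>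
    (\<forall>z\<in>pts circle. \<forall>p\<in>pts P. \<forall>v\<in>tangent_space P p. pullback P (act z) \<gamma> p [v] = \<gamma> p [v])"

definition simplicial_diff0 ::
  "('p, 'e, 'x::topological_space, 'f::euclidean_space) groupoid \<Rightarrow> 'x form \<Rightarrow> 'p form"
  where "simplicial_diff0 P \<omega> =
    (\<lambda>p vs. pullback (obj P) (src P) \<omega> p vs - pullback (obj P) (tgt P) \<omega> p vs)"

definition simplicial_diff0_fun :: "('p, 'e, 'x, 'f) groupoid \<Rightarrow> ('x \<Rightarrow> real) \<Rightarrow> 'p \<Rightarrow> real"
  where "simplicial_diff0_fun P g = (\<lambda>p. g (src P p) - g (tgt P p))"

definition simplicial_diff1 ::
  "('p::topological_space, 'e::euclidean_space, 'x, 'f) groupoid \<Rightarrow> 'p form \<Rightarrow> ('p \<times> 'p) form"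
  where "simplicial_diff1 P \<omega> =
    (\<lambda>pq us. pullback (arr P) fst \<omega> pq us - pullback (arr P) (\<lambda>(p, q). mul P p q) \<omega> pq us
             + pullback (arr P) snd \<omega> pq us)"

definition gerbe_connection ::
  "('p::topological_space, 'e::euclidean_space, 'x, 'f) groupoid \<Rightarrow> (complex \<Rightarrow> 'p \<Rightarrow> 'p) \<Rightarrow>
   'p form \<Rightarrow> bool"
  where "gerbe_connection P act \<gamma> \<longleftrightarrow> principal_connection (arr P) act \<gamma> \<and>
    (\<forall>pq\<in>pts (composable P). \<forall>u\<in>tangent_space (composable P) pq. simplicial_diff1 P \<gamma> pq [u] = 0)"

definition curving ::
  "('p::topological_space, 'e::euclidean_space, 'x::topological_space, 'f::euclidean_space) groupoid \<Rightarrow>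
   'p form \<Rightarrow> 'x form \<Rightarrow> bool"
  where "curving P \<gamma> B \<longleftrightarrow> B \<in> forms (obj P) 2 \<and> ext_deriv (arr P) 1 \<gamma> (simplicial_diff0 P B)"

definition three_curvature ::
  "('m::topological_space, 'd::euclidean_space) space \<Rightarrow>
   ('p, 'e, 'x::topological_space, 'f::euclidean_space) groupoid \<Rightarrow>
   ('x \<Rightarrow> 'm) \<Rightarrow> 'x form \<Rightarrow> 'm form \<Rightarrow> bool"
  where "three_curvature M P \<pi> B \<Omega> \<longleftrightarrow>
    \<Omega> \<in> forms M 3 \<and> ext_deriv (obj P) 2 B (pullback M \<pi> \<Omega>)"

text \<open>\<open>interior_prod x3 (interior_prod x2 (interior_prod x1 \<Omega>))\<close> is \<open>\<Omega>(x1, x2, x3)\<close>.\<close>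

definition atiyah_lie2 ::
  "('m::topological_space, 'd::euclidean_space) space \<Rightarrow> 'm form \<Rightarrow> ('m \<Rightarrow> 'm tvec, 'm \<Rightarrow> real) lie2"
  where "atiyah_lie2 M \<Omega> =
    \<lparr>V0 = vector_fields M,
     V1 = cinf M,
     dd = (\<lambda>_. 0),
     br = lie_bracket,
     bra = lie_deriv,
     jac = (\<lambda>x1 x2 x3.
       - form_fun (interior_prod x3 (interior_prod x2 (interior_prod x1 \<Omega>))))\<rparr>"

definition v_fun ::
  "('p::topological_space, 'e::euclidean_space, 'x, 'f) groupoid \<Rightarrow> 'p form \<Rightarrow> ('x \<Rightarrow> 'p tvec) \<Rightarrow>
   'x \<Rightarrow> real"
  where "v_fun P \<gamma> a = form_fun (interior_prod (right_vf P a) \<gamma>) \<circ> unt P"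

definition projects_to ::
  "('m::topological_space, 'd::euclidean_space) space \<Rightarrow> ('x \<Rightarrow> 'm) \<Rightarrow> ('x \<Rightarrow> 'x tvec) \<Rightarrow>
   ('m \<Rightarrow> 'm tvec) \<Rightarrow> bool"
  where "projects_to M \<pi> x xM \<longleftrightarrow> xM \<in> vector_fields M \<and> (\<forall>y. tmap M \<pi> (x y) = xM (\<pi> y))"

definition projected_vf ::
  "('m::topological_space, 'd::euclidean_space) space \<Rightarrow> ('x \<Rightarrow> 'm) \<Rightarrow> ('x \<Rightarrow> 'x tvec) \<Rightarrow>
   'm \<Rightarrow> 'm tvec"
  where "projected_vf M \<pi> x = (THE xM. projects_to M \<pi> x xM)"

end

theory Submission
  imports Defs
begin

text \<open>
  A tangent vector of \<open>P\<close> is determined by its components under \<open>t\<close>, \<open>s\<close> and its value under \<open>\<gamma>\<close>, and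
  compatible triples of such data lift to vector fields on \<open>P\<close>. In these terms a pair \<open>(x, v)\<close> is
  multiplicative iff \<open>v\<close> projects to \<open>x\<close> along \<open>s\<close> and \<open>t\<close> and \<open>\<iota>\<^sub>v \<gamma>\<close> is an additive function on \<open>P\<close>.
  Additive functions vanish on the isotropy circles by compactness, so they descend to
  \<open>X \<times>\<^sub>M X\<close>, where a partition of unity on \<open>M\<close> makes them of the form \<open>\<delta>g\<close>; this gives the surjectivity
  of \<open>\<sigma>\<close>. Dually, a section \<open>a\<close> of the Lie algebroid is the same thing as a vertical vector field on
  \<open>X\<close> (its anchor) together with a function \<open>v\<^sub>a\<close>, which gives the exactness at \<open>\<kappa>\<close> and \<open>\<rho>\<close>. The
  connection component of each bracket is computed from \<open>d\<gamma> = \<delta>B\<close>, and the Jacobiator of \<open>G\<close> is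
  \<open>- dB = - \<pi>\<^sup>*\<Omega>\<close> in its function component. The cocycle identity for \<open>\<Omega>\<close> then comes for free from \<open>G\<close>,
  so that the closedness of \<open>\<Omega>\<close> need not be shown separately.
\<close>

section \<open>Calculus of smooth functions\<close>

text \<open>Tangent vectors are derivations, and submanifolds are bare point sets with an ambient
  atlas, so pointwise arguments need a bridge to coordinates: Hadamard's lemma shows that a
  derivation is determined by its values on coordinate functions, and the inverse function theorem
  turns surjectivity on derivations into smooth local sections. The second obstacle is that P is
  accessible only through trivialisations over the fibre product of X with itself, which is a mere
  subset of X \<times> X. Fields on P are therefore prescribed on the ambient product of X, X and
  the complex plane, realised point by point as vectors of the subset, and pushed forward along the
  inverse trivialisation. The bracket of the theorem is forced up to pullbacks from M: if
  \<gamma>(v) = \<delta>g and \<gamma>(w) = \<delta>h, the formula for d\<gamma> = \<delta>B shows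
  that \<gamma>([v, w]) is \<delta> of L_x h - L_z g - B(x, z), and functions with the same \<delta>
  differ by a function constant on the fibres of \<pi>. Since an element of G is determined by its
  field on X and its function, identities between fields on P reduce to identities on X.\<close>

definition Cinf_on :: "('e::real_normed_vector \<Rightarrow> 'f::real_normed_vector) \<Rightarrow> 'e set \<Rightarrow> bool"
  where "Cinf_on f U \<longleftrightarrow> (\<forall>k. Ck_on k f U)"

lemma Ck_on_subset: "Ck_on k f U \<Longrightarrow> V \<subseteq> U \<Longrightarrow> Ck_on k f V"
  by (induction k arbitrary: f) (auto intro: continuous_on_subset)

lemma Ck_on_SucD: "Ck_on (Suc k) f U \<Longrightarrow> Ck_on k f U"
proof (induction k arbitrary: f)
  case 0
  then show ?case
    by (auto intro!: continuous_at_imp_continuous_on differentiable_imp_continuous_within)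
next
  case (Suc k)
  then show ?case by (metis Ck_on.simps(2))
qed

lemma has_derivative_cong_open:
  assumes "open U" "x \<in> U" "\<And>y. y \<in> U \<Longrightarrow> f y = g y"
  shows "(f has_derivative D) (at x) \<longleftrightarrow> (g has_derivative D) (at x)"
  using assms has_derivative_transform_within_open by metis

lemma frechet_derivative_cong_open:
  assumes "open U" "x \<in> U" "\<And>y. y \<in> U \<Longrightarrow> f y = g y"
  shows "frechet_derivative f (at x) = frechet_derivative g (at x)"
  unfolding frechet_derivative_def using has_derivative_cong_open[OF assms] by simp

lemma Ck_on_cong:
  assumes "open U" "\<And>x. x \<in> U \<Longrightarrow> f x = g x" "Ck_on k f U"
  shows "Ck_on k g U"
  using assms(2,3)
proof (induction k arbitrary: f g)
  case 0
  then show ?case by (simp cong: continuous_on_cong)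
next
  case (Suc k)
  have "\<forall>x\<in>U. g differentiable (at x)"
    using Suc.prems has_derivative_cong_open[OF assms(1)] unfolding differentiable_def
    by (metis Ck_on.simps(2) differentiable_def)
  moreover have "Ck_on k (\<lambda>x. frechet_derivative g (at x) v) U" for v
  proof (rule Suc.IH[of "\<lambda>x. frechet_derivative f (at x) v"])
    show "frechet_derivative f (at x) v = frechet_derivative g (at x) v" if "x \<in> U" for x
      using frechet_derivative_cong_open[OF assms(1) that Suc.prems(1)] by simp
  qed (use Suc.prems(2) in simp)
  ultimately show ?case by simp
qed

text \<open>Any formula for the derivative may take the place of \<open>frechet_derivative\<close>.
  The closure properties below are inductions on \<open>k\<close> through this rule.\<close>

lemma Ck_on_SucI:
  assumes "open U" "\<And>x. x \<in> U \<Longrightarrow> (f has_derivative f' x) (at x)"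
    and "\<And>v. Ck_on k (\<lambda>x. f' x v) U"
  shows "Ck_on (Suc k) f U"
proof -
  have "Ck_on k (\<lambda>x. frechet_derivative f (at x) v) U" for v
    by (rule Ck_on_cong[OF assms(1) _ assms(3)[of v]]) (use assms(2) frechet_derivative_at in metis)
  then show ?thesis using assms(2) by (auto simp: differentiable_def)
qed

lemma Ck_on_Suc_frechet: "Ck_on (Suc k) f U \<Longrightarrow> Ck_on k (\<lambda>x. frechet_derivative f (at x) v) U"
  by simp

lemma Ck_on_Suc_has_derivative:
  "Ck_on (Suc k) f U \<Longrightarrow> x \<in> U \<Longrightarrow> (f has_derivative frechet_derivative f (at x)) (at x)"
  by (simp add: frechet_derivative_works)

lemma Ck_on_local:
  assumes "\<And>x. x \<in> U \<Longrightarrow> \<exists>V. open V \<and> x \<in> V \<and> Ck_on k f V"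
  shows "Ck_on k f U"
  using assms
proof (induction k arbitrary: f)
  case 0
  then show ?case
    unfolding Ck_on.simps
    by (intro continuous_at_imp_continuous_on ballI) (metis continuous_on_eq_continuous_at)
next
  case (Suc k)
  have "f differentiable (at x)" if "x \<in> U" for x
    using Suc.prems[OF that] by (metis Ck_on.simps(2))
  moreover have "Ck_on k (\<lambda>x. frechet_derivative f (at x) v) U" for v
  proof (rule Suc.IH)
    fix x assume "x \<in> U"
    then obtain V where "open V" "x \<in> V" "Ck_on (Suc k) f V" using Suc.prems by blast
    then show "\<exists>V. open V \<and> x \<in> V \<and> Ck_on k (\<lambda>x. frechet_derivative f (at x) v) V" by auto
  qed
  ultimately show ?case by simp
qed

lemma Ck_on_const: "Ck_on k (\<lambda>x. c) U"
proof (induction k arbitrary: c)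
  case (Suc k)
  have "frechet_derivative (\<lambda>x. c) (at x) v = 0" for x :: 'a and v
    by (simp add: frechet_derivative_const)
  then show ?case using Suc by (simp add: frechet_derivative_const)
qed simp

lemma Ck_on_bounded_linear:
  assumes "bounded_linear f" shows "Ck_on k f U"
proof (cases k)
  case 0
  then show ?thesis by (simp add: assms linear_continuous_on)
next
  case (Suc n)
  have "frechet_derivative f (at x) = f" for x
    using assms bounded_linear_imp_has_derivative frechet_derivative_at by metis
  then show ?thesis
    using assms Suc Ck_on_const by (auto simp: bounded_linear_imp_differentiable)
qed

lemma Ck_on_add:
  assumes "open U" "Ck_on k f U" "Ck_on k g U" shows "Ck_on k (\<lambda>x. f x + g x) U"
  using assms(2,3)
proof (induction k arbitrary: f g)
  case 0
  then show ?case by (simp add: continuous_on_add)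
next
  case (Suc k)
  show ?case
    by (rule Ck_on_SucI[OF assms(1) has_derivative_add[OF Ck_on_Suc_has_derivative[OF Suc.prems(1)]
            Ck_on_Suc_has_derivative[OF Suc.prems(2)]]])
      (assumption | rule Suc.IH Ck_on_Suc_frechet Suc.prems)+
qed

text \<open>One rule covers products, scalar multiples and inner products. The product rule gives
  two bilinear terms whose factors are one order lower or unchanged, so the induction closes once
  \<open>f\<close> and \<open>g\<close> are arbitrary.\<close>

lemma Ck_on_bilinear:
  assumes "bounded_bilinear pr" "open U" "Ck_on k f U" "Ck_on k g U"
  shows "Ck_on k (\<lambda>x. pr (f x) (g x)) U"
  using assms(3,4)
proof (induction k arbitrary: f g)
  case 0
  then show ?case by (simp add: bounded_bilinear.continuous_on[OF assms(1)])
next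
  case (Suc k)
  show ?case
    by (rule Ck_on_SucI[OF assms(2) bounded_bilinear.FDERIV[OF assms(1)
            Ck_on_Suc_has_derivative[OF Suc.prems(1)] Ck_on_Suc_has_derivative[OF Suc.prems(2)]]])
      (assumption | rule Ck_on_add[OF assms(2)] Suc.IH Ck_on_Suc_frechet Suc.prems
        Ck_on_SucD[OF Suc.prems(1)] Ck_on_SucD[OF Suc.prems(2)])+
qed

lemma Ck_on_sum:
  assumes "open U" "\<And>i. i \<in> I \<Longrightarrow> Ck_on k (f i) U"
  shows "Ck_on k (\<lambda>x. \<Sum>i\<in>I. f i x) U"
  using assms(2)
proof (induction I rule: infinite_finite_induct)
  case (insert i I)
  then show ?case by (simp add: Ck_on_add[OF assms(1)])
qed (simp_all add: Ck_on_const)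

lemma linear_Basis_sum:
  fixes L :: "'a::euclidean_space \<Rightarrow> 'b::real_vector"
  assumes "linear L"
  shows "L v = (\<Sum>b\<in>Basis. (v \<bullet> b) *\<^sub>R L b)"
proof -
  interpret linear L by fact
  have "L v = L (\<Sum>b\<in>Basis. (v \<bullet> b) *\<^sub>R b)" by (simp add: euclidean_representation)
  also have "\<dots> = (\<Sum>b\<in>Basis. (v \<bullet> b) *\<^sub>R L b)" by (simp add: sum scale)
  finally show ?thesis .
qed

text \<open>In the chain rule the direction \<open>?f x v\<close> depends on \<open>x\<close>,
  whereas the definition of \<open>Ck_on\<close> differentiates in fixed directions. Expanding in
  the basis leaves a finite sum of products of functions with fixed directions, to which the
  induction applies.\<close>

lemma Ck_on_compose:
  fixes f :: "'a::real_normed_vector \<Rightarrow> 'b::euclidean_space"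
  assumes "open U" "Ck_on k g V" "Ck_on k f U" "f ` U \<subseteq> V"
  shows "Ck_on k (\<lambda>x. g (f x)) U"
  using assms(2,3)
proof (induction k arbitrary: g)
  case 0
  then show ?case using assms(4) by (simp add: continuous_on_compose2)
next
  case (Suc k)
  let ?g = "\<lambda>y. frechet_derivative g (at y)" and ?f = "\<lambda>x. frechet_derivative f (at x)"
  have g: "(g has_derivative ?g (f x)) (at (f x))" if "x \<in> U" for x
    using Ck_on_Suc_has_derivative[OF Suc.prems(1)] assms(4) that by blast
  have f: "(f has_derivative ?f x) (at x)" if "x \<in> U" for x
    using Ck_on_Suc_has_derivative[OF Suc.prems(2)] that by blast
  have gf: "((\<lambda>x. g (f x)) has_derivative (\<lambda>v. \<Sum>b\<in>Basis. (?f x v \<bullet> b) *\<^sub>R ?g (f x) b)) (at x)"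
    if "x \<in> U" for x
  proof -
    have "(\<lambda>v. ?g (f x) (?f x v)) = (\<lambda>v. \<Sum>b\<in>Basis. (?f x v \<bullet> b) *\<^sub>R ?g (f x) b)"
      by (rule ext, rule linear_Basis_sum) (use g[OF that] has_derivative_linear in blast)
    with has_derivative_compose[OF f[OF that] g[OF that]] show ?thesis by simp
  qed
  have "Ck_on k (\<lambda>x. (?f x v \<bullet> b) *\<^sub>R ?g (f x) b) U" for v b
    by (rule Ck_on_bilinear[OF bounded_bilinear_scaleR assms(1)])
      (rule Ck_on_bilinear[OF bounded_bilinear_inner assms(1)] Ck_on_const Suc.IH Ck_on_Suc_frechet
        Suc.prems Ck_on_SucD[OF Suc.prems(2)])+
  then show ?case
    by (intro Ck_on_SucI[OF assms(1) gf] Ck_on_sum[OF assms(1)]) auto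
qed

lemma Ck_on_Pair:
  assumes "open U" "Ck_on k f U" "Ck_on k g U" shows "Ck_on k (\<lambda>x. (f x, g x)) U"
  using assms(2,3)
proof (induction k arbitrary: f g)
  case 0
  then show ?case by (simp add: continuous_on_Pair)
next
  case (Suc k)
  show ?case
    by (rule Ck_on_SucI[OF assms(1) has_derivative_Pair[OF Ck_on_Suc_has_derivative[OF Suc.prems(1)]
            Ck_on_Suc_has_derivative[OF Suc.prems(2)]]])
      (assumption | rule Suc.IH Ck_on_Suc_frechet Suc.prems)+
qed

section \<open>Closure properties of smooth functions\<close>

lemma Cinf_on_subset: "Cinf_on f U \<Longrightarrow> V \<subseteq> U \<Longrightarrow> Cinf_on f V"
  using Ck_on_subset unfolding Cinf_on_def by blast

lemma Cinf_on_cong: "open U \<Longrightarrow> (\<And>x. x \<in> U \<Longrightarrow> f x = g x) \<Longrightarrow> Cinf_on f U \<Longrightarrow> Cinf_on g U"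
  unfolding Cinf_on_def using Ck_on_cong by metis

lemma Cinf_on_local:
  "(\<And>x. x \<in> U \<Longrightarrow> \<exists>V. open V \<and> x \<in> V \<and> Cinf_on f V) \<Longrightarrow> Cinf_on f U"
  unfolding Cinf_on_def using Ck_on_local by metis

lemma Cinf_on_const: "Cinf_on (\<lambda>x. c) U"
  by (simp add: Cinf_on_def Ck_on_const)

lemma Cinf_on_bounded_linear: "bounded_linear f \<Longrightarrow> Cinf_on f U"
  by (simp add: Cinf_on_def Ck_on_bounded_linear)

lemma Cinf_on_linear:
  fixes f :: "'a::euclidean_space \<Rightarrow> 'b::real_normed_vector"
  shows "linear f \<Longrightarrow> Cinf_on f U"
  by (simp add: Cinf_on_bounded_linear linear_conv_bounded_linear)

lemma Cinf_on_add: "open U \<Longrightarrow> Cinf_on f U \<Longrightarrow> Cinf_on g U \<Longrightarrow> Cinf_on (\<lambda>x. f x + g x) U"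
  by (simp add: Cinf_on_def Ck_on_add)

lemma Cinf_on_bilinear:
  "bounded_bilinear pr \<Longrightarrow> open U \<Longrightarrow> Cinf_on f U \<Longrightarrow> Cinf_on g U \<Longrightarrow> Cinf_on (\<lambda>x. pr (f x) (g x)) U"
  by (simp add: Cinf_on_def Ck_on_bilinear)

lemmas Cinf_on_mult = Cinf_on_bilinear[OF bounded_bilinear_mult]
  and Cinf_on_scaleR = Cinf_on_bilinear[OF bounded_bilinear_scaleR]
  and Cinf_on_inner = Cinf_on_bilinear[OF bounded_bilinear_inner]

lemma Cinf_on_diff:
  assumes "open U" "Cinf_on f U" "Cinf_on g U" shows "Cinf_on (\<lambda>x. f x - g x) U"
  using Cinf_on_add[OF assms(1,2) Cinf_on_scaleR[OF assms(1) Cinf_on_const[of "-1"] assms(3)]] by simp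

lemma Cinf_on_sum:
  "open U \<Longrightarrow> (\<And>i. i \<in> I \<Longrightarrow> Cinf_on (f i) U) \<Longrightarrow> Cinf_on (\<lambda>x. \<Sum>i\<in>I. f i x) U"
  by (simp add: Cinf_on_def Ck_on_sum)

lemma Cinf_on_compose:
  fixes f :: "'a::real_normed_vector \<Rightarrow> 'b::euclidean_space"
  shows "open U \<Longrightarrow> Cinf_on g V \<Longrightarrow> Cinf_on f U \<Longrightarrow> f ` U \<subseteq> V \<Longrightarrow> Cinf_on (\<lambda>x. g (f x)) U"
  unfolding Cinf_on_def using Ck_on_compose by blast

lemma Cinf_on_Pair: "open U \<Longrightarrow> Cinf_on f U \<Longrightarrow> Cinf_on g U \<Longrightarrow> Cinf_on (\<lambda>x. (f x, g x)) U"
  by (simp add: Cinf_on_def Ck_on_Pair)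

lemma Cinf_on_has_derivative:
  "Cinf_on f U \<Longrightarrow> x \<in> U \<Longrightarrow> (f has_derivative frechet_derivative f (at x)) (at x)"
  unfolding Cinf_on_def using Ck_on_Suc_has_derivative by blast

lemma Cinf_on_frechet_derivative:
  "Cinf_on f U \<Longrightarrow> Cinf_on (\<lambda>x. frechet_derivative f (at x) v) U"
  unfolding Cinf_on_def using Ck_on.simps(2) by blast

lemma Cinf_on_continuous: "Cinf_on f U \<Longrightarrow> continuous_on U f"
  unfolding Cinf_on_def using Ck_on.simps(1) by blast

text \<open>The factor \<open>c\<close> and the varying exponent make the family closed under
  differentiation.\<close>

lemma Cinf_on_powr: "Cinf_on (\<lambda>x::real. x powr a) {0<..}"
proof -
  have "Ck_on k (\<lambda>x::real. c * x powr a) {0<..}" for k c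
  proof (induction k arbitrary: a c)
    case 0
    then show ?case by (auto intro!: continuous_intros)
  next
    case (Suc k)
    have "((\<lambda>x. c * x powr a) has_derivative (\<lambda>v. (c * a * v) * x powr (a - 1))) (at x)"
      if "x \<in> {0<..}" for x :: real
      using that by (auto intro!: derivative_eq_intros simp: algebra_simps powr_diff)
    then show ?case by (rule Ck_on_SucI[OF open_greaterThan]) (use Suc in auto)
  qed
  from this[of _ 1] show ?thesis by (simp add: Cinf_on_def)
qed

lemma Cinf_on_divide:
  fixes f g :: "'a::real_normed_vector \<Rightarrow> real"
  assumes "open U" "Cinf_on f U" "Cinf_on g U" "\<And>x. x \<in> U \<Longrightarrow> g x \<noteq> 0"
  shows "Cinf_on (\<lambda>x. f x / g x) U"
proof (rule Cinf_on_cong[OF assms(1)])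
  have "0 < g x * g x" if "x \<in> U" for x
    using assms(4)[OF that] not_real_square_gt_zero[of "g x"] by blast
  then have "(\<lambda>x. g x * g x) ` U \<subseteq> {0<..}" by auto
  \<comment> \<open>The reciprocal of \<open>g\<close> is written as g / g^2, since
    \<open>powr\<close> is smooth only on positive arguments and \<open>g\<close> may be
    negative.\<close>
  then show "Cinf_on (\<lambda>x. f x * (g x * (g x * g x) powr -1)) U"
    by (intro Cinf_on_mult Cinf_on_compose[OF _ Cinf_on_powr] assms(1-3))
  show "f x * (g x * (g x * g x) powr -1) = f x / g x" if "x \<in> U" for x
    using assms(4)[OF that] by (simp add: powr_minus field_simps)
qed

section \<open>Smooth functions on arbitrary subsets\<close>

lemma smooth_on_iff_Cinf:
  "smooth_on f S \<longleftrightarrow> (\<forall>x\<in>S. \<exists>U g. open U \<and> x \<in> U \<and> Cinf_on g U \<and> (\<forall>y\<in>U \<inter> S. g y = f y))"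
  by (simp add: smooth_on_def Cinf_on_def)

lemma smooth_onE:
  assumes "smooth_on f S" "x \<in> S"
  obtains U g where "open U" "x \<in> U" "Cinf_on g U" "\<And>y. y \<in> U \<Longrightarrow> y \<in> S \<Longrightarrow> g y = f y"
proof -
  have "\<exists>U g. open U \<and> x \<in> U \<and> Cinf_on g U \<and> (\<forall>y\<in>U \<inter> S. g y = f y)"
    using assms(1)[unfolded smooth_on_iff_Cinf, rule_format, OF assms(2)] .
  then show thesis by (elim exE conjE) (rule that, assumption+, simp)
qed

lemma smooth_on_cong_subset:
  assumes "smooth_on f S" "T \<subseteq> S" "\<And>x. x \<in> T \<Longrightarrow> f x = g x"
  shows "smooth_on g T"
  unfolding smooth_on_iff_Cinf
proof
  fix x assume "x \<in> T"
  with assms(2) have "x \<in> S" by auto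
  then obtain U h where h: "open U" "x \<in> U" "Cinf_on h U" "\<And>y. y \<in> U \<Longrightarrow> y \<in> S \<Longrightarrow> h y = f y"
    by (rule smooth_onE[OF assms(1)]) (rule that)
  have "\<forall>y\<in>U \<inter> T. h y = g y"
    using assms(2,3) h(4) by (metis IntE subsetD)
  with h show "\<exists>U h. open U \<and> x \<in> U \<and> Cinf_on h U \<and> (\<forall>y\<in>U \<inter> T. h y = g y)"
    by (intro exI[of _ U] exI[of _ h]) simp
qed

lemma smooth_on_subset: "smooth_on f S \<Longrightarrow> T \<subseteq> S \<Longrightarrow> smooth_on f T"
  by (rule smooth_on_cong_subset) auto

lemma Cinf_on_imp_smooth_on: "open U \<Longrightarrow> Cinf_on f U \<Longrightarrow> smooth_on f U"
  unfolding smooth_on_iff_Cinf by (intro ballI exI[of _ U] exI[of _ f]) simp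

lemma smooth_on_compose:
  fixes f :: "'a::real_normed_vector \<Rightarrow> 'b::euclidean_space"
  assumes "smooth_on g T" "smooth_on f S" "f ` S \<subseteq> T"
  shows "smooth_on (\<lambda>x. g (f x)) S"
  unfolding smooth_on_iff_Cinf
proof
  fix x assume x: "x \<in> S"
  obtain U F where F: "open U" "x \<in> U" "Cinf_on F U" "\<And>y. y \<in> U \<Longrightarrow> y \<in> S \<Longrightarrow> F y = f y"
    by (rule smooth_onE[OF assms(2) x]) (rule that)
  have "f x \<in> T" using assms(3) x by blast
  then obtain V G where G: "open V" "f x \<in> V" "Cinf_on G V" "\<And>y. y \<in> V \<Longrightarrow> y \<in> T \<Longrightarrow> G y = g y"
    by (rule smooth_onE[OF assms(1)]) (rule that)
  have "open (U \<inter> F -` V)"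
    using continuous_open_preimage[OF Cinf_on_continuous[OF F(3)] F(1) G(1)] .
  moreover have "Cinf_on (\<lambda>y. G (F y)) (U \<inter> F -` V)"
    by (rule Cinf_on_compose[OF calculation G(3)]) (auto intro: Cinf_on_subset[OF F(3)])
  moreover have "x \<in> U \<inter> F -` V" using F G x by auto
  moreover have "\<forall>y\<in>(U \<inter> F -` V) \<inter> S. G (F y) = g (f y)" using F G assms(3) by auto
  ultimately show "\<exists>U h. open U \<and> x \<in> U \<and> Cinf_on h U \<and> (\<forall>y\<in>U \<inter> S. h y = g (f y))"
    by (intro exI[of _ "U \<inter> F -` V"] exI[of _ "\<lambda>y. G (F y)"]) simp
qed

text \<open>This family is closed under differentiation up to linear combinations, hence consists of smooth
  functions.\<close>

definition flat_exp :: "nat \<Rightarrow> real \<Rightarrow> real"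
  where "flat_exp n x = (if x > 0 then inverse x ^ n / exp (inverse x) else 0)"

lemma flat_exp_DERIV:
  "(flat_exp n has_real_derivative (flat_exp (n + 2) x - real n * flat_exp (n + 1) x)) (at x)"
proof -
  consider "x > 0" | "x < 0" | "x = 0" by linarith
  then show ?thesis
  proof cases
    case 1
    have "((\<lambda>x. inverse x ^ n / exp (inverse x)) has_real_derivative
        (flat_exp (n + 2) x - real n * flat_exp (n + 1) x)) (at x)"
    proof (cases n)
      case 0
      then show ?thesis using 1
        by (auto intro!: derivative_eq_intros simp: flat_exp_def field_simps power2_eq_square)
    next
      case (Suc m)
      have "m = 0 \<or> x * x ^ (m - Suc 0) = x ^ m" by (cases m) auto
      with Suc show ?thesis using 1
        by (auto intro!: derivative_eq_intros simp: flat_exp_def field_simps power2_eq_square)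
    qed
    then show ?thesis
      by (rule has_field_derivative_transform_within_open[of _ _ _ "{0<..}"])
        (use 1 in \<open>auto simp: flat_exp_def\<close>)
  next
    case 2
    have "((\<lambda>x. 0) has_real_derivative (flat_exp (n + 2) x - real n * flat_exp (n + 1) x)) (at x)"
      using 2 by (simp add: flat_exp_def)
    then show ?thesis
      by (rule has_field_derivative_transform_within_open[of _ _ _ "{..<0}"])
        (use 2 in \<open>auto simp: flat_exp_def\<close>)
  next
    case 3
    \<comment> \<open>With u = 1/h, the difference quotient from the right at 0 is u^(n+1) / exp u
      for u tending to infinity; from the left it is zero.\<close>
    have "((\<lambda>h. inverse h ^ Suc n / exp (inverse h)) \<longlongrightarrow> 0) (at_right (0::real))"
      by (rule filterlim_compose[OF tendsto_power_div_exp_0 filterlim_inverse_at_top_right])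
    then have "((\<lambda>h. flat_exp n h / h) \<longlongrightarrow> 0) (at_right 0)"
      by (rule Lim_transform_eventually)
        (auto simp: eventually_at_right_field flat_exp_def field_simps intro: exI[of _ 1])
    moreover have "((\<lambda>h. flat_exp n h / h) \<longlongrightarrow> 0) (at_left 0)"
      by (rule tendsto_eventually)
        (auto simp: eventually_at_left_field flat_exp_def intro: exI[of _ "-1"])
    ultimately have "((\<lambda>h. flat_exp n h / h) \<longlongrightarrow> 0) (at 0)"
      by (simp add: filterlim_at_split)
    then show ?thesis using 3 by (simp add: DERIV_def flat_exp_def)
  qed
qed

lemma Cinf_on_flat_exp: "Cinf_on (flat_exp n) U"
proof -
  have "Ck_on k (flat_exp n) UNIV" for k
  proof (induction k arbitrary: n)
    case 0
    then show ?case
      by (auto intro!: continuous_at_imp_continuous_on DERIV_isCont[OF flat_exp_DERIV])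
  next
    case (Suc k)
    show ?case
    proof (rule Ck_on_SucI[OF open_UNIV])
      show "(flat_exp n has_derivative
          (\<lambda>v. flat_exp (n + 2) x * v + (- real n * v) * flat_exp (n + 1) x)) (at x)" for x
        by (rule has_derivative_eq_rhs[OF flat_exp_DERIV[of n x, unfolded has_field_derivative_def]])
          (simp add: fun_eq_iff algebra_simps)
      show "Ck_on k (\<lambda>x. flat_exp (n + 2) x * v + (- real n * v) * flat_exp (n + 1) x) UNIV" for v
        by (intro Ck_on_add Ck_on_bilinear[OF bounded_bilinear_mult] Suc Ck_on_const open_UNIV)
    qed
  qed
  then show ?thesis by (auto simp: Cinf_on_def intro: Ck_on_subset)
qed

lemma smooth_plateau:
  fixes a :: "'a::euclidean_space"
  assumes "r > 0"
  obtains b :: "'a \<Rightarrow> real" where "Cinf_on b UNIV" "\<And>x. x \<in> ball a r \<Longrightarrow> b x = 1"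
    "\<And>x. x \<notin> ball a (2 * r) \<Longrightarrow> b x = 0"
proof -
  \<comment> \<open>A smooth step: 0 for t \<le> 0 and 1 for t \<ge> 1. The argument in
    \<open>b\<close> is at least 1 within distance r of \<open>a\<close> and negative outside
    distance 2r, since there the squared distance is at least 4 r^2.\<close>
  define \<sigma> where "\<sigma> t = flat_exp 0 t / (flat_exp 0 t + flat_exp 0 (1 - t))" for t
  define b where "b x = \<sigma> (2 - ((x - a) \<bullet> (x - a)) / r\<^sup>2)" for x
  have "flat_exp 0 t + flat_exp 0 (1 - t) \<noteq> 0" for t
  proof -
    have "t > 0 \<or> 1 - t > 0" by linarith
    then have "flat_exp 0 t + flat_exp 0 (1 - t) > 0"
      by (auto simp: flat_exp_def add_pos_nonneg add_nonneg_pos)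
    then show ?thesis by simp
  qed
  moreover have "Cinf_on (\<lambda>t::real. flat_exp 0 (1 - t)) UNIV"
    by (rule Cinf_on_compose[OF open_UNIV Cinf_on_flat_exp[of 0 UNIV] Cinf_on_diff[OF open_UNIV
            Cinf_on_const Cinf_on_bounded_linear[OF bounded_linear_ident]]]) simp
  ultimately have \<sigma>: "Cinf_on \<sigma> UNIV"
    unfolding \<sigma>_def by (intro Cinf_on_divide Cinf_on_add open_UNIV Cinf_on_flat_exp)
  have "Cinf_on (\<lambda>x. 2 - ((x - a) \<bullet> (x - a)) * (1 / r\<^sup>2)) UNIV"
    by (intro Cinf_on_diff Cinf_on_mult Cinf_on_inner Cinf_on_const open_UNIV
        Cinf_on_bounded_linear bounded_linear_ident)
  then have "Cinf_on b UNIV"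
    unfolding b_def using Cinf_on_compose[OF open_UNIV \<sigma>] by simp
  moreover have "b x = 1" if "x \<in> ball a r" for x
  proof -
    have "(x - a) \<bullet> (x - a) < r\<^sup>2"
      using that by (simp add: dist_norm norm_minus_commute power_strict_mono flip: power2_norm_eq_inner)
    then have "2 - ((x - a) \<bullet> (x - a)) / r\<^sup>2 > 1" using assms by (simp add: field_simps)
    then show ?thesis by (simp add: b_def \<sigma>_def flat_exp_def)
  qed
  moreover have "b x = 0" if "x \<notin> ball a (2 * r)" for x
  proof -
    have "2 * r \<le> norm (x - a)" using that by (simp add: dist_norm norm_minus_commute)
    then have "(2 * r)\<^sup>2 \<le> (x - a) \<bullet> (x - a)"
      using power_mono[of "2 * r" "norm (x - a)" 2] assms by (simp only: power2_norm_eq_inner)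
    moreover have "(2 * r)\<^sup>2 = 4 * r\<^sup>2" "r\<^sup>2 > 0" using assms by simp_all
    ultimately have "2 * r\<^sup>2 \<le> (x - a) \<bullet> (x - a)" by linarith
    then have "2 \<le> ((x - a) \<bullet> (x - a)) / r\<^sup>2"
      using \<open>r\<^sup>2 > 0\<close> by (simp add: pos_le_divide_eq)
    then show ?thesis by (simp add: b_def \<sigma>_def flat_exp_def)
  qed
  ultimately show thesis by (rule that)
qed

lemma Ck_on_continuous: "Ck_on k f U \<Longrightarrow> continuous_on U f"
proof (induction k)
  case (Suc k)
  then show ?case using Ck_on_SucD by blast
qed simp

text \<open>Differentiation under the integral sign in \<open>x\<close> produces a further factor
  \<open>t\<close>. Hence the weight \<open>t ^ n\<close> with \<open>n\<close> arbitrary in the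
  induction.\<close>

lemma Ck_on_param_integral:
  fixes f :: "'a::euclidean_space \<Rightarrow> real"
  assumes U: "open U" "convex U" "a \<in> U" and f: "Ck_on k f U"
  shows "Ck_on k (\<lambda>x. integral (cbox 0 1) (\<lambda>t. t ^ n * f (a + t *\<^sub>R (x - a)))) U"
  using f
proof (induction k arbitrary: f n)
  have mem: "a + t *\<^sub>R (x - a) \<in> U" if "x \<in> U" "t \<in> cbox 0 1" for x and t :: real
    using convexD_alt[OF U(2,3) that(1), of t] that(2) by (simp add: algebra_simps)
  have cont: "continuous_on (U \<times> cbox 0 1) (\<lambda>(x, t). t ^ n * g (a + t *\<^sub>R (x - a)))"
    if "continuous_on U g" for g :: "'a \<Rightarrow> real" and n
    unfolding split_beta
    by (intro continuous_intros continuous_on_compose2[OF that]) (use mem in auto)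
  {
    case 0
    then show ?case using integral_continuous_on_param[OF cont] by simp
  next
    case (Suc k)
    let ?f = "\<lambda>x. frechet_derivative f (at x)"
    have df: "(f has_derivative ?f x) (at x)" if "x \<in> U" for x
      using Ck_on_Suc_has_derivative[OF Suc.prems that] .
    have bl: "bounded_linear (\<lambda>v. t ^ Suc n * ?f (a + t *\<^sub>R (x - a)) v)" if "x \<in> U" "t \<in> cbox 0 1" for x t
      using has_derivative_bounded_linear[OF df[OF mem[OF that]]] bounded_linear_const_mult by blast
    \<comment> \<open>\<open>leibniz_rule\<close> takes the derivative as a continuous map into the
      bounded linear maps, while \<open>Ck_on\<close> only gives it direction by direction.\<close>
    define D where "D x t = Blinfun (\<lambda>v. t ^ Suc n * ?f (a + t *\<^sub>R (x - a)) v)" for x t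
    have D: "blinfun_apply (D x t) = (\<lambda>v. t ^ Suc n * ?f (a + t *\<^sub>R (x - a)) v)"
      if "x \<in> U" "t \<in> cbox 0 1" for x t
      unfolding D_def using bounded_linear_Blinfun_apply[OF bl[OF that]] .
    have contf: "continuous_on U f" using Ck_on_continuous[OF Suc.prems] .
    have contd: "continuous_on U (\<lambda>x. ?f x v)" for v
      using Ck_on_continuous[OF Ck_on_Suc_frechet[OF Suc.prems]] .
    have contD: "continuous_on (U \<times> cbox 0 1) (\<lambda>(x, t). D x t)"
    proof (rule continuous_on_blinfun_componentwise)
      fix i :: 'a
      have "continuous_on (U \<times> cbox 0 1) (\<lambda>(x, t). t ^ Suc n * ?f (a + t *\<^sub>R (x - a)) i)"
        by (rule cont[OF contd])
      then show "continuous_on (U \<times> cbox 0 1) (\<lambda>p. blinfun_apply (case p of (x, t) \<Rightarrow> D x t) i)"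
        by (rule continuous_on_eq) (auto simp: D)
    qed
    have der: "((\<lambda>x. integral (cbox 0 1) (\<lambda>t. t ^ n * f (a + t *\<^sub>R (x - a)))) has_derivative
        (\<lambda>v. integral (cbox 0 1) (\<lambda>t. t ^ Suc n * ?f (a + t *\<^sub>R (x - a)) v))) (at x)"
      if x: "x \<in> U" for x
    proof -
      have "((\<lambda>x. integral (cbox 0 1) (\<lambda>t. t ^ n * f (a + t *\<^sub>R (x - a)))) has_derivative
          integral (cbox 0 1) (D x)) (at x within U)"
      proof (rule leibniz_rule[OF _ _ contD x U(2)])
        fix y and t :: real assume yt: "y \<in> U" "t \<in> cbox 0 1"
        have "((\<lambda>x. t ^ n * f (a + t *\<^sub>R (x - a))) has_derivative
            (\<lambda>v. t ^ n * ?f (a + t *\<^sub>R (y - a)) (t *\<^sub>R v))) (at y)"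
          by (rule has_derivative_mult_right, rule has_derivative_compose[where f="\<lambda>x. a + t *\<^sub>R (x - a)", OF _ df[OF mem[OF yt]]])
            (auto intro!: derivative_eq_intros)
        moreover have "?f (a + t *\<^sub>R (y - a)) (t *\<^sub>R v) = t * ?f (a + t *\<^sub>R (y - a)) v" for v
          using linear_scale[OF has_derivative_linear[OF df[OF mem[OF yt]]]] by simp
        ultimately have "((\<lambda>x. t ^ n * f (a + t *\<^sub>R (x - a))) has_derivative D y t) (at y)"
          unfolding D[OF yt] by (simp add: algebra_simps)
        then show "((\<lambda>x. t ^ n * f (a + t *\<^sub>R (x - a))) has_derivative D y t) (at y within U)"
          by (rule has_derivative_at_withinI)
      next
        fix y assume y: "y \<in> U"
        have "continuous_on (cbox 0 1) (\<lambda>t. case (y, t) of (x, t) \<Rightarrow> t ^ n * f (a + t *\<^sub>R (x - a)))"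
          by (rule continuous_on_compose2[OF cont[OF contf]]) (use y in \<open>auto intro!: continuous_intros\<close>)
        then show "(\<lambda>t. t ^ n * f (a + t *\<^sub>R (y - a))) integrable_on cbox 0 1"
          by (simp add: integrable_continuous_real)
      qed
      moreover have "blinfun_apply (integral (cbox 0 1) (D x)) =
          (\<lambda>v. integral (cbox 0 1) (\<lambda>t. t ^ Suc n * ?f (a + t *\<^sub>R (x - a)) v))"
      proof
        fix v
        have "continuous_on (cbox 0 1) (\<lambda>t. case (x, t) of (x, t) \<Rightarrow> D x t)"
          by (rule continuous_on_compose2[OF contD]) (use x in \<open>auto intro!: continuous_intros\<close>)
        then have "D x integrable_on cbox 0 1" by (simp add: integrable_continuous_real)
        then have "blinfun_apply (integral (cbox 0 1) (D x)) v
            = integral (cbox 0 1) (\<lambda>t. blinfun_apply (D x t) v)"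
          by (rule blinfun_apply_integral)
        also have "\<dots> = integral (cbox 0 1) (\<lambda>t. t ^ Suc n * ?f (a + t *\<^sub>R (x - a)) v)"
          by (rule integral_cong) (simp only: D[OF x])
        finally show "blinfun_apply (integral (cbox 0 1) (D x)) v
            = integral (cbox 0 1) (\<lambda>t. t ^ Suc n * ?f (a + t *\<^sub>R (x - a)) v)" .
      qed
      ultimately show ?thesis using at_within_open[OF x U(1)] by (simp only:)
    qed
    show ?case
      by (rule Ck_on_SucI[OF U(1) der]) (use Suc in \<open>auto simp del: power_Suc\<close>)
  }
qed

text \<open>The derivative of \<open>f\<close> is integrated along the segment from \<open>a\<close>
  to \<open>x\<close>. The factor of (x - a) \<bullet> b is the mean of the partial derivative along
  that segment; at x = a the integrand is constant.\<close>

lemma Hadamard: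
  fixes f :: "'a::euclidean_space \<Rightarrow> real"
  assumes "Cinf_on f (ball a r)" "r > 0"
  obtains g where "\<And>b. Cinf_on (g b) (ball a r)"
    "\<And>x. x \<in> ball a r \<Longrightarrow> f x = f a + (\<Sum>b\<in>Basis. ((x - a) \<bullet> b) * g b x)"
    "\<And>b. g b a = frechet_derivative f (at a) b"
proof -
  let ?f = "\<lambda>x. frechet_derivative f (at x)"
  \<comment> \<open>The weight \<open>t ^ 0\<close> gives the integral the shape handled by
    \<open>Ck_on_param_integral\<close>.\<close>
  define g where "g b x = integral (cbox 0 1) (\<lambda>t. t ^ 0 * ?f (a + t *\<^sub>R (x - a)) b)" for b x
  have a: "a \<in> ball a r" using assms by simp
  have "Cinf_on (g b) (ball a r)" for b
    using Cinf_on_frechet_derivative[OF assms(1), of b] unfolding g_def Cinf_on_def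
    by (intro allI Ck_on_param_integral[OF open_ball convex_ball a]) blast
  moreover have "f x = f a + (\<Sum>b\<in>Basis. ((x - a) \<bullet> b) * g b x)" if x: "x \<in> ball a r" for x
  proof -
    have mem: "a + t *\<^sub>R (x - a) \<in> ball a r" if "t \<in> {0..1}" for t :: real
      using convexD_alt[OF convex_ball a x, of t] that by (simp add: algebra_simps)
    have df: "(f has_derivative ?f (a + t *\<^sub>R (x - a))) (at (a + t *\<^sub>R (x - a)))" if "t \<in> {0..1}" for t
      using Cinf_on_has_derivative[OF assms(1) mem[OF that]] .
    have "((\<lambda>t. ?f (a + t *\<^sub>R (x - a)) (x - a)) has_integral f (a + 1 *\<^sub>R (x - a)) - f (a + 0 *\<^sub>R (x - a))) {0..1}"
    proof (rule fundamental_theorem_of_calculus)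
      fix t :: real assume t: "t \<in> {0..1}"
      have "((\<lambda>t. f (a + t *\<^sub>R (x - a))) has_derivative (\<lambda>s. ?f (a + t *\<^sub>R (x - a)) (s *\<^sub>R (x - a)))) (at t)"
        by (rule has_derivative_compose[where f="\<lambda>t. a + t *\<^sub>R (x - a)", OF _ df[OF t]]) (auto intro!: derivative_eq_intros)
      moreover have "?f (a + t *\<^sub>R (x - a)) (s *\<^sub>R (x - a)) = s *\<^sub>R ?f (a + t *\<^sub>R (x - a)) (x - a)" for s
        using linear_scale[OF has_derivative_linear[OF df[OF t]]] .
      ultimately show "((\<lambda>t. f (a + t *\<^sub>R (x - a))) has_vector_derivative ?f (a + t *\<^sub>R (x - a)) (x - a)) (at t within {0..1})"
        by (simp add: has_vector_derivative_def has_derivative_at_withinI)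
    qed simp
    then have "f x - f a = integral {0..1} (\<lambda>t. ?f (a + t *\<^sub>R (x - a)) (x - a))"
      by (simp add: has_integral_iff)
    also have "\<dots> = integral {0..1} (\<lambda>t. \<Sum>b\<in>Basis. ((x - a) \<bullet> b) * ?f (a + t *\<^sub>R (x - a)) b)"
    proof (rule integral_cong)
      fix t :: real assume "t \<in> {0..1}"
      then show "?f (a + t *\<^sub>R (x - a)) (x - a) = (\<Sum>b\<in>Basis. ((x - a) \<bullet> b) * ?f (a + t *\<^sub>R (x - a)) b)"
        using linear_Basis_sum[OF has_derivative_linear[OF df], of t "x - a"] by simp
    qed
    also have "\<dots> = (\<Sum>b\<in>Basis. ((x - a) \<bullet> b) * integral {0..1} (\<lambda>t. ?f (a + t *\<^sub>R (x - a)) b))"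
    proof -
      have "(\<lambda>t. ?f (a + t *\<^sub>R (x - a)) b) integrable_on {0..1}" for b
        by (rule integrable_continuous_real)
          (intro continuous_on_compose2[OF Cinf_on_continuous[OF Cinf_on_frechet_derivative[OF assms(1)]]]
            continuous_intros, use mem in auto)
      then show ?thesis by (subst integral_sum) (auto intro!: integrable_on_mult_right)
    qed
    finally show ?thesis by (simp add: g_def cbox_interval)
  qed
  moreover have "g b a = ?f a b" for b
    by (simp add: g_def)
  ultimately show thesis by (rule that)
qed

text \<open>At a zero of \<open>f\<close> the product rule asks only for continuity of
  \<open>c\<close>. In the inverse function theorem this differentiates the inverse derivative when
  it is so far only known to be continuous.\<close>

lemma has_derivative_vanishing_scaleR:
  fixes f :: "'a::real_normed_vector \<Rightarrow> real" and c :: "'a \<Rightarrow> 'b::real_normed_vector"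
  assumes f: "(f has_derivative f') (at x)" "f x = 0" and c: "isCont c x"
  shows "((\<lambda>y. f y *\<^sub>R c y) has_derivative (\<lambda>v. f' v *\<^sub>R c x)) (at x)"
proof -
  have bl: "bounded_linear f'" using f(1) by (rule has_derivative_bounded_linear)
  obtain K where K: "\<And>v. norm (f' v) \<le> norm v * K"
    using bounded_linear.bounded[OF bl] by blast
  let ?R = "\<lambda>y. (f y - f' (y - x)) / norm (y - x)"
  have R: "(?R \<longlongrightarrow> 0) (at x)"
    using f unfolding has_derivative_at_within by (simp add: divide_inverse ac_simps)
  have cx: "(c \<longlongrightarrow> c x) (at x)" using c by (simp add: isCont_def)
  have 1: "((\<lambda>y. ?R y *\<^sub>R c y) \<longlongrightarrow> 0) (at x)"
    using tendsto_scaleR[OF R cx] by simp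
  have 2: "((\<lambda>y. (f' (y - x) / norm (y - x)) *\<^sub>R (c y - c x)) \<longlongrightarrow> 0) (at x)"
  proof (rule Lim_null_comparison)
    show "\<forall>\<^sub>F y in at x. norm ((f' (y - x) / norm (y - x)) *\<^sub>R (c y - c x)) \<le> \<bar>K\<bar> * norm (c y - c x)"
    proof (rule eventuallyI)
      fix y
      have "\<bar>f' (y - x)\<bar> \<le> norm (y - x) * \<bar>K\<bar>"
        using K[of "y - x"] by (smt (verit) mult_left_mono norm_ge_zero real_norm_def)
      then have "\<bar>f' (y - x)\<bar> / norm (y - x) \<le> \<bar>K\<bar>"
        by (cases "y = x") (auto simp: field_simps)
      from mult_right_mono[OF this norm_ge_zero[of "c y - c x"]]
      show "norm ((f' (y - x) / norm (y - x)) *\<^sub>R (c y - c x)) \<le> \<bar>K\<bar> * norm (c y - c x)"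
        by simp
    qed
    show "((\<lambda>y. \<bar>K\<bar> * norm (c y - c x)) \<longlongrightarrow> 0) (at x)"
      using tendsto_mult_left[OF tendsto_norm[OF LIM_zero[OF cx]], of "\<bar>K\<bar>"] by simp
  qed
  have "((\<lambda>y. (f y *\<^sub>R c y - f x *\<^sub>R c x - f' (y - x) *\<^sub>R c x) /\<^sub>R norm (y - x)) \<longlongrightarrow> 0) (at x)"
    using tendsto_add[OF 1 2] f(2)
    by (simp add: algebra_simps divide_inverse scaleR_diff_right scaleR_diff_left)
  moreover have "bounded_linear (\<lambda>v. f' v *\<^sub>R c x)"
    using bounded_linear_scaleR_const[OF bl] .
  ultimately show ?thesis by (simp add: has_derivative_at_within)
qed

text \<open>\<open>inverse_function_theorem\<close> gives a differentiable local inverse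
  \<open>g\<close>. Its derivative \<open>J y\<close> inverts the derivative \<open>F (g y)\<close>,
  and \<open>J\<close> is shown in turn to be continuous, differentiable and smooth, the last
  together with \<open>g\<close>.\<close>

lemma Cinf_inverse_function:
  fixes f :: "'a::euclidean_space \<Rightarrow> 'a"
  assumes U: "open U" "c \<in> U" and f: "Cinf_on f U" and inj: "inj (frechet_derivative f (at c))"
  obtains U' V g where "open U'" "U' \<subseteq> U" "c \<in> U'" "open V" "f c \<in> V" "homeomorphism U' V f g"
    "Cinf_on g V"
proof -
  define F where "F x = frechet_derivative f (at x)" for x
  define f' where "f' x = Blinfun (F x)" for x
  have df: "(f has_derivative F x) (at x)" if "x \<in> U" for x
    unfolding F_def using Cinf_on_has_derivative[OF f that] .
  have f': "blinfun_apply (f' x) = F x" if "x \<in> U" for x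
    unfolding f'_def using bounded_linear_Blinfun_apply[OF has_derivative_bounded_linear[OF df[OF that]]] .
  have CF: "Cinf_on (\<lambda>x. F x v) U" for v
    unfolding F_def using Cinf_on_frechet_derivative[OF f] .
  have contf': "continuous_on U f'"
    by (rule continuous_on_blinfun_componentwise, rule continuous_on_eq[OF Cinf_on_continuous[OF CF]])
      (simp add: f')
  obtain L where L: "linear L" "L \<circ> F c = id"
    using linear_injective_left_inverse[OF has_derivative_linear[OF df[OF U(2)]]] inj
    unfolding F_def by blast
  have "Blinfun L o\<^sub>L f' c = id_blinfun"
    by (rule blinfun_eqI)
      (use L in \<open>simp add: f'[OF U(2)] bounded_linear_Blinfun_apply linear_conv_bounded_linear fun_eq_iff\<close>)
  from inverse_function_theorem[OF U(1) _ contf' U(2) this] df f'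
  obtain U' V g g' where UV: "open U'" "U' \<subseteq> U" "c \<in> U'" "open V" "f c \<in> V" and hom: "homeomorphism U' V f g"
    and g': "\<And>y. y \<in> V \<Longrightarrow> (g has_derivative (g' y)) (at y)"
    "\<And>y. y \<in> V \<Longrightarrow> g' y = inv (blinfun_apply (f' (g y)))"
    "\<And>y. y \<in> V \<Longrightarrow> bij (blinfun_apply (f' (g y)))"
    by (metis (no_types, lifting))
  have gU: "g y \<in> U" if "y \<in> V" for y
    using hom UV(2) that unfolding homeomorphism_def by blast
  define J where "J y = inv (F (g y))" for y
  have dg: "(g has_derivative J y) (at y)" if "y \<in> V" for y
    using g'(1,2)[OF that] f'[OF gU[OF that]] by (simp add: J_def)
  have bij: "bij (F (g y))" if "y \<in> V" for y
    using g'(3)[OF that] f'[OF gU[OF that]] by simp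
  have JF: "J y (F (g y) v) = v" and FJ: "F (g y) (J y v) = v" if "y \<in> V" for y v
    using bij[OF that] unfolding J_def by (simp_all add: bij_is_inj bij_is_surj surj_f_inv_f)
  have linJ: "linear (J y)" and linF: "linear (F (g y))" if "y \<in> V" for y
    using has_derivative_linear[OF dg[OF that]] has_derivative_linear[OF df[OF gU[OF that]]] by auto
  have contg: "continuous_on V g"
    using hom unfolding homeomorphism_def by blast
  have contfg: "continuous_on V (\<lambda>y. f' (g y))"
    by (rule continuous_on_compose2[OF contf' contg]) (use gU in auto)
  \<comment> \<open>The resolvent identity. For z in \<open>V\<close> one has
    \<open>F (g z) (J z v) = v\<close>, so the argument of \<open>J y\<close> on the right vanishes
    at y = z.\<close>
  have Jdiff: "J y v - J z v = - J y (F (g y) (J z v) - v)" if "y \<in> V" for y z v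
    using linear_diff[OF linJ[OF that]] JF[OF that] by simp
  have contJ: "isCont (\<lambda>y. J y v) z" if z: "z \<in> V" for v z
  proof -
    \<comment> \<open>A lower bound for the derivative at \<open>g z\<close>. Nearby derivatives are
      then bounded below by B/2, which estimates the difference of \<open>J y v\<close> and
      \<open>J z v\<close> without a bound on \<open>J y\<close>.\<close>
    obtain B where B: "B > 0" "\<And>x. B * norm x \<le> norm (F (g z) x)"
      using linear_inj_bounded_below_pos[OF linF[OF z] bij_is_inj[OF bij[OF z]]] by blast
    have "isCont (\<lambda>y. f' (g y)) z"
      using contfg UV(4) z continuous_on_eq_continuous_at by blast
    then have "\<forall>\<^sub>F y in at z. dist (f' (g y)) (f' (g z)) < B / 2"
      using tendstoD[of "\<lambda>y. f' (g y)" "f' (g z)" "at z" "B / 2"] B(1) by (simp add: isCont_def)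
    moreover have "\<forall>\<^sub>F y in at z. y \<in> V"
      using UV(4) z by (simp add: eventually_at_in_open')
    ultimately have bd: "\<forall>\<^sub>F y in at z. norm (J y v - J z v) \<le> (2 / B) * norm (F (g y) (J z v) - v)"
    proof eventually_elim
      case (elim y)
      let ?x = "J y v - J z v"
      have "norm (F (g y) ?x - F (g z) ?x) = norm (blinfun_apply (f' (g y) - f' (g z)) ?x)"
        using f'[OF gU[OF elim(2)]] f'[OF gU[OF z]] by (simp add: blinfun.diff_left)
      also have "\<dots> \<le> B / 2 * norm ?x"
        using norm_blinfun[of "f' (g y) - f' (g z)" ?x] elim(1)
        by (smt (verit) dist_norm mult_right_mono norm_ge_zero)
      finally have "norm (F (g y) ?x) \<ge> B / 2 * norm ?x"
        using B(2)[of ?x] norm_triangle_ineq2[of "F (g z) ?x" "F (g y) ?x"]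
        by (simp add: norm_minus_commute)
      moreover have "F (g y) ?x = - (F (g y) (J z v) - v)"
        using linear_diff[OF linF[OF elim(2)]] FJ[OF elim(2)] by simp
      ultimately have "B / 2 * norm ?x \<le> norm (F (g y) (J z v) - v)"
        by (metis norm_minus_cancel)
      then show ?case using B(1) by (simp add: field_simps)
    qed
    have "isCont (\<lambda>y. F (g y) (J z v)) z"
      using continuous_on_compose2[OF Cinf_on_continuous[OF CF] contg] gU UV(4) z
        continuous_on_eq_continuous_at by blast
    then have "((\<lambda>y. F (g y) (J z v) - v) \<longlongrightarrow> 0) (at z)"
      using FJ[OF z] LIM_zero by (fastforce simp: isCont_def)
    then have "((\<lambda>y. (2 / B) * norm (F (g y) (J z v) - v)) \<longlongrightarrow> 0) (at z)"
      using tendsto_mult_left[OF tendsto_norm, of _ 0 "at z" "2 / B"] by simp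
    with bd have "((\<lambda>y. J y v - J z v) \<longlongrightarrow> 0) (at z)"
      by (rule Lim_null_comparison)
    then show ?thesis using LIM_zero_cancel[of "\<lambda>y. J y v" "J z v" "at z"] by (simp add: isCont_def)
  qed
  define H where "H b e x = frechet_derivative (\<lambda>x. F x b) (at x) e" for b e x
  have CH: "Cinf_on (H b e) U" for b e
    unfolding H_def using Cinf_on_frechet_derivative[OF CF] .
  \<comment> \<open>The second derivative of \<open>f\<close> at \<open>g y\<close> in the
    directions \<open>v\<close> and \<open>w\<close>, expanded in the basis.\<close>
  define E where "E y v w = (\<Sum>b\<in>Basis. (v \<bullet> b) *\<^sub>R (\<Sum>e\<in>Basis. (w \<bullet> e) *\<^sub>R H b e (g y)))" for y v w
  have dF: "((\<lambda>y. F (g y) w) has_derivative (\<lambda>u. E z w (J z u))) (at z)" if z: "z \<in> V" for z w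
  proof -
    have "((\<lambda>y. F (g y) b) has_derivative (\<lambda>u. \<Sum>e\<in>Basis. (J z u \<bullet> e) *\<^sub>R H b e (g z))) (at z)" for b
    proof -
      have d: "((\<lambda>x. F x b) has_derivative (\<lambda>e. H b e (g z))) (at (g z))"
        unfolding H_def using Cinf_on_has_derivative[OF CF gU[OF z]] by simp
      have "(\<lambda>u. H b (J z u) (g z)) = (\<lambda>u. \<Sum>e\<in>Basis. (J z u \<bullet> e) *\<^sub>R H b e (g z))"
        by (rule ext) (rule linear_Basis_sum[OF has_derivative_linear[OF d]])
      with has_derivative_compose[OF dg[OF z] d] show ?thesis by simp
    qed
    then have "((\<lambda>y. \<Sum>b\<in>Basis. (w \<bullet> b) *\<^sub>R F (g y) b) has_derivative (\<lambda>u. E z w (J z u))) (at z)"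
      unfolding E_def by (intro has_derivative_sum has_derivative_scaleR_right)
    moreover have "(\<Sum>b\<in>Basis. (w \<bullet> b) *\<^sub>R F (g y) b) = F (g y) w" if "y \<in> V" for y
      using linear_Basis_sum[OF linF[OF that], of w] by simp
    ultimately show ?thesis
      using has_derivative_cong_open[OF UV(4) z] by (metis (no_types, lifting))
  qed
  have dJ: "((\<lambda>y. J y v) has_derivative (\<lambda>u. - (\<Sum>b\<in>Basis. (E z (J z v) (J z u) \<bullet> b) *\<^sub>R J z b))) (at z)"
    if z: "z \<in> V" for v z
  proof -
    let ?K = "\<lambda>y. F (g y) (J z v) - v"
    have "((\<lambda>y. ?K y \<bullet> b) has_derivative (\<lambda>u. E z (J z v) (J z u) \<bullet> b)) (at z)" for b
      using has_derivative_inner_left[OF has_derivative_diff[OF dF[OF z] has_derivative_const]] by simp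
    moreover have "?K z \<bullet> b = 0" for b using FJ[OF z] by simp
    ultimately have "((\<lambda>y. \<Sum>b\<in>Basis. (?K y \<bullet> b) *\<^sub>R J y b) has_derivative
        (\<lambda>u. \<Sum>b\<in>Basis. (E z (J z v) (J z u) \<bullet> b) *\<^sub>R J z b)) (at z)"
      by (intro has_derivative_sum has_derivative_vanishing_scaleR contJ z) auto
    then have "((\<lambda>y. J z v - (\<Sum>b\<in>Basis. (?K y \<bullet> b) *\<^sub>R J y b)) has_derivative
        (\<lambda>u. 0 - (\<Sum>b\<in>Basis. (E z (J z v) (J z u) \<bullet> b) *\<^sub>R J z b))) (at z)"
      by (intro has_derivative_diff has_derivative_const)
    moreover have "J z v - (\<Sum>b\<in>Basis. (?K y \<bullet> b) *\<^sub>R J y b) = J y v" if "y \<in> V" for y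
      using linear_Basis_sum[OF linJ[OF that], of "?K y"] Jdiff[OF that, of v z] by (simp add: algebra_simps)
    ultimately show ?thesis
      using has_derivative_cong_open[OF UV(4) z, of "\<lambda>y. J z v - (\<Sum>b\<in>Basis. (?K y \<bullet> b) *\<^sub>R J y b)"]
      by simp
  qed
  \<comment> \<open>Bootstrapping: the derivative of \<open>g\<close> is \<open>J\<close>, and the
    derivative of \<open>J\<close> is a polynomial in components of \<open>J\<close> and of second
    derivatives of \<open>f\<close> composed with \<open>g\<close>. Both therefore gain an order
    together.\<close>
  have "Ck_on k g V \<and> (\<forall>v. Ck_on k (\<lambda>y. J y v) V)" for k
  proof (induction k)
    case 0
    then show ?case using contg contJ by (simp add: continuous_at_imp_continuous_on)
  next
    case (Suc k)
    then have g: "Ck_on k g V" and J: "Ck_on k (\<lambda>y. J y v) V" for v by auto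
    have "Ck_on k (\<lambda>y. H b e (g y)) V" for b e
      by (rule Ck_on_compose[OF UV(4) _ g, of _ U]) (use CH gU in \<open>auto simp: Cinf_on_def\<close>)
    then have "Ck_on k (\<lambda>y. (- 1) *\<^sub>R (\<Sum>b\<in>Basis. (E y (J y v) (J y u) \<bullet> b) *\<^sub>R J y b)) V" for u v
      unfolding E_def
      by (intro Ck_on_bilinear[OF bounded_bilinear_scaleR UV(4)] Ck_on_const Ck_on_sum[OF UV(4)]
          Ck_on_bilinear[OF bounded_bilinear_inner UV(4)] J)
    then have "Ck_on (Suc k) (\<lambda>y. J y v) V" for v
      by (intro Ck_on_SucI[OF UV(4) dJ]) auto
    then show ?case using Ck_on_SucI[OF UV(4) dg J] by blast
  qed
  then have "Cinf_on g V" by (simp add: Cinf_on_def)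
  then show thesis using that UV hom by blast
qed

section \<open>Charts and smooth maps\<close>

text \<open>Charts take values in the range of a linear projection \<open>h\<close>, which is the identity or zero for a
  manifold, and can be mixed for a product. Composing inverse charts with \<open>h\<close> makes them defined on
  open sets in all cases.\<close>

definition atlas :: "('a::topological_space, 'e::euclidean_space) space \<Rightarrow> ('e \<Rightarrow> 'e) \<Rightarrow> bool"
  where "atlas X h \<longleftrightarrow> linear h \<and> (\<forall>e. h (h e) = h e) \<and> (\<forall>x. \<exists>U \<phi>. (U, \<phi>) \<in> charts X \<and> x \<in> U) \<and>
    (\<forall>U \<phi>. (U, \<phi>) \<in> charts X \<longrightarrow> open U \<and> (\<exists>W. open W \<and> \<phi> ` U = W \<inter> range h) \<and>
       homeomorphism U (\<phi> ` U) \<phi> (inv_into U \<phi>)) \<and>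
    (\<forall>U \<phi> V \<psi>. (U, \<phi>) \<in> charts X \<longrightarrow> (V, \<psi>) \<in> charts X \<longrightarrow>
       smooth_on (\<lambda>u. \<psi> (inv_into U \<phi> u)) (\<phi> ` (U \<inter> V)))"

abbreviation restr :: "('a, 'e) space \<Rightarrow> 'a set \<Rightarrow> ('a, 'e) space"
  where "restr X S \<equiv> X\<lparr>pts := S\<rparr>"

lemma atlas_restr [simp]: "atlas (restr X S) h \<longleftrightarrow> atlas X h"
  by (simp add: atlas_def)

lemma restr_pts [simp]: "restr X (pts X) = X"
  by (cases X) simp

lemma manifold_imp_atlas:
  fixes X :: "('a::{t2_space, second_countable_topology}, 'e::euclidean_space) space"
  assumes X: "manifold X"
  obtains h where "atlas X h"
proof -
  from X obtain H where H: "H \<in> {UNIV, {0}}" and ch: "\<forall>(U, \<phi>)\<in>charts X.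
      open U \<and> openin (top_of_set H) (\<phi> ` U) \<and> homeomorphism U (\<phi> ` U) \<phi> (inv_into U \<phi>)"
    unfolding manifold_def by (elim conjE bexE) (rule that)
  define h :: "'e \<Rightarrow> 'e" where "h = (if H = UNIV then (\<lambda>e. e) else (\<lambda>e. 0))"
  have h: "range h = H" "linear h" "h (h e) = h e" for e
    using H by (auto simp: h_def linear_iff)
  have cov: "(\<Union>(U, \<phi>)\<in>charts X. U) = UNIV"
    using X unfolding manifold_def by (elim conjE)
  have tr: "\<forall>(U, \<phi>)\<in>charts X. \<forall>(V, \<psi>)\<in>charts X.
      smooth_on (\<psi> \<circ> inv_into U \<phi>) (\<phi> ` (U \<inter> V))"
    using X unfolding manifold_def by (elim conjE)
  have "\<exists>U \<phi>. (U, \<phi>) \<in> charts X \<and> x \<in> U" for x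
  proof -
    have "x \<in> (\<Union>(U, \<phi>)\<in>charts X. U)" using cov by simp
    then show ?thesis by auto
  qed
  moreover have "open U \<and> (\<exists>W. open W \<and> \<phi> ` U = W \<inter> range h) \<and>
      homeomorphism U (\<phi> ` U) \<phi> (inv_into U \<phi>)" if "(U, \<phi>) \<in> charts X" for U \<phi>
  proof -
    have "openin (top_of_set (range h)) (\<phi> ` U)" using ch that h(1) by auto
    then have "\<exists>W. open W \<and> \<phi> ` U = W \<inter> range h" by (metis openin_open Int_commute)
    then show ?thesis using ch that by auto
  qed
  moreover have "smooth_on (\<lambda>u. \<psi> (inv_into U \<phi> u)) (\<phi> ` (U \<inter> V))"
    if "(U, \<phi>) \<in> charts X" "(V, \<psi>) \<in> charts X" for U \<phi> V \<psi>
    using bspec[OF bspec[OF tr that(1), unfolded split_conv] that(2)] by (simp add: o_def)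
  ultimately have "atlas X h" using h(2,3) unfolding atlas_def by simp
  then show thesis by (rule that)
qed

lemma smooth_on_id: "smooth_on (\<lambda>x. x) S"
  by (rule smooth_on_subset[OF Cinf_on_imp_smooth_on[OF open_UNIV
          Cinf_on_bounded_linear[OF bounded_linear_ident]]]) simp

lemma smooth_on_inv_image: "inj_on f U \<Longrightarrow> V \<subseteq> U \<Longrightarrow> smooth_on (\<lambda>u. f (inv_into U f u)) (f ` V)"
  by (rule smooth_on_cong_subset[OF smooth_on_id subset_UNIV]) (auto simp: f_inv_into_f)

lemma atlas_eucl: "atlas eucl (\<lambda>x. x)"
proof -
  have "smooth_on (\<lambda>u. id (inv_into UNIV id u)) (id ` (UNIV \<inter> UNIV :: 'a set))"
    by (rule smooth_on_inv_image) auto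
  moreover have "inv_into UNIV id = (id :: 'a \<Rightarrow> 'a)" by (rule ext) (simp add: inv_f_eq)
  ultimately show ?thesis
    by (auto simp: atlas_def eucl_def linear_ident intro!: homeomorphismI continuous_intros)
qed

context
  fixes X :: "('a::topological_space, 'e::euclidean_space) space" and h
  assumes X: "atlas X h"
begin

lemma atlas_linear: "linear h"
  using X unfolding atlas_def by (elim conjE)

lemma atlas_proj: "h (h e) = h e"
  using X unfolding atlas_def by (elim conjE) (erule spec)

lemma atlas_chart: obtains U \<phi> where "(U, \<phi>) \<in> charts X" "x \<in> U"
proof -
  have "\<forall>x. \<exists>U \<phi>. (U, \<phi>) \<in> charts X \<and> x \<in> U" using X unfolding atlas_def by (elim conjE)
  then show thesis using that by blast
qed

context
  fixes U \<phi> assumes c: "(U, \<phi>) \<in> charts X"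
begin

lemma chart_basic: "open U \<and> (\<exists>W. open W \<and> \<phi> ` U = W \<inter> range h) \<and>
    homeomorphism U (\<phi> ` U) \<phi> (inv_into U \<phi>)"
proof -
  have "\<forall>U \<phi>. (U, \<phi>) \<in> charts X \<longrightarrow> open U \<and> (\<exists>W. open W \<and> \<phi> ` U = W \<inter> range h) \<and>
       homeomorphism U (\<phi> ` U) \<phi> (inv_into U \<phi>)"
    using X unfolding atlas_def by (elim conjE)
  from this[rule_format, OF c] show ?thesis .
qed

lemma chart_open: "open U" and chart_homeomorphism: "homeomorphism U (\<phi> ` U) \<phi> (inv_into U \<phi>)"
  using chart_basic by simp_all

lemma chart_image: obtains W where "open W" "\<phi> ` U = W \<inter> range h"
  using chart_basic by (elim conjE exE) (rule that)

lemma chart_transition: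
  assumes "(V, \<psi>) \<in> charts X"
  shows "smooth_on (\<lambda>u. \<psi> (inv_into U \<phi> u)) (\<phi> ` (U \<inter> V))"
proof -
  have "\<forall>U \<phi> V \<psi>. (U, \<phi>) \<in> charts X \<longrightarrow> (V, \<psi>) \<in> charts X \<longrightarrow>
       smooth_on (\<lambda>u. \<psi> (inv_into U \<phi> u)) (\<phi> ` (U \<inter> V))"
    using X unfolding atlas_def by (elim conjE)
  from this[rule_format, OF c assms] show ?thesis .
qed

lemma chart_continuous: "continuous_on U \<phi>"
  and chart_inv_continuous: "continuous_on (\<phi> ` U) (inv_into U \<phi>)"
  and chart_inv: "x \<in> U \<Longrightarrow> inv_into U \<phi> (\<phi> x) = x"
  using chart_homeomorphism unfolding homeomorphism_def by auto

lemma chart_inj: "inj_on \<phi> U"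
  by (rule inj_on_inverseI) (rule chart_inv)

lemma chart_proj: "x \<in> U \<Longrightarrow> h (\<phi> x) = \<phi> x"
proof -
  assume x: "x \<in> U"
  obtain W where "\<phi> ` U = W \<inter> range h" by (rule chart_image)
  with x have "\<phi> x \<in> range h" by blast
  then obtain e where "\<phi> x = h e" by blast
  then show ?thesis by (simp add: atlas_proj)
qed

lemma chart_preimage_open: "open W \<Longrightarrow> open (U \<inter> \<phi> -` W)"
  using continuous_open_preimage[OF chart_continuous chart_open] .

text \<open>Open sets of the manifold are traced by open sets of the full coordinate space, although
  the chart image is only relatively open in the range of \<open>h\<close>.\<close>

lemma chart_open_image:
  assumes "open V"
  obtains W where "open W" "\<And>y. y \<in> U \<Longrightarrow> \<phi> y \<in> W \<longleftrightarrow> y \<in> V"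
proof -
  obtain W where W: "open W" "W \<inter> \<phi> ` U = inv_into U \<phi> -` V \<inter> \<phi> ` U"
    using chart_inv_continuous[unfolded continuous_on_open_invariant] assms by blast
  have "\<phi> y \<in> W \<longleftrightarrow> y \<in> V" if "y \<in> U" for y
  proof -
    have "\<phi> y \<in> W \<longleftrightarrow> \<phi> y \<in> W \<inter> \<phi> ` U" using that by blast
    also have "\<dots> \<longleftrightarrow> y \<in> V" using W(2) chart_inv[OF that] that by simp
    finally show ?thesis .
  qed
  then show thesis using that W(1) by blast
qed

end

end

section \<open>Smooth maps between spaces\<close>

lemma smooth_map_into: "smooth_map X Y f \<Longrightarrow> f ` pts X \<subseteq> T \<Longrightarrow> smooth_map X (restr Y T) f"
  unfolding smooth_map_def by simp

lemma smooth_map_maps: "smooth_map X Y f \<Longrightarrow> x \<in> pts X \<Longrightarrow> f x \<in> pts Y"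
  unfolding smooth_map_def by blast

lemma smooth_mapE:
  assumes "smooth_map X Y f" "x \<in> pts X"
  obtains W g where "open W" "x \<in> W" "\<And>y. y \<in> W \<Longrightarrow> y \<in> pts X \<Longrightarrow> g y = f y" "continuous_on W g"
    "\<And>U \<phi> V \<psi>. (U, \<phi>) \<in> charts X \<Longrightarrow> (V, \<psi>) \<in> charts Y \<Longrightarrow>
       smooth_on (\<lambda>u. \<psi> (g (inv_into U \<phi> u))) (\<phi> ` (U \<inter> W \<inter> g -` V))"
proof -
  have "\<exists>W g. open W \<and> x \<in> W \<and> (\<forall>y\<in>W \<inter> pts X. g y = f y) \<and> continuous_on W g \<and>
       (\<forall>(U, \<phi>)\<in>charts X. \<forall>(V, \<psi>)\<in>charts Y.
          smooth_on (\<psi> \<circ> g \<circ> inv_into U \<phi>) (\<phi> ` (U \<inter> W \<inter> g -` V)))"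
    using assms unfolding smooth_map_def by (elim conjE) (drule (1) bspec)
  then obtain W g where W: "open W" "x \<in> W" "\<forall>y\<in>W \<inter> pts X. g y = f y" "continuous_on W g"
       "\<forall>(U, \<phi>)\<in>charts X. \<forall>(V, \<psi>)\<in>charts Y.
          smooth_on (\<psi> \<circ> g \<circ> inv_into U \<phi>) (\<phi> ` (U \<inter> W \<inter> g -` V))"
    by (elim exE conjE) (rule that)
  have "smooth_on (\<lambda>u. \<psi> (g (inv_into U \<phi> u))) (\<phi> ` (U \<inter> W \<inter> g -` V))"
    if "(U, \<phi>) \<in> charts X" "(V, \<psi>) \<in> charts Y" for U \<phi> V \<psi>
    using bspec[OF bspec[OF W(5) that(1), unfolded split_conv] that(2)] by (simp add: o_def)
  with W(3) show thesis by (intro that[OF W(1,2) _ W(4)]) auto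
qed

lemma smooth_mapI:
  assumes "\<And>x. x \<in> pts X \<Longrightarrow> f x \<in> pts Y"
    and "\<And>x. x \<in> pts X \<Longrightarrow> \<exists>W g. open W \<and> x \<in> W \<and> (\<forall>y. y \<in> W \<longrightarrow> y \<in> pts X \<longrightarrow> g y = f y) \<and>
       continuous_on W g \<and> (\<forall>U \<phi> V \<psi>. (U, \<phi>) \<in> charts X \<longrightarrow> (V, \<psi>) \<in> charts Y \<longrightarrow>
       smooth_on (\<lambda>u. \<psi> (g (inv_into U \<phi> u))) (\<phi> ` (U \<inter> W \<inter> g -` V)))"
  shows "smooth_map X Y f"
  unfolding smooth_map_def
proof (intro conjI ballI)
  fix x assume "x \<in> pts X"
  from assms(2)[OF this] obtain W g where W: "open W" "x \<in> W" "\<forall>y. y \<in> W \<longrightarrow> y \<in> pts X \<longrightarrow> g y = f y" "continuous_on W g"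
    "\<forall>U \<phi> V \<psi>. (U, \<phi>) \<in> charts X \<longrightarrow> (V, \<psi>) \<in> charts Y \<longrightarrow>
       smooth_on (\<lambda>u. \<psi> (g (inv_into U \<phi> u))) (\<phi> ` (U \<inter> W \<inter> g -` V))"
    by (elim exE conjE) (rule that)
  then show "\<exists>W g. open W \<and> x \<in> W \<and> (\<forall>y\<in>W \<inter> pts X. g y = f y) \<and> continuous_on W g \<and>
       (\<forall>(U, \<phi>)\<in>charts X. \<forall>(V, \<psi>)\<in>charts Y.
          smooth_on (\<psi> \<circ> g \<circ> inv_into U \<phi>) (\<phi> ` (U \<inter> W \<inter> g -` V)))"
    by (intro exI[of _ W] exI[of _ g]) (simp add: o_def split_beta)
qed (use assms(1) in blast)

text \<open>\<open>Y'\<close> may have other points than \<open>Y\<close>: the local condition of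
  smoothness involves only the charts of the codomain.\<close>

lemma smooth_map_local:
  assumes "\<And>x. x \<in> pts X \<Longrightarrow> f x \<in> pts Y"
    and "\<And>x. x \<in> pts X \<Longrightarrow> \<exists>N g Y'. open N \<and> x \<in> N \<and> smooth_map (restr X (N \<inter> pts X)) Y' g \<and>
      charts Y' = charts Y \<and> (\<forall>y\<in>N \<inter> pts X. f y = g y)"
  shows "smooth_map X Y f"
proof (rule smooth_mapI[OF assms(1)])
  fix x assume x: "x \<in> pts X"
  from assms(2)[OF x] obtain O' g' Y' where N: "open O'" "x \<in> O'" "smooth_map (restr X (O' \<inter> pts X)) Y' g'"
    "charts Y' = charts Y" "\<forall>y\<in>O' \<inter> pts X. f y = g' y"
    by (elim exE conjE) (rule that)
  have "x \<in> pts (restr X (O' \<inter> pts X))" using x N by simp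
  then obtain W g where W: "open W" "x \<in> W" "\<And>y. y \<in> W \<Longrightarrow> y \<in> pts (restr X (O' \<inter> pts X)) \<Longrightarrow> g y = g' y"
    "continuous_on W g" "\<And>U \<phi> V \<psi>. (U, \<phi>) \<in> charts (restr X (O' \<inter> pts X)) \<Longrightarrow> (V, \<psi>) \<in> charts Y' \<Longrightarrow>
       smooth_on (\<lambda>u. \<psi> (g (inv_into U \<phi> u))) (\<phi> ` (U \<inter> W \<inter> g -` V))"
    by (rule smooth_mapE[OF N(3)]) (rule that)
  have "smooth_on (\<lambda>u. \<psi> (g (inv_into U \<phi> u))) (\<phi> ` (U \<inter> (W \<inter> O') \<inter> g -` V))"
    if "(U, \<phi>) \<in> charts X" "(V, \<psi>) \<in> charts Y" for U \<phi> V \<psi>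
    by (rule smooth_on_subset[OF W(5)]) (use that N(4) in auto)
  then show "\<exists>W g. open W \<and> x \<in> W \<and> (\<forall>y. y \<in> W \<longrightarrow> y \<in> pts X \<longrightarrow> g y = f y) \<and>
       continuous_on W g \<and> (\<forall>U \<phi> V \<psi>. (U, \<phi>) \<in> charts X \<longrightarrow> (V, \<psi>) \<in> charts Y \<longrightarrow>
       smooth_on (\<lambda>u. \<psi> (g (inv_into U \<phi> u))) (\<phi> ` (U \<inter> W \<inter> g -` V)))"
    using N W(1-4) by (intro exI[of _ "W \<inter> O'"] exI[of _ g]) (auto intro: continuous_on_subset)
qed

lemma smooth_map_restr:
  assumes "smooth_map X Y f" "S \<subseteq> pts X" shows "smooth_map (restr X S) Y f"
proof (rule smooth_mapI)
  show "f x \<in> pts Y" if "x \<in> pts (restr X S)" for x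
    using smooth_map_maps[OF assms(1)] assms(2) that by auto
  fix x assume x: "x \<in> pts (restr X S)"
  then have "x \<in> pts X" using assms(2) by auto
  then obtain W g where W: "open W" "x \<in> W" "\<And>y. y \<in> W \<Longrightarrow> y \<in> pts X \<Longrightarrow> g y = f y" "continuous_on W g"
    "\<And>U \<phi> V \<psi>. (U, \<phi>) \<in> charts X \<Longrightarrow> (V, \<psi>) \<in> charts Y \<Longrightarrow>
       smooth_on (\<lambda>u. \<psi> (g (inv_into U \<phi> u))) (\<phi> ` (U \<inter> W \<inter> g -` V))"
    by (rule smooth_mapE[OF assms(1)]) (rule that)
  then show "\<exists>W g. open W \<and> x \<in> W \<and> (\<forall>y. y \<in> W \<longrightarrow> y \<in> pts (restr X S) \<longrightarrow> g y = f y) \<and>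
       continuous_on W g \<and> (\<forall>U \<phi> V \<psi>. (U, \<phi>) \<in> charts (restr X S) \<longrightarrow> (V, \<psi>) \<in> charts Y \<longrightarrow>
       smooth_on (\<lambda>u. \<psi> (g (inv_into U \<phi> u))) (\<phi> ` (U \<inter> W \<inter> g -` V)))"
    using assms(2) by (intro exI[of _ W] exI[of _ g]) auto
qed

lemma smooth_map_cong:
  assumes "smooth_map X Y f" "\<And>x. x \<in> pts X \<Longrightarrow> f x = g x"
  shows "smooth_map X Y g"
proof (rule smooth_map_local)
  show "g x \<in> pts Y" if "x \<in> pts X" for x
    using smooth_map_maps[OF assms(1) that] assms(2)[OF that] by simp
  show "\<exists>N g' Y'. open N \<and> x \<in> N \<and> smooth_map (restr X (N \<inter> pts X)) Y' g' \<and>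
      charts Y' = charts Y \<and> (\<forall>y\<in>N \<inter> pts X. g y = g' y)" for x
    using assms by (intro exI[of _ UNIV] exI[of _ f] exI[of _ Y]) simp
qed

lemma smooth_map_continuous:
  assumes "smooth_map X Y f" shows "continuous_on (pts X) f"
  unfolding continuous_on_def
proof (intro ballI)
  fix x assume x: "x \<in> pts X"
  obtain W g where W: "open W" "x \<in> W" "\<And>y. y \<in> W \<Longrightarrow> y \<in> pts X \<Longrightarrow> g y = f y" "continuous_on W g"
    by (rule smooth_mapE[OF assms x]) (rule that)
  have "(g \<longlongrightarrow> g x) (at x)"
    using bspec[OF W(4)[unfolded continuous_on_def] W(2)] at_within_open[OF W(2,1)] by simp
  then have "(g \<longlongrightarrow> f x) (at x within pts X)"
    using W(3)[OF W(2) x] tendsto_within_subset[of g _ x UNIV] by simp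
  moreover have "\<forall>\<^sub>F y in at x within pts X. g y = f y"
    using W(1-3) by (auto simp: eventually_at_filter eventually_nhds)
  ultimately show "(f \<longlongrightarrow> f x) (at x within pts X)"
    by (rule Lim_transform_eventually)
qed

text \<open>Neither the chart image nor \<open>pts X\<close> need be open, so a coordinate
  expression has no derivative of its own. \<open>F\<close> is an extension of it to an open set,
  and all calculus is done on \<open>F\<close>.\<close>

lemma smooth_map_rep:
  assumes X: "atlas X h" and f: "smooth_map X Y f" and x: "x \<in> pts X"
    and c: "(U, \<phi>) \<in> charts X" "x \<in> U" and d: "(V, \<psi>) \<in> charts Y" "open V" "f x \<in> V"
  obtains N F where "open N" "\<phi> x \<in> N" "Cinf_on F N"
    "\<And>y. y \<in> U \<Longrightarrow> y \<in> pts X \<Longrightarrow> \<phi> y \<in> N \<Longrightarrow> f y \<in> V \<and> F (\<phi> y) = \<psi> (f y)"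
proof -
  obtain W g where W: "open W" "x \<in> W" "\<And>y. y \<in> W \<Longrightarrow> y \<in> pts X \<Longrightarrow> g y = f y" "continuous_on W g"
    "\<And>U \<phi> V \<psi>. (U, \<phi>) \<in> charts X \<Longrightarrow> (V, \<psi>) \<in> charts Y \<Longrightarrow>
       smooth_on (\<lambda>u. \<psi> (g (inv_into U \<phi> u))) (\<phi> ` (U \<inter> W \<inter> g -` V))"
    by (rule smooth_mapE[OF f x]) (rule that)
  have gx: "g x = f x" using W x by simp
  have x': "\<phi> x \<in> \<phi> ` (U \<inter> W \<inter> g -` V)" using c W gx d by auto
  obtain O1 F where F: "open O1" "\<phi> x \<in> O1" "Cinf_on F O1"
    "\<And>u. u \<in> O1 \<Longrightarrow> u \<in> \<phi> ` (U \<inter> W \<inter> g -` V) \<Longrightarrow> F u = \<psi> (g (inv_into U \<phi> u))"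
    by (rule smooth_onE[OF W(5)[OF c(1) d(1)] x']) (rule that)
  have "open (W \<inter> g -` V)" using continuous_open_preimage[OF W(4,1) d(2)] .
  then obtain O2 where O2: "open O2" "\<And>y. y \<in> U \<Longrightarrow> \<phi> y \<in> O2 \<longleftrightarrow> y \<in> W \<inter> g -` V"
    using chart_open_image[OF X c(1)] by metis
  show thesis
  proof (rule that[of "O1 \<inter> O2" F])
    show "open (O1 \<inter> O2)" "\<phi> x \<in> O1 \<inter> O2" using F O2 W d gx c by auto
    show "Cinf_on F (O1 \<inter> O2)" using F(3) Cinf_on_subset by blast
    fix y assume y: "y \<in> U" "y \<in> pts X" "\<phi> y \<in> O1 \<inter> O2"
    then have yW: "y \<in> W" "g y \<in> V" using O2 by auto
    with y have "F (\<phi> y) = \<psi> (g (inv_into U \<phi> (\<phi> y)))" by (intro F(4)) auto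
    then show "f y \<in> V \<and> F (\<phi> y) = \<psi> (f y)"
      using yW W(3) y chart_inv[OF X c(1)] by simp
  qed
qed

text \<open>The converse of \<open>smooth_map_rep\<close>: one pair of charts at each point is
  enough, because the transition maps carry smoothness to all other pairs.\<close>

lemma smooth_mapI_rep:
  assumes X: "atlas X h" and Y: "atlas Y k" and maps: "\<And>x. x \<in> pts X \<Longrightarrow> f x \<in> pts Y"
    and rep: "\<And>x. x \<in> pts X \<Longrightarrow> \<exists>U \<phi> V \<psi> N F. (U, \<phi>) \<in> charts X \<and> x \<in> U \<and> (V, \<psi>) \<in> charts Y \<and> f x \<in> V \<and>
      open N \<and> \<phi> x \<in> N \<and> Cinf_on F N \<and>
      (\<forall>y\<in>U. y \<in> pts X \<longrightarrow> \<phi> y \<in> N \<longrightarrow> f y \<in> V \<and> F (\<phi> y) = \<psi> (f y))"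
  shows "smooth_map X Y f"
proof (rule smooth_mapI[OF maps])
  fix x assume x: "x \<in> pts X"
  from rep[OF x] obtain U \<phi> V \<psi> O1 F where c: "(U, \<phi>) \<in> charts X" "x \<in> U" and d: "(V, \<psi>) \<in> charts Y" "f x \<in> V"
    and F: "open O1" "\<phi> x \<in> O1" "Cinf_on F O1"
    "\<forall>y\<in>U. y \<in> pts X \<longrightarrow> \<phi> y \<in> O1 \<longrightarrow> f y \<in> V \<and> F (\<phi> y) = \<psi> (f y)"
    by (elim exE conjE) (rule that)
  obtain Z where Z: "open Z" "\<psi> ` V = Z \<inter> range k" by (rule chart_image[OF Y d(1)])
  have Fx: "F (\<phi> x) = \<psi> (f x)" using F c x by blast
  have contkF: "continuous_on O1 (\<lambda>u. k (F u))"
    using linear_continuous_on_compose[OF Cinf_on_continuous[OF F(3)] atlas_linear[OF Y]]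
    by (simp add: o_def)
  define O2 where "O2 = O1 \<inter> (\<lambda>u. k (F u)) -` Z"
  have O2: "open O2" unfolding O2_def by (rule continuous_open_preimage[OF contkF F(1) Z(1)])
  have \<phi>x: "\<phi> x \<in> O2"
    using F(2) Fx Z(2) d(2) chart_proj[OF Y d] by (auto simp: O2_def)
  have kFV: "k (F u) \<in> \<psi> ` V" if "u \<in> O2" for u using that Z by (auto simp: O2_def)
  define W where "W = U \<inter> \<phi> -` O2"
  \<comment> \<open>\<open>F\<close> is arbitrary off the coordinates of \<open>pts X\<close>.
    Composition with the projection \<open>k\<close> moves its values into the chart image, so that
    the inverse chart can be applied on a whole neighbourhood.\<close>
  define g where "g y = inv_into V \<psi> (k (F (\<phi> y)))" for y
  have W: "open W" unfolding W_def by (rule chart_preimage_open[OF X c(1) O2])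
  have gy: "\<psi> (g y) = k (F (\<phi> y))" "g y \<in> V" if "y \<in> W" for y
    using kFV[of "\<phi> y"] that unfolding g_def W_def by (auto simp: f_inv_into_f inv_into_into)
  have "continuous_on W g"
    unfolding g_def
  proof (rule continuous_on_compose2[OF chart_inv_continuous[OF Y d(1)]])
    show "continuous_on W (\<lambda>y. k (F (\<phi> y)))"
      by (rule continuous_on_compose2[OF contkF continuous_on_subset[OF chart_continuous[OF X c(1)]]])
        (auto simp: W_def O2_def)
    show "(\<lambda>y. k (F (\<phi> y))) ` W \<subseteq> \<psi> ` V" using kFV by (auto simp: W_def)
  qed
  moreover have "g y = f y" if "y \<in> W" "y \<in> pts X" for y
  proof -
    have y: "y \<in> U" "\<phi> y \<in> O1" using that by (auto simp: W_def O2_def)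
    then have "f y \<in> V" "F (\<phi> y) = \<psi> (f y)" using F(4) that by auto
    then show ?thesis by (simp add: g_def chart_proj[OF Y d(1)] chart_inv[OF Y d(1)])
  qed
  moreover have "smooth_on (\<lambda>u. \<psi>' (g (inv_into U' \<phi>' u))) (\<phi>' ` (U' \<inter> W \<inter> g -` V'))"
    if c': "(U', \<phi>') \<in> charts X" and d': "(V', \<psi>') \<in> charts Y" for U' \<phi>' V' \<psi>'
  proof -
    let ?S = "\<phi>' ` (U' \<inter> W \<inter> g -` V')"
    have 1: "smooth_on (\<lambda>u. \<phi> (inv_into U' \<phi>' u)) ?S"
      by (rule smooth_on_subset[OF chart_transition[OF X c' c(1)]]) (auto simp: W_def)
    have 2: "smooth_on F O2"
      by (rule smooth_on_subset[OF Cinf_on_imp_smooth_on[OF F(1,3)]]) (auto simp: O2_def)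
    have 3: "smooth_on k UNIV"
      by (rule Cinf_on_imp_smooth_on[OF open_UNIV Cinf_on_linear[OF atlas_linear[OF Y]]])
    have 4: "smooth_on (\<lambda>u. F (\<phi> (inv_into U' \<phi>' u))) ?S"
      by (rule smooth_on_compose[OF 2 1]) (auto simp: W_def chart_inv[OF X c'])
    have 5: "smooth_on (\<lambda>u. k (F (\<phi> (inv_into U' \<phi>' u)))) ?S"
      by (rule smooth_on_compose[OF 3 4]) simp
    have "smooth_on (\<lambda>u. \<psi>' (inv_into V \<psi> (k (F (\<phi> (inv_into U' \<phi>' u)))))) ?S"
    proof (rule smooth_on_compose[OF chart_transition[OF Y d(1) d'] 5], clarify)
      fix y assume y: "y \<in> U'" "y \<in> W" "g y \<in> V'"
      have "k (F (\<phi> y)) = \<psi> (g y)" "g y \<in> V \<inter> V'" using gy y by auto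
      then show "k (F (\<phi> (inv_into U' \<phi>' (\<phi>' y)))) \<in> \<psi> ` (V \<inter> V')"
        using chart_inv[OF X c' y(1)] by auto
    qed
    then show ?thesis by (simp add: g_def)
  qed
  moreover have "x \<in> W" using c \<phi>x by (simp add: W_def)
  ultimately show "\<exists>W g. open W \<and> x \<in> W \<and> (\<forall>y. y \<in> W \<longrightarrow> y \<in> pts X \<longrightarrow> g y = f y) \<and>
       continuous_on W g \<and> (\<forall>U \<phi> V \<psi>. (U, \<phi>) \<in> charts X \<longrightarrow> (V, \<psi>) \<in> charts Y \<longrightarrow>
       smooth_on (\<lambda>u. \<psi> (g (inv_into U \<phi> u))) (\<phi> ` (U \<inter> W \<inter> g -` V)))"
    using W by (intro exI[of _ W] exI[of _ g]) simp
qed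

lemma smooth_map_compose:
  assumes X: "atlas X h" and Y: "atlas Y k" and Z: "atlas Z l"
    and f: "smooth_map X Y f" and g: "smooth_map Y Z g"
  shows "smooth_map X Z (\<lambda>x. g (f x))"
proof (rule smooth_mapI_rep[OF X Z])
  show "g (f x) \<in> pts Z" if "x \<in> pts X" for x
    using smooth_map_maps f g that by metis
  fix x assume x: "x \<in> pts X"
  have fx: "f x \<in> pts Y" using smooth_map_maps[OF f x] .
  obtain U \<phi> where c: "(U, \<phi>) \<in> charts X" "x \<in> U" by (rule atlas_chart[OF X])
  obtain V \<psi> where d: "(V, \<psi>) \<in> charts Y" "f x \<in> V" by (rule atlas_chart[OF Y])
  obtain W \<zeta> where e: "(W, \<zeta>) \<in> charts Z" "g (f x) \<in> W" by (rule atlas_chart[OF Z])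
  obtain O1 F where F: "open O1" "\<phi> x \<in> O1" "Cinf_on F O1"
    "\<And>y. y \<in> U \<Longrightarrow> y \<in> pts X \<Longrightarrow> \<phi> y \<in> O1 \<Longrightarrow> f y \<in> V \<and> F (\<phi> y) = \<psi> (f y)"
    by (rule smooth_map_rep[OF X f x c d(1) chart_open[OF Y d(1)] d(2)]) (rule that)
  obtain O2 G where G: "open O2" "\<psi> (f x) \<in> O2" "Cinf_on G O2"
    "\<And>y. y \<in> V \<Longrightarrow> y \<in> pts Y \<Longrightarrow> \<psi> y \<in> O2 \<Longrightarrow> g y \<in> W \<and> G (\<psi> y) = \<zeta> (g y)"
    by (rule smooth_map_rep[OF Y g fx d e(1) chart_open[OF Z e(1)] e(2)]) (rule that)
  have "open (O1 \<inter> F -` O2)"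
    by (rule continuous_open_preimage[OF Cinf_on_continuous[OF F(3)] F(1) G(1)])
  moreover from this have "Cinf_on (\<lambda>u. G (F u)) (O1 \<inter> F -` O2)"
    by (rule Cinf_on_compose[OF _ G(3) Cinf_on_subset[OF F(3)]]) auto
  moreover have "\<phi> x \<in> O1 \<inter> F -` O2" using F G c x by auto
  moreover have "g (f y) \<in> W \<and> G (F (\<phi> y)) = \<zeta> (g (f y))"
    if "y \<in> U" "y \<in> pts X" "\<phi> y \<in> O1 \<inter> F -` O2" for y
    using F(4)[of y] G(4)[of "f y"] that smooth_map_maps[OF f] by auto
  ultimately show "\<exists>U \<phi> V \<psi> N F. (U, \<phi>) \<in> charts X \<and> x \<in> U \<and> (V, \<psi>) \<in> charts Z \<and> g (f x) \<in> V \<and>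
      open N \<and> \<phi> x \<in> N \<and> Cinf_on F N \<and>
      (\<forall>y\<in>U. y \<in> pts X \<longrightarrow> \<phi> y \<in> N \<longrightarrow> g (f y) \<in> V \<and> F (\<phi> y) = \<psi> (g (f y)))"
    using c e by (intro exI[of _ U] exI[of _ \<phi>] exI[of _ W] exI[of _ \<zeta>] exI[of _ "O1 \<inter> F -` O2"]
        exI[of _ "\<lambda>u. G (F u)"]) simp
qed

lemma smooth_map_id: "atlas X h \<Longrightarrow> smooth_map X X (\<lambda>x. x)"
proof (rule smooth_mapI_rep, assumption+)
  fix x assume X: "atlas X h"
  obtain U \<phi> where "(U, \<phi>) \<in> charts X" "x \<in> U" by (rule atlas_chart[OF X])
  then show "\<exists>U \<phi> V \<psi> N F. (U, \<phi>) \<in> charts X \<and> x \<in> U \<and> (V, \<psi>) \<in> charts X \<and> x \<in> V \<and>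
      open N \<and> \<phi> x \<in> N \<and> Cinf_on F N \<and>
      (\<forall>y\<in>U. y \<in> pts X \<longrightarrow> \<phi> y \<in> N \<longrightarrow> y \<in> V \<and> F (\<phi> y) = \<psi> y)"
    by (intro exI[of _ U] exI[of _ \<phi>] exI[of _ UNIV] exI[of _ "\<lambda>x. x"])
      (simp add: Cinf_on_bounded_linear bounded_linear_ident)
qed

lemma smooth_map_const:
  assumes X: "atlas X h" and Y: "atlas Y k" and "c \<in> pts Y"
  shows "smooth_map X Y (\<lambda>x. c)"
proof (rule smooth_mapI_rep[OF X Y])
  fix x
  obtain U \<phi> where "(U, \<phi>) \<in> charts X" "x \<in> U" by (rule atlas_chart[OF X])
  moreover obtain V \<psi> where "(V, \<psi>) \<in> charts Y" "c \<in> V" by (rule atlas_chart[OF Y])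
  ultimately show "\<exists>U \<phi> V \<psi> N F. (U, \<phi>) \<in> charts X \<and> x \<in> U \<and> (V, \<psi>) \<in> charts Y \<and> c \<in> V \<and>
      open N \<and> \<phi> x \<in> N \<and> Cinf_on F N \<and>
      (\<forall>y\<in>U. y \<in> pts X \<longrightarrow> \<phi> y \<in> N \<longrightarrow> c \<in> V \<and> F (\<phi> y) = \<psi> c)"
    by (intro exI[of _ U] exI[of _ \<phi>] exI[of _ V] exI[of _ \<psi>] exI[of _ UNIV] exI[of _ "\<lambda>x. \<psi> c"])
      (simp add: Cinf_on_const)
qed (rule assms(3))

section \<open>Smooth real functions\<close>

lemma charts_eucl [simp]: "charts eucl = {(UNIV, id)}" and pts_eucl [simp]: "pts eucl = UNIV"
  by (simp_all add: eucl_def)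

lemma cinf_rep:
  assumes X: "atlas X h" and f: "f \<in> cinf X" and x: "x \<in> pts X"
    and c: "(U, \<phi>) \<in> charts X" "x \<in> U"
  obtains N F where "open N" "\<phi> x \<in> N" "Cinf_on F N"
    "\<And>y. y \<in> U \<Longrightarrow> y \<in> pts X \<Longrightarrow> \<phi> y \<in> N \<Longrightarrow> F (\<phi> y) = f y"
proof -
  have f': "smooth_map X eucl f" using f by (simp add: cinf_def)
  obtain N F where "open N" "\<phi> x \<in> N" "Cinf_on F N"
    "\<And>y. y \<in> U \<Longrightarrow> y \<in> pts X \<Longrightarrow> \<phi> y \<in> N \<Longrightarrow> f y \<in> UNIV \<and> F (\<phi> y) = id (f y)"
    by (rule smooth_map_rep[OF X f' x c, of UNIV id]) (auto intro: that)
  then show thesis by (intro that[of N F]) auto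
qed

lemma smooth_map_euclI_rep:
  fixes f :: "'a::topological_space \<Rightarrow> 'b::euclidean_space"
  assumes X: "atlas X h" and f: "\<And>x. x \<in> pts X \<Longrightarrow> \<exists>U \<phi> N F. (U, \<phi>) \<in> charts X \<and> x \<in> U \<and>
      open N \<and> \<phi> x \<in> N \<and> Cinf_on F N \<and> (\<forall>y\<in>U. y \<in> pts X \<longrightarrow> \<phi> y \<in> N \<longrightarrow> F (\<phi> y) = f y)"
  shows "smooth_map X eucl f"
proof (rule smooth_mapI_rep[OF X atlas_eucl])
  fix x assume x: "x \<in> pts X"
  from f[OF x] obtain U \<phi> N F where "(U, \<phi>) \<in> charts X" "x \<in> U"
      "open N" "\<phi> x \<in> N" "Cinf_on F N" "\<forall>y\<in>U. y \<in> pts X \<longrightarrow> \<phi> y \<in> N \<longrightarrow> F (\<phi> y) = f y"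
    by (elim exE conjE) (rule that)
  then show "\<exists>U \<phi> V \<psi> N F. (U, \<phi>) \<in> charts X \<and> x \<in> U \<and> (V, \<psi>) \<in> charts eucl \<and> f x \<in> V \<and>
      open N \<and> \<phi> x \<in> N \<and> Cinf_on F N \<and>
      (\<forall>y\<in>U. y \<in> pts X \<longrightarrow> \<phi> y \<in> N \<longrightarrow> f y \<in> V \<and> F (\<phi> y) = \<psi> (f y))"
    by (intro exI[of _ U] exI[of _ \<phi>] exI[of _ UNIV] exI[of _ id] exI[of _ N] exI[of _ F]) simp
qed simp

lemma cinfI_rep:
  assumes X: "atlas X h" and "\<And>x. x \<in> pts X \<Longrightarrow> \<exists>U \<phi> N F. (U, \<phi>) \<in> charts X \<and> x \<in> U \<and>
      open N \<and> \<phi> x \<in> N \<and> Cinf_on F N \<and> (\<forall>y\<in>U. y \<in> pts X \<longrightarrow> \<phi> y \<in> N \<longrightarrow> F (\<phi> y) = f y)"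
  shows "f \<in> cinf X"
  unfolding cinf_def mem_Collect_eq by (rule smooth_map_euclI_rep[OF X]) (rule assms(2))

lemma cinf_local:
  assumes "\<And>x. x \<in> pts X \<Longrightarrow> \<exists>N g. open N \<and> x \<in> N \<and> g \<in> cinf (restr X (N \<inter> pts X)) \<and> (\<forall>y\<in>N \<inter> pts X. f y = g y)"
  shows "f \<in> cinf X"
  unfolding cinf_def mem_Collect_eq
proof (rule smooth_map_local)
  fix x assume "x \<in> pts X"
  from assms[OF this] obtain N g where "open N" "x \<in> N" "g \<in> cinf (restr X (N \<inter> pts X))" "\<forall>y\<in>N \<inter> pts X. f y = g y"
    by (elim exE conjE) (rule that)
  then show "\<exists>N g Y'. open N \<and> x \<in> N \<and> smooth_map (restr X (N \<inter> pts X)) Y' g \<and>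
      charts Y' = charts eucl \<and> (\<forall>y\<in>N \<inter> pts X. f y = g y)"
    by (intro exI[of _ N] exI[of _ g] exI[of _ eucl]) (simp add: cinf_def)
qed simp

lemma cinf_compose:
  "atlas X h \<Longrightarrow> atlas Y k \<Longrightarrow> smooth_map X Y f \<Longrightarrow> g \<in> cinf Y \<Longrightarrow> (\<lambda>x. g (f x)) \<in> cinf X"
  unfolding cinf_def using smooth_map_compose[OF _ _ atlas_eucl] by auto

lemma cinf_restr: "f \<in> cinf X \<Longrightarrow> S \<subseteq> pts X \<Longrightarrow> f \<in> cinf (restr X S)"
  unfolding cinf_def using smooth_map_restr by auto

lemma cinf_cong: "f \<in> cinf X \<Longrightarrow> (\<And>x. x \<in> pts X \<Longrightarrow> f x = g x) \<Longrightarrow> g \<in> cinf X"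
  unfolding cinf_def using smooth_map_cong by blast

lemma cinf_const: "atlas X h \<Longrightarrow> (\<lambda>x. c) \<in> cinf X"
  unfolding cinf_def using smooth_map_const[OF _ atlas_eucl] by auto

text \<open>The common source of sums, differences, products and quotients; the open set
  \<open>D\<close> admits operations that are smooth only in part of the plane, such as
  division.\<close>

lemma cinf_binop:
  assumes X: "atlas X h" and D: "open D" "Cinf_on G D" and fg: "f \<in> cinf X" "g \<in> cinf X"
    and mem: "\<And>x. x \<in> pts X \<Longrightarrow> (f x, g x) \<in> D"
  shows "(\<lambda>x. G (f x, g x)) \<in> cinf X"
proof (rule cinfI_rep[OF X])
  fix x assume x: "x \<in> pts X"
  obtain U \<phi> where c: "(U, \<phi>) \<in> charts X" "x \<in> U" by (rule atlas_chart[OF X])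
  obtain N1 F1 where 1: "open N1" "\<phi> x \<in> N1" "Cinf_on F1 N1"
    "\<And>y. y \<in> U \<Longrightarrow> y \<in> pts X \<Longrightarrow> \<phi> y \<in> N1 \<Longrightarrow> F1 (\<phi> y) = f y"
    by (rule cinf_rep[OF X fg(1) x c]) (rule that)
  obtain N2 F2 where 2: "open N2" "\<phi> x \<in> N2" "Cinf_on F2 N2"
    "\<And>y. y \<in> U \<Longrightarrow> y \<in> pts X \<Longrightarrow> \<phi> y \<in> N2 \<Longrightarrow> F2 (\<phi> y) = g y"
    by (rule cinf_rep[OF X fg(2) x c]) (rule that)
  have F: "Cinf_on (\<lambda>u. (F1 u, F2 u)) (N1 \<inter> N2)"
    by (intro Cinf_on_Pair open_Int 1(1) 2(1) Cinf_on_subset[OF 1(3)] Cinf_on_subset[OF 2(3)]) auto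
  let ?N = "(N1 \<inter> N2) \<inter> (\<lambda>u. (F1 u, F2 u)) -` D"
  have N: "open ?N"
    by (rule continuous_open_preimage[OF Cinf_on_continuous[OF F] open_Int[OF 1(1) 2(1)] D(1)])
  have "Cinf_on (\<lambda>u. G (F1 u, F2 u)) ?N"
    by (rule Cinf_on_compose[OF N D(2) Cinf_on_subset[OF F]]) auto
  then show "\<exists>U \<phi> N F. (U, \<phi>) \<in> charts X \<and> x \<in> U \<and> open N \<and> \<phi> x \<in> N \<and> Cinf_on F N \<and>
      (\<forall>y\<in>U. y \<in> pts X \<longrightarrow> \<phi> y \<in> N \<longrightarrow> F (\<phi> y) = G (f y, g y))"
    using c N 1 2 mem[OF x] x
    by (intro exI[of _ U] exI[of _ \<phi>] exI[of _ ?N] exI[of _ "\<lambda>u. G (F1 u, F2 u)"]) simp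
qed

lemma Cinf_on_fst: "Cinf_on fst U" and Cinf_on_snd: "Cinf_on snd U"
  by (simp_all add: Cinf_on_bounded_linear bounded_linear_fst bounded_linear_snd)

lemma cinf_add: "atlas X h \<Longrightarrow> f \<in> cinf X \<Longrightarrow> g \<in> cinf X \<Longrightarrow> (\<lambda>x. f x + g x) \<in> cinf X"
  using cinf_binop[where G="\<lambda>p. fst p + snd p" and D=UNIV and f=f and g=g]
  by (simp add: Cinf_on_add Cinf_on_fst Cinf_on_snd)

lemma cinf_diff: "atlas X h \<Longrightarrow> f \<in> cinf X \<Longrightarrow> g \<in> cinf X \<Longrightarrow> (\<lambda>x. f x - g x) \<in> cinf X"
  using cinf_binop[where G="\<lambda>p. fst p - snd p" and D=UNIV and f=f and g=g]
  by (simp add: Cinf_on_diff Cinf_on_fst Cinf_on_snd)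

lemma cinf_mult: "atlas X h \<Longrightarrow> f \<in> cinf X \<Longrightarrow> g \<in> cinf X \<Longrightarrow> (\<lambda>x. f x * g x) \<in> cinf X"
  using cinf_binop[where G="\<lambda>p. fst p * snd p" and D=UNIV and f=f and g=g]
  by (simp add: Cinf_on_mult Cinf_on_fst Cinf_on_snd)

lemma cinf_divide:
  assumes "atlas X h" "f \<in> cinf X" "g \<in> cinf X" "\<And>x. x \<in> pts X \<Longrightarrow> g x \<noteq> 0"
  shows "(\<lambda>x. f x / g x) \<in> cinf X"
proof -
  have "open (snd -` (- {0}) :: (real \<times> real) set)" by (intro open_vimage_snd open_Compl closed_singleton)
  from cinf_binop[OF assms(1) this, of "\<lambda>p. fst p / snd p" f g] show ?thesis
    using assms Cinf_on_divide[OF \<open>open (snd -` (- {0}))\<close> Cinf_on_fst Cinf_on_snd] by simp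
qed

lemma cinf_cmult: "atlas X h \<Longrightarrow> f \<in> cinf X \<Longrightarrow> (\<lambda>x. c * f x) \<in> cinf X"
  using cinf_mult cinf_const by blast

lemma cinf_uminus: "atlas X h \<Longrightarrow> f \<in> cinf X \<Longrightarrow> (\<lambda>x. - f x) \<in> cinf X"
  using cinf_cmult[of X h f "-1"] by simp

lemma cinf_sum:
  assumes "atlas X h" "\<And>i. i \<in> I \<Longrightarrow> f i \<in> cinf X"
  shows "(\<lambda>x. \<Sum>i\<in>I. f i x) \<in> cinf X"
  using assms(2)
proof (induction I rule: infinite_finite_induct)
  case (insert i I)
  then show ?case by (simp add: cinf_add[OF assms(1)])
qed (simp_all add: cinf_const[OF assms(1)])

lemma cinf_prod:
  assumes "atlas X h" "\<And>i. i \<in> I \<Longrightarrow> f i \<in> cinf X"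
  shows "(\<lambda>x. \<Prod>i\<in>I. f i x) \<in> cinf X"
  using assms(2)
proof (induction I rule: infinite_finite_induct)
  case (insert i I)
  then show ?case by (simp add: cinf_mult[OF assms(1)])
qed (simp_all add: cinf_const[OF assms(1)])

lemma cinf_chart:
  assumes X: "atlas X h" and c: "(U, \<phi>) \<in> charts X" and N: "open N" and F: "Cinf_on F N"
  shows "(\<lambda>y. F (\<phi> y)) \<in> cinf (restr X (U \<inter> \<phi> -` N))"
proof (rule cinfI_rep)
  show "atlas (restr X (U \<inter> \<phi> -` N)) h" using X by simp
  fix x assume "x \<in> pts (restr X (U \<inter> \<phi> -` N))"
  then show "\<exists>V \<psi> M G. (V, \<psi>) \<in> charts (restr X (U \<inter> \<phi> -` N)) \<and> x \<in> V \<and>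
      open M \<and> \<psi> x \<in> M \<and> Cinf_on G M \<and>
      (\<forall>y\<in>V. y \<in> pts (restr X (U \<inter> \<phi> -` N)) \<longrightarrow> \<psi> y \<in> M \<longrightarrow> G (\<psi> y) = F (\<phi> y))"
    using c N F by (intro exI[of _ U] exI[of _ \<phi>] exI[of _ N] exI[of _ F]) simp
qed

section \<open>Bump functions\<close>

text \<open>Extension by zero is smooth if the support is closed in the whole space. Here it lies in
  the image of a compact piece of a closed ball under the inverse chart, which is closed because the
  space is Hausdorff.\<close>

lemma bump_function:
  fixes X :: "('a::t2_space, 'e::euclidean_space) space"
  assumes X: "atlas X h" and N: "open N" "p \<in> N"
  obtains b V C where "b \<in> cinf (restr X UNIV)" "open V" "p \<in> V" "V \<subseteq> C" "closed C" "C \<subseteq> N"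
    "\<And>y. y \<in> V \<Longrightarrow> b y = 1" "\<And>y. y \<notin> C \<Longrightarrow> b y = 0"
proof -
  obtain U \<phi> where c: "(U, \<phi>) \<in> charts X" "p \<in> U" by (rule atlas_chart[OF X])
  obtain W where W: "open W" "\<phi> ` U = W \<inter> range h" by (rule chart_image[OF X c(1)])
  obtain N' where N': "open N'" "\<And>y. y \<in> U \<Longrightarrow> \<phi> y \<in> N' \<longleftrightarrow> y \<in> N"
    by (rule chart_open_image[OF X c(1) N(1)]) (rule that)
  have "\<phi> p \<in> N' \<inter> W" using N' N c W by blast
  then obtain r where r: "r > 0" "cball (\<phi> p) r \<subseteq> N' \<inter> W"
    using open_contains_cball N'(1) W(1) open_Int by metis
  define s where "s = r / 2"
  have s: "s > 0" "2 * s = r" using r by (auto simp: s_def)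
  obtain b :: "'e \<Rightarrow> real" where b: "Cinf_on b UNIV" "\<And>x. x \<in> ball (\<phi> p) s \<Longrightarrow> b x = 1"
    "\<And>x. x \<notin> ball (\<phi> p) (2 * s) \<Longrightarrow> b x = 0"
    using smooth_plateau[OF s(1), of "\<phi> p"] by metis
  define \<beta> where "\<beta> y = (if y \<in> U then b (\<phi> y) else 0)" for y
  define V where "V = U \<inter> \<phi> -` ball (\<phi> p) s"
  define K where "K = cball (\<phi> p) r \<inter> range h"
  define C where "C = inv_into U \<phi> ` K"
  have K: "K \<subseteq> \<phi> ` U" using r W by (auto simp: K_def)
  have "compact K"
    unfolding K_def by (intro compact_Int_closed compact_cball closed_subspace
        linear_subspace_image[OF atlas_linear[OF X] subspace_UNIV])
  then have "closed C"
    unfolding C_def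
    by (intro compact_imp_closed compact_continuous_image
        continuous_on_subset[OF chart_inv_continuous[OF X c(1)] K])
  have CU: "y \<in> C \<longleftrightarrow> y \<in> U \<and> \<phi> y \<in> cball (\<phi> p) r" for y
  proof
    assume "y \<in> C"
    then obtain k where k: "k \<in> K" "y = inv_into U \<phi> k" by (auto simp: C_def)
    then have "y \<in> U" "\<phi> y = k" using K by (auto simp: inv_into_into f_inv_into_f)
    then show "y \<in> U \<and> \<phi> y \<in> cball (\<phi> p) r" using k by (simp add: K_def)
  next
    assume y: "y \<in> U \<and> \<phi> y \<in> cball (\<phi> p) r"
    then have "\<phi> y \<in> K" using W unfolding K_def by blast
    then show "y \<in> C" unfolding C_def using chart_inv[OF X c(1)] y by (metis imageI)
  qed
  have \<beta>0: "\<beta> y = 0" if "y \<notin> C" for y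
    using that b(3)[of "\<phi> y"] s(2) by (auto simp: \<beta>_def CU)
  have "\<beta> \<in> cinf (restr X UNIV)"
  proof (rule cinf_local)
    fix x
    show "\<exists>N g. open N \<and> x \<in> N \<and> g \<in> cinf (restr (restr X UNIV) (N \<inter> pts (restr X UNIV))) \<and>
        (\<forall>y\<in>N \<inter> pts (restr X UNIV). \<beta> y = g y)"
    proof (cases "x \<in> U")
      case True
      have "(\<lambda>y. b (\<phi> y)) \<in> cinf (restr X (U \<inter> \<phi> -` UNIV))"
        by (rule cinf_chart[OF X c(1) open_UNIV b(1)])
      then show ?thesis using True chart_open[OF X c(1)]
        by (intro exI[of _ U] exI[of _ "\<lambda>y. b (\<phi> y)"]) (simp add: \<beta>_def)
    next
      case False
      then have "x \<in> - C" using CU by simp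
      then show ?thesis using \<open>closed C\<close> \<beta>0 cinf_const[of "restr X (- C)" h 0] X
        by (intro exI[of _ "- C"] exI[of _ "\<lambda>y. 0"]) (simp add: open_Compl)
    qed
  qed
  moreover have "open V" unfolding V_def by (rule chart_preimage_open[OF X c(1) open_ball])
  moreover have "p \<in> V" using s c by (simp add: V_def)
  moreover have "V \<subseteq> C" using s by (auto simp: V_def CU)
  moreover have "C \<subseteq> N" using CU N'(2) r(2) by blast
  moreover have "\<beta> y = 1" if "y \<in> V" for y using that b(2) by (simp add: V_def \<beta>_def)
  ultimately show thesis using \<open>closed C\<close> \<beta>0 by (intro that[of \<beta> V C]) auto
qed

lemma cinf_extend_zero:
  assumes X: "atlas X h" and N: "open N" and f: "f \<in> cinf (restr X (N \<inter> S))"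
    and b: "b \<in> cinf (restr X S)" and C: "closed C" "C \<subseteq> N" "\<And>y. y \<notin> C \<Longrightarrow> b y = 0"
  shows "(\<lambda>y. b y * f y) \<in> cinf (restr X S)"
proof (rule cinf_local)
  fix x assume x: "x \<in> pts (restr X S)"
  show "\<exists>M g. open M \<and> x \<in> M \<and> g \<in> cinf (restr (restr X S) (M \<inter> pts (restr X S))) \<and>
      (\<forall>y\<in>M \<inter> pts (restr X S). b y * f y = g y)"
  proof (cases "x \<in> N")
    case True
    have "b \<in> cinf (restr X (N \<inter> S))" using cinf_restr[OF b, of "N \<inter> S"] by simp
    with f have "(\<lambda>y. b y * f y) \<in> cinf (restr X (N \<inter> S))" using X by (intro cinf_mult) auto
    then show ?thesis using True N by (intro exI[of _ N] exI[of _ "\<lambda>y. b y * f y"]) simp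
  next
    case False
    then show ?thesis using C cinf_const[of "restr X (- C \<inter> S)" h 0] X
      by (intro exI[of _ "- C"] exI[of _ "\<lambda>y. 0"]) (auto simp: open_Compl)
  qed
qed

lemma cinf_extend:
  fixes X :: "('a::t2_space, 'e::euclidean_space) space"
  assumes X: "atlas X h" and N: "open N" "p \<in> N" and f: "f \<in> cinf (restr X (N \<inter> S))"
  obtains g V where "g \<in> cinf (restr X S)" "open V" "p \<in> V" "V \<subseteq> N" "\<And>y. y \<in> V \<Longrightarrow> g y = f y"
proof -
  obtain b V C where b: "b \<in> cinf (restr X UNIV)" "open V" "p \<in> V" "V \<subseteq> C" "closed C" "C \<subseteq> N"
    "\<And>y. y \<in> V \<Longrightarrow> b y = 1" "\<And>y. y \<notin> C \<Longrightarrow> b y = 0"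
    by (rule bump_function[OF X N]) (rule that)
  have "b \<in> cinf (restr X S)" using cinf_restr[OF b(1), of S] by simp
  from cinf_extend_zero[OF X N(1) f this b(5,6,8)] show thesis
    using b by (intro that[of "\<lambda>y. b y * f y" V]) auto
qed

text \<open>Smooth functions on a submanifold come locally from the ambient manifold. Tangent
  vectors of the submanifold are therefore determined by their values on ambient functions.\<close>

lemma cinf_extend_ambient:
  fixes X :: "('a::t2_space, 'e::euclidean_space) space"
  assumes X: "atlas X h" and f: "f \<in> cinf X" and p: "p \<in> pts X"
  obtains g V where "g \<in> cinf (restr X UNIV)" "open V" "p \<in> V" "\<And>y. y \<in> V \<Longrightarrow> y \<in> pts X \<Longrightarrow> g y = f y"
proof -
  obtain U \<phi> where c: "(U, \<phi>) \<in> charts X" "p \<in> U" by (rule atlas_chart[OF X])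
  obtain N F where F: "open N" "\<phi> p \<in> N" "Cinf_on F N"
    "\<And>y. y \<in> U \<Longrightarrow> y \<in> pts X \<Longrightarrow> \<phi> y \<in> N \<Longrightarrow> F (\<phi> y) = f y"
    by (rule cinf_rep[OF X f p c]) (rule that)
  have "(\<lambda>y. F (\<phi> y)) \<in> cinf (restr X ((U \<inter> \<phi> -` N) \<inter> UNIV))"
    using cinf_chart[OF X c(1) F(1,3)] by simp
  moreover have "open (U \<inter> \<phi> -` N)" "p \<in> U \<inter> \<phi> -` N"
    using chart_preimage_open[OF X c(1) F(1)] c F by auto
  ultimately obtain g V where g: "g \<in> cinf (restr X UNIV)" "open V" "p \<in> V" "V \<subseteq> U \<inter> \<phi> -` N"
    "\<And>y. y \<in> V \<Longrightarrow> g y = F (\<phi> y)"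
    using cinf_extend[OF X, of "U \<inter> \<phi> -` N" p "\<lambda>y. F (\<phi> y)" UNIV] by metis
  show thesis
    using g F(4) by (intro that[of g V]) auto
qed

section \<open>Products\<close>

lemma charts_prod_space: "(A, \<theta>) \<in> charts (prod_space X Y) \<longleftrightarrow>
    (\<exists>U \<phi> V \<psi>. A = U \<times> V \<and> \<theta> = map_prod \<phi> \<psi> \<and> (U, \<phi>) \<in> charts X \<and> (V, \<psi>) \<in> charts Y)"
  by (auto simp: prod_space_def)

lemma pts_prod_space [simp]: "pts (prod_space X Y) = pts X \<times> pts Y"
  by (simp add: prod_space_def)

lemma prod_space_restr: "prod_space (restr X S) (restr Y T) = restr (prod_space X Y) (S \<times> T)"
  by (simp add: prod_space_def)

lemma fibre_prod_restr: "fibre_prod X Y f g = restr (prod_space X Y) {(x, y). x \<in> pts X \<and> y \<in> pts Y \<and> f x = g y}"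
  by (simp add: fibre_prod_def)

lemma smooth_on_Pair:
  assumes "smooth_on f S" "smooth_on g S" shows "smooth_on (\<lambda>x. (f x, g x)) S"
  unfolding smooth_on_iff_Cinf
proof
  fix x assume x: "x \<in> S"
  obtain U F where F: "open U" "x \<in> U" "Cinf_on F U" "\<And>y. y \<in> U \<Longrightarrow> y \<in> S \<Longrightarrow> F y = f y"
    by (rule smooth_onE[OF assms(1) x]) (rule that)
  obtain V G where G: "open V" "x \<in> V" "Cinf_on G V" "\<And>y. y \<in> V \<Longrightarrow> y \<in> S \<Longrightarrow> G y = g y"
    by (rule smooth_onE[OF assms(2) x]) (rule that)
  have "Cinf_on (\<lambda>y. (F y, G y)) (U \<inter> V)"
    by (intro Cinf_on_Pair open_Int F(1) G(1) Cinf_on_subset[OF F(3)] Cinf_on_subset[OF G(3)]) auto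
  then show "\<exists>U h. open U \<and> x \<in> U \<and> Cinf_on h U \<and> (\<forall>y\<in>U \<inter> S. h y = (f y, g y))"
    using F G by (intro exI[of _ "U \<inter> V"] exI[of _ "\<lambda>y. (F y, G y)"]) auto
qed

lemma inv_into_map_prod:
  assumes "inj_on \<phi> U" "inj_on \<psi> V" "z \<in> map_prod \<phi> \<psi> ` (U \<times> V)"
  shows "inv_into (U \<times> V) (map_prod \<phi> \<psi>) z = (inv_into U \<phi> (fst z), inv_into V \<psi> (snd z))"
proof -
  obtain a b where ab: "a \<in> U" "b \<in> V" "z = map_prod \<phi> \<psi> (a, b)"
    using assms(3) by (elim imageE SigmaE) (auto intro: that)
  have "inj_on (map_prod \<phi> \<psi>) (U \<times> V)"
    using assms(1,2) by (auto simp: inj_on_def)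
  from inv_into_f_f[OF this, of "(a, b)"] have "inv_into (U \<times> V) (map_prod \<phi> \<psi>) z = (a, b)"
    using ab by simp
  then show ?thesis using ab assms by simp
qed

lemma atlas_prod:
  fixes X :: "('a::topological_space, 'e::euclidean_space) space"
    and Y :: "('b::topological_space, 'f::euclidean_space) space"
  assumes X: "atlas X h" and Y: "atlas Y k"
  shows "atlas (prod_space X Y) (map_prod h k)"
proof -
  have lin: "linear (map_prod h k)"
    using atlas_linear[OF X] atlas_linear[OF Y] by (auto simp: linear_iff)
  have proj: "\<forall>e. map_prod h k (map_prod h k e) = map_prod h k e"
    using atlas_proj[OF X] atlas_proj[OF Y] by (auto simp: split_paired_all)
  have cov: "\<forall>z. \<exists>A \<theta>. (A, \<theta>) \<in> charts (prod_space X Y) \<and> z \<in> A"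
  proof
    fix z :: "'a \<times> 'b"
    obtain U \<phi> where "(U, \<phi>) \<in> charts X" "fst z \<in> U" by (rule atlas_chart[OF X])
    moreover obtain V \<psi> where "(V, \<psi>) \<in> charts Y" "snd z \<in> V" by (rule atlas_chart[OF Y])
    ultimately show "\<exists>A \<theta>. (A, \<theta>) \<in> charts (prod_space X Y) \<and> z \<in> A"
      unfolding charts_prod_space by (intro exI[of _ "U \<times> V"] exI[of _ "map_prod \<phi> \<psi>"]) (auto simp: mem_Times_iff)
  qed
  have chart: "open A \<and> (\<exists>W. open W \<and> \<theta> ` A = W \<inter> range (map_prod h k)) \<and> homeomorphism A (\<theta> ` A) \<theta> (inv_into A \<theta>)"
    if A: "(A, \<theta>) \<in> charts (prod_space X Y)" for A \<theta>
  proof -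
    obtain U \<phi> V \<psi> where e: "A = U \<times> V" "\<theta> = map_prod \<phi> \<psi>" and c: "(U, \<phi>) \<in> charts X" and d: "(V, \<psi>) \<in> charts Y"
      using A unfolding charts_prod_space by (elim exE conjE) (rule that)
    have im: "\<theta> ` A = \<phi> ` U \<times> \<psi> ` V" unfolding e by auto
    obtain W where W: "open W" "\<phi> ` U = W \<inter> range h" by (rule chart_image[OF X c])
    obtain Z where Z: "open Z" "\<psi> ` V = Z \<inter> range k" by (rule chart_image[OF Y d])
    have "\<theta> ` A = (W \<times> Z) \<inter> range (map_prod h k)"
    proof -
      have "range (map_prod h k) = range h \<times> range k" by auto
      then show ?thesis unfolding im W(2) Z(2) by auto
    qed
    then have 2: "\<exists>W. open W \<and> \<theta> ` A = W \<inter> range (map_prod h k)"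
      using open_Times[OF W(1) Z(1)] by (intro exI[of _ "W \<times> Z"]) simp
    have inv: "inv_into A \<theta> z = (inv_into U \<phi> (fst z), inv_into V \<psi> (snd z))" if "z \<in> \<theta> ` A" for z
      using inv_into_map_prod[OF chart_inj[OF X c] chart_inj[OF Y d]] that unfolding e by blast
    have "homeomorphism A (\<theta> ` A) \<theta> (inv_into A \<theta>)"
    proof (rule homeomorphismI)
      show "continuous_on A \<theta>"
        unfolding e map_prod_def split_beta
        by (intro continuous_on_Pair continuous_on_compose2[OF chart_continuous[OF X c]]
            continuous_on_compose2[OF chart_continuous[OF Y d]] continuous_intros) auto
      have "continuous_on (\<theta> ` A) (\<lambda>z. (inv_into U \<phi> (fst z), inv_into V \<psi> (snd z)))"
        by (intro continuous_on_Pair continuous_on_compose2[OF chart_inv_continuous[OF X c]]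
            continuous_on_compose2[OF chart_inv_continuous[OF Y d]] continuous_intros) (auto simp: im)
      then show "continuous_on (\<theta> ` A) (inv_into A \<theta>)"
        by (rule continuous_on_eq) (simp add: inv)
      have inj: "inj_on \<theta> A"
        using chart_inj[OF X c] chart_inj[OF Y d] unfolding e by (auto simp: inj_on_def)
      show "inv_into A \<theta> (\<theta> x) = x" if "x \<in> A" for x using inv_into_f_f[OF inj that] .
      show "\<theta> (inv_into A \<theta> y) = y" if "y \<in> \<theta> ` A" for y using f_inv_into_f[OF that] .
      show "inv_into A \<theta> ` \<theta> ` A \<subseteq> A"
        by (intro subsetI, elim imageE) (simp add: inv_into_f_f[OF inj])
      show "\<theta> ` A \<subseteq> \<theta> ` A" by (rule subset_refl)
    qed
    with 2 show ?thesis
      using open_Times[OF chart_open[OF X c] chart_open[OF Y d]] unfolding e by simp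
  qed
  have trans: "smooth_on (\<lambda>u. \<theta>' (inv_into A \<theta> u)) (\<theta> ` (A \<inter> A'))"
    if A: "(A, \<theta>) \<in> charts (prod_space X Y)" and A': "(A', \<theta>') \<in> charts (prod_space X Y)" for A \<theta> A' \<theta>'
  proof -
    obtain U \<phi> V \<psi> where e: "A = U \<times> V" "\<theta> = map_prod \<phi> \<psi>" and c: "(U, \<phi>) \<in> charts X" and d: "(V, \<psi>) \<in> charts Y"
      using A unfolding charts_prod_space by (elim exE conjE) (rule that)
    obtain U' \<phi>' V' \<psi>' where e': "A' = U' \<times> V'" "\<theta>' = map_prod \<phi>' \<psi>'" and c': "(U', \<phi>') \<in> charts X" and d': "(V', \<psi>') \<in> charts Y"
      using A' unfolding charts_prod_space by (elim exE conjE) (rule that)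
    have f: "smooth_on fst (\<theta> ` (A \<inter> A'))" and s: "smooth_on snd (\<theta> ` (A \<inter> A'))"
      by (auto intro!: smooth_on_subset[OF Cinf_on_imp_smooth_on[OF open_UNIV Cinf_on_bounded_linear]]
          bounded_linear_fst bounded_linear_snd)
    have "smooth_on (\<lambda>u. (\<phi>' (inv_into U \<phi> (fst u)), \<psi>' (inv_into V \<psi> (snd u)))) (\<theta> ` (A \<inter> A'))"
      by (intro smooth_on_Pair smooth_on_compose[OF chart_transition[OF X c c'] f]
          smooth_on_compose[OF chart_transition[OF Y d d'] s]) (auto simp: e e')
    then show ?thesis
    proof (rule smooth_on_cong_subset[OF _ subset_refl])
      fix u assume "u \<in> \<theta> ` (A \<inter> A')"
      then have "u \<in> map_prod \<phi> \<psi> ` (U \<times> V)" unfolding e by blast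
      from inv_into_map_prod[OF chart_inj[OF X c] chart_inj[OF Y d] this]
      show "(\<phi>' (inv_into U \<phi> (fst u)), \<psi>' (inv_into V \<psi> (snd u))) = \<theta>' (inv_into A \<theta> u)"
        by (simp add: e e')
    qed
  qed
  show ?thesis
    unfolding atlas_def by (intro conjI lin proj cov allI impI chart trans)
qed

lemma atlas_prod_restr: "atlas X h \<Longrightarrow> atlas Y k \<Longrightarrow> atlas (restr (prod_space X Y) S) (map_prod h k)"
  by (simp add: atlas_prod)

lemma smooth_map_fst:
  fixes X :: "('a::topological_space, 'e::euclidean_space) space"
    and Y :: "('b::topological_space, 'f::euclidean_space) space"
  assumes X: "atlas X h" and Y: "atlas Y k" and "\<And>z. z \<in> S \<Longrightarrow> fst z \<in> pts X"
  shows "smooth_map (restr (prod_space X Y) S) X fst"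
proof (rule smooth_mapI_rep[OF atlas_prod_restr[OF X Y] X])
  show "fst z \<in> pts X" if "z \<in> pts (restr (prod_space X Y) S)" for z using that assms(3) by simp
  fix z :: "'a \<times> 'b"
  obtain U \<phi> where c: "(U, \<phi>) \<in> charts X" "fst z \<in> U" by (rule atlas_chart[OF X])
  obtain V \<psi> where d: "(V, \<psi>) \<in> charts Y" "snd z \<in> V" by (rule atlas_chart[OF Y])
  have "(U \<times> V, map_prod \<phi> \<psi>) \<in> charts (prod_space X Y)"
    unfolding charts_prod_space using c d by (intro exI[of _ U] exI[of _ \<phi>] exI[of _ V] exI[of _ \<psi>]) simp
  with c d show "\<exists>A \<theta> U \<phi> N F. (A, \<theta>) \<in> charts (restr (prod_space X Y) S) \<and> z \<in> A \<and> (U, \<phi>) \<in> charts X \<and> fst z \<in> U \<and>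
      open N \<and> \<theta> z \<in> N \<and> Cinf_on F N \<and>
      (\<forall>y\<in>A. y \<in> pts (restr (prod_space X Y) S) \<longrightarrow> \<theta> y \<in> N \<longrightarrow> fst y \<in> U \<and> F (\<theta> y) = \<phi> (fst y))"
    by (intro exI[of _ "U \<times> V"] exI[of _ "map_prod \<phi> \<psi>"] exI[of _ U] exI[of _ \<phi>] exI[of _ UNIV] exI[of _ fst])
      (auto simp: mem_Times_iff intro: Cinf_on_bounded_linear[OF bounded_linear_fst])
qed

lemma smooth_map_snd:
  fixes X :: "('a::topological_space, 'e::euclidean_space) space"
    and Y :: "('b::topological_space, 'f::euclidean_space) space"
  assumes X: "atlas X h" and Y: "atlas Y k" and "\<And>z. z \<in> S \<Longrightarrow> snd z \<in> pts Y"
  shows "smooth_map (restr (prod_space X Y) S) Y snd"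
proof (rule smooth_mapI_rep[OF atlas_prod_restr[OF X Y] Y])
  show "snd z \<in> pts Y" if "z \<in> pts (restr (prod_space X Y) S)" for z using that assms(3) by simp
  fix z :: "'a \<times> 'b"
  obtain U \<phi> where c: "(U, \<phi>) \<in> charts X" "fst z \<in> U" by (rule atlas_chart[OF X])
  obtain V \<psi> where d: "(V, \<psi>) \<in> charts Y" "snd z \<in> V" by (rule atlas_chart[OF Y])
  have "(U \<times> V, map_prod \<phi> \<psi>) \<in> charts (prod_space X Y)"
    unfolding charts_prod_space using c d by (intro exI[of _ U] exI[of _ \<phi>] exI[of _ V] exI[of _ \<psi>]) simp
  with c d show "\<exists>A \<theta> U \<phi> N F. (A, \<theta>) \<in> charts (restr (prod_space X Y) S) \<and> z \<in> A \<and> (U, \<phi>) \<in> charts Y \<and> snd z \<in> U \<and>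
      open N \<and> \<theta> z \<in> N \<and> Cinf_on F N \<and>
      (\<forall>y\<in>A. y \<in> pts (restr (prod_space X Y) S) \<longrightarrow> \<theta> y \<in> N \<longrightarrow> snd y \<in> U \<and> F (\<theta> y) = \<phi> (snd y))"
    by (intro exI[of _ "U \<times> V"] exI[of _ "map_prod \<phi> \<psi>"] exI[of _ V] exI[of _ \<psi>] exI[of _ UNIV] exI[of _ snd])
      (auto simp: mem_Times_iff intro: Cinf_on_bounded_linear[OF bounded_linear_snd])
qed

lemma smooth_map_Pair:
  assumes Z: "atlas Z l" and X: "atlas X h" and Y: "atlas Y k"
    and f: "smooth_map Z X f" and g: "smooth_map Z Y g" and S: "\<And>z. z \<in> pts Z \<Longrightarrow> (f z, g z) \<in> S"
  shows "smooth_map Z (restr (prod_space X Y) S) (\<lambda>z. (f z, g z))"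
proof (rule smooth_mapI_rep[OF Z atlas_prod_restr[OF X Y]])
  show "(f z, g z) \<in> pts (restr (prod_space X Y) S)" if "z \<in> pts Z" for z using that S by simp
  fix z assume z: "z \<in> pts Z"
  obtain A \<theta> where a: "(A, \<theta>) \<in> charts Z" "z \<in> A" by (rule atlas_chart[OF Z])
  obtain U \<phi> where c: "(U, \<phi>) \<in> charts X" "f z \<in> U" by (rule atlas_chart[OF X])
  obtain V \<psi> where d: "(V, \<psi>) \<in> charts Y" "g z \<in> V" by (rule atlas_chart[OF Y])
  obtain N1 F where F: "open N1" "\<theta> z \<in> N1" "Cinf_on F N1"
    "\<And>y. y \<in> A \<Longrightarrow> y \<in> pts Z \<Longrightarrow> \<theta> y \<in> N1 \<Longrightarrow> f y \<in> U \<and> F (\<theta> y) = \<phi> (f y)"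
    by (rule smooth_map_rep[OF Z f z a c(1) chart_open[OF X c(1)] c(2)]) (rule that)
  obtain N2 G where G: "open N2" "\<theta> z \<in> N2" "Cinf_on G N2"
    "\<And>y. y \<in> A \<Longrightarrow> y \<in> pts Z \<Longrightarrow> \<theta> y \<in> N2 \<Longrightarrow> g y \<in> V \<and> G (\<theta> y) = \<psi> (g y)"
    by (rule smooth_map_rep[OF Z g z a d(1) chart_open[OF Y d(1)] d(2)]) (rule that)
  have "Cinf_on (\<lambda>u. (F u, G u)) (N1 \<inter> N2)"
    by (intro Cinf_on_Pair open_Int F(1) G(1) Cinf_on_subset[OF F(3)] Cinf_on_subset[OF G(3)]) auto
  moreover have "(U \<times> V, map_prod \<phi> \<psi>) \<in> charts (prod_space X Y)"
    unfolding charts_prod_space using c d by (intro exI[of _ U] exI[of _ \<phi>] exI[of _ V] exI[of _ \<psi>]) simp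
  ultimately show "\<exists>A \<theta> U \<phi> N F. (A, \<theta>) \<in> charts Z \<and> z \<in> A \<and>
      (U, \<phi>) \<in> charts (restr (prod_space X Y) S) \<and> (f z, g z) \<in> U \<and>
      open N \<and> \<theta> z \<in> N \<and> Cinf_on F N \<and>
      (\<forall>y\<in>A. y \<in> pts Z \<longrightarrow> \<theta> y \<in> N \<longrightarrow> (f y, g y) \<in> U \<and> F (\<theta> y) = \<phi> (f y, g y))"
    using a c d F G
    by (intro exI[of _ A] exI[of _ \<theta>] exI[of _ "U \<times> V"] exI[of _ "map_prod \<phi> \<psi>"] exI[of _ "N1 \<inter> N2"]
        exI[of _ "\<lambda>u. (F u, G u)"]) (simp add: open_Int)
qed

section \<open>Tangent vectors\<close>

lemma tangentD:
  assumes "v \<in> tangent_space X p"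
  shows tangent_lin: "f \<in> cinf X \<Longrightarrow> g \<in> cinf X \<Longrightarrow> v (\<lambda>y. a * f y + b * g y) = a * v f + b * v g"
    and tangent_mult: "f \<in> cinf X \<Longrightarrow> g \<in> cinf X \<Longrightarrow> v (\<lambda>y. f y * g y) = f p * v g + g p * v f"
    and tangent_nonsmooth: "f \<notin> cinf X \<Longrightarrow> v f = 0"
  using assms unfolding tangent_space_def by auto

lemma tangent_spaceI:
  assumes "\<And>f g a b. f \<in> cinf X \<Longrightarrow> g \<in> cinf X \<Longrightarrow> v (\<lambda>y. a * f y + b * g y) = a * v f + b * v g"
    and "\<And>f g. f \<in> cinf X \<Longrightarrow> g \<in> cinf X \<Longrightarrow> v (\<lambda>y. f y * g y) = f p * v g + g p * v f"
    and "\<And>f. f \<notin> cinf X \<Longrightarrow> v f = 0"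
  shows "v \<in> tangent_space X p"
  unfolding tangent_space_def using assms by simp

lemma subspace_tangent_space: "subspace (tangent_space X p)"
  unfolding subspace_def tangent_space_def
  by (auto simp: scaleR_fun_def algebra_simps)

lemma tangent_eqI:
  assumes "v \<in> tangent_space X p" "w \<in> tangent_space X p" "\<And>f. f \<in> cinf X \<Longrightarrow> v f = w f"
  shows "v = w"
proof
  fix f
  show "v f = w f"
  proof (cases "f \<in> cinf X")
    case False
    then show ?thesis using tangent_nonsmooth[OF assms(1)] tangent_nonsmooth[OF assms(2)] by simp
  qed (rule assms(3))
qed

context
  fixes X :: "('a::topological_space, 'e::euclidean_space) space" and h v p
  assumes X: "atlas X h" and v: "v \<in> tangent_space X p"
begin

lemma tangent_add: "f \<in> cinf X \<Longrightarrow> g \<in> cinf X \<Longrightarrow> v (\<lambda>y. f y + g y) = v f + v g"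
  and tangent_diff: "f \<in> cinf X \<Longrightarrow> g \<in> cinf X \<Longrightarrow> v (\<lambda>y. f y - g y) = v f - v g"
  and tangent_cmult: "f \<in> cinf X \<Longrightarrow> v (\<lambda>y. a * f y) = a * v f"
  and tangent_uminus: "f \<in> cinf X \<Longrightarrow> v (\<lambda>y. - f y) = - v f"
  using tangent_lin[OF v, of f g 1 1] tangent_lin[OF v, of f g 1 "-1"] tangent_lin[OF v, of f f a 0]
    tangent_lin[OF v, of f f "-1" 0] by simp_all

lemma tangent_const: "v (\<lambda>y. c) = 0"
  using tangent_mult[OF v, of "\<lambda>y. 1" "\<lambda>y. 1"] tangent_cmult[of "\<lambda>y. 1" c] cinf_const[OF X, of 1]
  by simp

lemma tangent_sum:
  assumes "finite I" "\<And>i. i \<in> I \<Longrightarrow> f i \<in> cinf X"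
  shows "v (\<lambda>y. \<Sum>i\<in>I. f i y) = (\<Sum>i\<in>I. v (f i))"
  using assms
proof (induction I)
  case (insert i I)
  then have "f i \<in> cinf X" "(\<lambda>y. \<Sum>i\<in>I. f i y) \<in> cinf X" using cinf_sum[OF X, of I f] by auto
  from tangent_add[OF this] show ?case using insert by simp
qed (simp add: tangent_const)

text \<open>Functions are total on the type, so agreement on \<open>pts X\<close> is not equality.
  The difference \<open>?d\<close> vanishes on the points, and \<open>?c\<close> is 0 on the points
  and 1 elsewhere; hence \<open>?d\<close> equals \<open>?d\<close> times \<open>?c\<close>, and the
  product rule at \<open>p\<close> gives 0 because both factors vanish there.\<close>

lemma tangent_cong:
  assumes p: "p \<in> pts X" and fg: "f \<in> cinf X" "g \<in> cinf X" and eq: "\<And>y. y \<in> pts X \<Longrightarrow> f y = g y"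
  shows "v f = v g"
proof -
  let ?d = "\<lambda>y. f y - g y" and ?c = "\<lambda>y. if y \<in> pts X then 0 else 1 :: real"
  have d: "?d \<in> cinf X" using cinf_diff[OF X fg] .
  have c: "?c \<in> cinf X" by (rule cinf_cong[OF cinf_const[OF X, of 0]]) simp
  have "v (\<lambda>y. ?d y * ?c y) = 0"
    using tangent_mult[OF v d c] p eq[OF p] by simp
  moreover have "(\<lambda>y. ?d y * ?c y) = ?d" using eq by (auto simp: fun_eq_iff)
  ultimately show ?thesis using tangent_diff[OF fg] by simp
qed

end

text \<open>A bump function supported in \<open>N\<close> times the difference vanishes on
  \<open>pts X\<close>; the product rule at \<open>p\<close>, where the bump function is 1, gives
  the claim.\<close>

lemma tangent_local:
  fixes X :: "('a::t2_space, 'e::euclidean_space) space"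
  assumes X: "atlas X h" and v: "v \<in> tangent_space X p" and p: "p \<in> pts X"
    and fg: "f \<in> cinf X" "g \<in> cinf X" and N: "open N" "p \<in> N" "\<And>y. y \<in> N \<Longrightarrow> y \<in> pts X \<Longrightarrow> f y = g y"
  shows "v f = v g"
proof -
  obtain b V C where b: "b \<in> cinf (restr X UNIV)" "open V" "p \<in> V" "V \<subseteq> C" "closed C" "C \<subseteq> N"
    "\<And>y. y \<in> V \<Longrightarrow> b y = 1" "\<And>y. y \<notin> C \<Longrightarrow> b y = 0"
    by (rule bump_function[OF X N(1,2)]) (rule that)
  have b': "b \<in> cinf X" using cinf_restr[OF b(1), of "pts X"] by simp
  have d: "(\<lambda>y. f y - g y) \<in> cinf X" using cinf_diff[OF X fg] .
  have "v (\<lambda>y. b y * (f y - g y)) = v (\<lambda>y. 0)"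
    by (rule tangent_cong[OF X v p cinf_mult[OF X b' d] cinf_const[OF X]]) (use N b in force)
  then have "b p * v (\<lambda>y. f y - g y) = 0"
    using tangent_mult[OF v b' d] N p tangent_const[OF X v] by simp
  then show ?thesis using b tangent_diff[OF X v fg] by simp
qed

section \<open>Push-forward of tangent vectors\<close>

lemma tmap_apply: "g \<in> cinf Y \<Longrightarrow> tmap Y f v g = v (\<lambda>x. g (f x))"
  by (simp add: tmap_def o_def)

lemma tmap_add: "tmap Y f (v + w) = tmap Y f v + tmap Y f w"
  and tmap_scaleR: "tmap Y f (a *\<^sub>R v) = a *\<^sub>R tmap Y f v"
  and tmap_diff: "tmap Y f (v - w) = tmap Y f v - tmap Y f w"
  and tmap_0: "tmap Y f 0 = 0"
  by (auto simp: tmap_def fun_eq_iff scaleR_fun_def)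

lemma tmap_tangent:
  assumes X: "atlas X h" and Y: "atlas Y k" and f: "smooth_map X Y f" and v: "v \<in> tangent_space X p"
  shows "tmap Y f v \<in> tangent_space Y (f p)"
proof (rule tangent_spaceI)
  show "tmap Y f v g = 0" if "g \<notin> cinf Y" for g using that by (simp add: tmap_def)
  fix g g' assume g: "g \<in> cinf Y" "g' \<in> cinf Y"
  then have g': "(\<lambda>x. g (f x)) \<in> cinf X" "(\<lambda>x. g' (f x)) \<in> cinf X"
    using cinf_compose[OF X Y f] by auto
  show "tmap Y f v (\<lambda>y. a * g y + b * g' y) = a * tmap Y f v g + b * tmap Y f v g'" for a b
    using tangent_lin[OF v g'] cinf_add[OF Y cinf_cmult[OF Y g(1), of a] cinf_cmult[OF Y g(2), of b]] g
    by (simp add: tmap_apply)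
  show "tmap Y f v (\<lambda>y. g y * g' y) = g (f p) * tmap Y f v g' + g' (f p) * tmap Y f v g"
    using tangent_mult[OF v g'] cinf_mult[OF Y g] g by (simp add: tmap_apply)
qed

lemma tmap_compose:
  assumes Y: "atlas Y k" and Z: "atlas Z l" and g: "smooth_map Y Z g"
  shows "tmap Z g (tmap Y f v) = tmap Z (\<lambda>x. g (f x)) v"
  using cinf_compose[OF Y Z g] by (auto simp: tmap_def fun_eq_iff o_def)

lemma tmap_id: "v \<in> tangent_space X p \<Longrightarrow> tmap X (\<lambda>x. x) v = v"
  by (auto simp: tmap_def fun_eq_iff o_def dest: tangent_nonsmooth)

lemma tmap_const: "atlas X h \<Longrightarrow> v \<in> tangent_space X p \<Longrightarrow> tmap Y (\<lambda>x. c) v = 0"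
  by (auto simp: tmap_def fun_eq_iff o_def tangent_const)

lemma tmap_local:
  fixes X :: "('a::t2_space, 'e::euclidean_space) space"
  assumes X: "atlas X h" and Y: "atlas Y k" and f: "smooth_map X Y f" "smooth_map X Y g"
    and v: "v \<in> tangent_space X p" "p \<in> pts X"
    and N: "open N" "p \<in> N" "\<And>y. y \<in> N \<Longrightarrow> y \<in> pts X \<Longrightarrow> f y = g y"
  shows "tmap Y f v = tmap Y g v"
proof
  fix u
  show "tmap Y f v u = tmap Y g v u"
  proof (cases "u \<in> cinf Y")
    case True
    have "v (\<lambda>x. u (f x)) = v (\<lambda>x. u (g x))"
      by (rule tangent_local[OF X v cinf_compose[OF X Y f(1) True] cinf_compose[OF X Y f(2) True] N(1,2)])
        (use N in auto)
    with True show ?thesis by (simp add: tmap_apply)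
  qed (simp add: tmap_def)
qed

text \<open>Application of a tangent vector to a function that is smooth only near the base point.\<close>

definition tapp :: "('a::topological_space, 'e::euclidean_space) space \<Rightarrow> 'a \<Rightarrow> 'a tvec \<Rightarrow> ('a \<Rightarrow> real) \<Rightarrow> real"
  where "tapp X p v f = v (SOME g. g \<in> cinf X \<and> (\<exists>V. open V \<and> p \<in> V \<and> (\<forall>y\<in>V \<inter> pts X. g y = f y)))"

lemma tapp_eq:
  fixes X :: "('a::t2_space, 'e::euclidean_space) space"
  assumes X: "atlas X h" and v: "v \<in> tangent_space X p" and p: "p \<in> pts X"
    and g: "g \<in> cinf X" and V: "open V" "p \<in> V" "\<And>y. y \<in> V \<Longrightarrow> y \<in> pts X \<Longrightarrow> g y = f y"
  shows "tapp X p v f = v g"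
proof -
  let ?P = "\<lambda>g. g \<in> cinf X \<and> (\<exists>V. open V \<and> p \<in> V \<and> (\<forall>y\<in>V \<inter> pts X. g y = f y))"
  have "?P g" using g V by blast
  then have "?P (SOME g. ?P g)" by (rule someI[where P="?P"])
  then obtain W where W: "(SOME g. ?P g) \<in> cinf X" "open W" "p \<in> W" "\<forall>y\<in>W \<inter> pts X. (SOME g. ?P g) y = f y"
    by (elim conjE exE) (rule that)
  show ?thesis
    unfolding tapp_def
    by (rule tangent_local[OF X v p W(1) g open_Int[OF W(2) V(1)]]) (use W V in auto)
qed

text \<open>The vector \<open>v\<close> seen as a tangent vector of the open part \<open>N\<close>.
  As \<open>tangent_space\<close> demands, it is zero on functions that are not smooth
  there.\<close>

definition trestr :: "('a::topological_space, 'e::euclidean_space) space \<Rightarrow> 'a set \<Rightarrow> 'a \<Rightarrow> 'a tvec \<Rightarrow> 'a tvec"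
  where "trestr X N p v f = (if f \<in> cinf (restr X (N \<inter> pts X)) then tapp X p v f else 0)"

lemma trestr:
  fixes X :: "('a::t2_space, 'e::euclidean_space) space"
  assumes X: "atlas X h" and v: "v \<in> tangent_space X p" and p: "p \<in> pts X" and N: "open N" "p \<in> N"
  shows "trestr X N p v \<in> tangent_space (restr X (N \<inter> pts X)) p" and "f \<in> cinf X \<Longrightarrow> trestr X N p v f = v f"
proof -
  let ?N = "restr X (N \<inter> pts X)"
  define w where w_def': "w = trestr X N p v"
  have w_def: "w f = (if f \<in> cinf ?N then tapp X p v f else 0)" for f
    by (simp add: w_def' trestr_def)
  have XN: "atlas ?N h" using X by simp
  have ext: "\<exists>g V. g \<in> cinf X \<and> open V \<and> p \<in> V \<and> V \<subseteq> N \<and> (\<forall>y\<in>V. g y = f y)" if f: "f \<in> cinf ?N" for f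
  proof -
    obtain g V where "g \<in> cinf (restr X (pts X))" "open V" "p \<in> V" "V \<subseteq> N" "\<And>y. y \<in> V \<Longrightarrow> g y = f y"
      by (rule cinf_extend[OF X N f]) (rule that)
    then show ?thesis by (intro exI[of _ g] exI[of _ V]) simp
  qed
  show "trestr X N p v \<in> tangent_space ?N p"
    unfolding w_def'[symmetric]
  proof (rule tangent_spaceI)
    show "w f = 0" if "f \<notin> cinf ?N" for f using that by (simp add: w_def)
    fix f g assume f: "f \<in> cinf ?N" and g: "g \<in> cinf ?N"
    from ext[OF f] obtain f' V where f': "f' \<in> cinf X" "open V" "p \<in> V" "\<forall>y\<in>V. f' y = f y"
      by (elim exE conjE) (rule that)
    from ext[OF g] obtain g' W where g': "g' \<in> cinf X" "open W" "p \<in> W" "\<forall>y\<in>W. g' y = g y"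
      by (elim exE conjE) (rule that)
    have wf: "w f = v f'" and wg: "w g = v g'"
      unfolding w_def using f g f' g' tapp_eq[OF X v p f'(1), of V f] tapp_eq[OF X v p g'(1), of W g] by auto
    have "w (\<lambda>y. a * f y + b * g y) = v (\<lambda>y. a * f' y + b * g' y)" for a b
    proof -
      have "tapp X p v (\<lambda>y. a * f y + b * g y) = v (\<lambda>y. a * f' y + b * g' y)"
        by (rule tapp_eq[OF X v p _ open_Int[OF f'(2) g'(2)]])
          (use f' g' X in \<open>auto intro!: cinf_add[OF X] cinf_cmult[OF X]\<close>)
      moreover have "(\<lambda>y. a * f y + b * g y) \<in> cinf ?N"
        using cinf_add[OF XN cinf_cmult[OF XN f] cinf_cmult[OF XN g]] .
      ultimately show ?thesis by (simp add: w_def)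
    qed
    then show "w (\<lambda>y. a * f y + b * g y) = a * w f + b * w g" for a b
      using tangent_lin[OF v f'(1) g'(1)] wf wg by simp
    have "w (\<lambda>y. f y * g y) = v (\<lambda>y. f' y * g' y)"
    proof -
      have "tapp X p v (\<lambda>y. f y * g y) = v (\<lambda>y. f' y * g' y)"
        by (rule tapp_eq[OF X v p cinf_mult[OF X f'(1) g'(1)] open_Int[OF f'(2) g'(2)]])
          (use f' g' in auto)
      moreover have "(\<lambda>y. f y * g y) \<in> cinf ?N" using cinf_mult[OF XN f g] .
      ultimately show ?thesis by (simp add: w_def)
    qed
    then show "w (\<lambda>y. f y * g y) = f p * w g + g p * w f"
      using tangent_mult[OF v f'(1) g'(1)] f'(3,4) g'(3,4) wf wg by simp
  qed
  show "trestr X N p v f = v f" if "f \<in> cinf X"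
    using tapp_eq[OF X v p that open_UNIV] cinf_restr[OF that, of "N \<inter> pts X"] by (simp add: trestr_def)
qed

lemma tangent_open:
  fixes X :: "('a::t2_space, 'e::euclidean_space) space"
  assumes X: "atlas X h" and v: "v \<in> tangent_space X p" and p: "p \<in> pts X" and N: "open N" "p \<in> N"
  obtains w where "w \<in> tangent_space (restr X (N \<inter> pts X)) p" "\<And>f. f \<in> cinf X \<Longrightarrow> w f = v f"
  using trestr[OF assms] that by blast

lemma tangent_eqI_ambient:
  fixes X :: "('a::t2_space, 'e::euclidean_space) space"
  assumes X: "atlas X h" and v: "v \<in> tangent_space (restr X S) p" "w \<in> tangent_space (restr X S) p" and p: "p \<in> S"
    and eq: "\<And>f. f \<in> cinf (restr X UNIV) \<Longrightarrow> v f = w f"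
  shows "v = w"
proof (rule tangent_eqI[OF v])
  fix f assume f: "f \<in> cinf (restr X S)"
  obtain g V where g: "g \<in> cinf (restr (restr X S) UNIV)" "open V" "p \<in> V"
    "\<And>y. y \<in> V \<Longrightarrow> y \<in> pts (restr X S) \<Longrightarrow> g y = f y"
    by (rule cinf_extend_ambient[of "restr X S" h f p]) (use X f p in \<open>auto intro: that\<close>)
  have g': "g \<in> cinf (restr X S)" using cinf_restr[OF g(1), of S] by simp
  have XS: "atlas (restr X S) h" using X by simp
  have pS: "p \<in> pts (restr X S)" using p by simp
  have "v f = v g" "w f = w g"
    using tangent_local[OF XS v(1) pS f g' g(2,3)] tangent_local[OF XS v(2) pS f g' g(2,3)] g(4)
    by simp_all
  then show "v f = w f" using eq[of g] g(1) by simp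
qed

text \<open>Derivations apply to globally smooth functions, so the chart coordinates are cut off by
  a bump function and keep their values only near \<open>p\<close>.\<close>

lemma coordinate_functions:
  fixes X :: "('a::t2_space, 'e::euclidean_space) space"
  assumes X: "atlas X h" and c: "(U, \<phi>) \<in> charts X" "p \<in> U"
  obtains \<xi> V where "\<And>b. \<xi> b \<in> cinf (restr X UNIV)" "open V" "p \<in> V" "V \<subseteq> U"
    "\<And>b y. y \<in> V \<Longrightarrow> \<xi> b y = \<phi> y \<bullet> b"
proof -
  obtain \<beta> V C where \<beta>: "\<beta> \<in> cinf (restr X UNIV)" "open V" "p \<in> V" "V \<subseteq> C" "closed C" "C \<subseteq> U"
    "\<And>y. y \<in> V \<Longrightarrow> \<beta> y = 1" "\<And>y. y \<notin> C \<Longrightarrow> \<beta> y = 0"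
    by (rule bump_function[OF X chart_open[OF X c(1)] c(2)]) (rule that)
  define \<xi> where "\<xi> b y = \<beta> y * (\<phi> y \<bullet> b)" for b y
  have \<xi>: "\<xi> b \<in> cinf (restr X UNIV)" for b
  proof -
    have "Cinf_on (\<lambda>u. u \<bullet> b) UNIV"
      by (rule Cinf_on_bounded_linear[OF bounded_linear_inner_left])
    from cinf_chart[OF X c(1) open_UNIV this] have "(\<lambda>y. \<phi> y \<bullet> b) \<in> cinf (restr X (U \<inter> UNIV))" by simp
    from cinf_extend_zero[OF X chart_open[OF X c(1)] this \<beta>(1,5,6,8)] show ?thesis by (simp add: \<xi>_def[abs_def])
  qed
  then show thesis using \<beta> by (intro that[of \<xi> V]) (auto simp: \<xi>_def)
qed

text \<open>Evaluation of tangent vectors in coordinates, by Hadamard's lemma.\<close>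

lemma tangent_expand:
  fixes X :: "('a::t2_space, 'e::euclidean_space) space"
  assumes X: "atlas X h" and c: "(U, \<phi>) \<in> charts X" and \<xi>: "\<And>b. \<xi> b \<in> cinf (restr X UNIV)"
    and V: "open V" "V \<subseteq> U" "\<And>b y. y \<in> V \<Longrightarrow> \<xi> b y = \<phi> y \<bullet> b"
    and p: "p \<in> V" "p \<in> S" and v: "v \<in> tangent_space (restr X S) p" and f: "f \<in> cinf (restr X S)"
    and F: "open N" "\<phi> p \<in> N" "Cinf_on F N" "\<And>y. y \<in> U \<Longrightarrow> y \<in> S \<Longrightarrow> \<phi> y \<in> N \<Longrightarrow> F (\<phi> y) = f y"
  shows "v f = (\<Sum>b\<in>Basis. v (\<xi> b) * frechet_derivative F (at (\<phi> p)) b)"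
proof -
  have XS: "atlas (restr X S) h" using X by simp
  have pU: "p \<in> U" using p V by auto
  obtain r where r: "r > 0" "ball (\<phi> p) r \<subseteq> N" using F open_contains_ball by blast
  obtain g where g: "\<And>b. Cinf_on (g b) (ball (\<phi> p) r)"
    "\<And>x. x \<in> ball (\<phi> p) r \<Longrightarrow> F x = F (\<phi> p) + (\<Sum>b\<in>Basis. ((x - \<phi> p) \<bullet> b) * g b x)"
    "\<And>b. g b (\<phi> p) = frechet_derivative F (at (\<phi> p)) b"
    by (rule Hadamard[OF Cinf_on_subset[OF F(3) r(2)] r(1)]) (rule that)
  let ?B = "U \<inter> \<phi> -` ball (\<phi> p) r"
  have B: "open ?B" "p \<in> ?B" using chart_preimage_open[OF X c(1) open_ball] pU r(1) by auto
  obtain \<beta>' W C' where \<beta>': "\<beta>' \<in> cinf (restr X UNIV)" "open W" "p \<in> W" "W \<subseteq> C'" "closed C'" "C' \<subseteq> ?B"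
    "\<And>y. y \<in> W \<Longrightarrow> \<beta>' y = 1" "\<And>y. y \<notin> C' \<Longrightarrow> \<beta>' y = 0"
    by (rule bump_function[OF X B]) (rule that)
  define G where "G b y = \<beta>' y * g b (\<phi> y)" for b y
  have G: "G b \<in> cinf (restr X S)" for b
  proof -
    have "(\<lambda>y. g b (\<phi> y)) \<in> cinf (restr X (?B \<inter> UNIV))"
      using cinf_chart[OF X c(1) open_ball g(1)] by simp
    from cinf_extend_zero[OF X B(1) this \<beta>'(1,5,6,8)] have "G b \<in> cinf (restr X UNIV)"
      by (simp add: G_def[abs_def])
    then show ?thesis using cinf_restr[of "G b" "restr X UNIV" S] by simp
  qed
  have \<xi>S: "\<xi> b \<in> cinf (restr X S)" for b using cinf_restr[OF \<xi>, of S] by simp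
  have \<xi>c: "(\<lambda>y. \<xi> b y - \<phi> p \<bullet> b) \<in> cinf (restr X S)" for b
    by (rule cinf_diff[OF XS \<xi>S cinf_const[OF XS]])
  have t: "(\<lambda>y. (\<xi> b y - \<phi> p \<bullet> b) * G b y) \<in> cinf (restr X S)" for b
    by (rule cinf_mult[OF XS \<xi>c G])
  let ?f = "\<lambda>y. F (\<phi> p) + (\<Sum>b\<in>Basis. (\<xi> b y - \<phi> p \<bullet> b) * G b y)"
  have f': "?f \<in> cinf (restr X S)"
    by (rule cinf_add[OF XS cinf_const[OF XS] cinf_sum[OF XS t]])
  have "v f = v ?f"
  proof (rule tangent_local[OF XS v _ f f' open_Int[OF V(1) \<beta>'(2)]])
    show "p \<in> pts (restr X S)" "p \<in> V \<inter> W" using p \<beta>' by auto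
    fix y assume y: "y \<in> V \<inter> W" "y \<in> pts (restr X S)"
    then have yB: "y \<in> U" "\<phi> y \<in> ball (\<phi> p) r" "y \<in> S" using \<beta>' by auto
    then have "f y = F (\<phi> y)" using F(4) r(2) by (metis subsetD)
    also have "\<dots> = ?f y"
      using g(2)[OF yB(2)] y V(3) \<beta>'(7) by (simp add: G_def inner_diff_left)
    finally show "f y = ?f y" .
  qed
  also have "\<dots> = (\<Sum>b\<in>Basis. v (\<lambda>y. (\<xi> b y - \<phi> p \<bullet> b) * G b y))"
    by (subst tangent_add[OF XS v cinf_const[OF XS] cinf_sum[OF XS t]])
      (simp add: tangent_const[OF XS v] tangent_sum[OF XS v finite_Basis t])
  also have "\<dots> = (\<Sum>b\<in>Basis. v (\<xi> b) * frechet_derivative F (at (\<phi> p)) b)"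
  proof (rule sum.cong[OF refl])
    fix b :: 'e
    have "\<xi> b p = \<phi> p \<bullet> b" "G b p = frechet_derivative F (at (\<phi> p)) b"
      using p(1) V(3) \<beta>'(3,7) g(3) by (simp_all add: G_def)
    then show "v (\<lambda>y. (\<xi> b y - \<phi> p \<bullet> b) * G b y) = v (\<xi> b) * frechet_derivative F (at (\<phi> p)) b"
      using tangent_mult[OF v \<xi>c G] tangent_diff[OF XS v \<xi>S cinf_const[OF XS]] tangent_const[OF XS v]
      by simp
  qed
  finally show ?thesis .
qed

lemma restr_full: "pts X = UNIV \<Longrightarrow> restr X UNIV = X"
  by (cases X) simp

lemma cinf_subset:
  assumes "f \<in> cinf (restr X S)" "T \<subseteq> S" shows "f \<in> cinf (restr X T)"
  using cinf_restr[OF assms(1), of T] assms(2) by simp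

text \<open>Each coordinate of a product chart is a function of the first factor plus a function of
  the second, so the two push-forwards determine a vector on coordinates and hence everywhere.
  \<open>S\<close> may be any subset of the product, which covers the composable pairs and the
  trivialised arrows.\<close>

lemma tangent_prod_unique:
  fixes X :: "('a::t2_space, 'e::euclidean_space) space" and Y :: "('b::t2_space, 'f::euclidean_space) space"
  assumes X: "atlas X h" "pts X = UNIV" and Y: "atlas Y k" "pts Y = UNIV" and z: "z \<in> S"
    and u: "u \<in> tangent_space (restr (prod_space X Y) S) z" and w: "w \<in> tangent_space (restr (prod_space X Y) S) z"
    and fst: "tmap X fst u = tmap X fst w" and snd: "tmap Y snd u = tmap Y snd w"
  shows "u = w"
proof -
  let ?P = "prod_space X Y"
  have P: "atlas ?P (map_prod h k)" using atlas_prod X(1) Y(1) .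
  have PS: "atlas (restr ?P S) (map_prod h k)" using P by simp
  obtain U \<phi> where c: "(U, \<phi>) \<in> charts X" "fst z \<in> U" by (rule atlas_chart[OF X(1)])
  obtain V \<psi> where d: "(V, \<psi>) \<in> charts Y" "snd z \<in> V" by (rule atlas_chart[OF Y(1)])
  have ch: "(U \<times> V, map_prod \<phi> \<psi>) \<in> charts ?P"
    unfolding charts_prod_space using c d by (intro exI[of _ U] exI[of _ \<phi>] exI[of _ V] exI[of _ \<psi>]) simp
  have zUV: "z \<in> U \<times> V" using c d by (simp add: mem_Times_iff)
  obtain \<xi> W where \<xi>: "\<And>b. \<xi> b \<in> cinf (restr ?P UNIV)" "open W" "z \<in> W" "W \<subseteq> U \<times> V"
    "\<And>b y. y \<in> W \<Longrightarrow> \<xi> b y = map_prod \<phi> \<psi> y \<bullet> b"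
    by (rule coordinate_functions[OF P ch zUV]) (rule that)
  obtain \<xi>1 W1 where \<xi>1: "\<And>b. \<xi>1 b \<in> cinf (restr X UNIV)" "open W1" "fst z \<in> W1" "W1 \<subseteq> U"
    "\<And>b y. y \<in> W1 \<Longrightarrow> \<xi>1 b y = \<phi> y \<bullet> b"
    by (rule coordinate_functions[OF X(1) c]) (rule that)
  obtain \<xi>2 W2 where \<xi>2: "\<And>b. \<xi>2 b \<in> cinf (restr Y UNIV)" "open W2" "snd z \<in> W2" "W2 \<subseteq> V"
    "\<And>b y. y \<in> W2 \<Longrightarrow> \<xi>2 b y = \<psi> y \<bullet> b"
    by (rule coordinate_functions[OF Y(1) d]) (rule that)
  have \<xi>1X: "\<xi>1 b \<in> cinf X" for b using \<xi>1(1)[of b] restr_full[OF X(2)] by simp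
  have \<xi>2Y: "\<xi>2 b \<in> cinf Y" for b using \<xi>2(1)[of b] restr_full[OF Y(2)] by simp
  have sf: "smooth_map (restr ?P S) X fst" by (rule smooth_map_fst[OF X(1) Y(1)]) (simp add: X(2))
  have ss: "smooth_map (restr ?P S) Y snd" by (rule smooth_map_snd[OF X(1) Y(1)]) (simp add: Y(2))
  have f1: "(\<lambda>z. \<xi>1 b (fst z)) \<in> cinf (restr ?P S)" for b by (rule cinf_compose[OF PS X(1) sf \<xi>1X])
  have f2: "(\<lambda>z. \<xi>2 b (snd z)) \<in> cinf (restr ?P S)" for b by (rule cinf_compose[OF PS Y(1) ss \<xi>2Y])
  let ?W = "W \<inter> W1 \<times> W2"
  have W: "open ?W" "z \<in> ?W" using \<xi> \<xi>1 \<xi>2 by (auto intro!: open_Int open_Times simp: mem_Times_iff)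
  have coord: "v (\<xi> b) = tmap X fst v (\<xi>1 (fst b)) + tmap Y snd v (\<xi>2 (snd b))"
    if v: "v \<in> tangent_space (restr ?P S) z" for v b
  proof -
    have "v (\<xi> b) = v (\<lambda>z. \<xi>1 (fst b) (fst z) + \<xi>2 (snd b) (snd z))"
    proof (rule tangent_local[OF PS v _ _ cinf_add[OF PS f1 f2] W])
      show "z \<in> pts (restr ?P S)" using z by simp
      show "\<xi> b \<in> cinf (restr ?P S)" using cinf_restr[OF \<xi>(1), of S] by simp
      show "\<xi> b y = \<xi>1 (fst b) (fst y) + \<xi>2 (snd b) (snd y)" if "y \<in> ?W" for y
        using that \<xi>(5) \<xi>1(5) \<xi>2(5) by (auto simp: inner_prod_def)
    qed
    also have "\<dots> = tmap X fst v (\<xi>1 (fst b)) + tmap Y snd v (\<xi>2 (snd b))"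
      using tangent_add[OF PS v f1 f2] by (simp add: tmap_apply \<xi>1X \<xi>2Y)
    finally show ?thesis .
  qed
  show ?thesis
  proof (rule tangent_eqI[OF u w])
    fix f assume f: "f \<in> cinf (restr ?P S)"
    obtain N F where F: "open N" "map_prod \<phi> \<psi> z \<in> N" "Cinf_on F N"
      "\<And>y. y \<in> U \<times> V \<Longrightarrow> y \<in> pts (restr ?P S) \<Longrightarrow> map_prod \<phi> \<psi> y \<in> N \<Longrightarrow> F (map_prod \<phi> \<psi> y) = f y"
      by (rule cinf_rep[OF PS f, of z "U \<times> V" "map_prod \<phi> \<psi>"]) (use z ch zUV in \<open>auto intro: that\<close>)
    have E: "v f = (\<Sum>b\<in>Basis. v (\<xi> b) * frechet_derivative F (at (map_prod \<phi> \<psi> z)) b)"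
      if "v \<in> tangent_space (restr ?P S) z" for v
      by (rule tangent_expand[OF P ch \<xi>(1,2,4,5,3) z that f F(1-3)]) (use F(4) in simp_all)
    show "u f = w f" unfolding E[OF u] E[OF w] coord[OF u] coord[OF w] fst snd ..
  qed
qed

definition prod_tvec :: "('a::topological_space, 'e::euclidean_space) space \<Rightarrow>
    ('b::topological_space, 'f::euclidean_space) space \<Rightarrow> 'a \<times> 'b \<Rightarrow> 'a tvec \<Rightarrow> 'b tvec \<Rightarrow> ('a \<times> 'b) tvec"
  where "prod_tvec X Y z v w =
    tmap (prod_space X Y) (\<lambda>x. (x, snd z)) v + tmap (prod_space X Y) (\<lambda>y. (fst z, y)) w"

lemma prod_tvec:
  fixes X :: "('a::topological_space, 'e::euclidean_space) space"
    and Y :: "('b::topological_space, 'f::euclidean_space) space"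
  assumes X: "atlas X h" "pts X = UNIV" and Y: "atlas Y k" "pts Y = UNIV"
    and v: "v \<in> tangent_space X (fst z)" and w: "w \<in> tangent_space Y (snd z)"
  shows "prod_tvec X Y z v w \<in> tangent_space (prod_space X Y) z"
    and "tmap X fst (prod_tvec X Y z v w) = v" and "tmap Y snd (prod_tvec X Y z v w) = w"
proof -
  let ?P = "prod_space X Y"
  have P: "atlas ?P (map_prod h k)" using atlas_prod X(1) Y(1) .
  have full: "restr ?P UNIV = ?P" using restr_full[of ?P] X(2) Y(2) by simp
  have 1: "smooth_map X ?P (\<lambda>x. (x, snd z))"
    using smooth_map_Pair[OF X(1) X(1) Y(1) smooth_map_id[OF X(1)] smooth_map_const[OF X(1) Y(1)], of "snd z" UNIV] Y(2)
    by (simp add: full)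
  have 2: "smooth_map Y ?P (\<lambda>y. (fst z, y))"
    using smooth_map_Pair[OF Y(1) X(1) Y(1) smooth_map_const[OF Y(1) X(1)] smooth_map_id[OF Y(1)], of "fst z" UNIV] X(2)
    by (simp add: full)
  have f: "smooth_map ?P X fst" using smooth_map_fst[OF X(1) Y(1), of UNIV] X(2) by (simp add: full)
  have s: "smooth_map ?P Y snd" using smooth_map_snd[OF X(1) Y(1), of UNIV] Y(2) by (simp add: full)
  show "prod_tvec X Y z v w \<in> tangent_space ?P z"
    unfolding prod_tvec_def
    using tmap_tangent[OF X(1) P 1 v] tmap_tangent[OF Y(1) P 2 w] subspace_add[OF subspace_tangent_space]
    by fastforce
  show "tmap X fst (prod_tvec X Y z v w) = v"
    unfolding prod_tvec_def
    by (simp add: tmap_add tmap_compose[OF P X(1) f] tmap_id[OF v] tmap_const[OF Y(1) w])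
  show "tmap Y snd (prod_tvec X Y z v w) = w"
    unfolding prod_tvec_def
    by (simp add: tmap_add tmap_compose[OF P Y(1) s] tmap_id[OF w] tmap_const[OF X(1) v])
qed

section \<open>Vector fields\<close>

lemma vector_fieldsD:
  assumes "x \<in> vector_fields X"
  shows vf_tangent: "p \<in> pts X \<Longrightarrow> x p \<in> tangent_space X p"
    and vf_cinf: "f \<in> cinf X \<Longrightarrow> (\<lambda>p. x p f) \<in> cinf X"
  using assms unfolding vector_fields_def by auto

lemma vector_fieldsI:
  assumes "\<And>p. p \<in> pts X \<Longrightarrow> x p \<in> tangent_space X p" "\<And>f. f \<in> cinf X \<Longrightarrow> (\<lambda>p. x p f) \<in> cinf X"
  shows "x \<in> vector_fields X"
  using assms unfolding vector_fields_def by auto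

lemma subspace_vector_fields:
  assumes "atlas X h" shows "subspace (vector_fields X)"
  unfolding subspace_def
proof (intro conjI ballI allI)
  show "0 \<in> vector_fields X"
    by (rule vector_fieldsI) (simp_all add: subspace_0[OF subspace_tangent_space] cinf_const[OF assms])
  fix x assume x: "x \<in> vector_fields X"
  show "c *\<^sub>R x \<in> vector_fields X" for c
  proof (rule vector_fieldsI)
    show "(c *\<^sub>R x) p \<in> tangent_space X p" if "p \<in> pts X" for p
      using subspace_scale[OF subspace_tangent_space vf_tangent[OF x that], of c]
      by (simp add: scaleR_fun_def[of _ x])
    show "(\<lambda>p. (c *\<^sub>R x) p f) \<in> cinf X" if "f \<in> cinf X" for f
      using cinf_cmult[OF assms vf_cinf[OF x that], of c] by (simp add: scaleR_fun_def)
  qed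
  fix y assume y: "y \<in> vector_fields X"
  show "x + y \<in> vector_fields X"
  proof (rule vector_fieldsI)
    show "(x + y) p \<in> tangent_space X p" if "p \<in> pts X" for p
      using subspace_add[OF subspace_tangent_space vf_tangent[OF x that] vf_tangent[OF y that]] by simp
    show "(\<lambda>p. (x + y) p f) \<in> cinf X" if "f \<in> cinf X" for f
      using cinf_add[OF assms vf_cinf[OF x that] vf_cinf[OF y that]] by simp
  qed
qed

lemma subspace_cinf: "atlas X h \<Longrightarrow> subspace (cinf X)"
  unfolding subspace_def
  by (auto simp: scaleR_fun_def zero_fun_def plus_fun_def intro!: cinf_const cinf_add cinf_cmult)

lemma lie_bracket_vector_fields:
  assumes X: "atlas X h" "pts X = UNIV" and x: "x \<in> vector_fields X" and y: "y \<in> vector_fields X"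
  shows "lie_bracket x y \<in> vector_fields X"
proof (rule vector_fieldsI)
  fix f assume f: "f \<in> cinf X"
  show "(\<lambda>p. lie_bracket x y p f) \<in> cinf X"
    unfolding lie_bracket_def lie_deriv_def
    by (intro cinf_diff[OF X(1)] vf_cinf[OF x] vf_cinf[OF y] f)
next
  fix p
  have xt: "x q \<in> tangent_space X q" and yt: "y q \<in> tangent_space X q" for q
    using vf_tangent[OF x] vf_tangent[OF y] X(2) by auto
  show "lie_bracket x y p \<in> tangent_space X p"
  proof (rule tangent_spaceI)
    fix f assume "f \<notin> cinf X"
    then have "lie_deriv x f = (\<lambda>p. 0)" "lie_deriv y f = (\<lambda>p. 0)"
      unfolding lie_deriv_def using tangent_nonsmooth[OF xt] tangent_nonsmooth[OF yt] by auto
    then show "lie_bracket x y p f = 0"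
      by (simp add: lie_bracket_def tangent_const[OF X(1) xt] tangent_const[OF X(1) yt])
  next
    fix f g assume fg: "f \<in> cinf X" "g \<in> cinf X"
    note c = vf_cinf[OF x fg(1)] vf_cinf[OF x fg(2)] vf_cinf[OF y fg(1)] vf_cinf[OF y fg(2)]
    show "lie_bracket x y p (\<lambda>y. a * f y + b * g y) = a * lie_bracket x y p f + b * lie_bracket x y p g" for a b
      unfolding lie_bracket_def lie_deriv_def tangent_lin[OF xt fg] tangent_lin[OF yt fg]
        tangent_lin[OF xt c(3,4)] tangent_lin[OF yt c(1,2)]
      by (simp add: algebra_simps)
    show "lie_bracket x y p (\<lambda>y. f y * g y) = f p * lie_bracket x y p g + g p * lie_bracket x y p f"
      unfolding lie_bracket_def lie_deriv_def tangent_mult[OF xt fg] tangent_mult[OF yt fg]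
        tangent_add[OF X(1) xt cinf_mult[OF X(1) fg(1) c(4)] cinf_mult[OF X(1) fg(2) c(3)]]
        tangent_add[OF X(1) yt cinf_mult[OF X(1) fg(1) c(2)] cinf_mult[OF X(1) fg(2) c(1)]]
        tangent_mult[OF xt fg(1) c(4)] tangent_mult[OF xt fg(2) c(3)]
        tangent_mult[OF yt fg(1) c(2)] tangent_mult[OF yt fg(2) c(1)]
      by (simp add: algebra_simps)
  qed
qed

text \<open>Near each point \<open>f\<close> agrees with a global smooth function, on which
  \<open>x\<close> is smooth. This allows a field to be applied to functions composed with a merely
  local section.\<close>

lemma tapp_cinf:
  fixes X :: "('a::t2_space, 'e::euclidean_space) space"
  assumes X: "atlas X h" and x: "x \<in> vector_fields X" and N: "open N" and f: "f \<in> cinf (restr X (N \<inter> pts X))"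
  shows "(\<lambda>q. tapp X q (x q) f) \<in> cinf (restr X (N \<inter> pts X))"
proof (rule cinf_local)
  fix p assume p: "p \<in> pts (restr X (N \<inter> pts X))"
  then have pN: "p \<in> N" by simp
  obtain g V where g: "g \<in> cinf (restr X (pts X))" "open V" "p \<in> V" "V \<subseteq> N" "\<And>y. y \<in> V \<Longrightarrow> g y = f y"
    by (rule cinf_extend[OF X N pN f]) (rule that)
  have g': "g \<in> cinf X" using g(1) by simp
  have "tapp X q (x q) f = x q g" if "q \<in> V" "q \<in> pts X" for q
    by (rule tapp_eq[OF X vf_tangent[OF x that(2)] that(2) g' g(2) that(1)]) (use g in auto)
  moreover have "(\<lambda>q. x q g) \<in> cinf (restr X (V \<inter> (N \<inter> pts X)))"
    by (rule cinf_restr[OF vf_cinf[OF x g']]) auto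
  ultimately show "\<exists>M u. open M \<and> p \<in> M \<and> u \<in> cinf (restr (restr X (N \<inter> pts X)) (M \<inter> pts (restr X (N \<inter> pts X)))) \<and>
      (\<forall>y\<in>M \<inter> pts (restr X (N \<inter> pts X)). tapp X y (x y) f = u y)"
    using g by (intro exI[of _ V] exI[of _ "\<lambda>q. x q g"]) simp
qed

text \<open>By \<open>tangent_expand\<close>, \<open>x q f\<close> is a combination of the values of
  \<open>x\<close> on coordinates with smooth coefficients, so smoothness has to be tested on
  coordinates only.\<close>

lemma vf_coordsI:
  fixes X :: "('a::t2_space, 'e::euclidean_space) space"
  assumes X: "atlas X h" "pts X = UNIV" and x: "\<And>p. x p \<in> tangent_space X p"
    and co: "\<And>p. \<exists>U \<phi> N c. (U, \<phi>) \<in> charts X \<and> p \<in> U \<and> open N \<and> p \<in> N \<and>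
       (\<forall>b. c b \<in> cinf X \<and> (\<forall>y\<in>N. c b y = \<phi> y \<bullet> b) \<and> (\<lambda>q. x q (c b)) \<in> cinf (restr X N))"
  shows "x \<in> vector_fields X"
proof (rule vector_fieldsI[OF x])
  fix f assume f: "f \<in> cinf X"
  show "(\<lambda>p. x p f) \<in> cinf X"
  proof (rule cinf_local)
    fix p
    from co[of p] obtain U \<phi> N c where c: "(U, \<phi>) \<in> charts X" "p \<in> U" and N: "open N" "p \<in> N" and
      co: "\<forall>b. c b \<in> cinf X \<and> (\<forall>y\<in>N. c b y = \<phi> y \<bullet> b) \<and> (\<lambda>q. x q (c b)) \<in> cinf (restr X N)"
      by (elim exE conjE) (rule that)
    obtain \<xi> V where \<xi>: "\<And>b. \<xi> b \<in> cinf (restr X UNIV)" "open V" "p \<in> V" "V \<subseteq> U"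
      "\<And>b y. y \<in> V \<Longrightarrow> \<xi> b y = \<phi> y \<bullet> b"
      by (rule coordinate_functions[OF X(1) c]) (rule that)
    have fullX: "restr X UNIV = X" by (rule restr_full[OF X(2)])
    obtain M F where F: "open M" "\<phi> p \<in> M" "Cinf_on F M"
      "\<And>y. y \<in> U \<Longrightarrow> y \<in> pts X \<Longrightarrow> \<phi> y \<in> M \<Longrightarrow> F (\<phi> y) = f y"
      by (rule cinf_rep[OF X(1) f _ c]) (use X(2) in \<open>auto intro: that\<close>)
    let ?W = "V \<inter> N \<inter> (U \<inter> \<phi> -` M)"
    have W: "open ?W" "p \<in> ?W"
      using \<xi>(2,3) N F(1,2) c chart_preimage_open[OF X(1) c(1) F(1)] by auto
    let ?g = "\<lambda>q. \<Sum>b\<in>Basis. x q (c b) * frechet_derivative F (at (\<phi> q)) b"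
    have "x q f = ?g q" if q: "q \<in> ?W" for q
    proof -
      have "x q f = (\<Sum>b\<in>Basis. x q (\<xi> b) * frechet_derivative F (at (\<phi> q)) b)"
        by (rule tangent_expand[OF X(1) c(1) \<xi>(1,2,4,5), of q UNIV, unfolded fullX, OF _ _ _ x f F(1) _ F(3)])
          (use q F(4) X(2) in auto)
      moreover have "x q (\<xi> b) = x q (c b)" for b
        by (rule tangent_local[OF X(1) x _ _ _ open_Int[OF \<xi>(2) N(1)]])
          (use q X(2) \<xi>(1,5) co fullX in auto)
      ultimately show ?thesis by simp
    qed
    moreover have "?g \<in> cinf (restr X ?W)"
    proof -
      have XW: "atlas (restr X ?W) h" using X by simp
      have "(\<lambda>q. frechet_derivative F (at (\<phi> q)) b) \<in> cinf (restr X (U \<inter> \<phi> -` M))" for b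
        by (rule cinf_chart[OF X(1) c(1) F(1) Cinf_on_frechet_derivative[OF F(3)]])
      then have "(\<lambda>q. frechet_derivative F (at (\<phi> q)) b) \<in> cinf (restr X ?W)" for b
        by (rule cinf_subset) blast
      moreover have "(\<lambda>q. x q (c b)) \<in> cinf (restr X ?W)" for b
        by (rule cinf_subset[where S=N]) (use co in auto)
      ultimately show ?thesis by (intro cinf_sum[OF XW] cinf_mult[OF XW])
    qed
    ultimately show "\<exists>N g. open N \<and> p \<in> N \<and> g \<in> cinf (restr X (N \<inter> pts X)) \<and> (\<forall>y\<in>N \<inter> pts X. x y f = g y)"
      using W X(2) by (intro exI[of _ ?W] exI[of _ ?g]) simp
  qed
qed

lemma prod_tvec_apply:
  assumes X: "atlas X h" "pts X = UNIV" and Y: "atlas Y k" "pts Y = UNIV"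
    and v: "v \<in> tangent_space X (fst z)" and w: "w \<in> tangent_space Y (snd z)"
    and f: "f \<in> cinf X" "g \<in> cinf Y"
  shows "(\<lambda>z. f (fst z) + g (snd z)) \<in> cinf (prod_space X Y)"
    and "prod_tvec X Y z v w (\<lambda>z. f (fst z) + g (snd z)) = v f + w g"
proof -
  let ?P = "prod_space X Y"
  have P: "atlas ?P (map_prod h k)" using atlas_prod X(1) Y(1) .
  have full: "restr ?P UNIV = ?P" using restr_full[of ?P] X(2) Y(2) by simp
  have 1: "smooth_map ?P X fst" using smooth_map_fst[OF X(1) Y(1), of UNIV] X(2) by (simp add: full)
  have 2: "smooth_map ?P Y snd" using smooth_map_snd[OF X(1) Y(1), of UNIV] Y(2) by (simp add: full)
  note c = cinf_compose[OF P X(1) 1 f(1)] cinf_compose[OF P Y(1) 2 f(2)]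
  show "(\<lambda>z. f (fst z) + g (snd z)) \<in> cinf ?P" by (rule cinf_add[OF P c])
  note u = prod_tvec[OF X Y v w]
  show "prod_tvec X Y z v w (\<lambda>z. f (fst z) + g (snd z)) = v f + w g"
    unfolding tangent_add[OF P u(1) c]
    using fun_cong[OF u(2), of f] fun_cong[OF u(3), of g] f by (simp add: tmap_apply)
qed

text \<open>The test functions can be taken as sums of one function on each factor, on which the
  product field is computed factor by factor.\<close>

lemma prod_vector_field:
  fixes X :: "('a::t2_space, 'e::euclidean_space) space" and Y :: "('b::t2_space, 'f::euclidean_space) space"
  assumes X: "atlas X h" "pts X = UNIV" and Y: "atlas Y k" "pts Y = UNIV"
    and x: "x \<in> vector_fields X" and y: "y \<in> vector_fields Y"
  shows "(\<lambda>z. prod_tvec X Y z (x (fst z)) (y (snd z))) \<in> vector_fields (prod_space X Y)"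
proof (rule vf_coordsI)
  let ?P = "prod_space X Y"
  show P: "atlas ?P (map_prod h k)" using atlas_prod X(1) Y(1) .
  show "pts ?P = UNIV" using X(2) Y(2) by simp
  then have full: "restr ?P UNIV = ?P" by (rule restr_full)
  have xt: "x p \<in> tangent_space X p" and yt: "y q \<in> tangent_space Y q" for p q
    using vf_tangent[OF x] vf_tangent[OF y] X(2) Y(2) by auto
  show "prod_tvec X Y z (x (fst z)) (y (snd z)) \<in> tangent_space ?P z" for z
    by (rule prod_tvec[OF X Y xt yt])
  fix z :: "'a \<times> 'b"
  obtain U \<phi> where c: "(U, \<phi>) \<in> charts X" "fst z \<in> U" by (rule atlas_chart[OF X(1)])
  obtain V \<psi> where d: "(V, \<psi>) \<in> charts Y" "snd z \<in> V" by (rule atlas_chart[OF Y(1)])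
  have ch: "(U \<times> V, map_prod \<phi> \<psi>) \<in> charts ?P"
    unfolding charts_prod_space using c d by (intro exI[of _ U] exI[of _ \<phi>] exI[of _ V] exI[of _ \<psi>]) simp
  obtain \<xi>1 W1 where \<xi>1: "\<And>b. \<xi>1 b \<in> cinf (restr X UNIV)" "open W1" "fst z \<in> W1" "W1 \<subseteq> U"
    "\<And>b y. y \<in> W1 \<Longrightarrow> \<xi>1 b y = \<phi> y \<bullet> b"
    by (rule coordinate_functions[OF X(1) c]) (rule that)
  obtain \<xi>2 W2 where \<xi>2: "\<And>b. \<xi>2 b \<in> cinf (restr Y UNIV)" "open W2" "snd z \<in> W2" "W2 \<subseteq> V"
    "\<And>b y. y \<in> W2 \<Longrightarrow> \<xi>2 b y = \<psi> y \<bullet> b"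
    by (rule coordinate_functions[OF Y(1) d]) (rule that)
  have \<xi>1X: "\<xi>1 b \<in> cinf X" for b using \<xi>1(1)[of b] restr_full[OF X(2)] by simp
  have \<xi>2Y: "\<xi>2 b \<in> cinf Y" for b using \<xi>2(1)[of b] restr_full[OF Y(2)] by simp
  let ?c = "\<lambda>b z. \<xi>1 (fst b) (fst z) + \<xi>2 (snd b) (snd z)"
  have 1: "?c b \<in> cinf ?P" for b
    using prod_tvec_apply(1)[OF X Y xt yt \<xi>1X \<xi>2Y] .
  have "(\<lambda>q. x q (\<xi>1 b)) \<in> cinf X" "(\<lambda>q. y q (\<xi>2 b')) \<in> cinf Y" for b b'
    using vf_cinf[OF x \<xi>1X] vf_cinf[OF y \<xi>2Y] .
  from prod_tvec_apply(1)[OF X Y xt yt this]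
  have 2: "(\<lambda>z. prod_tvec X Y z (x (fst z)) (y (snd z)) (?c b)) \<in> cinf ?P" for b
    using prod_tvec_apply(2)[OF X Y xt yt \<xi>1X \<xi>2Y] by simp
  have 3: "?c b w = map_prod \<phi> \<psi> w \<bullet> b" if "w \<in> W1 \<times> W2" for b w
    using that \<xi>1(5) \<xi>2(5) by (auto simp: inner_prod_def)
  have 4: "(\<lambda>z. prod_tvec X Y z (x (fst z)) (y (snd z)) (?c b)) \<in> cinf (restr ?P (W1 \<times> W2))" for b
    by (rule cinf_restr[OF 2]) (simp add: X(2) Y(2))
  show "\<exists>U \<phi> N c. (U, \<phi>) \<in> charts ?P \<and> z \<in> U \<and> open N \<and> z \<in> N \<and>
       (\<forall>b. c b \<in> cinf ?P \<and> (\<forall>y\<in>N. c b y = \<phi> y \<bullet> b) \<and>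
          (\<lambda>q. prod_tvec X Y q (x (fst q)) (y (snd q)) (c b)) \<in> cinf (restr ?P N))"
    using ch c d 1 3 4 \<xi>1(2,3) \<xi>2(2,3)
    by (intro exI[of _ "U \<times> V"] exI[of _ "map_prod \<phi> \<psi>"] exI[of _ "W1 \<times> W2"] exI[of _ ?c])
      (simp add: open_Times mem_Times_iff)
qed

section \<open>Partitions of unity\<close>

text \<open>The functions are \<open>b\<^sub>i \<Prod>\<^sub>j\<^sub><\<^sub>i (1 - b\<^sub>j)\<close> for countably many bump functions \<open>b\<^sub>i\<close>. They are
  locally finite because they vanish for \<open>i > j\<close> where \<open>b\<^sub>j = 1\<close>; no paracompactness is needed.\<close>

lemma partition_of_unity:
  fixes X :: "('a::{t2_space, second_countable_topology}, 'e::euclidean_space) space"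
  assumes X: "atlas X h" "pts X = UNIV" and N: "\<And>x. open (N x)" "\<And>x. x \<in> N x"
  obtains c :: "nat \<Rightarrow> 'a" and b C V where "\<And>i. b i \<in> cinf X" "\<And>i. closed (C i)" "\<And>i. C i \<subseteq> N (c i)"
    "\<And>i x. x \<notin> C i \<Longrightarrow> b i x = 0" "\<And>i. open (V i)" "\<And>x. \<exists>i. x \<in> V i"
    "\<And>i j x. x \<in> V j \<Longrightarrow> j < i \<Longrightarrow> b i x = 0" "\<And>j x. x \<in> V j \<Longrightarrow> (\<Sum>i\<le>j. b i x) = 1"
proof -
  have "\<exists>\<beta> V C. \<beta> \<in> cinf X \<and> open V \<and> x \<in> V \<and> closed C \<and> C \<subseteq> N x \<and> (\<forall>y\<in>V. \<beta> y = 1) \<and> (\<forall>y. y \<notin> C \<longrightarrow> \<beta> y = 0)" for x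
  proof -
    obtain \<beta> V C where "\<beta> \<in> cinf (restr X UNIV)" "open V" "x \<in> V" "V \<subseteq> C" "closed C" "C \<subseteq> N x"
      "\<And>y. y \<in> V \<Longrightarrow> \<beta> y = 1" "\<And>y. y \<notin> C \<Longrightarrow> \<beta> y = 0"
      by (rule bump_function[OF X(1) N]) (rule that)
    then show ?thesis using restr_full[OF X(2)]
      by (intro exI[of _ \<beta>] exI[of _ V] exI[of _ C]) auto
  qed
  then obtain \<beta> V C where \<beta>: "\<And>x. \<beta> x \<in> cinf X \<and> open (V x) \<and> x \<in> V x \<and> closed (C x) \<and> C x \<subseteq> N x \<and>
      (\<forall>y\<in>V x. \<beta> x y = 1) \<and> (\<forall>y. y \<notin> C x \<longrightarrow> \<beta> x y = 0)"
    by metis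
  obtain \<F> where \<F>: "\<F> \<subseteq> range V" "countable \<F>" "\<Union>\<F> = \<Union>(range V)"
    by (rule Lindelof[of "range V"]) (use \<beta> in \<open>auto intro: that\<close>)
  obtain A where A: "countable A" "\<F> = V ` A"
    using countable_subset_image[of \<F> V UNIV] \<F>(1,2) by auto
  have cov: "\<exists>a\<in>A. x \<in> V a" for x
  proof -
    have "x \<in> V x" using \<beta>[of x] by simp
    then have "x \<in> \<Union>\<F>" unfolding \<F>(3) by blast
    then show ?thesis using A(2) by auto
  qed
  then have "A \<noteq> {}" by blast
  define c where "c = from_nat_into A"
  have c: "\<exists>i. x \<in> V (c i)" for x
    using cov[of x] from_nat_into_surj[OF A(1)] by (auto simp: c_def)
  define b where "b i x = \<beta> (c i) x * (\<Prod>j<i. 1 - \<beta> (c j) x)" for i x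
  \<comment> \<open>Telescoping: \<open>b i\<close> is the difference of two consecutive partial
    products of the functions 1 - \<beta>.\<close>
  have sum: "(\<Sum>i\<le>j. b i x) = 1 - (\<Prod>i\<le>j. 1 - \<beta> (c i) x)" for j x
    by (induction j) (simp_all add: b_def lessThan_Suc_atMost algebra_simps)
  show thesis
  proof (rule that[of b "\<lambda>i. C (c i)" c "\<lambda>i. V (c i)"])
    show "b i \<in> cinf X" for i
    proof -
      have "\<beta> a \<in> cinf X" for a using \<beta>[of a] by simp
      then show ?thesis unfolding b_def[abs_def]
        by (intro cinf_mult[OF X(1)] cinf_prod[OF X(1)] cinf_diff[OF X(1)] cinf_const[OF X(1)])
    qed
    show "b i x = 0" if "x \<in> V (c j)" "j < i" for i j x
    proof -
      have "1 - \<beta> (c j) x = 0" using \<beta> that(1) by auto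
      then have "(\<Prod>j<i. 1 - \<beta> (c j) x) = 0" using that(2) by (intro prod_zero) auto
      then show ?thesis by (simp add: b_def)
    qed
    show "(\<Sum>i\<le>j. b i x) = 1" if "x \<in> V (c j)" for j x
    proof -
      have "1 - \<beta> (c j) x = 0" using \<beta> that by auto
      then have "(\<Prod>i\<le>j. 1 - \<beta> (c i) x) = 0" by (intro prod_zero) auto
      then show ?thesis by (simp add: sum)
    qed
    show "closed (C (c i))" "C (c i) \<subseteq> N (c i)" "open (V (c i))" for i
      using \<beta>[of "c i"] by auto
    show "b i x = 0" if "x \<notin> C (c i)" for i x
      using \<beta>[of "c i"] that by (simp add: b_def)
  qed (rule c)
qed

section \<open>Tangent vectors in Euclidean space and velocity of curves\<close>

lemma cinf_eucl_iff: "f \<in> cinf eucl \<longleftrightarrow> Cinf_on f UNIV"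
proof
  assume f: "f \<in> cinf eucl"
  show "Cinf_on f UNIV"
  proof (rule Cinf_on_local)
    fix x :: 'a
    obtain N F where F: "open N" "id x \<in> N" "Cinf_on F N"
      "\<And>y. y \<in> UNIV \<Longrightarrow> y \<in> pts eucl \<Longrightarrow> id y \<in> N \<Longrightarrow> F (id y) = f y"
      by (rule cinf_rep[OF atlas_eucl f, of x UNIV id]) (auto intro: that)
    have "Cinf_on f N" by (rule Cinf_on_cong[OF F(1) _ F(3)]) (use F(4) in simp)
    then show "\<exists>V. open V \<and> x \<in> V \<and> Cinf_on f V" using F by auto
  qed
next
  assume f: "Cinf_on f UNIV"
  show "f \<in> cinf eucl"
  proof (rule cinfI_rep[OF atlas_eucl])
    fix x :: 'a
    show "\<exists>U \<phi> N F. (U, \<phi>) \<in> charts eucl \<and> x \<in> U \<and> open N \<and> \<phi> x \<in> N \<and> Cinf_on F N \<and>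
        (\<forall>y\<in>U. y \<in> pts eucl \<longrightarrow> \<phi> y \<in> N \<longrightarrow> F (\<phi> y) = f y)"
      using f by (intro exI[of _ UNIV] exI[of _ id] exI[of _ f]) simp
  qed
qed

lemma smooth_map_eucl:
  fixes F :: "'a::euclidean_space \<Rightarrow> 'b::euclidean_space"
  assumes "open W" "Cinf_on F W" shows "smooth_map (restr eucl W) eucl F"
proof (rule smooth_map_euclI_rep)
  show "atlas (restr eucl W) (\<lambda>x::'a. x)" by (simp add: atlas_eucl)
  fix x assume "x \<in> pts (restr eucl W)"
  then show "\<exists>U \<phi> N G. (U, \<phi>) \<in> charts (restr eucl W) \<and> x \<in> U \<and> open N \<and> \<phi> x \<in> N \<and> Cinf_on G N \<and>
      (\<forall>y\<in>U. y \<in> pts (restr eucl W) \<longrightarrow> \<phi> y \<in> N \<longrightarrow> G (\<phi> y) = F y)"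
    using assms by (intro exI[of _ UNIV] exI[of _ id] exI[of _ W] exI[of _ F]) simp
qed

definition dir_tvec :: "'a::euclidean_space \<Rightarrow> 'a \<Rightarrow> 'a tvec"
  where "dir_tvec a e f = (if f \<in> cinf eucl then frechet_derivative f (at a) e else 0)"

lemma cinf_eucl_has_derivative:
  "f \<in> cinf eucl \<Longrightarrow> (f has_derivative frechet_derivative f (at a)) (at a)"
  using Cinf_on_has_derivative[of f UNIV a] by (simp add: cinf_eucl_iff)

lemma dir_tvec_tangent: "dir_tvec a e \<in> tangent_space eucl a"
proof (rule tangent_spaceI)
  show "dir_tvec a e f = 0" if "f \<notin> cinf eucl" for f using that by (simp add: dir_tvec_def)
  fix f g :: "'a \<Rightarrow> real" assume f: "f \<in> cinf eucl" and g: "g \<in> cinf eucl"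
  note d = cinf_eucl_has_derivative[OF f, of a] cinf_eucl_has_derivative[OF g, of a]
  show "dir_tvec a e (\<lambda>y. c * f y + c' * g y) = c * dir_tvec a e f + c' * dir_tvec a e g" for c c'
  proof -
    have "((\<lambda>y. c * f y + c' * g y) has_derivative
        (\<lambda>v. c * frechet_derivative f (at a) v + c' * frechet_derivative g (at a) v)) (at a)"
      by (intro has_derivative_add has_derivative_mult_right d)
    from frechet_derivative_at[OF this, symmetric] show ?thesis
      using f g cinf_add[OF atlas_eucl cinf_cmult[OF atlas_eucl f, of c] cinf_cmult[OF atlas_eucl g, of c']]
      by (simp add: dir_tvec_def)
  qed
  have "((\<lambda>y. f y * g y) has_derivative
      (\<lambda>v. f a * frechet_derivative g (at a) v + frechet_derivative f (at a) v * g a)) (at a)"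
    by (rule has_derivative_mult[OF d])
  from frechet_derivative_at[OF this, symmetric]
  show "dir_tvec a e (\<lambda>y. f y * g y) = f a * dir_tvec a e g + g a * dir_tvec a e f"
    using f g cinf_mult[OF atlas_eucl f g] by (simp add: dir_tvec_def)
qed

text \<open>The counterpart of \<open>tangent_expand\<close>: each direction in the range of
  \<open>h\<close> is realised by a derivation, namely the push-forward of a directional derivative
  along the inverse chart composed with \<open>h\<close>.\<close>

lemma tangent_of_coordinates:
  fixes X :: "('a::t2_space, 'e::euclidean_space) space"
  assumes X: "atlas X h" "pts X = UNIV" and c: "(U, \<phi>) \<in> charts X" "p \<in> U"
  obtains v where "v \<in> tangent_space X p"
    "\<And>f N F. f \<in> cinf X \<Longrightarrow> open N \<Longrightarrow> \<phi> p \<in> N \<Longrightarrow> Cinf_on F N \<Longrightarrow> (\<forall>y\<in>U. \<phi> y \<in> N \<longrightarrow> F (\<phi> y) = f y) \<Longrightarrow>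
       v f = frechet_derivative F (at (\<phi> p)) (h e)"
proof -
  obtain W where W: "open W" "\<phi> ` U = W \<inter> range h" by (rule chart_image[OF X(1) c(1)])
  have linh: "linear h" by (rule atlas_linear[OF X(1)])
  have conth: "continuous_on UNIV h"
    using Cinf_on_continuous[OF Cinf_on_linear[OF linh]] .
  define W' where "W' = h -` W"
  have W': "open W'" unfolding W'_def using continuous_open_preimage[OF conth open_UNIV W(1)] by simp
  have hp: "h (\<phi> p) = \<phi> p" by (rule chart_proj[OF X(1) c])
  have pW: "\<phi> p \<in> W'" using W(2) c(2) hp by (auto simp: W'_def)
  let ?E = "restr eucl W' :: ('e, 'e) space"
  have E: "atlas ?E (\<lambda>x. x)" by (simp add: atlas_eucl)
  define \<psi> where "\<psi> u = inv_into U \<phi> (h u)" for u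
  have \<psi>: "\<phi> (\<psi> u) = h u" "\<psi> u \<in> U" if "u \<in> W'" for u
  proof -
    have "h u \<in> \<phi> ` U" using that W(2) by (auto simp: W'_def)
    then show "\<phi> (\<psi> u) = h u" "\<psi> u \<in> U" unfolding \<psi>_def by (auto simp: f_inv_into_f inv_into_into)
  qed
  have sm: "smooth_map ?E X \<psi>"
  proof (rule smooth_mapI_rep[OF E X(1)])
    show "\<psi> x \<in> pts X" for x by (simp add: X(2))
    fix u assume "u \<in> pts ?E"
    then show "\<exists>V \<theta> A \<zeta> N F. (V, \<theta>) \<in> charts ?E \<and> u \<in> V \<and> (A, \<zeta>) \<in> charts X \<and> \<psi> u \<in> A \<and>
        open N \<and> \<theta> u \<in> N \<and> Cinf_on F N \<and>
        (\<forall>y\<in>V. y \<in> pts ?E \<longrightarrow> \<theta> y \<in> N \<longrightarrow> \<psi> y \<in> A \<and> F (\<theta> y) = \<zeta> (\<psi> y))"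
      using c W' \<psi> Cinf_on_linear[OF linh]
      by (intro exI[of _ UNIV] exI[of _ id] exI[of _ U] exI[of _ \<phi>] exI[of _ W'] exI[of _ h]) simp
  qed
  obtain w where w: "w \<in> tangent_space (restr eucl (W' \<inter> pts eucl)) (\<phi> p)"
    "\<And>f. f \<in> cinf eucl \<Longrightarrow> w f = dir_tvec (\<phi> p) e f"
    by (rule tangent_open[OF atlas_eucl dir_tvec_tangent _ W' pW, of e]) (auto intro: that)
  have w': "w \<in> tangent_space ?E (\<phi> p)" using w(1) by simp
  have \<psi>p: "\<psi> (\<phi> p) = p" using chart_inv[OF X(1) c] hp by (simp add: \<psi>_def)
  show thesis
  proof (rule that[of "tmap X \<psi> w"])
    show "tmap X \<psi> w \<in> tangent_space X p"
      using tmap_tangent[OF E X(1) sm w'] \<psi>p by simp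
    fix f N F assume f: "f \<in> cinf X" and N: "open N" "\<phi> p \<in> N" "Cinf_on F N" "\<forall>y\<in>U. \<phi> y \<in> N \<longrightarrow> F (\<phi> y) = f y"
    have f\<psi>: "(\<lambda>u. f (\<psi> u)) \<in> cinf ?E" by (rule cinf_compose[OF E X(1) sm f])
    have f\<psi>': "(\<lambda>u. f (\<psi> u)) \<in> cinf (restr eucl (W' \<inter> UNIV))" using f\<psi> by simp
    obtain g V where g: "g \<in> cinf (restr eucl UNIV)" "open V" "\<phi> p \<in> V" "V \<subseteq> W'" "\<And>y. y \<in> V \<Longrightarrow> g y = f (\<psi> y)"
      by (rule cinf_extend[OF atlas_eucl W' pW f\<psi>']) (rule that)
    have g1: "g \<in> cinf eucl" using g(1) unfolding restr_full[OF pts_eucl] .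
    have g2: "g \<in> cinf ?E" using cinf_subset[OF g(1), of W'] by simp
    let ?V = "V \<inter> h -` N"
    have V: "open ?V" "\<phi> p \<in> ?V"
      using g N hp continuous_open_preimage[OF conth open_UNIV N(1)] by (auto intro!: open_Int)
    have gF: "g y = F (h y)" if "y \<in> ?V" for y
    proof -
      have y: "y \<in> W'" "h y \<in> N" "y \<in> V" using that g(4) by auto
      then have "F (\<phi> (\<psi> y)) = f (\<psi> y)" using bspec[OF N(4) \<psi>(2)[OF y(1)]] \<psi>(1)[OF y(1)] by simp
      then show ?thesis using g(5)[OF y(3)] \<psi>(1)[OF y(1)] by simp
    qed
    have "w (\<lambda>u. f (\<psi> u)) = w g"
      by (rule tangent_local[OF E w' _ f\<psi> g2 V]) (use pW g in auto)
    also have "\<dots> = frechet_derivative g (at (\<phi> p)) e" using w(2)[OF g1] g1 by (simp add: dir_tvec_def)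
    also have "frechet_derivative g (at (\<phi> p)) = frechet_derivative (\<lambda>y. F (h y)) (at (\<phi> p))"
      by (rule frechet_derivative_cong_open[OF V gF])
    also have "\<dots> = (\<lambda>e. frechet_derivative F (at (\<phi> p)) (h e))"
    proof -
      have dF: "(F has_derivative frechet_derivative F (at (\<phi> p))) (at (h (\<phi> p)))"
        using Cinf_on_has_derivative[OF N(3,2)] hp by simp
      have dh: "(h has_derivative h) (at (\<phi> p))"
        using linh bounded_linear_imp_has_derivative linear_conv_bounded_linear by blast
      show ?thesis
        using frechet_derivative_at[OF has_derivative_compose[OF dh dF]] by simp
    qed
    finally show "tmap X \<psi> w f = frechet_derivative F (at (\<phi> p)) (h e)"
      using f by (simp add: tmap_apply)
  qed
qed

section \<open>Submersions\<close>

text \<open>The point \<open>y\<close> is moved along a right inverse \<open>R\<close> of the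
  derivative until the level \<open>m\<close> is reached: G (y + R w) = m is solved for
  \<open>w\<close> by the inverse function theorem, with \<open>y\<close> as a parameter. The
  projections \<open>h\<close> and \<open>k\<close> account for coordinates that fill only the range
  of a projection.\<close>

lemma submersion_euclidean:
  fixes G :: "'e::euclidean_space \<Rightarrow> 'd::euclidean_space"
  assumes N: "open N" "a \<in> N" and G: "Cinf_on G N" and h: "linear h" "\<And>x. h (h x) = h x"
    and k: "linear k" "\<And>x. k (k x) = k x" and kG: "\<And>x. k (G x) = G x" and Gh: "\<And>x. G (h x) = G x"
    and ah: "h a = a"
    and surj: "\<And>e. \<exists>x. frechet_derivative G (at a) x = k e"
  obtains Q s where "open Q" "(G a, a) \<in> Q" "Cinf_on s Q"
    "\<And>m y. (m, y) \<in> Q \<Longrightarrow> k m = m \<Longrightarrow> G (s (m, y)) = m \<and> h (s (m, y)) = s (m, y) \<and> s (m, y) \<in> N"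
    "\<And>y. (G y, y) \<in> Q \<Longrightarrow> h y = y \<Longrightarrow> s (G y, y) = y"
proof -
  let ?D = "frechet_derivative G (at a)"
  have dG: "(G has_derivative ?D) (at a)" using Cinf_on_has_derivative[OF G N(2)] .
  have linD: "linear ?D" using has_derivative_linear[OF dG] .
  obtain R0 where R0: "linear R0" "\<forall>v\<in>?D ` UNIV. ?D (R0 v) = v"
    using linear_exists_right_inverse_on[OF linD subspace_UNIV] by blast
  define R where "R w = h (R0 (k w))" for w
  have linR: "linear R" unfolding R_def[abs_def]
    using linear_compose[OF linear_compose[OF k(1) R0(1)] h(1)] by (simp add: o_def)
  have hR: "h (R w) = R w" for w by (simp add: R_def h(2))
  have dGh: "?D (h x) = ?D x" for x
  proof -
    have dh: "(h has_derivative h) (at a)"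
      using h(1) bounded_linear_imp_has_derivative linear_conv_bounded_linear by blast
    have "((\<lambda>x. G (h x)) has_derivative (\<lambda>x. ?D (h x))) (at a)"
      by (rule has_derivative_compose[OF dh]) (use dG ah in simp)
    then have "(G has_derivative (\<lambda>x. ?D (h x))) (at a)" by (simp add: Gh)
    from frechet_derivative_at[OF this] show ?thesis by metis
  qed
  have DR: "?D (R w) = k w" for w
    using surj[of w] R0(2) by (auto simp: R_def dGh) (metis rangeI)
  \<comment> \<open>The derivative of the first summand sees only \<open>k w\<close>. The correction
    w - k w supplies the complementary directions and makes the derivative at (0, a)
    injective.\<close>
  define \<Psi> where "\<Psi> p = (G (snd p + R (fst p)) + (fst p - k (fst p)), snd p)" for p
  let ?\<tau> = "\<lambda>p. snd p + R (fst p)"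
  have lin\<tau>: "linear ?\<tau>" using linR by (auto simp: linear_iff algebra_simps)
  have \<tau>: "Cinf_on ?\<tau> UNIV" by (rule Cinf_on_linear[OF lin\<tau>])
  define U where "U = ?\<tau> -` N"
  have U: "open U" unfolding U_def using continuous_open_preimage[OF Cinf_on_continuous[OF \<tau>] open_UNIV N(1)] by simp
  have aU: "(0, a) \<in> U" using N(2) linear_0[OF linR] by (simp add: U_def)
  have lin1: "linear (\<lambda>p::'d \<times> 'e. fst p - k (fst p))" using k(1) by (auto simp: linear_iff algebra_simps)
  have C\<Psi>: "Cinf_on \<Psi> U"
    unfolding \<Psi>_def
    by (intro Cinf_on_Pair Cinf_on_add U Cinf_on_compose[OF U G] Cinf_on_subset[OF \<tau>] Cinf_on_linear[OF lin1] Cinf_on_snd)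
      (auto simp: U_def)
  have d\<Psi>: "(\<Psi> has_derivative (\<lambda>p. (?D (?\<tau> p) + (fst p - k (fst p)), snd p))) (at (0, a))"
  proof -
    have d\<tau>: "(?\<tau> has_derivative ?\<tau>) (at (0, a))" and d1: "((\<lambda>p::'d \<times> 'e. fst p - k (fst p)) has_derivative (\<lambda>p. fst p - k (fst p))) (at (0, a))"
      using lin\<tau> lin1 bounded_linear_imp_has_derivative linear_conv_bounded_linear by blast+
    have "(G has_derivative ?D) (at (?\<tau> (0, a)))" using dG linear_0[OF linR] by simp
    from has_derivative_compose[OF d\<tau> this] show ?thesis
      unfolding \<Psi>_def[abs_def] by (intro has_derivative_Pair has_derivative_add d1 has_derivative_snd has_derivative_ident)
  qed
  have "inj (frechet_derivative \<Psi> (at (0, a)))"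
    unfolding frechet_derivative_at[OF d\<Psi>, symmetric]
  proof (rule injI, clarsimp)
    fix w y w' assume "?D (y + R w) + (w - k w) = ?D (y + R w') + (w' - k w')"
    then show "w = w'" using linear_add[OF linD] DR by simp
  qed
  then obtain U' V g where I: "open U'" "U' \<subseteq> U" "(0, a) \<in> U'" "open V" "\<Psi> (0, a) \<in> V" "homeomorphism U' V \<Psi> g" "Cinf_on g V"
    using Cinf_inverse_function[OF U aU C\<Psi>] by metis
  have g: "g (\<Psi> p) = p" if "p \<in> U'" for p using I(6) that by (auto simp: homeomorphism_def)
  have gV: "\<Psi> (g q) = q" "g q \<in> U'" if "q \<in> V" for q using I(6) that by (auto simp: homeomorphism_def)
  define s where "s q = h (snd q) + R (fst (g q))" for q
  have lin2: "linear (\<lambda>p::'d \<times> 'e. R (fst p))" using linR by (auto simp: linear_iff)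
  have lin3: "linear (\<lambda>p::'d \<times> 'e. h (snd p))" using h(1) by (auto simp: linear_iff)
  have Cs: "Cinf_on s V"
    unfolding s_def
    by (intro Cinf_on_add I(4) Cinf_on_linear[OF lin3] Cinf_on_compose[OF I(4) Cinf_on_linear[OF lin2, of UNIV] I(7)]) simp
  define \<iota> where "\<iota> y = (0::'d, y)" for y :: 'e
  \<comment> \<open>The last condition places (0, y) in \<open>U'\<close>, so that \<open>g\<close>
    returns it from (G y, y). This is what gives s (G y, y) = y.\<close>
  define Q where "Q = {q \<in> V. s q \<in> N \<and> \<iota> (snd q) \<in> U'}"
  have "open Q"
  proof -
    have "open (V \<inter> s -` N)" by (rule continuous_open_preimage[OF Cinf_on_continuous[OF Cs] I(4) N(1)])
    moreover have "open ((\<lambda>q::'d \<times> 'e. \<iota> (snd q)) -` U')"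
      using I(1) unfolding \<iota>_def by (intro open_vimage) (auto intro!: continuous_intros)
    moreover have "Q = (V \<inter> s -` N) \<inter> (\<lambda>q. \<iota> (snd q)) -` U'" by (auto simp: Q_def)
    ultimately show ?thesis by (simp add: open_Int)
  qed
  have \<Psi>0: "\<Psi> (0, y) = (G y, y)" for y using linear_0[OF linR] linear_0[OF k(1)] by (simp add: \<Psi>_def)
  have sG: "s (G y, y) = y" if "(0, y) \<in> U'" "h y = y" for y
    using g[OF that(1)] that(2) linear_0[OF linR] by (simp add: s_def \<Psi>0)
  show thesis
  proof (rule that[of Q s])
    show "open Q" by fact
    show "(G a, a) \<in> Q" using I(5,3) sG[OF I(3) ah] N(2) by (simp add: Q_def \<Psi>0 \<iota>_def)
    show "Cinf_on s Q" by (rule Cinf_on_subset[OF Cs]) (auto simp: Q_def)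
    show "G (s (m, y)) = m \<and> h (s (m, y)) = s (m, y) \<and> s (m, y) \<in> N" if q: "(m, y) \<in> Q" "k m = m" for m y
    proof -
      obtain w z where wz: "g (m, y) = (w, z)" by (cases "g (m, y)")
      have "\<Psi> (w, z) = (m, y)" using gV[of "(m, y)"] q(1) wz by (simp add: Q_def)
      then have e: "G (y + R w) + (w - k w) = m" "z = y" by (auto simp: \<Psi>_def)
      have "k (G (y + R w) + (w - k w)) = G (y + R w)"
        using linear_add[OF k(1)] linear_diff[OF k(1)] k(2) kG by simp
      then have "G (y + R w) = m" using e q(2) by simp
      moreover have "s (m, y) = h (y + R w)" using wz linear_add[OF h(1)] hR by (simp add: s_def)
      ultimately show ?thesis using Gh h(2) q(1) by (simp add: Q_def)
    qed
    show "s (G y, y) = y" if "(G y, y) \<in> Q" "h y = y" for y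
      using sG that by (simp add: Q_def \<iota>_def)
  qed
qed

text \<open>A family of local sections, depending smoothly on a point \<open>y\<close> through which
  the section passes. The parameter turns sections into retractions onto fibre products and into
  lifts of vector fields.\<close>

lemma submersion_section:
  fixes X :: "('x::t2_space, 'e::euclidean_space) space" and M :: "('m::t2_space, 'd::euclidean_space) space"
  assumes X: "atlas X h" "pts X = UNIV" and M: "atlas M k" "pts M = UNIV" and \<pi>: "surjective_submersion X M \<pi>"
  obtains N s where "open N" "(\<pi> y0, y0) \<in> N" "smooth_map (restr (prod_space M X) N) X s"
    "\<And>m y. (m, y) \<in> N \<Longrightarrow> \<pi> (s (m, y)) = m" "\<And>y. (\<pi> y, y) \<in> N \<Longrightarrow> s (\<pi> y, y) = y"
proof -
  have sm: "smooth_map X M \<pi>" and surj: "tmap M \<pi> ` tangent_space X y0 = tangent_space M (\<pi> y0)"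
    using \<pi> X(2) unfolding surjective_submersion_def by auto
  have fX: "restr X UNIV = X" and fM: "restr M UNIV = M" using restr_full X(2) M(2) by auto
  obtain U \<phi> where c: "(U, \<phi>) \<in> charts X" "y0 \<in> U" by (rule atlas_chart[OF X(1)])
  obtain V \<psi> where d: "(V, \<psi>) \<in> charts M" "\<pi> y0 \<in> V" by (rule atlas_chart[OF M(1)])
  have y0: "y0 \<in> pts X" using X(2) by simp
  obtain N1 F where F: "open N1" "\<phi> y0 \<in> N1" "Cinf_on F N1"
    "\<And>y. y \<in> U \<Longrightarrow> y \<in> pts X \<Longrightarrow> \<phi> y \<in> N1 \<Longrightarrow> \<pi> y \<in> V \<and> F (\<phi> y) = \<psi> (\<pi> y)"
    by (rule smooth_map_rep[OF X(1) sm y0 c d(1) chart_open[OF M(1) d(1)] d(2)]) (rule that)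
  obtain W where W: "open W" "\<phi> ` U = W \<inter> range h" by (rule chart_image[OF X(1) c(1)])
  have linh: "linear h" and link: "linear k" using atlas_linear X(1) M(1) by auto
  define G where "G u = k (F (h u))" for u
  define N' where "N' = h -` (N1 \<inter> W)"
  have conth: "continuous_on UNIV h" using Cinf_on_continuous[OF Cinf_on_linear[OF linh]] .
  have N': "open N'"
    unfolding N'_def using continuous_open_preimage[OF conth open_UNIV open_Int[OF F(1) W(1)]] by simp
  have h\<phi>: "h (\<phi> y) = \<phi> y" if "y \<in> U" for y using chart_proj[OF X(1) c(1) that] .
  have N'\<phi>: "\<phi> y \<in> N' \<longleftrightarrow> \<phi> y \<in> N1" if "y \<in> U" for y
    using that h\<phi> W(2) by (auto simp: N'_def)
  have G\<phi>: "G (\<phi> y) = \<psi> (\<pi> y)" if "y \<in> U" "\<phi> y \<in> N1" for y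
    using that F(4)[of y] X(2) chart_proj[OF M(1) d(1), of "\<pi> y"] by (simp add: G_def h\<phi>)
  have G: "Cinf_on G N'"
    unfolding G_def
    by (rule Cinf_on_compose[OF N' Cinf_on_linear[OF link, of UNIV]
          Cinf_on_compose[OF N' F(3) Cinf_on_linear[OF linh]]]) (auto simp: N'_def)
  have ph: "h (h x) = h x" for x using atlas_proj[OF X(1)] .
  have pk: "k (k x) = k x" for x using atlas_proj[OF M(1)] .
  have a: "\<phi> y0 \<in> N'" using N'\<phi> c F by simp
  \<comment> \<open>Surjectivity on derivations becomes surjectivity of the coordinate derivative:
    \<open>tangent_of_coordinates\<close> realises \<open>k e\<close>, the hypothesis lifts it to
    some \<open>v\<close>, and \<open>tangent_expand\<close> reads off the coordinates of
    \<open>v\<close>.\<close>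
  have rk: "\<exists>x. frechet_derivative G (at (\<phi> y0)) x = k e" for e
  proof -
    obtain \<xi> V' where \<xi>: "\<And>b. \<xi> b \<in> cinf (restr M UNIV)" "open V'" "\<pi> y0 \<in> V'" "V' \<subseteq> V"
      "\<And>b y. y \<in> V' \<Longrightarrow> \<xi> b y = \<psi> y \<bullet> b"
      by (rule coordinate_functions[OF M(1) d]) (rule that)
    obtain \<eta> U' where \<eta>: "\<And>b. \<eta> b \<in> cinf (restr X UNIV)" "open U'" "y0 \<in> U'" "U' \<subseteq> U"
      "\<And>b y. y \<in> U' \<Longrightarrow> \<eta> b y = \<phi> y \<bullet> b"
      by (rule coordinate_functions[OF X(1) c]) (rule that)
    have \<xi>M: "\<xi> b \<in> cinf M" for b using \<xi>(1)[of b] fM by simp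
    obtain w where w: "w \<in> tangent_space M (\<pi> y0)"
      "\<And>f N F. f \<in> cinf M \<Longrightarrow> open N \<Longrightarrow> \<psi> (\<pi> y0) \<in> N \<Longrightarrow> Cinf_on F N \<Longrightarrow> (\<forall>y\<in>V. \<psi> y \<in> N \<longrightarrow> F (\<psi> y) = f y) \<Longrightarrow>
         w f = frechet_derivative F (at (\<psi> (\<pi> y0))) (k e)"
      using tangent_of_coordinates[OF M d, of e] by metis
    have "w \<in> tmap M \<pi> ` tangent_space X y0" using surj w(1) by simp
    then obtain v where v: "v \<in> tangent_space X y0" "tmap M \<pi> v = w" by (elim imageE) (simp add: that)
    obtain N5 where N5: "open N5" "\<And>y. y \<in> V \<Longrightarrow> \<psi> y \<in> N5 \<longleftrightarrow> y \<in> V'"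
      by (rule chart_open_image[OF M(1) d(1) \<xi>(2)]) (rule that)
    have "open (\<pi> -` V')"
      using continuous_open_preimage[OF smooth_map_continuous[OF sm] _ \<xi>(2)] X(2) by simp
    then obtain N4 where N4: "open N4" "\<And>y. y \<in> U \<Longrightarrow> \<phi> y \<in> N4 \<longleftrightarrow> y \<in> \<pi> -` V'"
      by (rule chart_open_image[OF X(1) c(1)]) (rule that)
    let ?D = "frechet_derivative G (at (\<phi> y0))"
    have dG: "(G has_derivative ?D) (at (\<phi> y0))" using Cinf_on_has_derivative[OF G a] .
    define x where "x = (\<Sum>b\<in>Basis. v (\<eta> b) *\<^sub>R b)"
    have *: "?D x \<bullet> b = k e \<bullet> b" for b
    proof -
      have "k e \<bullet> b = w (\<xi> b)"
      proof -
        have "w (\<xi> b) = frechet_derivative (\<lambda>u. u \<bullet> b) (at (\<psi> (\<pi> y0))) (k e)"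
          by (rule w(2)[OF \<xi>M N5(1)])
            (use N5 \<xi>(3,5) d in \<open>auto intro: Cinf_on_bounded_linear bounded_linear_inner_left\<close>)
        then show ?thesis
          using frechet_derivative_at[OF bounded_linear_imp_has_derivative[OF bounded_linear_inner_left[of b]], symmetric]
          by simp
      qed
      also have "\<dots> = v (\<lambda>y. \<xi> b (\<pi> y))" using v(2) tmap_apply[OF \<xi>M] by metis
      also have "\<dots> = (\<Sum>c\<in>Basis. v (\<eta> c) * frechet_derivative (\<lambda>u. G u \<bullet> b) (at (\<phi> y0)) c)"
      proof (rule tangent_expand[OF X(1) c(1) \<eta>(1,2,4,5,3), of UNIV])
        show "v \<in> tangent_space (restr X UNIV) y0" using v fX by simp
        show "(\<lambda>y. \<xi> b (\<pi> y)) \<in> cinf (restr X UNIV)"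
          using cinf_compose[OF X(1) M(1) sm \<xi>M] fX by simp
        show "open (N' \<inter> N4)" "\<phi> y0 \<in> N' \<inter> N4" using N' N4 a c \<xi>(3) by auto
        show "Cinf_on (\<lambda>u. G u \<bullet> b) (N' \<inter> N4)"
          by (intro Cinf_on_inner Cinf_on_const Cinf_on_subset[OF G] open_Int N' N4(1)) auto
        fix y assume "y \<in> U" "\<phi> y \<in> N' \<inter> N4"
        then show "G (\<phi> y) \<bullet> b = \<xi> b (\<pi> y)"
          using G\<phi> N'\<phi> N4(2) \<xi>(5) by simp
      qed simp_all
      also have "\<dots> = (\<Sum>c\<in>Basis. v (\<eta> c) * (?D c \<bullet> b))"
        using frechet_derivative_at[OF has_derivative_inner_left[OF dG, of b], symmetric] by simp
      also have "\<dots> = ?D x \<bullet> b"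
        unfolding x_def linear_sum[OF has_derivative_linear[OF dG]]
        by (simp add: inner_sum_left linear_scale[OF has_derivative_linear[OF dG]])
      finally show ?thesis by simp
    qed
    have "?D x = k e" by (rule euclidean_eqI) (rule *)
    then show ?thesis by (rule exI)
  qed
  have kG: "k (G x) = G x" and Gh: "G (h x) = G x" for x by (simp_all add: G_def ph pk)
  obtain Q s0 where Q: "open Q" "(G (\<phi> y0), \<phi> y0) \<in> Q" "Cinf_on s0 Q"
    "\<And>m y. (m, y) \<in> Q \<Longrightarrow> k m = m \<Longrightarrow> G (s0 (m, y)) = m \<and> h (s0 (m, y)) = s0 (m, y) \<and> s0 (m, y) \<in> N'"
    "\<And>y. (G y, y) \<in> Q \<Longrightarrow> h y = y \<Longrightarrow> s0 (G y, y) = y"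
    by (rule submersion_euclidean[OF N' a G linh ph link pk kG Gh h\<phi>[OF c(2)] rk]) (rule that)
  have P: "atlas (prod_space M X) (map_prod k h)" by (rule atlas_prod[OF M(1) X(1)])
  have ch: "(V \<times> U, map_prod \<psi> \<phi>) \<in> charts (prod_space M X)"
    unfolding charts_prod_space using c d by (intro exI[of _ V] exI[of _ \<psi>] exI[of _ U] exI[of _ \<phi>]) simp
  let ?Q = "Q \<inter> UNIV \<times> N'"
  have Q': "open ?Q" using Q(1) N' by (intro open_Int open_Times) auto
  define N where "N = (V \<times> U) \<inter> map_prod \<psi> \<phi> -` ?Q"
  define s where "s z = inv_into U \<phi> (s0 (map_prod \<psi> \<phi> z))" for z
  have key: "s (m, y) \<in> U \<and> \<phi> (s (m, y)) = s0 (\<psi> m, \<phi> y) \<and> \<pi> (s (m, y)) = m" if "(m, y) \<in> N" for m y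
  proof -
    have my: "m \<in> V" "y \<in> U" "(\<psi> m, \<phi> y) \<in> Q" using that by (auto simp: N_def)
    let ?u = "s0 (\<psi> m, \<phi> y)"
    have u: "G ?u = \<psi> m" "h ?u = ?u" "?u \<in> N'"
      using Q(4)[OF my(3) chart_proj[OF M(1) d(1) my(1)]] by auto
    then have "?u \<in> \<phi> ` U" "?u \<in> N1" using W(2) by (auto simp: N'_def) (metis IntI rangeI)
    then have sU: "s (m, y) \<in> U" "\<phi> (s (m, y)) = ?u"
      by (simp_all add: s_def inv_into_into f_inv_into_f)
    have "\<psi> (\<pi> (s (m, y))) = \<psi> m" using G\<phi>[OF sU(1)] sU(2) \<open>?u \<in> N1\<close> u(1) by simp
    moreover have "\<pi> (s (m, y)) \<in> V" using F(4)[OF sU(1)] sU(2) \<open>?u \<in> N1\<close> X(2) by simp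
    ultimately have "\<pi> (s (m, y)) = m" using chart_inj[OF M(1) d(1)] my(1) by (auto dest: inj_onD)
    with sU show ?thesis by simp
  qed
  show thesis
  proof (rule that[of N s])
    show "open N" unfolding N_def by (rule chart_preimage_open[OF P ch Q'])
    show "(\<pi> y0, y0) \<in> N" using c d Q(2) a G\<phi>[OF c(2) F(2)] by (simp add: N_def)
    show "\<pi> (s (m, y)) = m" if "(m, y) \<in> N" for m y using key[OF that] by simp
    show "s (\<pi> y, y) = y" if "(\<pi> y, y) \<in> N" for y
    proof -
      have y: "y \<in> U" "(\<psi> (\<pi> y), \<phi> y) \<in> Q" "\<phi> y \<in> N1" using that N'\<phi> by (auto simp: N_def)
      then have "s0 (\<psi> (\<pi> y), \<phi> y) = \<phi> y" using Q(5)[of "\<phi> y"] h\<phi> G\<phi> by simp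
      then show ?thesis using chart_inv[OF X(1) c(1) y(1)] by (simp add: s_def)
    qed
    show "smooth_map (restr (prod_space M X) N) X s"
    proof (rule smooth_mapI_rep[OF atlas_prod_restr[OF M(1) X(1)] X(1)])
      fix z assume "z \<in> pts (restr (prod_space M X) N)"
      then have z: "z \<in> N" by simp
      then show "\<exists>A \<theta> B \<zeta> L H. (A, \<theta>) \<in> charts (restr (prod_space M X) N) \<and> z \<in> A \<and> (B, \<zeta>) \<in> charts X \<and> s z \<in> B \<and>
          open L \<and> \<theta> z \<in> L \<and> Cinf_on H L \<and>
          (\<forall>y\<in>A. y \<in> pts (restr (prod_space M X) N) \<longrightarrow> \<theta> y \<in> L \<longrightarrow> s y \<in> B \<and> H (\<theta> y) = \<zeta> (s y))"
        using ch c(1) key Q(1,3)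
        by (intro exI[of _ "V \<times> U"] exI[of _ "map_prod \<psi> \<phi>"] exI[of _ U] exI[of _ \<phi>] exI[of _ Q] exI[of _ s0])
          (cases z, auto simp: N_def)
    qed (simp add: X(2))
  qed
qed

lemma tmap_restr_eq:
  assumes "atlas X h" "atlas Y k" "smooth_map X Y f" "\<And>g. g \<in> cinf X \<Longrightarrow> w g = v g"
  shows "tmap Y f w = tmap Y f v"
  using cinf_compose[OF assms(1-3)] assms(4) by (auto simp: tmap_def fun_eq_iff o_def)

lemma tmap_cong:
  assumes X: "atlas X h" and Y: "atlas Y k" and f: "smooth_map X Y f" "smooth_map X Y g"
    and v: "v \<in> tangent_space X p" "p \<in> pts X" and eq: "\<And>y. y \<in> pts X \<Longrightarrow> f y = g y"
  shows "tmap Y f v = tmap Y g v"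
proof
  fix u
  show "tmap Y f v u = tmap Y g v u"
  proof (cases "u \<in> cinf Y")
    case True
    then show ?thesis
      using tangent_cong[OF X v cinf_compose[OF X Y f(1) True] cinf_compose[OF X Y f(2) True]] eq
      by (simp add: tmap_apply)
  qed (simp add: tmap_def)
qed

text \<open>Near \<open>(p, q)\<close> the fibre product is the image of the smooth retraction
  \<open>(x, y) \<mapsto> (s (g y, x), y)\<close> of the product, with \<open>s\<close> from \<open>submersion_section\<close>.\<close>

lemma fibre_prod_tangent:
  fixes X :: "('x::t2_space, 'e::euclidean_space) space" and Y :: "('y::t2_space, 'f::euclidean_space) space"
    and M :: "('m::t2_space, 'd::euclidean_space) space"
  assumes X: "atlas X h" "pts X = UNIV" and Y: "atlas Y l" "pts Y = UNIV" and M: "atlas M k" "pts M = UNIV"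
    and f: "surjective_submersion X M f" and g: "smooth_map Y M g" and pq: "f p = g q"
    and v: "v \<in> tangent_space X p" and w: "w \<in> tangent_space Y q" and vw: "tmap M f v = tmap M g w"
  obtains u where "u \<in> tangent_space (fibre_prod X Y f g) (p, q)" "tmap X fst u = v" "tmap Y snd u = w"
proof -
  have sf: "smooth_map X M f" using f by (simp add: surjective_submersion_def)
  obtain N s where N: "open N" "(f p, p) \<in> N" and s: "smooth_map (restr (prod_space M X) N) X s"
    "\<And>m y. (m, y) \<in> N \<Longrightarrow> f (s (m, y)) = m" "\<And>y. (f y, y) \<in> N \<Longrightarrow> s (f y, y) = y"
    by (rule submersion_section[OF X M f]) (rule that)
  let ?P = "prod_space X Y" and ?R = "prod_space M X"
  have P: "atlas ?P (map_prod h l)" "pts ?P = UNIV" and R: "atlas ?R (map_prod k h)" "pts ?R = UNIV"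
    using atlas_prod X Y M by auto
  have fP: "restr ?P UNIV = ?P" and fR: "restr ?R UNIV = ?R" using restr_full P(2) R(2) by auto
  have RN: "atlas (restr ?R N) (map_prod k h)" using R by simp
  have p1: "smooth_map ?P X fst" and p2: "smooth_map ?P Y snd"
    using smooth_map_fst[OF X(1) Y(1), of UNIV] smooth_map_snd[OF X(1) Y(1), of UNIV] X(2) Y(2) by (simp_all add: fP)
  define j where "j z = (g (snd z), fst z)" for z :: "'x \<times> 'y"
  have j: "smooth_map ?P ?R j"
    unfolding j_def
    using smooth_map_Pair[OF P(1) M(1) X(1) smooth_map_compose[OF P(1) Y(1) M(1) p2 g] p1, of UNIV] by (simp add: fR)
  define L where "L = j -` N"
  have L: "open L" "(p, q) \<in> L"
    unfolding L_def using continuous_open_preimage[OF smooth_map_continuous[OF j] _ N(1)] P(2) N(2) pq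
    by (simp_all add: j_def)
  have PL: "atlas (restr ?P L) (map_prod h l)" using P by simp
  have jL: "smooth_map (restr ?P L) (restr ?R N) j"
    by (rule smooth_map_into[OF smooth_map_restr[OF j]]) (auto simp: P(2) L_def simp del: pts_prod_space)
  define u0 where "u0 = prod_tvec X Y (p, q) v w"
  have u0: "u0 \<in> tangent_space ?P (p, q)" "tmap X fst u0 = v" "tmap Y snd u0 = w"
    unfolding u0_def using prod_tvec[OF X Y, of v "(p, q)" w] v w by simp_all
  have pqP: "(p, q) \<in> pts ?P" using P(2) by simp
  obtain u1 where u1: "u1 \<in> tangent_space (restr ?P (L \<inter> pts ?P)) (p, q)" "\<And>f. f \<in> cinf ?P \<Longrightarrow> u1 f = u0 f"
    by (rule tangent_open[OF P(1) u0(1) pqP L]) (rule that)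
  have u1': "u1 \<in> tangent_space (restr ?P L) (p, q)" using u1(1) unfolding P(2) by simp
  have u1X: "tmap X fst u1 = v" and u1Y: "tmap Y snd u1 = w"
    using tmap_restr_eq[OF P(1) X(1) p1 u1(2)] tmap_restr_eq[OF P(1) Y(1) p2 u1(2)] u0 by simp_all
  let ?F = "fibre_prod X Y f g"
  have F: "?F = restr ?P {(x, y). f x = g y}" by (simp add: fibre_prod_restr X(2) Y(2))
  have Fa: "atlas ?F (map_prod h l)" using P F by simp
  define r where "r z = (s (j z), snd z)" for z :: "'x \<times> 'y"
  have sj: "smooth_map (restr ?P L) X (\<lambda>z. s (j z))" by (rule smooth_map_compose[OF PL RN X(1) jL s(1)])
  have p1L: "smooth_map (restr ?P L) X fst" and p2L: "smooth_map (restr ?P L) Y snd"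
    using smooth_map_restr[OF p1, of L] smooth_map_restr[OF p2, of L] P(2) by simp_all
  have r: "smooth_map (restr ?P L) ?F r"
    unfolding r_def F
    by (rule smooth_map_Pair[OF PL X(1) Y(1) sj p2L]) (use s(2) in \<open>auto simp: L_def j_def\<close>)
  have rpq: "r (p, q) = (p, q)" using s(3)[OF N(2)] pq by (simp add: r_def j_def)
  define u where "u = tmap ?F r u1"
  have u: "u \<in> tangent_space ?F (p, q)"
    unfolding u_def using tmap_tangent[OF PL Fa r u1'] rpq by simp
  have F1: "smooth_map ?F X fst" and F2: "smooth_map ?F Y snd"
    unfolding F using smooth_map_fst[OF X(1) Y(1)] smooth_map_snd[OF X(1) Y(1)] X(2) Y(2) by auto
  have uY: "tmap Y snd u = w"
    unfolding u_def tmap_compose[OF Fa Y(1) F2] by (simp add: r_def u1Y)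
  define K where "K = (\<lambda>x. (f x, x)) -` N"
  have i: "smooth_map X ?R (\<lambda>x. (f x, x))"
    using smooth_map_Pair[OF X(1) M(1) X(1) sf smooth_map_id[OF X(1)], of UNIV] by (simp add: fR)
  have K: "open K" "p \<in> K"
    unfolding K_def using continuous_open_preimage[OF smooth_map_continuous[OF i] _ N(1)] X(2) N(2) by simp_all
  have XK: "atlas (restr X K) h" using X by simp
  have iK: "smooth_map (restr X K) (restr ?R N) (\<lambda>x. (f x, x))"
    by (rule smooth_map_into[OF smooth_map_restr[OF i]]) (auto simp: X(2) K_def)
  obtain v1 where v1: "v1 \<in> tangent_space (restr X (K \<inter> pts X)) p" "\<And>f. f \<in> cinf X \<Longrightarrow> v1 f = v f"
    by (rule tangent_open[OF X(1) v _ K]) (auto simp: X(2) intro: that)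
  have v1': "v1 \<in> tangent_space (restr X K) p" using v1(1) X(2) by simp
  have N1: "smooth_map (restr ?R N) M fst" and N2: "smooth_map (restr ?R N) X snd"
    using smooth_map_fst[OF M(1) X(1)] smooth_map_snd[OF M(1) X(1)] X(2) M(2) by auto
  \<comment> \<open>Both vectors on M \<times> X have second component \<open>v\<close>, and the
    first components agree by the hypothesis \<open>vw\<close>. Applying \<open>s\<close> to the
    right-hand side returns \<open>v\<close>, since s (f x, x) = x.\<close>
  have eq: "tmap (restr ?R N) j u1 = tmap (restr ?R N) (\<lambda>x. (f x, x)) v1"
  proof (rule tangent_prod_unique[OF M X])
    show "(f p, p) \<in> N" by (rule N(2))
    show "tmap (restr ?R N) j u1 \<in> tangent_space (restr ?R N) (f p, p)"
      using tmap_tangent[OF PL RN jL u1'] pq by (simp add: j_def)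
    show "tmap (restr ?R N) (\<lambda>x. (f x, x)) v1 \<in> tangent_space (restr ?R N) (f p, p)"
      using tmap_tangent[OF XK RN iK v1'] by simp
    have "tmap M fst (tmap (restr ?R N) j u1) = tmap M g (tmap Y snd u1)"
      unfolding tmap_compose[OF RN M(1) N1] tmap_compose[OF Y(1) M(1) g] by (simp add: j_def)
    also have "\<dots> = tmap M f v1" using u1Y vw tmap_restr_eq[OF X(1) M(1) sf v1(2)] by simp
    finally show "tmap M fst (tmap (restr ?R N) j u1) = tmap M fst (tmap (restr ?R N) (\<lambda>x. (f x, x)) v1)"
      unfolding tmap_compose[OF RN M(1) N1] by simp
    have "tmap X (\<lambda>x. x) v1 = v"
      using tmap_restr_eq[OF X(1) X(1) smooth_map_id[OF X(1)] v1(2)] tmap_id[OF v] by simp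
    then show "tmap X snd (tmap (restr ?R N) j u1) = tmap X snd (tmap (restr ?R N) (\<lambda>x. (f x, x)) v1)"
      unfolding tmap_compose[OF RN X(1) N2] using u1X by (simp add: j_def)
  qed
  have "tmap X fst u = tmap X (\<lambda>z. s (j z)) u1"
    unfolding u_def tmap_compose[OF Fa X(1) F1] by (simp add: r_def)
  also have "\<dots> = tmap X (\<lambda>x. s (f x, x)) v1"
    using arg_cong[OF eq, of "tmap X s"] unfolding tmap_compose[OF RN X(1) s(1)] .
  also have "\<dots> = tmap X (\<lambda>x. x) v1"
    by (rule tmap_cong[OF XK X(1) smooth_map_compose[OF XK RN X(1) iK s(1)] smooth_map_restr[OF smooth_map_id[OF X(1)]] v1'])
      (use s(3) K X(2) in \<open>auto simp: K_def\<close>)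
  also have "\<dots> = v"
    using tmap_restr_eq[OF X(1) X(1) smooth_map_id[OF X(1)] v1(2)] tmap_id[OF v] by simp
  finally show thesis using that u uY by blast
qed

text \<open>At a point \<open>p\<close> the sum stops at the least \<open>j\<close> with p in
  \<open>V j\<close>. On each \<open>V j\<close> it equals the fixed sum up to \<open>j\<close>,
  because later weights vanish there, so no infinite sum occurs and smoothness is local.\<close>

lemma vf_glue:
  fixes X :: "('a::t2_space, 'e::euclidean_space) space"
  assumes X: "atlas X h" "pts X = UNIV"
    and pou: "\<And>i. b i \<in> cinf X" "\<And>i::nat. closed (C i)" "\<And>i. C i \<subseteq> N i" "\<And>i x. x \<notin> C i \<Longrightarrow> b i x = 0"
      "\<And>i. open (V i)" "\<And>x. \<exists>i. x \<in> V i" "\<And>i j x. x \<in> V j \<Longrightarrow> j < i \<Longrightarrow> b i x = 0"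
    and N: "\<And>i. open (N i)" and x: "\<And>i p. p \<in> N i \<Longrightarrow> x i p \<in> tangent_space X p"
    and xf: "\<And>i f. f \<in> cinf X \<Longrightarrow> (\<lambda>p. x i p f) \<in> cinf (restr X (N i))"
  obtains y where "y \<in> vector_fields X" "\<And>p j. p \<in> V j \<Longrightarrow> y p = (\<Sum>i\<le>j. b i p *\<^sub>R x i p)"
proof -
  define J where "J p = (LEAST j. p \<in> V j)" for p
  define y where "y p = (\<Sum>i\<le>J p. b i p *\<^sub>R x i p)" for p
  have y: "y p = (\<Sum>i\<le>j. b i p *\<^sub>R x i p)" if "p \<in> V j" for p j
    unfolding y_def
  proof (rule sum.mono_neutral_left)
    show "{..J p} \<subseteq> {..j}" unfolding J_def using Least_le[of "\<lambda>j. p \<in> V j" j, OF that] by auto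
    have "p \<in> V (J p)" unfolding J_def using LeastI_ex[OF pou(6)] .
    then show "\<forall>i\<in>{..j} - {..J p}. b i p *\<^sub>R x i p = 0" using pou(7) by auto
  qed simp
  have fX: "restr X UNIV = X" by (rule restr_full[OF X(2)])
  have ev: "(\<Sum>i\<in>I. b i p *\<^sub>R x i p) f = (\<Sum>i\<in>I. b i p * x i p f)" for I :: "nat set" and p f
    by (induction I rule: infinite_finite_induct) (simp_all add: scaleR_fun_def)
  have "y \<in> vector_fields X"
  proof (rule vector_fieldsI)
    fix p
    show "y p \<in> tangent_space X p"
      unfolding y_def
    proof (rule subspace_sum[OF subspace_tangent_space])
      fix i
      show "b i p *\<^sub>R x i p \<in> tangent_space X p"
      proof (cases "p \<in> C i")
        case True
        then show ?thesis using pou(3) by (intro subspace_scale[OF subspace_tangent_space] x) auto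
      next
        case False
        then show ?thesis using pou(4) subspace_0[OF subspace_tangent_space] by simp
      qed
    qed
  next
    fix f assume f: "f \<in> cinf X"
    have *: "(\<lambda>p. b i p * x i p f) \<in> cinf X" for i
      using cinf_extend_zero[OF X(1) N[of i], of "\<lambda>p. x i p f" UNIV "b i" "C i"] xf[OF f] pou(1,2,3,4) fX by simp
    show "(\<lambda>p. y p f) \<in> cinf X"
    proof (rule cinf_local)
      fix p
      obtain j where "p \<in> V j" using pou(6) by blast
      moreover have "y q f = (\<Sum>i\<le>j. b i q * x i q f)" if "q \<in> V j" for q
        by (simp add: y[OF that] ev)
      moreover have "(\<lambda>q. \<Sum>i\<le>j. b i q * x i q f) \<in> cinf (restr X (V j \<inter> pts X))"
        by (rule cinf_restr[OF cinf_sum[OF X(1) *]]) simp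
      ultimately show "\<exists>N g. open N \<and> p \<in> N \<and> g \<in> cinf (restr X (N \<inter> pts X)) \<and> (\<forall>q\<in>N \<inter> pts X. y q f = g q)"
        using pou(5) by (intro exI[of _ "V j"] exI[of _ "\<lambda>q. \<Sum>i\<le>j. b i q * x i q f"]) auto
    qed
  qed
  then show thesis using y that by blast
qed

section \<open>Descent and lifting along a surjective submersion\<close>

context
  fixes X :: "('x::{t2_space, second_countable_topology}, 'e::euclidean_space) space" and h
    and M :: "('m::t2_space, 'd::euclidean_space) space" and k \<pi>
  assumes X: "atlas X h" "pts X = UNIV" and M: "atlas M k" "pts M = UNIV"
    and \<pi>: "surjective_submersion X M \<pi>"
begin

lemma submersion_smooth: "smooth_map X M \<pi>" and submersion_surj: "\<exists>y. \<pi> y = m"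
  using \<pi> X(2) M(2) unfolding surjective_submersion_def by (simp, metis imageE UNIV_I)

lemma submersion_local_section:
  obtains L \<sigma> where "open L" "m \<in> L" "smooth_map (restr M L) X \<sigma>" "\<And>m. m \<in> L \<Longrightarrow> \<pi> (\<sigma> m) = m"
proof -
  obtain y0 where y0: "\<pi> y0 = m" using submersion_surj by blast
  obtain N s where N: "open N" "(\<pi> y0, y0) \<in> N" "smooth_map (restr (prod_space M X) N) X s"
    "\<And>m y. (m, y) \<in> N \<Longrightarrow> \<pi> (s (m, y)) = m"
    by (rule submersion_section[OF X M \<pi>, of y0]) (rule that)
  define L where "L = (\<lambda>m. (m, y0)) -` N"
  have R: "atlas (restr (prod_space M X) N) (map_prod k h)" using atlas_prod[OF M(1) X(1)] by simp
  have aL: "atlas (restr M L) k" using M(1) by simp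
  have "open L" unfolding L_def
    by (rule open_vimage[OF N(1)]) (intro continuous_on_Pair continuous_on_id continuous_on_const)
  moreover have "m \<in> L" using N(2) y0 by (simp add: L_def)
  moreover have "smooth_map (restr M L) X (\<lambda>m. s (m, y0))"
    by (rule smooth_map_compose[OF aL R X(1) _ N(3)],
        rule smooth_map_Pair[OF aL M(1) X(1) smooth_map_restr[OF smooth_map_id[OF M(1)]] smooth_map_const[OF aL X(1)]])
      (auto simp: L_def M(2) X(2))
  moreover have "\<pi> (s (m, y0)) = m" if "m \<in> L" for m using N(4) that by (simp add: L_def)
  ultimately show thesis by (rule that)
qed

text \<open>For a local section \<sigma>, the function \<open>f\<close> is locally the composite of
  f \<circ> \<pi> with \<sigma>.\<close>

lemma cinf_descend:
  assumes "(\<lambda>y. f (\<pi> y)) \<in> cinf X" shows "f \<in> cinf M"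
proof (rule cinf_local)
  fix m
  obtain L \<sigma> where L: "open L" "m \<in> L" "smooth_map (restr M L) X \<sigma>" "\<And>m. m \<in> L \<Longrightarrow> \<pi> (\<sigma> m) = m"
    by (rule submersion_local_section) (rule that)
  have aL: "atlas (restr M L) k" using M by simp
  have "(\<lambda>m. f (\<pi> (\<sigma> m))) \<in> cinf (restr M L)" by (rule cinf_compose[OF aL X(1) L(3) assms])
  then show "\<exists>N g. open N \<and> m \<in> N \<and> g \<in> cinf (restr M (N \<inter> pts M)) \<and> (\<forall>y\<in>N \<inter> pts M. f y = g y)"
    using L M(2) by (intro exI[of _ L] exI[of _ "\<lambda>m. f (\<pi> (\<sigma> m))"]) simp
qed

lemma vector_field_descend:
  assumes x: "x \<in> vector_fields X" and inv: "\<And>y z. \<pi> y = \<pi> z \<Longrightarrow> tmap M \<pi> (x y) = tmap M \<pi> (x z)"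
  obtains xM where "xM \<in> vector_fields M" "\<And>y. tmap M \<pi> (x y) = xM (\<pi> y)"
proof -
  define xM where "xM m = tmap M \<pi> (x (SOME y. \<pi> y = m))" for m
  have xM: "tmap M \<pi> (x y) = xM (\<pi> y)" for y
    unfolding xM_def by (rule inv) (rule someI[where P="\<lambda>z. \<pi> z = \<pi> y", OF refl, symmetric])
  have "xM \<in> vector_fields M"
  proof (rule vector_fieldsI)
    fix m
    obtain y where y: "\<pi> y = m" using submersion_surj by blast
    have "x y \<in> tangent_space X y" using vf_tangent[OF x] X(2) by simp
    from tmap_tangent[OF X(1) M(1) submersion_smooth this]
    show "xM m \<in> tangent_space M m" using xM[of y] y by simp
  next
    fix f assume f: "f \<in> cinf M"
    have "(\<lambda>y. x y (\<lambda>z. f (\<pi> z))) \<in> cinf X"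
      by (rule vf_cinf[OF x cinf_compose[OF X(1) M(1) submersion_smooth f]])
    moreover have "x y (\<lambda>z. f (\<pi> z)) = xM (\<pi> y) f" for y
      using xM[of y] tmap_apply[OF f] by metis
    ultimately show "(\<lambda>m. xM m f) \<in> cinf M" by (intro cinf_descend) simp
  qed
  then show thesis using xM that by blast
qed

text \<open>The field (z, 0) on M \<times> X is pushed forward along the parametrised section
  \<open>s\<close> at the points (\<pi> y, y); the identity \<pi> (s (m, y)) = m shows that the
  result projects to \<open>z\<close>. Local lifts are glued by a partition of unity, as the
  condition of lifting \<open>z\<close> is affine.\<close>

lemma vector_field_lift:
  assumes z: "z \<in> vector_fields M"
  obtains x where "x \<in> vector_fields X" "\<And>y. tmap M \<pi> (x y) = z (\<pi> y)"
proof -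
  have R: "atlas (prod_space M X) (map_prod k h)" "pts (prod_space M X) = UNIV"
    using atlas_prod[OF M(1) X(1)] X(2) M(2) by auto
  have fR: "restr (prod_space M X) UNIV = prod_space M X" by (rule restr_full[OF R(2)])
  have zt: "z m \<in> tangent_space M m" for m using vf_tangent[OF z] M(2) by simp
  have 0: "(0 :: 'x \<Rightarrow> 'x tvec) \<in> vector_fields X" using subspace_0[OF subspace_vector_fields[OF X(1)]] .
  define \<xi> where "\<xi> r = prod_tvec M X r (z (fst r)) 0" for r
  have \<xi>: "\<xi> \<in> vector_fields (prod_space M X)"
    using prod_vector_field[OF M X z 0] by (simp add: \<xi>_def[abs_def])
  have \<xi>t: "\<xi> r \<in> tangent_space (prod_space M X) r" "tmap M fst (\<xi> r) = z (fst r)" for r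
    unfolding \<xi>_def using prod_tvec[OF M X zt subspace_0[OF subspace_tangent_space]] by auto
  have p1: "smooth_map (prod_space M X) M fst" using smooth_map_fst[OF M(1) X(1), of UNIV] M(2) by (simp add: fR)
  have i: "smooth_map X (prod_space M X) (\<lambda>y. (\<pi> y, y))"
    using smooth_map_Pair[OF X(1) M(1) X(1) submersion_smooth smooth_map_id[OF X(1)], of UNIV] by (simp add: fR)
  have "\<exists>K x. open K \<and> y0 \<in> K \<and> (\<forall>y\<in>K. x y \<in> tangent_space X y) \<and> (\<forall>f\<in>cinf X. (\<lambda>y. x y f) \<in> cinf (restr X K)) \<and>
      (\<forall>y\<in>K. tmap M \<pi> (x y) = z (\<pi> y))" for y0
  proof -
    obtain N s where N: "open N" "(\<pi> y0, y0) \<in> N" and s: "smooth_map (restr (prod_space M X) N) X s"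
      "\<And>m y. (m, y) \<in> N \<Longrightarrow> \<pi> (s (m, y)) = m" "\<And>y. (\<pi> y, y) \<in> N \<Longrightarrow> s (\<pi> y, y) = y"
      by (rule submersion_section[OF X M \<pi>, of y0]) (rule that)
    define K where "K = (\<lambda>y. (\<pi> y, y)) -` N"
    have K: "open K" "y0 \<in> K"
      unfolding K_def using continuous_open_preimage[OF smooth_map_continuous[OF i] _ N(1)] X(2) N(2) by simp_all
    have RN: "atlas (restr (prod_space M X) N) (map_prod k h)" using R by simp
    have XK: "atlas (restr X K) h" using X by simp
    have iK: "smooth_map (restr X K) (restr (prod_space M X) N) (\<lambda>y. (\<pi> y, y))"
      by (rule smooth_map_into[OF smooth_map_restr[OF i]]) (auto simp: X(2) K_def)
    define w where "w y = trestr (prod_space M X) N (\<pi> y, y) (\<xi> (\<pi> y, y))" for y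
    have w: "w y \<in> tangent_space (restr (prod_space M X) N) (\<pi> y, y)" "f \<in> cinf (prod_space M X) \<Longrightarrow> w y f = \<xi> (\<pi> y, y) f"
      if "y \<in> K" for y f
      using trestr[OF R(1) \<xi>t(1) _ N(1), of "(\<pi> y, y)"] that R(2) by (auto simp: w_def K_def)
    define x where "x y = tmap X s (w y)" for y
    have "x y \<in> tangent_space X y" if "y \<in> K" for y
      using tmap_tangent[OF RN X(1) s(1) w(1)[OF that]] s(3)[of y] that by (simp add: x_def K_def)
    moreover have "(\<lambda>y. x y f) \<in> cinf (restr X K)" if f: "f \<in> cinf X" for f
    proof -
      have fs: "(\<lambda>r. f (s r)) \<in> cinf (restr (prod_space M X) (N \<inter> pts (prod_space M X)))"
        using cinf_compose[OF RN X(1) s(1) f] unfolding R(2) by simp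
      have "(\<lambda>r. tapp (prod_space M X) r (\<xi> r) (\<lambda>r. f (s r))) \<in> cinf (restr (prod_space M X) N)"
        using tapp_cinf[OF R(1) \<xi> N(1) fs] unfolding R(2) by simp
      from cinf_compose[OF XK RN iK this]
      show ?thesis using f fs by (simp add: x_def tmap_apply w_def trestr_def)
    qed
    moreover have "tmap M \<pi> (x y) = z (\<pi> y)" if y: "y \<in> K" for y
    proof -
      have "tmap M \<pi> (x y) = tmap M (\<lambda>r. \<pi> (s r)) (w y)"
        unfolding x_def tmap_compose[OF X(1) M(1) submersion_smooth] ..
      also have "\<dots> = tmap M fst (w y)"
        by (rule tmap_cong[OF RN M(1) smooth_map_compose[OF RN X(1) M(1) s(1) submersion_smooth] _ w(1)[OF y]])
          (use s(2) y smooth_map_restr[OF p1, of N] R(2) in \<open>auto simp: K_def\<close>)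
      also have "\<dots> = tmap M fst (\<xi> (\<pi> y, y))" by (rule tmap_restr_eq[OF R(1) M(1) p1 w(2)[OF y]])
      also have "\<dots> = z (\<pi> y)" using \<xi>t(2)[of "(\<pi> y, y)"] by simp
      finally show ?thesis .
    qed
    ultimately show ?thesis using K by blast
  qed
  then obtain K x where Kx: "\<And>y0. open (K y0) \<and> y0 \<in> K y0 \<and> (\<forall>y\<in>K y0. x y0 y \<in> tangent_space X y) \<and>
      (\<forall>f\<in>cinf X. (\<lambda>y. x y0 y f) \<in> cinf (restr X (K y0))) \<and> (\<forall>y\<in>K y0. tmap M \<pi> (x y0 y) = z (\<pi> y))"
    by metis
  have K1: "open (K y)" and K2: "y \<in> K y" and K3: "p \<in> K y \<Longrightarrow> x y p \<in> tangent_space X p"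
    and K4: "f \<in> cinf X \<Longrightarrow> (\<lambda>p. x y p f) \<in> cinf (restr X (K y))" for y p f
    using Kx[of y] by auto
  obtain c :: "nat \<Rightarrow> 'x" and b C V where pou: "\<And>i. b i \<in> cinf X" "\<And>i. closed (C i)" "\<And>i. C i \<subseteq> K (c i)"
    "\<And>i x. x \<notin> C i \<Longrightarrow> b i x = 0" "\<And>i. open (V i)" "\<And>x. \<exists>i. x \<in> V i"
    "\<And>i j x. x \<in> V j \<Longrightarrow> j < i \<Longrightarrow> b i x = 0" "\<And>j x. x \<in> V j \<Longrightarrow> (\<Sum>i\<le>j. b i x) = 1"
    by (rule partition_of_unity[OF X K1 K2]) (rule that)
  obtain y where y: "y \<in> vector_fields X" "\<And>p j. p \<in> V j \<Longrightarrow> y p = (\<Sum>i\<le>j. b i p *\<^sub>R x (c i) p)"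
    by (rule vf_glue[where b=b and C=C and N="\<lambda>i. K (c i)" and V=V and x="\<lambda>i. x (c i)",
          OF X pou(1-7) K1 K3 K4]) (assumption+, rule that)
  have "tmap M \<pi> (y p) = z (\<pi> p)" for p
  proof -
    obtain j where j: "p \<in> V j" using pou(6) by blast
    have lin: "tmap M \<pi> (\<Sum>i\<in>I. b i p *\<^sub>R x (c i) p) = (\<Sum>i\<in>I. b i p *\<^sub>R tmap M \<pi> (x (c i) p))" for I
      by (induction I rule: infinite_finite_induct)
        (simp_all only: sum.infinite sum.empty sum.insert tmap_add tmap_scaleR tmap_0 simp_thms)
    have *: "b i p *\<^sub>R tmap M \<pi> (x (c i) p) = b i p *\<^sub>R z (\<pi> p)" for i
    proof (cases "p \<in> C i")
      case True
      then have "p \<in> K (c i)" using pou(3) by blast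
      then show ?thesis using Kx[of "c i"] by simp
    qed (simp add: pou(4))
    have "tmap M \<pi> (y p) = (\<Sum>i\<le>j. b i p *\<^sub>R z (\<pi> p))"
      unfolding y(2)[OF j] lin by (rule sum.cong[OF refl *])
    also have "\<dots> = (\<Sum>i\<le>j. b i p) *\<^sub>R z (\<pi> p)" by (simp add: scaleR_sum_left)
    finally show ?thesis using pou(8)[OF j] by simp
  qed
  then show thesis using y(1) that by blast
qed

end

section \<open>Euclidean factors\<close>

lemma restr_eucl [simp]: "restr eucl UNIV = eucl"
  by (rule restr_full) simp

lemma dir_tvec_scaleR: "dir_tvec a (c *\<^sub>R e) = c *\<^sub>R dir_tvec a e"
  using linear_scale[OF has_derivative_linear[OF cinf_eucl_has_derivative]]
  by (auto simp: dir_tvec_def scaleR_fun_def fun_eq_iff)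

lemma tmap_dir_tvec:
  fixes F :: "'a::euclidean_space \<Rightarrow> 'b::euclidean_space"
  assumes F: "Cinf_on F UNIV" "(F has_derivative F') (at a)"
  shows "tmap eucl F (dir_tvec a e) = dir_tvec (F a) (F' e)"
proof
  fix f :: "'b \<Rightarrow> real"
  show "tmap eucl F (dir_tvec a e) f = dir_tvec (F a) (F' e) f"
  proof (cases "f \<in> cinf eucl")
    case True
    then have "(\<lambda>x. f (F x)) \<in> cinf eucl"
      using Cinf_on_compose[OF open_UNIV _ F(1), of f UNIV] by (simp add: cinf_eucl_iff)
    then show ?thesis
      using True frechet_derivative_at[OF has_derivative_compose[OF F(2) cinf_eucl_has_derivative[OF True]], symmetric]
      by (simp add: tmap_apply dir_tvec_def)
  qed (simp add: tmap_def dir_tvec_def)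
qed

lemma eucl_tangent:
  fixes v :: "'a::euclidean_space tvec"
  assumes v: "v \<in> tangent_space eucl a"
  shows "v = dir_tvec a (\<Sum>b\<in>Basis. v (\<lambda>y. y \<bullet> b) *\<^sub>R b)"
proof (rule tangent_eqI[OF v dir_tvec_tangent])
  fix f :: "'a \<Rightarrow> real" assume f: "f \<in> cinf eucl"
  have E: "restr eucl UNIV = (eucl :: ('a, 'a) space)" by (rule restr_full) simp
  have "v f = (\<Sum>b\<in>Basis. v (\<lambda>y. y \<bullet> b) * frechet_derivative f (at (id a)) b)"
  proof (rule tangent_expand[OF atlas_eucl, of UNIV id "\<lambda>b y. y \<bullet> b" UNIV a UNIV v f UNIV f])
    show "(\<lambda>y. y \<bullet> b) \<in> cinf (restr eucl UNIV)" for b :: 'a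
      unfolding E cinf_eucl_iff by (rule Cinf_on_bounded_linear[OF bounded_linear_inner_left])
    show "v \<in> tangent_space (restr eucl UNIV) a" "f \<in> cinf (restr eucl UNIV)" unfolding E by fact+
    show "Cinf_on f UNIV" using f by (simp add: cinf_eucl_iff)
  qed simp_all
  also have "\<dots> = frechet_derivative f (at a) (\<Sum>b\<in>Basis. v (\<lambda>y. y \<bullet> b) *\<^sub>R b)"
    using has_derivative_linear[OF cinf_eucl_has_derivative[OF f, of a]]
    by (simp add: linear_sum linear_scale)
  finally show "v f = dir_tvec a (\<Sum>b\<in>Basis. v (\<lambda>y. y \<bullet> b) *\<^sub>R b) f" using f by (simp add: dir_tvec_def)
qed

lemma has_derivative_cis: "(cis has_derivative (\<lambda>v. v *\<^sub>R (\<i> * cis x))) (at x)"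
proof -
  have "((\<lambda>x. of_real (cos x) + \<i> * of_real (sin x)) has_derivative (\<lambda>v. v *\<^sub>R (\<i> * cis x))) (at x)"
    by (auto intro!: derivative_eq_intros simp: fun_eq_iff complex_eq_iff)
  moreover have "(\<lambda>x. of_real (cos x) + \<i> * of_real (sin x)) = cis"
    by (auto simp: fun_eq_iff complex_eq_iff)
  ultimately show ?thesis by simp
qed

lemma Cinf_on_cis: "Cinf_on cis U"
proof -
  have "Ck_on k (\<lambda>x. c * cis x) UNIV" for k c
  proof (induction k arbitrary: c)
    case 0
    then show ?case by (auto intro!: continuous_intros continuous_at_imp_continuous_on has_derivative_continuous[OF has_derivative_cis])
  next
    case (Suc k)
    have "((\<lambda>x. c * cis x) has_derivative (\<lambda>v. (c * (v *\<^sub>R \<i>)) * cis x)) (at x)" for x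
      using has_derivative_mult_right[OF has_derivative_cis[of x], of c] by (simp add: algebra_simps)
    then show ?case by (rule Ck_on_SucI[OF open_UNIV]) (rule Suc)
  qed
  from this[of _ 1] show ?thesis by (auto simp: Cinf_on_def intro: Ck_on_subset)
qed

text \<open>The generator of rotations, taken on the whole plane rather than on the circle, because
  vector fields on trivialised arrows are prescribed in the ambient product.\<close>

lemma rotation_vector_field: "(\<lambda>z. dir_tvec z (\<i> * z)) \<in> vector_fields eucl"
proof (rule vector_fieldsI[OF dir_tvec_tangent])
  fix f :: "complex \<Rightarrow> real" assume f: "f \<in> cinf eucl"
  have "frechet_derivative f (at z) (\<i> * z) = (\<Sum>b\<in>Basis. ((\<i> * z) \<bullet> b) *\<^sub>R frechet_derivative f (at z) b)" for z
    by (rule linear_Basis_sum[OF has_derivative_linear[OF cinf_eucl_has_derivative[OF f]]])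
  moreover have "Cinf_on (\<lambda>z. frechet_derivative f (at z) b) UNIV" for b
    using f by (intro Cinf_on_frechet_derivative) (simp add: cinf_eucl_iff)
  then have "Cinf_on (\<lambda>z. \<Sum>b\<in>Basis. ((\<i> * z) \<bullet> b) *\<^sub>R frechet_derivative f (at z) b) UNIV"
    by (intro Cinf_on_sum Cinf_on_scaleR Cinf_on_inner Cinf_on_const open_UNIV
        Cinf_on_bounded_linear[OF bounded_linear_mult_right])
  ultimately show "(\<lambda>z. dir_tvec z (\<i> * z) f) \<in> cinf eucl"
    using f by (simp add: dir_tvec_def cinf_eucl_iff)
qed

text \<open>For a unit vector z, the vectors z and iz form an orthonormal basis of the
  plane.\<close>

lemma orthogonal_circle:
  fixes z e :: complex
  assumes "norm z = 1" "z \<bullet> e = 0"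
  shows "e = (e \<bullet> (\<i> * z)) *\<^sub>R (\<i> * z)"
proof -
  have n: "Re z * Re z + Im z * Im z = 1" using assms(1) by (simp add: cmod_def power2_eq_square)
  have o: "Re z * Re e + Im z * Im e = 0" using assms(2) by (simp add: inner_complex_def)
  have "Re e = (Re z * Re z + Im z * Im z) * Re e" "Im e = (Re z * Re z + Im z * Im z) * Im e"
    using n by simp_all
  moreover have "(Re z * Re z + Im z * Im z) * Re e = Re z * (Re z * Re e + Im z * Im e) - Im z * (Re z * Im e - Im z * Re e)"
    "(Re z * Re z + Im z * Im z) * Im e = Im z * (Re z * Re e + Im z * Im e) + Re z * (Re z * Im e - Im z * Re e)"
    by (simp_all add: algebra_simps)
  ultimately have "Re e = - Im z * (Re z * Im e - Im z * Re e)" "Im e = Re z * (Re z * Im e - Im z * Re e)"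
    unfolding o by simp_all
  then show ?thesis by (simp add: complex_eq_iff inner_complex_def algebra_simps)
qed

lemma circle_eq: "circle = restr eucl {z. norm z = 1}"
  by (simp add: circle_def)

lemma pts_circle [simp]: "pts circle = {z. norm z = 1}"
  by (simp add: circle_def)

lemma atlas_circle: "atlas circle (\<lambda>x. x)"
  by (simp add: circle_eq atlas_eucl)

section \<open>The tangent bundle of the arrows of a bundle gerbe\<close>

locale gerbe =
  fixes M :: "('m::{t2_space, second_countable_topology}, 'd::euclidean_space) space"
    and P :: "('p::{t2_space, second_countable_topology}, 'e::euclidean_space,
               'x::{t2_space, second_countable_topology}, 'f::euclidean_space) groupoid"
    and \<pi> :: "'x \<Rightarrow> 'm"
    and \<Phi> :: "'p \<Rightarrow> 'x \<times> 'x"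
    and act :: "complex \<Rightarrow> 'p \<Rightarrow> 'p"
    and \<gamma> :: "'p form"
    and B :: "'x form"
    and \<Omega> :: "'m form"
  assumes bundle_gerbe: "bundle_gerbe M P \<pi> \<Phi> act"
    and connection: "gerbe_connection P act \<gamma>"
    and curving: "curving P \<gamma> B"
    and three_curvature: "three_curvature M P \<pi> B \<Omega>"
begin

abbreviation "A \<equiv> arr P"
abbreviation "X \<equiv> obj P"
abbreviation "s \<equiv> src P"
abbreviation "t \<equiv> tgt P"

text \<open>The coordinate projections of the three manifolds are fixed once, so that they can be
  handed to the chart lemmas.\<close>

definition "hA = (SOME h. atlas A h)"
definition "hX = (SOME h. atlas X h)"
definition "hM = (SOME h. atlas M h)"

lemma groupoid: "lie_groupoid P" using bundle_gerbe by (simp add: bundle_gerbe_def)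

lemma manifolds: "manifold A" "manifold X" "manifold M"
  using bundle_gerbe unfolding bundle_gerbe_def lie_groupoid_def by auto

lemma A: "atlas A hA" "pts A = UNIV"
proof -
  obtain h where "atlas A h" by (rule manifold_imp_atlas[OF manifolds(1)])
  then show "atlas A hA" unfolding hA_def by (rule someI[where P="atlas A"])
  show "pts A = UNIV" using manifolds(1) unfolding manifold_def by (elim conjE)
qed

lemma X: "atlas X hX" "pts X = UNIV"
proof -
  obtain h where "atlas X h" by (rule manifold_imp_atlas[OF manifolds(2)])
  then show "atlas X hX" unfolding hX_def by (rule someI[where P="atlas X"])
  show "pts X = UNIV" using manifolds(2) unfolding manifold_def by (elim conjE)
qed

lemma M: "atlas M hM" "pts M = UNIV"
proof -
  obtain h where "atlas M h" by (rule manifold_imp_atlas[OF manifolds(3)])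
  then show "atlas M hM" unfolding hM_def by (rule someI[where P="atlas M"])
  show "pts M = UNIV" using manifolds(3) unfolding manifold_def by (elim conjE)
qed

lemma submersions: "surjective_submersion A X s" "surjective_submersion A X t" "surjective_submersion X M \<pi>"
  using bundle_gerbe unfolding bundle_gerbe_def lie_groupoid_def by auto

lemma smooth_src: "smooth_map A X s" and smooth_tgt: "smooth_map A X t" and smooth_\<pi>: "smooth_map X M \<pi>"
  using submersions by (auto simp: surjective_submersion_def)

lemma smooth_mul: "smooth_map (composable P) A (\<lambda>z. mul P (fst z) (snd z))"
  and smooth_unt: "smooth_map X A (unt P)" and smooth_ivs: "smooth_map A A (ivs P)"
  using groupoid unfolding lie_groupoid_def by (auto simp: case_prod_unfold)

lemma groupoid_laws:
  shows src_mul: "s p = t q \<Longrightarrow> s (mul P p q) = s q"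
    and tgt_mul: "s p = t q \<Longrightarrow> t (mul P p q) = t p"
    and src_unt: "s (unt P x) = x" and tgt_unt: "t (unt P x) = x"
    and mul_unt_left: "mul P (unt P (t p)) p = p" and mul_unt_right: "mul P p (unt P (s p)) = p"
    and src_ivs: "s (ivs P p) = t p" and tgt_ivs: "t (ivs P p) = s p"
    and mul_ivs: "mul P p (ivs P p) = unt P (t p)"
  using groupoid unfolding lie_groupoid_def by auto

lemma ivs_unt: "ivs P (unt P x) = unt P x"
  using mul_ivs[of "unt P x"] mul_unt_left[of "ivs P (unt P x)"] by (simp add: tgt_ivs src_unt tgt_unt)

abbreviation "Y \<equiv> fibre_prod X X \<pi> \<pi>"

lemma \<Phi>_morphism: "groupoid_morphism_over_id P (submersion_groupoid X \<pi>) \<Phi>"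
  and principal: "principal_circle_bundle A Y \<Phi> act"
  using bundle_gerbe by (auto simp: bundle_gerbe_def)

lemma \<Phi>_eq: "\<Phi> q = (t q, s q)"
  using \<Phi>_morphism unfolding groupoid_morphism_over_id_def submersion_groupoid_def
  by (simp add: prod_eq_iff)

lemma \<Phi>_smooth: "smooth_map A Y \<Phi>"
  using principal by (simp add: principal_circle_bundle_def)

lemma \<pi>_arrow: "\<pi> (t q) = \<pi> (s q)"
  using smooth_map_maps[OF \<Phi>_smooth, of q] A(2) by (simp add: \<Phi>_eq fibre_prod_def)

lemma act_smooth: "smooth_map (prod_space circle A) A (\<lambda>z. act (fst z) (snd z))"
  and act_one: "act 1 p = p"
  and \<Phi>_act: "norm z = 1 \<Longrightarrow> \<Phi> (act z p) = \<Phi> p"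
  using principal A(2) by (auto simp: principal_circle_bundle_def case_prod_unfold)

lemma act_mul: "norm z = 1 \<Longrightarrow> norm w = 1 \<Longrightarrow> s p = t q \<Longrightarrow>
    mul P (act z p) (act w q) = act (z * w) (mul P p q)"
  using bundle_gerbe by (simp add: bundle_gerbe_def)

lemma src_act: "norm z = 1 \<Longrightarrow> s (act z p) = s p" and tgt_act: "norm z = 1 \<Longrightarrow> t (act z p) = t p"
  using \<Phi>_act[of z p] by (simp_all add: \<Phi>_eq)

section \<open>The ambient product that contains the trivialised arrows\<close>

abbreviation "XX \<equiv> prod_space X X"
abbreviation "Z \<equiv> prod_space XX (eucl :: (complex, complex) space)"
abbreviation "hXX \<equiv> map_prod hX hX"
abbreviation "hZ \<equiv> map_prod hXX (\<lambda>x::complex. x)"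

lemma XX: "atlas XX hXX" "pts XX = UNIV"
  using atlas_prod[OF X(1) X(1)] X(2) by auto

lemma Z: "atlas Z hZ" "pts Z = UNIV"
  using atlas_prod[OF XX(1) atlas_eucl] X(2) by auto

lemma full: "restr A UNIV = A" "restr X UNIV = X" "restr XX UNIV = XX" "restr Z UNIV = Z"
  using restr_full A(2) X(2) XX(2) Z(2) by auto

lemma tangent_XX_unique:
  assumes "u \<in> tangent_space XX y" "w \<in> tangent_space XX y" "tmap X fst u = tmap X fst w" "tmap X snd u = tmap X snd w"
  shows "u = w"
  by (rule tangent_prod_unique[OF X X UNIV_I]) (use assms full in simp_all)

lemma tangent_Z_unique:
  assumes "u \<in> tangent_space Z c" "w \<in> tangent_space Z c" "tmap XX fst u = tmap XX fst w" "tmap eucl snd u = tmap eucl snd w"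
  shows "u = w"
  by (rule tangent_prod_unique[OF XX atlas_eucl pts_eucl UNIV_I]) (use assms full in simp_all)

text \<open>The range of a trivialisation over \<open>U\<close>: the part over \<open>U\<close> of
  the fibre product of X with itself, times the circle, as a subset of the manifold
  \<open>Z\<close>.\<close>

definition cyl :: "('x \<times> 'x) set \<Rightarrow> (('x \<times> 'x) \<times> complex) set"
  where "cyl U = {c. \<pi> (fst (fst c)) = \<pi> (snd (fst c)) \<and> fst c \<in> U \<and> norm (snd c) = 1}"

definition triv :: "('x \<times> 'x) set \<Rightarrow> ('p \<Rightarrow> ('x \<times> 'x) \<times> complex) \<Rightarrow> (('x \<times> 'x) \<times> complex \<Rightarrow> 'p) \<Rightarrow> bool"
  where "triv U \<tau> \<tau>' \<longleftrightarrow> open U \<and> smooth_map (restr A (\<Phi> -` U)) (restr Z (cyl U)) \<tau> \<and>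
    smooth_map (restr Z (cyl U)) (restr A (\<Phi> -` U)) \<tau>' \<and>
    (\<forall>q. \<Phi> q \<in> U \<longrightarrow> \<tau>' (\<tau> q) = q \<and> fst (\<tau> q) = \<Phi> q \<and> (\<forall>z. norm z = 1 \<longrightarrow> snd (\<tau> (act z q)) = z * snd (\<tau> q))) \<and>
    (\<forall>c\<in>cyl U. \<tau> (\<tau>' c) = c)"

lemma trivialization:
  assumes "\<pi> (fst y) = \<pi> (snd y)"
  obtains U \<tau> \<tau>' where "triv U \<tau> \<tau>'" "y \<in> U"
proof -
  have all: "\<forall>y\<in>pts Y. \<exists>U \<tau>. open U \<and> y \<in> U \<and>
       diffeo (A\<lparr>pts := {p \<in> pts A. \<Phi> p \<in> U}\<rparr>) (prod_space (Y\<lparr>pts := pts Y \<inter> U\<rparr>) circle) \<tau> \<and>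
       (\<forall>p\<in>pts A. \<Phi> p \<in> U \<longrightarrow> fst (\<tau> p) = \<Phi> p \<and>
          (\<forall>z\<in>pts circle. snd (\<tau> (act z p)) = z * snd (\<tau> p)))"
    using principal unfolding principal_circle_bundle_def by (elim conjE)
  have y: "y \<in> pts Y" using assms X(2) by (auto simp: fibre_prod_def)
  from bspec[OF all y] obtain U \<tau> where U: "open U" "y \<in> U"
    and d: "diffeo (A\<lparr>pts := {p \<in> pts A. \<Phi> p \<in> U}\<rparr>) (prod_space (Y\<lparr>pts := pts Y \<inter> U\<rparr>) circle) \<tau>"
    and \<tau>: "\<forall>p\<in>pts A. \<Phi> p \<in> U \<longrightarrow> fst (\<tau> p) = \<Phi> p \<and> (\<forall>z\<in>pts circle. snd (\<tau> (act z p)) = z * snd (\<tau> p))"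
    by (elim exE conjE) (rule that)
  have e1: "A\<lparr>pts := {p \<in> pts A. \<Phi> p \<in> U}\<rparr> = restr A (\<Phi> -` U)"
    by (rule arg_cong[where f="restr A"]) (auto simp: A(2))
  have "prod_space (Y\<lparr>pts := pts Y \<inter> U\<rparr>) circle
      = prod_space (restr XX (pts Y \<inter> U)) (restr eucl {z. norm z = 1})"
    by (simp add: fibre_prod_def circle_eq)
  also have "\<dots> = restr Z ((pts Y \<inter> U) \<times> {z. norm z = 1})" by (rule prod_space_restr)
  also have "(pts Y \<inter> U) \<times> {z. norm z = 1} = cyl U"
    by (auto simp: cyl_def fibre_prod_def X(2))
  finally have e2: "prod_space (Y\<lparr>pts := pts Y \<inter> U\<rparr>) circle = restr Z (cyl U)" .
  define \<tau>' where "\<tau>' = inv_into (\<Phi> -` U) \<tau>"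
  have d': "bij_betw \<tau> (\<Phi> -` U) (cyl U)" "smooth_map (restr A (\<Phi> -` U)) (restr Z (cyl U)) \<tau>"
    "smooth_map (restr Z (cyl U)) (restr A (\<Phi> -` U)) \<tau>'"
    using d unfolding e1 e2 diffeo_def \<tau>'_def by auto
  have "triv U \<tau> \<tau>'"
    unfolding triv_def
    using U(1) d' \<tau> A(2) bij_betw_inv_into_left[OF d'(1)] bij_betw_inv_into_right[OF d'(1)]
    by (auto simp: \<tau>'_def)
  then show thesis using U(2) that by blast
qed

lemma trivD:
  assumes "triv U \<tau> \<tau>'"
  shows triv_open: "open U" and triv_smooth: "smooth_map (restr A (\<Phi> -` U)) (restr Z (cyl U)) \<tau>"
    and triv_smooth_inv: "smooth_map (restr Z (cyl U)) (restr A (\<Phi> -` U)) \<tau>'"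
    and triv_inv: "\<Phi> q \<in> U \<Longrightarrow> \<tau>' (\<tau> q) = q" and triv_fst: "\<Phi> q \<in> U \<Longrightarrow> fst (\<tau> q) = \<Phi> q"
    and triv_act: "\<Phi> q \<in> U \<Longrightarrow> norm z = 1 \<Longrightarrow> snd (\<tau> (act z q)) = z * snd (\<tau> q)"
    and triv_inv': "c \<in> cyl U \<Longrightarrow> \<tau> (\<tau>' c) = c"
  using assms unfolding triv_def by auto

lemma open_\<Phi>: "open U \<Longrightarrow> open (\<Phi> -` U)"
  using continuous_open_preimage[OF smooth_map_continuous[OF \<Phi>_smooth]] A(2) by simp

context
  fixes U \<tau> \<tau>' assumes tr: "triv U \<tau> \<tau>'"
begin

lemma triv_cyl: "\<Phi> q \<in> U \<Longrightarrow> \<tau> q \<in> cyl U"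
  using smooth_map_maps[OF triv_smooth[OF tr], of q] by simp

lemma triv_norm: "\<Phi> q \<in> U \<Longrightarrow> norm (snd (\<tau> q)) = 1"
  using triv_cyl by (simp add: cyl_def)

lemma triv_inv_\<Phi>: "c \<in> cyl U \<Longrightarrow> \<Phi> (\<tau>' c) = fst c"
  using smooth_map_maps[OF triv_smooth_inv[OF tr], of c] triv_fst[OF tr, of "\<tau>' c"] triv_inv'[OF tr, of c] by simp

lemma triv_smooth_inv_A: "smooth_map (restr Z (cyl U)) A \<tau>'"
  using smooth_map_into[OF triv_smooth_inv[OF tr], of UNIV] full by simp

lemma atlas_cyl: "atlas (restr Z (cyl U)) hZ" and atlas_AU: "atlas (restr A (\<Phi> -` U)) hA"
  using Z(1) A(1) by simp_all

text \<open>The function f \<circ> \<tau>' lives only on the cylinder. It is extended locally to a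
  function F on \<open>Z\<close>; there \<open>w q\<close> acts as the smooth field \<xi>, and \<xi>
  (\<tau> q) F depends smoothly on \<open>q\<close>.\<close>

lemma triv_field_smooth:
  assumes \<xi>: "\<xi> \<in> vector_fields Z"
    and w: "\<And>q. \<Phi> q \<in> U \<Longrightarrow> w q \<in> tangent_space (restr Z (cyl U)) (\<tau> q)"
      "\<And>q F. \<Phi> q \<in> U \<Longrightarrow> F \<in> cinf Z \<Longrightarrow> w q F = \<xi> (\<tau> q) F"
    and f: "f \<in> cinf A"
  shows "(\<lambda>q. tmap A \<tau>' (w q) f) \<in> cinf (restr A (\<Phi> -` U))"
proof (rule cinf_local)
  fix q assume "q \<in> pts (restr A (\<Phi> -` U))"
  then have q: "\<Phi> q \<in> U" by simp
  have f': "(\<lambda>c. f (\<tau>' c)) \<in> cinf (restr Z (cyl U))" by (rule cinf_compose[OF atlas_cyl A(1) triv_smooth_inv_A f])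
  obtain F V where F: "F \<in> cinf (restr (restr Z (cyl U)) UNIV)" "open V" "\<tau> q \<in> V"
    "\<And>c. c \<in> V \<Longrightarrow> c \<in> pts (restr Z (cyl U)) \<Longrightarrow> F c = f (\<tau>' c)"
    by (rule cinf_extend_ambient[OF atlas_cyl f', of "\<tau> q"]) (use triv_cyl[OF q] in \<open>auto intro: that\<close>)
  have FZ: "F \<in> cinf Z" using F(1) full by simp
  have FU: "F \<in> cinf (restr Z (cyl U))" using cinf_restr[OF FZ, of "cyl U"] Z(2) by simp
  let ?N = "\<Phi> -` U \<inter> \<tau> -` V"
  have "open ?N"
    using continuous_open_preimage[OF smooth_map_continuous[OF triv_smooth[OF tr]] _ F(2)] open_\<Phi>[OF triv_open[OF tr]] by simp
  moreover have "tmap A \<tau>' (w q) f = \<xi> (\<tau> q) F" if "q \<in> ?N" for q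
  proof -
    have qU: "\<Phi> q \<in> U" using that by simp
    have "w q (\<lambda>c. f (\<tau>' c)) = w q F"
      by (rule tangent_local[OF atlas_cyl w(1)[OF qU] _ f' FU F(2)]) (use that F(4) triv_cyl[OF qU] in auto)
    then show ?thesis using w(2)[OF qU FZ] f by (simp add: tmap_apply)
  qed
  moreover have "(\<lambda>q. \<xi> (\<tau> q) F) \<in> cinf (restr A (\<Phi> -` U))"
    using cinf_compose[OF atlas_AU atlas_cyl triv_smooth[OF tr]] cinf_restr[OF vf_cinf[OF \<xi> FZ], of "cyl U"] Z(2) by simp
  ultimately show "\<exists>N g. open N \<and> q \<in> N \<and> g \<in> cinf (restr (restr A (\<Phi> -` U)) (N \<inter> pts (restr A (\<Phi> -` U)))) \<and>
      (\<forall>y\<in>N \<inter> pts (restr A (\<Phi> -` U)). tmap A \<tau>' (w y) f = g y)"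
    using q F(3) cinf_subset[where X=A and S="\<Phi> -` U" and T="?N \<inter> \<Phi> -` U"]
    by (intro exI[of _ ?N] exI[of _ "\<lambda>q. \<xi> (\<tau> q) F"]) simp
qed

end

lemma p1XX: "smooth_map XX X fst" and p2XX: "smooth_map XX X snd"
  using smooth_map_fst[OF X(1) X(1), of UNIV] smooth_map_snd[OF X(1) X(1), of UNIV] X(2) by (simp_all add: full)

lemma p1Z: "smooth_map Z XX fst" and p2Z: "smooth_map Z eucl snd"
  using smooth_map_fst[OF XX(1) atlas_eucl[where 'a=complex], of UNIV]
    smooth_map_snd[OF XX(1) atlas_eucl[where 'a=complex], of UNIV] XX(2) by (simp_all add: full)

lemma p1ZS: "smooth_map (restr Z S) XX fst" and p2ZS: "smooth_map (restr Z S) eucl snd"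
  using smooth_map_restr[OF p1Z, of S] smooth_map_restr[OF p2Z, of S] Z(2) by simp_all

section \<open>The generator of the circle action\<close>

definition orbit :: "'p \<Rightarrow> real \<Rightarrow> 'p" where "orbit q \<theta> = act (cis \<theta>) q"

lemma smooth_orbit: "smooth_map eucl A (orbit q)"
proof -
  have c: "smooth_map eucl circle cis"
    unfolding circle_eq
    by (rule smooth_map_into) (use smooth_map_eucl[OF open_UNIV Cinf_on_cis] in auto)
  have pc: "restr (prod_space circle A) ({z. norm z = 1} \<times> UNIV) = prod_space circle A"
    using restr_pts[of "prod_space circle A"] A(2) by simp
  have "smooth_map eucl (prod_space circle A) (\<lambda>\<theta>. (cis \<theta>, q))"
    using smooth_map_Pair[OF atlas_eucl atlas_circle A(1) c smooth_map_const[OF atlas_eucl A(1)],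
        of q "{z. norm z = 1} \<times> UNIV"] A(2) unfolding pc by simp
  from smooth_map_compose[OF atlas_eucl atlas_prod[OF atlas_circle A(1)] A(1) this act_smooth]
  show ?thesis by (simp add: orbit_def[abs_def])
qed

definition gen :: "'p \<Rightarrow> 'p tvec" where "gen = circle_generator A act"

text \<open>Turns the ordinary derivative in \<open>circle_generator\<close> into a push-forward
  along the orbit, to which the rules for \<open>tmap\<close> apply.\<close>

lemma gen_eq: "gen q = tmap A (orbit q) (dir_tvec 0 1)"
proof
  fix f
  show "gen q f = tmap A (orbit q) (dir_tvec 0 1) f"
  proof (cases "f \<in> cinf A")
    case True
    then have f: "(\<lambda>\<theta>. f (orbit q \<theta>)) \<in> cinf eucl" using cinf_compose[OF atlas_eucl A(1) smooth_orbit] by simp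
    let ?D = "frechet_derivative (\<lambda>\<theta>. f (orbit q \<theta>)) (at 0)"
    have d: "((\<lambda>\<theta>. f (orbit q \<theta>)) has_derivative ?D) (at 0)" by (rule cinf_eucl_has_derivative[OF f])
    have "?D v = ?D 1 * v" for v using linear_scale[OF has_derivative_linear[OF d], of v 1] by simp
    then have "((\<lambda>\<theta>. f (orbit q \<theta>)) has_field_derivative ?D 1) (at 0)"
      using d by (metis has_derivative_imp_has_field_derivative mult.commute)
    then have "deriv (\<lambda>\<theta>. f (orbit q \<theta>)) 0 = ?D 1" by (rule DERIV_imp_deriv)
    then show ?thesis using True f by (simp add: gen_def circle_generator_def tmap_apply dir_tvec_def orbit_def)
  qed (simp add: gen_def circle_generator_def tmap_def)
qed

lemma gen_tangent: "gen q \<in> tangent_space A q"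
  using tmap_tangent[OF atlas_eucl A(1) smooth_orbit dir_tvec_tangent, of q 0 1] by (simp add: gen_eq orbit_def act_one)

lemma tmap_src_gen: "tmap X s (gen q) = 0" and tmap_tgt_gen: "tmap X t (gen q) = 0"
  using tmap_const[OF atlas_eucl dir_tvec_tangent]
  by (simp_all add: gen_eq tmap_compose[OF A(1) X(1) smooth_src] tmap_compose[OF A(1) X(1) smooth_tgt]
      orbit_def src_act tgt_act)

text \<open>The generator in trivialised form: no motion in X \<times> X and rotation in the fibre.
  It is defined on all of \<open>Z\<close> and is the same for every trivialisation.\<close>

definition "rot c = prod_tvec XX eucl c 0 (dir_tvec (snd c) (\<i> * snd c))"

lemma rot_field: "rot \<in> vector_fields Z"
  using prod_vector_field[OF XX atlas_eucl pts_eucl subspace_0[OF subspace_vector_fields[OF XX(1)]] rotation_vector_field]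
  by (simp add: rot_def[abs_def])

context
  fixes U \<tau> \<tau>' q assumes tr: "triv U \<tau> \<tau>'" and q: "\<Phi> q \<in> U"
begin

definition "gen_triv = tmap (restr Z (cyl U)) (\<lambda>\<theta>. \<tau> (orbit q \<theta>)) (dir_tvec 0 1)"

lemma orbit_smooth_U: "smooth_map eucl (restr A (\<Phi> -` U)) (orbit q)"
  by (rule smooth_map_into[OF smooth_orbit]) (use q \<Phi>_act in \<open>auto simp: orbit_def\<close>)

lemma orbit_triv: "\<tau> (orbit q \<theta>) = (\<Phi> q, cis \<theta> * snd (\<tau> q))"
proof -
  have "\<Phi> (orbit q \<theta>) = \<Phi> q" by (simp add: orbit_def \<Phi>_act)
  then have "fst (\<tau> (orbit q \<theta>)) = \<Phi> q" using triv_fst[OF tr, of "orbit q \<theta>"] q by simp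
  moreover have "snd (\<tau> (orbit q \<theta>)) = cis \<theta> * snd (\<tau> q)"
    using triv_act[OF tr q, of "cis \<theta>"] by (simp add: orbit_def)
  ultimately show ?thesis by (simp add: prod_eq_iff)
qed

lemma gen_triv:
  shows "gen_triv \<in> tangent_space (restr Z (cyl U)) (\<tau> q)"
    and "tmap XX fst gen_triv = 0" and "tmap eucl snd gen_triv = dir_tvec (snd (\<tau> q)) (\<i> * snd (\<tau> q))"
    and "tmap A \<tau>' gen_triv = gen q" and "F \<in> cinf Z \<Longrightarrow> gen_triv F = rot (\<tau> q) F"
proof -
  have sm: "smooth_map eucl (restr Z (cyl U)) (\<lambda>\<theta>. \<tau> (orbit q \<theta>))"
    by (rule smooth_map_compose[OF atlas_eucl atlas_AU[OF tr] atlas_cyl[OF tr] orbit_smooth_U triv_smooth[OF tr]])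
  show 1: "gen_triv \<in> tangent_space (restr Z (cyl U)) (\<tau> q)"
    using tmap_tangent[OF atlas_eucl atlas_cyl[OF tr] sm dir_tvec_tangent, of 0 1]
    by (simp add: gen_triv_def orbit_def act_one)
  show 2: "tmap XX fst gen_triv = 0"
    unfolding gen_triv_def tmap_compose[OF atlas_cyl[OF tr] XX(1) p1ZS]
    using tmap_const[OF atlas_eucl dir_tvec_tangent] by (simp add: orbit_triv)
  have "((\<lambda>\<theta>. cis \<theta> * snd (\<tau> q)) has_derivative (\<lambda>v. v *\<^sub>R (\<i> * cis 0) * snd (\<tau> q))) (at 0)"
    by (rule has_derivative_mult_left[OF has_derivative_cis])
  from tmap_dir_tvec[OF Cinf_on_mult[OF open_UNIV Cinf_on_cis Cinf_on_const] this, of 1]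
  show 3: "tmap eucl snd gen_triv = dir_tvec (snd (\<tau> q)) (\<i> * snd (\<tau> q))"
    unfolding gen_triv_def tmap_compose[OF atlas_cyl[OF tr] atlas_eucl p2ZS] by (simp add: orbit_triv)
  show "tmap A \<tau>' gen_triv = gen q"
  proof -
    have "\<tau>' (\<tau> (orbit q \<theta>)) = orbit q \<theta>" for \<theta>
      using triv_inv[OF tr, of "orbit q \<theta>"] q by (simp add: orbit_def \<Phi>_act)
    then show ?thesis
      unfolding gen_triv_def tmap_compose[OF atlas_cyl[OF tr] A(1) triv_smooth_inv_A[OF tr]] by (simp add: gen_eq)
  qed
  have i: "smooth_map (restr Z (cyl U)) Z (\<lambda>c. c)"
    using smooth_map_restr[OF smooth_map_id[OF Z(1)], of "cyl U"] Z(2) by simp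
  note r = prod_tvec[OF XX atlas_eucl pts_eucl subspace_0[OF subspace_tangent_space] dir_tvec_tangent,
      of "\<tau> q" "\<i> * snd (\<tau> q)", folded rot_def]
  have "tmap Z (\<lambda>c. c) gen_triv = rot (\<tau> q)"
  proof (rule tangent_Z_unique)
    show "tmap Z (\<lambda>c. c) gen_triv \<in> tangent_space Z (\<tau> q)"
      by (rule tmap_tangent[OF atlas_cyl[OF tr] Z(1) i 1])
    show "rot (\<tau> q) \<in> tangent_space Z (\<tau> q)" by (rule r(1))
    show "tmap XX fst (tmap Z (\<lambda>c. c) gen_triv) = tmap XX fst (rot (\<tau> q))"
      unfolding tmap_compose[OF Z(1) XX(1) p1Z] r(2) by (rule 2)
    show "tmap eucl snd (tmap Z (\<lambda>c. c) gen_triv) = tmap eucl snd (rot (\<tau> q))"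
      unfolding tmap_compose[OF Z(1) atlas_eucl p2Z] r(3) by (rule 3)
  qed
  then show "gen_triv F = rot (\<tau> q) F" if "F \<in> cinf Z"
    using tmap_apply[OF that, of "\<lambda>c. c" gen_triv] by simp
qed

text \<open>The fibre coordinate of a vertical vector is tangent to the circle, hence a multiple of
  \<open>\<i> z\<close>, the fibre coordinate of the generator.\<close>

lemma vertical_multiple:
  assumes v: "v \<in> tangent_space A q" and vert: "tmap X t v = 0" "tmap X s v = 0"
  shows "\<exists>c. v = c *\<^sub>R gen q"
proof -
  let ?C = "restr Z (cyl U)" and ?AU = "restr A (\<Phi> -` U)"
  note aC = atlas_cyl[OF tr] and aU = atlas_AU[OF tr]
  obtain v1 where v1: "v1 \<in> tangent_space (restr A (\<Phi> -` U \<inter> pts A)) q" "\<And>f. f \<in> cinf A \<Longrightarrow> v1 f = v f"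
    by (rule tangent_open[OF A(1) v _ open_\<Phi>[OF triv_open[OF tr]]]) (use q A(2) in \<open>auto intro: that\<close>)
  have v1': "v1 \<in> tangent_space ?AU q" using v1(1) A(2) by simp
  define u where "u = tmap ?C \<tau> v1"
  have u: "u \<in> tangent_space ?C (\<tau> q)" unfolding u_def by (rule tmap_tangent[OF aU aC triv_smooth[OF tr] v1'])
  have sU: "smooth_map ?AU X s" and tU: "smooth_map ?AU X t"
    using smooth_map_restr[OF smooth_src, of "\<Phi> -` U"] smooth_map_restr[OF smooth_tgt, of "\<Phi> -` U"] A(2) by simp_all
  have ff: "smooth_map ?C X (\<lambda>c. fst (fst c))" and sf: "smooth_map ?C X (\<lambda>c. snd (fst c))"
    using smooth_map_compose[OF aC XX(1) X(1) p1ZS p1XX] smooth_map_compose[OF aC XX(1) X(1) p1ZS p2XX] .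
  have fst0: "tmap XX fst u = 0"
  proof (rule tangent_XX_unique)
    show "tmap XX fst u \<in> tangent_space XX (fst (\<tau> q))" by (rule tmap_tangent[OF aC XX(1) p1ZS u])
    show "0 \<in> tangent_space XX (fst (\<tau> q))" by (rule subspace_0[OF subspace_tangent_space])
    have "tmap X fst (tmap XX fst u) = tmap X (\<lambda>q. fst (fst (\<tau> q))) v1"
      unfolding tmap_compose[OF XX(1) X(1) p1XX] u_def tmap_compose[OF aC X(1) ff] ..
    also have "\<dots> = tmap X t v1"
      by (rule tmap_cong[OF aU X(1) smooth_map_compose[OF aU aC X(1) triv_smooth[OF tr] ff] tU v1'])
        (use q triv_fst[OF tr] in \<open>auto simp: \<Phi>_eq\<close>)
    also have "\<dots> = 0" using tmap_restr_eq[OF A(1) X(1) smooth_tgt v1(2)] vert by simp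
    finally show "tmap X fst (tmap XX fst u) = tmap X fst 0" by (simp only: tmap_0)
    have "tmap X snd (tmap XX fst u) = tmap X (\<lambda>q. snd (fst (\<tau> q))) v1"
      unfolding tmap_compose[OF XX(1) X(1) p2XX] u_def tmap_compose[OF aC X(1) sf] ..
    also have "\<dots> = tmap X s v1"
      by (rule tmap_cong[OF aU X(1) smooth_map_compose[OF aU aC X(1) triv_smooth[OF tr] sf] sU v1'])
        (use q triv_fst[OF tr] in \<open>auto simp: \<Phi>_eq\<close>)
    also have "\<dots> = 0" using tmap_restr_eq[OF A(1) X(1) smooth_src v1(2)] vert by simp
    finally show "tmap X snd (tmap XX fst u) = tmap X snd 0" by (simp only: tmap_0)
  qed
  define z where "z = snd (\<tau> q)"
  have nz: "norm z = 1" using triv_norm[OF tr q] by (simp add: z_def)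
  have u3: "tmap eucl snd u \<in> tangent_space eucl z" unfolding z_def by (rule tmap_tangent[OF aC atlas_eucl p2ZS u])
  obtain e where e: "tmap eucl snd u = dir_tvec z e" using eucl_tangent[OF u3] by blast
  have sq: "(\<lambda>y::complex. y \<bullet> y) \<in> cinf eucl"
    unfolding cinf_eucl_iff by (intro Cinf_on_inner open_UNIV Cinf_on_bounded_linear bounded_linear_ident)
  \<comment> \<open>The squared norm of the fibre coordinate is constant on the cylinder, so
    \<open>u\<close> annihilates it; its derivative at z in the direction e is twice the inner
    product.\<close>
  have "z \<bullet> e = 0"
  proof -
    have "((\<lambda>y. y \<bullet> y) has_derivative (\<lambda>v. z \<bullet> v + v \<bullet> z)) (at z)"
      by (rule has_derivative_inner[OF has_derivative_ident has_derivative_ident])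
    from frechet_derivative_at[OF this, symmetric]
    have "tmap eucl snd u (\<lambda>y. y \<bullet> y) = 2 * (z \<bullet> e)"
      unfolding e using sq by (simp add: dir_tvec_def inner_commute)
    moreover have "u (\<lambda>c. snd c \<bullet> snd c) = u (\<lambda>c. 1)"
      by (rule tangent_cong[OF aC u _ cinf_compose[OF aC atlas_eucl p2ZS sq] cinf_const[OF aC]])
        (use triv_cyl[OF tr q] in \<open>auto simp: cyl_def simp flip: power2_norm_eq_inner\<close>)
    ultimately show ?thesis using tangent_const[OF aC u] sq by (simp add: tmap_apply)
  qed
  from orthogonal_circle[OF nz this] obtain c where c: "e = c *\<^sub>R (\<i> * z)" by blast
  have "u = c *\<^sub>R gen_triv"
  proof (rule tangent_prod_unique[OF XX atlas_eucl pts_eucl triv_cyl[OF tr q] u])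
    show "c *\<^sub>R gen_triv \<in> tangent_space ?C (\<tau> q)" by (rule subspace_scale[OF subspace_tangent_space gen_triv(1)])
    show "tmap XX fst u = tmap XX fst (c *\<^sub>R gen_triv)" by (simp only: fst0 tmap_scaleR gen_triv(2) scaleR_zero_right)
    show "tmap eucl snd u = tmap eucl snd (c *\<^sub>R gen_triv)"
      by (simp add: e c tmap_scaleR gen_triv(3) dir_tvec_scaleR flip: z_def)
  qed
  then have "tmap A \<tau>' u = c *\<^sub>R gen q" by (simp add: tmap_scaleR gen_triv(4))
  moreover have "tmap A \<tau>' u = v"
  proof -
    have iU: "smooth_map ?AU A (\<lambda>q. q)" using smooth_map_restr[OF smooth_map_id[OF A(1)], of "\<Phi> -` U"] A(2) by simp
    have "tmap A \<tau>' u = tmap A (\<lambda>q. \<tau>' (\<tau> q)) v1"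
      unfolding u_def tmap_compose[OF aC A(1) triv_smooth_inv_A[OF tr]] ..
    also have "\<dots> = tmap A (\<lambda>q. q) v1"
      by (rule tmap_cong[OF aU A(1) smooth_map_compose[OF aU aC A(1) triv_smooth[OF tr] triv_smooth_inv_A[OF tr]] iU v1'])
        (use q triv_inv[OF tr] in auto)
    also have "\<dots> = tmap A (\<lambda>q. q) v" by (rule tmap_restr_eq[OF A(1) A(1) smooth_map_id[OF A(1)] v1(2)])
    also have "\<dots> = v" by (rule tmap_id[OF v])
    finally show ?thesis .
  qed
  ultimately show ?thesis by auto
qed

end

lemma triv_at: obtains U \<tau> \<tau>' where "triv U \<tau> \<tau>'" "\<Phi> q \<in> U"
  using trivialization[of "\<Phi> q"] \<pi>_arrow[of q] \<Phi>_eq by (metis fst_conv snd_conv)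

lemma gen_field: "gen \<in> vector_fields A"
proof (rule vector_fieldsI[OF gen_tangent])
  fix f assume f: "f \<in> cinf A"
  show "(\<lambda>q. gen q f) \<in> cinf A"
  proof (rule cinf_local)
    fix q0
    obtain U \<tau> \<tau>' where tr: "triv U \<tau> \<tau>'" and q0: "\<Phi> q0 \<in> U" by (rule triv_at)
    have "(\<lambda>q. tmap A \<tau>' (gen_triv U \<tau> q) f) \<in> cinf (restr A (\<Phi> -` U))"
      by (rule triv_field_smooth[OF tr rot_field gen_triv(1)[OF tr] gen_triv(5)[OF tr] f])
    then show "\<exists>N g. open N \<and> q0 \<in> N \<and> g \<in> cinf (restr A (N \<inter> pts A)) \<and> (\<forall>q\<in>N \<inter> pts A. gen q f = g q)"
      using q0 open_\<Phi>[OF triv_open[OF tr]] gen_triv(4)[OF tr] A(2)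
      by (intro exI[of _ "\<Phi> -` U"] exI[of _ "\<lambda>q. tmap A \<tau>' (gen_triv U \<tau> q) f"]) simp
  qed
qed

section \<open>Values of the connection on tangent vectors\<close>

lemma \<gamma>_forms: "\<gamma> \<in> forms A 1" and \<gamma>_gen: "\<gamma> q [gen q] = 1"
  using connection A(2) by (auto simp: gerbe_connection_def principal_connection_def gen_def)

lemma \<gamma>_lin:
  assumes "v \<in> tangent_space A q" "w \<in> tangent_space A q"
  shows "\<gamma> q [a *\<^sub>R v + b *\<^sub>R w] = a * \<gamma> q [v] + b * \<gamma> q [w]"
proof -
  have "\<forall>p\<in>pts A. \<forall>vs. length vs = 1 \<and> set vs \<subseteq> tangent_space A p \<longrightarrow>
       (\<forall>i<1. \<forall>v\<in>tangent_space A p. \<forall>w\<in>tangent_space A p. \<forall>a b.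
          \<gamma> p (vs[i := a *\<^sub>R v + b *\<^sub>R w]) = a * \<gamma> p (vs[i := v]) + b * \<gamma> p (vs[i := w])) \<and>
       (\<not> distinct vs \<longrightarrow> \<gamma> p vs = 0)"
    using \<gamma>_forms unfolding forms_def mem_Collect_eq by (elim conjE)
  from bspec[OF this, of q, rule_format, of "[v]"] assms A(2) show ?thesis by simp
qed

lemma \<gamma>_add: "v \<in> tangent_space A q \<Longrightarrow> w \<in> tangent_space A q \<Longrightarrow> \<gamma> q [v + w] = \<gamma> q [v] + \<gamma> q [w]"
  and \<gamma>_scale: "v \<in> tangent_space A q \<Longrightarrow> \<gamma> q [a *\<^sub>R v] = a * \<gamma> q [v]"
  using \<gamma>_lin[of v q w 1 1] \<gamma>_lin[of v q v a 0] by (simp_all only: scaleR_one scaleR_zero_left mult_1 mult_zero_left add_0_right)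

lemma \<gamma>_0: "\<gamma> q [0] = 0"
  using \<gamma>_scale[OF gen_tangent, of q 0] by (simp only: scaleR_zero_left mult_zero_left)

lemma \<gamma>_diff: "v \<in> tangent_space A q \<Longrightarrow> w \<in> tangent_space A q \<Longrightarrow> \<gamma> q [v - w] = \<gamma> q [v] - \<gamma> q [w]"
  using \<gamma>_lin[of v q w 1 "-1"] by (simp only: scaleR_one scaleR_minus_left mult_1 add_uminus_conv_diff mult_minus_left)

lemma \<gamma>_cinf: "x \<in> vector_fields A \<Longrightarrow> (\<lambda>q. \<gamma> q [x q]) \<in> cinf A"
proof -
  assume x: "x \<in> vector_fields A"
  have "\<forall>xs. length xs = 1 \<and> set xs \<subseteq> vector_fields A \<longrightarrow> (\<lambda>p. \<gamma> p (map (\<lambda>x. x p) xs)) \<in> cinf A"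
    using \<gamma>_forms unfolding forms_def mem_Collect_eq by (elim conjE)
  from spec[OF this, of "[x]"] x show ?thesis by simp
qed

text \<open>The difference is killed by both projections, hence equals \<open>c\<close> times the
  generator, and \<open>c\<close> is its value under \<gamma>.\<close>

lemma tangent_unique:
  assumes v: "v \<in> tangent_space A q" and w: "w \<in> tangent_space A q"
    and eq: "tmap X t v = tmap X t w" "tmap X s v = tmap X s w" "\<gamma> q [v] = \<gamma> q [w]"
  shows "v = w"
proof -
  obtain U \<tau> \<tau>' where tr: "triv U \<tau> \<tau>'" and q: "\<Phi> q \<in> U" by (rule triv_at)
  have d: "v - w \<in> tangent_space A q" by (rule subspace_diff[OF subspace_tangent_space v w])
  have "tmap X t (v - w) = 0" "tmap X s (v - w) = 0" using eq by (simp_all only: tmap_diff diff_self)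
  from vertical_multiple[OF tr q d this] obtain c where c: "v - w = c *\<^sub>R gen q" by blast
  have "c = \<gamma> q [v - w]" unfolding c \<gamma>_scale[OF gen_tangent] \<gamma>_gen by simp
  also have "\<dots> = 0" using \<gamma>_diff[OF v w] eq(3) by simp
  finally have "v - w = 0" using c by (simp only: scaleR_zero_left)
  then show ?thesis by (simp only: right_minus_eq)
qed

text \<open>The inverse trivialisation at ((y1, y2), 1) is such an arrow. This is how conditions on
  all arrows become conditions on the fibres of \<pi>.\<close>

lemma \<pi>_connected: "\<pi> y1 = \<pi> y2 \<Longrightarrow> \<exists>q. t q = y1 \<and> s q = y2"
proof -
  assume "\<pi> y1 = \<pi> y2"
  then obtain U \<tau> \<tau>' where tr: "triv U \<tau> \<tau>'" "(y1, y2) \<in> U"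
    using trivialization[of "(y1, y2)"] by auto
  then have "((y1, y2), 1) \<in> cyl U" using \<open>\<pi> y1 = \<pi> y2\<close> by (simp add: cyl_def)
  from triv_inv_\<Phi>[OF tr(1) this] show ?thesis by (intro exI[of _ "\<tau>' ((y1, y2), 1)"]) (simp add: \<Phi>_eq)
qed

lemma fibre_transitive:
  assumes "\<Phi> q = \<Phi> q'"
  obtains z where "norm z = 1" "q' = act z q"
proof -
  obtain U \<tau> \<tau>' where tr: "triv U \<tau> \<tau>'" and q: "\<Phi> q \<in> U" by (rule triv_at)
  define z where "z = snd (\<tau> q') / snd (\<tau> q)"
  have n: "norm (snd (\<tau> q)) = 1" "norm (snd (\<tau> q')) = 1" using triv_norm[OF tr] q assms by auto
  then have z: "norm z = 1" by (simp add: z_def norm_divide)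
  have q2: "\<Phi> q' \<in> U" "\<Phi> (act z q) \<in> U" using q assms \<Phi>_act[OF z] by auto
  have "\<tau> (act z q) = \<tau> q'"
  proof (rule prod_eqI)
    show "fst (\<tau> (act z q)) = fst (\<tau> q')" using triv_fst[OF tr] q2 \<Phi>_act[OF z] assms by simp
    have "snd (\<tau> q) \<noteq> 0" using n by auto
    then show "snd (\<tau> (act z q)) = snd (\<tau> q')" using triv_act[OF tr q z] by (simp add: z_def)
  qed
  then have "act z q = q'" using triv_inv[OF tr q2(1)] triv_inv[OF tr q2(2)] by simp
  then show thesis using z that by blast
qed

section \<open>Vector fields on the arrows\<close>

text \<open>Says that the pair (x1, x2) is tangent to the fibre product of X with itself, which is
  what lifting the pair to P requires.\<close>

definition pcompat :: "('x \<Rightarrow> 'x tvec) \<Rightarrow> ('x \<Rightarrow> 'x tvec) \<Rightarrow> bool"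
  where "pcompat x1 x2 \<longleftrightarrow> (\<forall>y1 y2. \<pi> y1 = \<pi> y2 \<longrightarrow> tmap M \<pi> (x1 y1) = tmap M \<pi> (x2 y2))"

text \<open>In a trivialisation the vector (x1, x2, 0) is taken. It is a vector of \<open>Z\<close>;
  that it comes from the cylinder is shown pointwise with \<open>fibre_prod_tangent\<close>, by
  sliding a vector of the fibre product along at fixed fibre coordinate. Smoothness needs only the
  field on \<open>Z\<close>, by \<open>triv_field_smooth\<close>.\<close>

lemma local_field:
  assumes x: "x1 \<in> vector_fields X" "x2 \<in> vector_fields X" and comp: "pcompat x1 x2"
  obtains N v where "open N" "q0 \<in> N" "\<And>q. q \<in> N \<Longrightarrow> v q \<in> tangent_space A q"
    "\<And>q. q \<in> N \<Longrightarrow> tmap X t (v q) = x1 (t q)" "\<And>q. q \<in> N \<Longrightarrow> tmap X s (v q) = x2 (s q)"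
    "\<And>f. f \<in> cinf A \<Longrightarrow> (\<lambda>q. v q f) \<in> cinf (restr A N)"
proof -
  obtain U \<tau> \<tau>' where tr: "triv U \<tau> \<tau>'" and q0: "\<Phi> q0 \<in> U" by (rule triv_at)
  note aC = atlas_cyl[OF tr]
  define \<eta> where "\<eta> y = prod_tvec X X y (x1 (fst y)) (x2 (snd y))" for y
  define \<xi> where "\<xi> c = prod_tvec XX eucl c (\<eta> (fst c)) 0" for c :: "('x \<times> 'x) \<times> complex"
  have \<eta>F: "\<eta> \<in> vector_fields XX" using prod_vector_field[OF X X x] by (simp add: \<eta>_def[abs_def])
  have \<xi>F: "\<xi> \<in> vector_fields Z"
    using prod_vector_field[OF XX atlas_eucl pts_eucl \<eta>F subspace_0[OF subspace_vector_fields[OF atlas_eucl]]]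
    by (simp add: \<xi>_def[abs_def])
  have xt: "x1 y \<in> tangent_space X y" "x2 y \<in> tangent_space X y" for y
    using vf_tangent[OF x(1)] vf_tangent[OF x(2)] X(2) by auto
  note \<eta> = prod_tvec[OF X X xt(1) xt(2), folded \<eta>_def]
  have \<eta>t: "\<eta> y \<in> tangent_space XX y" for y using vf_tangent[OF \<eta>F] XX(2) by simp
  have \<xi>t: "\<xi> c \<in> tangent_space Z c" for c using vf_tangent[OF \<xi>F] Z(2) by simp
  have \<xi>: "tmap XX fst (\<xi> c) = \<eta> (fst c)" "tmap eucl snd (\<xi> c) = 0" for c
    unfolding \<xi>_def using prod_tvec[OF XX atlas_eucl pts_eucl \<eta>t subspace_0[OF subspace_tangent_space]] by blast+
  have ex: "\<exists>w. w \<in> tangent_space (restr Z (cyl U)) (\<tau> q) \<and> (\<forall>F\<in>cinf Z. w F = \<xi> (\<tau> q) F)" if q: "\<Phi> q \<in> U" for q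
  proof -
    have eq: "tmap M \<pi> (x1 (t q)) = tmap M \<pi> (x2 (s q))" using comp \<pi>_arrow unfolding pcompat_def by blast
    obtain u where u: "u \<in> tangent_space Y (t q, s q)" "tmap X fst u = x1 (t q)" "tmap X snd u = x2 (s q)"
      by (rule fibre_prod_tangent[OF X X M submersions(3) smooth_\<pi> \<pi>_arrow xt eq]) (rule that)
    let ?YU = "restr Y (U \<inter> pts Y)"
    have Y: "Y = restr XX (pts Y)" by (simp add: fibre_prod_def)
    have aY: "atlas Y hXX" using XX(1) Y by (metis atlas_restr)
    have aYU: "atlas ?YU hXX" using aY by simp
    have qY: "(t q, s q) \<in> pts Y" using \<pi>_arrow X(2) by (simp add: fibre_prod_def)
    have qU: "(t q, s q) \<in> U" using q by (simp add: \<Phi>_eq)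
    obtain u' where u': "u' \<in> tangent_space ?YU (t q, s q)" "\<And>f. f \<in> cinf Y \<Longrightarrow> u' f = u f"
      by (rule tangent_open[OF aY u(1) qY triv_open[OF tr] qU]) (rule that)
    define z where "z = snd (\<tau> q)"
    have iY: "smooth_map Y XX (\<lambda>y. y)"
      using smooth_map_restr[OF smooth_map_id[OF XX(1)], of "pts Y"] Y XX(2) by (metis subset_UNIV)
    have iYU: "smooth_map ?YU XX (\<lambda>y. y)" by (rule smooth_map_restr[OF iY]) simp
    have sl: "smooth_map ?YU (restr Z (cyl U)) (\<lambda>y. (y, z))"
      by (rule smooth_map_Pair[OF aYU XX(1) atlas_eucl iYU smooth_map_const[OF aYU atlas_eucl]])
        (use triv_norm[OF tr q] in \<open>auto simp: cyl_def fibre_prod_def z_def\<close>)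
    define w where "w = tmap (restr Z (cyl U)) (\<lambda>y. (y, z)) u'"
    have \<tau>q: "\<tau> q = ((t q, s q), z)" using triv_fst[OF tr q] by (simp add: z_def \<Phi>_eq prod_eq_iff)
    have w: "w \<in> tangent_space (restr Z (cyl U)) (\<tau> q)"
      unfolding w_def \<tau>q using tmap_tangent[OF aYU aC sl u'(1)] .
    have i: "smooth_map (restr Z (cyl U)) Z (\<lambda>c. c)"
      using smooth_map_restr[OF smooth_map_id[OF Z(1)], of "cyl U"] Z(2) by simp
    have "tmap Z (\<lambda>c. c) w = \<xi> (\<tau> q)"
    proof (rule tangent_Z_unique)
      show "tmap Z (\<lambda>c. c) w \<in> tangent_space Z (\<tau> q)" by (rule tmap_tangent[OF aC Z(1) i w])
      show "\<xi> (\<tau> q) \<in> tangent_space Z (\<tau> q)" by (rule \<xi>t)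
      have "tmap XX fst (tmap Z (\<lambda>c. c) w) = tmap XX (\<lambda>y. y) u'"
        unfolding tmap_compose[OF Z(1) XX(1) p1Z] w_def tmap_compose[OF aC XX(1) p1ZS] by simp
      also have "\<dots> = \<eta> (t q, s q)"
      proof (rule tangent_XX_unique)
        show "tmap XX (\<lambda>y. y) u' \<in> tangent_space XX (t q, s q)" by (rule tmap_tangent[OF aYU XX(1) iYU u'(1)])
        show "\<eta> (t q, s q) \<in> tangent_space XX (t q, s q)" by (rule \<eta>t)
        have "tmap X fst (tmap XX (\<lambda>y. y) u') = tmap X fst u'"
          unfolding tmap_compose[OF XX(1) X(1) p1XX] ..
        also have "\<dots> = tmap X fst u"
          by (rule tmap_restr_eq[OF aY X(1) smooth_map_compose[OF aY XX(1) X(1) iY p1XX] u'(2)])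
        finally show "tmap X fst (tmap XX (\<lambda>y. y) u') = tmap X fst (\<eta> (t q, s q))"
          using u(2) \<eta>(2)[of "(t q, s q)"] by simp
        have "tmap X snd (tmap XX (\<lambda>y. y) u') = tmap X snd u'"
          unfolding tmap_compose[OF XX(1) X(1) p2XX] ..
        also have "\<dots> = tmap X snd u"
          by (rule tmap_restr_eq[OF aY X(1) smooth_map_compose[OF aY XX(1) X(1) iY p2XX] u'(2)])
        finally show "tmap X snd (tmap XX (\<lambda>y. y) u') = tmap X snd (\<eta> (t q, s q))"
          using u(3) \<eta>(3)[of "(t q, s q)"] by simp
      qed
      finally show "tmap XX fst (tmap Z (\<lambda>c. c) w) = tmap XX fst (\<xi> (\<tau> q))"
        unfolding \<xi>(1) by (simp only: \<tau>q fst_conv)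
      have "tmap eucl snd (tmap Z (\<lambda>c. c) w) = tmap eucl (\<lambda>y. z) u'"
        unfolding tmap_compose[OF Z(1) atlas_eucl p2Z] w_def tmap_compose[OF aC atlas_eucl p2ZS] by simp
      also have "\<dots> = 0" by (rule tmap_const[OF aYU u'(1)])
      finally show "tmap eucl snd (tmap Z (\<lambda>c. c) w) = tmap eucl snd (\<xi> (\<tau> q))"
        unfolding \<xi>(2) .
    qed
    then have "w F = \<xi> (\<tau> q) F" if "F \<in> cinf Z" for F
      using tmap_apply[OF that, of "\<lambda>c. c" w] by simp
    then show ?thesis using w by blast
  qed
  define w where "w q = (SOME w. w \<in> tangent_space (restr Z (cyl U)) (\<tau> q) \<and> (\<forall>F\<in>cinf Z. w F = \<xi> (\<tau> q) F))" for q
  have w: "w q \<in> tangent_space (restr Z (cyl U)) (\<tau> q)" "\<And>F. F \<in> cinf Z \<Longrightarrow> w q F = \<xi> (\<tau> q) F"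
    if "\<Phi> q \<in> U" for q
    using someI_ex[OF ex[OF that]] unfolding w_def by auto
  define v where "v q = tmap A \<tau>' (w q)" for q
  have v: "v q \<in> tangent_space A q" if "\<Phi> q \<in> U" for q
    using tmap_tangent[OF aC A(1) triv_smooth_inv_A[OF tr] w(1)[OF that]] triv_inv[OF tr that] by (simp add: v_def)
  have ff: "smooth_map Z X (\<lambda>c. fst (fst c))" and sf: "smooth_map Z X (\<lambda>c. snd (fst c))"
    using smooth_map_compose[OF Z(1) XX(1) X(1) p1Z p1XX] smooth_map_compose[OF Z(1) XX(1) X(1) p1Z p2XX] .
  have ffC: "smooth_map (restr Z (cyl U)) X (\<lambda>c. fst (fst c))" and sfC: "smooth_map (restr Z (cyl U)) X (\<lambda>c. snd (fst c))"
    using smooth_map_restr[OF ff, of "cyl U"] smooth_map_restr[OF sf, of "cyl U"] Z(2) by simp_all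
  have vt: "tmap X t (v q) = x1 (t q)" if q: "\<Phi> q \<in> U" for q
  proof -
    have "tmap X t (v q) = tmap X (\<lambda>c. t (\<tau>' c)) (w q)" unfolding v_def tmap_compose[OF A(1) X(1) smooth_tgt] ..
    also have "\<dots> = tmap X (\<lambda>c. fst (fst c)) (w q)"
      by (rule tmap_cong[OF aC X(1) smooth_map_compose[OF aC A(1) X(1) triv_smooth_inv_A[OF tr] smooth_tgt] ffC w(1)[OF q]])
        (use triv_cyl[OF tr q] triv_inv_\<Phi>[OF tr] in \<open>auto simp: \<Phi>_eq dest: sym\<close>)
    also have "\<dots> = tmap X (\<lambda>c. fst (fst c)) (\<xi> (\<tau> q))" by (rule tmap_restr_eq[OF Z(1) X(1) ff w(2)[OF q]])
    also have "\<dots> = tmap X fst (tmap XX fst (\<xi> (\<tau> q)))" unfolding tmap_compose[OF XX(1) X(1) p1XX] ..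
    also have "\<dots> = x1 (t q)" unfolding \<xi>(1) \<eta>(2) triv_fst[OF tr q] by (simp add: \<Phi>_eq)
    finally show ?thesis .
  qed
  have vs: "tmap X s (v q) = x2 (s q)" if q: "\<Phi> q \<in> U" for q
  proof -
    have "tmap X s (v q) = tmap X (\<lambda>c. s (\<tau>' c)) (w q)" unfolding v_def tmap_compose[OF A(1) X(1) smooth_src] ..
    also have "\<dots> = tmap X (\<lambda>c. snd (fst c)) (w q)"
      by (rule tmap_cong[OF aC X(1) smooth_map_compose[OF aC A(1) X(1) triv_smooth_inv_A[OF tr] smooth_src] sfC w(1)[OF q]])
        (use triv_cyl[OF tr q] triv_inv_\<Phi>[OF tr] in \<open>auto simp: \<Phi>_eq dest: sym\<close>)
    also have "\<dots> = tmap X (\<lambda>c. snd (fst c)) (\<xi> (\<tau> q))" by (rule tmap_restr_eq[OF Z(1) X(1) sf w(2)[OF q]])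
    also have "\<dots> = tmap X snd (tmap XX fst (\<xi> (\<tau> q)))" unfolding tmap_compose[OF XX(1) X(1) p2XX] ..
    also have "\<dots> = x2 (s q)" unfolding \<xi>(1) \<eta>(3) triv_fst[OF tr q] by (simp add: \<Phi>_eq)
    finally show ?thesis .
  qed
  show thesis
  proof (rule that[of "\<Phi> -` U" v])
    show "(\<lambda>q. v q f) \<in> cinf (restr A (\<Phi> -` U))" if "f \<in> cinf A" for f
      unfolding v_def by (rule triv_field_smooth[OF tr \<xi>F w that])
  qed (use open_\<Phi>[OF triv_open[OF tr]] q0 v vt vs in auto)
qed

text \<open>Vectors on the arrow manifold correspond to triples of a target component, a source component and a
  value of the connection; this also holds for vector fields.\<close>

lemma field_exists:
  assumes x: "x1 \<in> vector_fields X" "x2 \<in> vector_fields X" and comp: "pcompat x1 x2" and h: "h \<in> cinf A"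
  obtains v where "v \<in> vector_fields A" "\<And>q. tmap X t (v q) = x1 (t q)" "\<And>q. tmap X s (v q) = x2 (s q)"
    "\<And>q. \<gamma> q [v q] = h q"
proof -
  let ?P = "\<lambda>q v. v \<in> tangent_space A q \<and> tmap X t v = x1 (t q) \<and> tmap X s v = x2 (s q) \<and> \<gamma> q [v] = h q"
  \<comment> \<open>A multiple of the generator adjusts the value of \<gamma> without changing the
    source and target components.\<close>
  have mk: "?P q (v + (h q - \<gamma> q [v]) *\<^sub>R gen q)"
    if "v \<in> tangent_space A q" "tmap X t v = x1 (t q)" "tmap X s v = x2 (s q)" for v q
    using that gen_tangent[of q]
    by (simp only: subspace_add[OF subspace_tangent_space] subspace_scale[OF subspace_tangent_space] tmap_add tmap_scaleR
        tmap_tgt_gen tmap_src_gen scaleR_zero_right add_0_right \<gamma>_add \<gamma>_scale \<gamma>_gen mult_1_right) simp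
  define v where "v q = (SOME v. ?P q v)" for q
  have v: "?P q (v q)" for q
  proof -
    obtain N u where "q \<in> N" "\<And>q. q \<in> N \<Longrightarrow> u q \<in> tangent_space A q"
      "\<And>q. q \<in> N \<Longrightarrow> tmap X t (u q) = x1 (t q)" "\<And>q. q \<in> N \<Longrightarrow> tmap X s (u q) = x2 (s q)"
      by (rule local_field[OF x comp, of q]) (rule that)
    from mk[of "u q" q] this show ?thesis unfolding v_def by (intro someI[where P="?P q"]) auto
  qed
  have "v \<in> vector_fields A"
  proof (rule vector_fieldsI)
    show "v q \<in> tangent_space A q" for q using v by simp
    fix f assume f: "f \<in> cinf A"
    show "(\<lambda>q. v q f) \<in> cinf A"
    proof (rule cinf_local)
      fix q0
      obtain N u where N: "open N" "q0 \<in> N" and u: "\<And>q. q \<in> N \<Longrightarrow> u q \<in> tangent_space A q"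
        "\<And>q. q \<in> N \<Longrightarrow> tmap X t (u q) = x1 (t q)" "\<And>q. q \<in> N \<Longrightarrow> tmap X s (u q) = x2 (s q)"
        "\<And>f. f \<in> cinf A \<Longrightarrow> (\<lambda>q. u q f) \<in> cinf (restr A N)"
        by (rule local_field[OF x comp, of q0]) (rule that)
      obtain b V C where b: "b \<in> cinf (restr A UNIV)" "open V" "q0 \<in> V" "V \<subseteq> C" "closed C" "C \<subseteq> N"
        "\<And>y. y \<in> V \<Longrightarrow> b y = 1" "\<And>y. y \<notin> C \<Longrightarrow> b y = 0"
        by (rule bump_function[OF A(1) N]) (rule that)
      \<comment> \<open>Smoothness of \<gamma> is tested on global fields, so the local field
        \<open>u\<close> is cut off before \<gamma> is applied.\<close>
      define w where "w q = b q *\<^sub>R u q" for q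
      have wF: "w \<in> vector_fields A"
      proof (rule vector_fieldsI)
        show "w q \<in> tangent_space A q" for q
          unfolding w_def using u(1)[of q] b(6,8)
          by (cases "q \<in> C") (auto intro: subspace_scale[OF subspace_tangent_space] subspace_0[OF subspace_tangent_space])
        fix g assume g: "g \<in> cinf A"
        have "(\<lambda>q. b q * u q g) \<in> cinf (restr A UNIV)"
          by (rule cinf_extend_zero[OF A(1) N(1) _ b(1,5,6,8)]) (use u(4)[OF g] in simp)
        then show "(\<lambda>q. w q g) \<in> cinf A" by (simp add: w_def scaleR_fun_def full)
      qed
      have wu: "w q = u q" if "q \<in> V" for q using b(7)[OF that] by (simp only: w_def scaleR_one)
      let ?g = "\<lambda>q. w q f + (h q - \<gamma> q [w q]) * gen q f"
      have "?g \<in> cinf A"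
        by (intro cinf_add[OF A(1)] cinf_mult[OF A(1)] cinf_diff[OF A(1)] vf_cinf[OF wF f] vf_cinf[OF gen_field f] h \<gamma>_cinf wF)
      then have "?g \<in> cinf (restr A (V \<inter> pts A))" by (rule cinf_restr) (simp add: A(2))
      moreover have "v q f = ?g q" if q: "q \<in> V" for q
      proof -
        have qN: "q \<in> N" using q b by auto
        have "v q = u q + (h q - \<gamma> q [u q]) *\<^sub>R gen q"
          using mk[OF u(1-3)[OF qN]] v[of q] by (intro tangent_unique[where q=q]) (simp_all only:)
        then show ?thesis by (simp add: wu[OF q] scaleR_fun_def)
      qed
      ultimately show "\<exists>N g. open N \<and> q0 \<in> N \<and> g \<in> cinf (restr A (N \<inter> pts A)) \<and> (\<forall>q\<in>N \<inter> pts A. v q f = g q)"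
        using b by (intro exI[of _ V] exI[of _ ?g]) simp
    qed
  qed
  then show thesis using v that by blast
qed

section \<open>Tangent vectors of composable pairs\<close>

abbreviation "CP \<equiv> composable P"
abbreviation "mu \<equiv> (\<lambda>z. mul P (fst z) (snd z))"

lemma comp_eq: "CP = restr (prod_space A A) {(p, q). s p = t q}"
  by (simp add: composable_def fibre_prod_def A(2))

lemma comp_atlas: "atlas CP (map_prod hA hA)" and comp_pts: "(p, q) \<in> pts CP \<longleftrightarrow> s p = t q"
  unfolding comp_eq using atlas_prod[OF A(1) A(1)] by auto

lemma comp_fst: "smooth_map CP A fst" and comp_snd: "smooth_map CP A snd"
  unfolding comp_eq using smooth_map_fst[OF A(1) A(1)] smooth_map_snd[OF A(1) A(1)] A(2) by auto

lemma comp_Pair: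
  assumes "atlas W h" "smooth_map W A f" "smooth_map W A g" "\<And>w. w \<in> pts W \<Longrightarrow> s (f w) = t (g w)"
  shows "smooth_map W CP (\<lambda>w. (f w, g w))"
  unfolding comp_eq by (rule smooth_map_Pair[OF assms(1) A(1) A(1) assms(2,3)]) (simp add: assms(4))

lemma tangent_comp_unique:
  assumes "u \<in> tangent_space CP (p, q)" "w \<in> tangent_space CP (p, q)" "s p = t q"
    "tmap A fst u = tmap A fst w" "tmap A snd u = tmap A snd w"
  shows "u = w"
  by (rule tangent_prod_unique[OF A A]) (use assms in \<open>auto simp: comp_eq\<close>)

lemma \<gamma>_mul:
  assumes "u \<in> tangent_space CP (p, q)" "s p = t q"
  shows "\<gamma> (mul P p q) [tmap A mu u] = \<gamma> p [tmap A fst u] + \<gamma> q [tmap A snd u]"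
proof -
  have "simplicial_diff1 P \<gamma> (p, q) [u] = 0"
    using connection assms comp_pts unfolding gerbe_connection_def by blast
  then show ?thesis by (simp add: simplicial_diff1_def pullback_def case_prod_unfold)
qed

text \<open>\<open>fibre_prod_tangent\<close> and \<open>tangent_comp_unique\<close> provide
  existence and uniqueness of the vector described by \<open>THE\<close> in the definition. The
  value of \<gamma> then follows from \<delta>\<gamma> = 0.\<close>

lemma tangent_mul:
  assumes pq: "s p = t q" and v: "v \<in> tangent_space A p" and w: "w \<in> tangent_space A q"
    and vw: "tmap X s v = tmap X t w"
  shows "tangent_mul P p q v w \<in> tangent_space A (mul P p q)"
    and "tmap X t (tangent_mul P p q v w) = tmap X t v" and "tmap X s (tangent_mul P p q v w) = tmap X s w"
    and "\<gamma> (mul P p q) [tangent_mul P p q v w] = \<gamma> p [v] + \<gamma> q [w]"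
proof -
  obtain u where "u \<in> tangent_space (fibre_prod A A s t) (p, q)" "tmap A fst u = v" "tmap A snd u = w"
    by (rule fibre_prod_tangent[OF A A X submersions(1) smooth_tgt pq v w vw]) (rule that)
  note u = this[folded composable_def]
  have "(THE u. u \<in> tangent_space CP (p, q) \<and> tmap A fst u = v \<and> tmap A snd u = w) = u"
    by (rule the_equality) (use u tangent_comp_unique[OF _ _ pq] in auto)
  then have eq: "tangent_mul P p q v w = tmap A mu u"
    by (simp add: tangent_mul_def case_prod_unfold)
  show "tangent_mul P p q v w \<in> tangent_space A (mul P p q)"
    unfolding eq using tmap_tangent[OF comp_atlas A(1) smooth_mul u(1)] by simp
  have pqc: "(p, q) \<in> pts CP" using pq comp_pts by simp
  note c = smooth_map_compose[OF comp_atlas A(1) X(1)]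
  have "tmap X t (tmap A mu u) = tmap X (\<lambda>z. t (mu z)) u" by (rule tmap_compose[OF A(1) X(1) smooth_tgt])
  also have "\<dots> = tmap X (\<lambda>z. t (fst z)) u"
    by (rule tmap_cong[OF comp_atlas X(1) c[OF smooth_mul smooth_tgt] c[OF comp_fst smooth_tgt] u(1) pqc])
      (auto simp: comp_pts tgt_mul split_paired_all)
  also have "\<dots> = tmap X t v" unfolding u(2)[symmetric] tmap_compose[OF A(1) X(1) smooth_tgt] ..
  finally show "tmap X t (tangent_mul P p q v w) = tmap X t v" by (simp add: eq)
  have "tmap X s (tmap A mu u) = tmap X (\<lambda>z. s (mu z)) u" by (rule tmap_compose[OF A(1) X(1) smooth_src])
  also have "\<dots> = tmap X (\<lambda>z. s (snd z)) u"
    by (rule tmap_cong[OF comp_atlas X(1) c[OF smooth_mul smooth_src] c[OF comp_snd smooth_src] u(1) pqc])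
      (auto simp: comp_pts src_mul split_paired_all)
  also have "\<dots> = tmap X s w" unfolding u(3)[symmetric] tmap_compose[OF A(1) X(1) smooth_src] ..
  finally show "tmap X s (tangent_mul P p q v w) = tmap X s w" by (simp add: eq)
  show "\<gamma> (mul P p q) [tangent_mul P p q v w] = \<gamma> p [v] + \<gamma> q [w]"
    unfolding eq \<gamma>_mul[OF u(1) pq] u(2,3) ..
qed

lemma mul_unt_unt: "mul P (unt P y) (unt P y) = unt P y"
  using mul_unt_left[of "unt P y"] by (simp add: tgt_unt)

text \<open>A unit times itself is itself, so \<delta>\<gamma> = 0 along the diagonal of the units
  reads c = c + c.\<close>

lemma \<gamma>_unt:
  assumes "x \<in> tangent_space X y" shows "\<gamma> (unt P y) [tmap A (unt P) x] = 0"
proof -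
  have i: "smooth_map X CP (\<lambda>y. (unt P y, unt P y))"
    by (rule comp_Pair[OF X(1) smooth_unt smooth_unt]) (simp add: src_unt tgt_unt)
  from \<gamma>_mul[OF tmap_tangent[OF X(1) comp_atlas i assms]]
  show ?thesis
    by (simp add: src_unt tgt_unt tmap_compose[OF comp_atlas A(1) smooth_mul] tmap_compose[OF comp_atlas A(1) comp_fst]
        tmap_compose[OF comp_atlas A(1) comp_snd] mul_unt_unt)
qed

section \<open>Multiplicative vector fields and additive functions\<close>

definition related :: "('x \<Rightarrow> 'x tvec) \<Rightarrow> ('p \<Rightarrow> 'p tvec) \<Rightarrow> bool"
  where "related x v \<longleftrightarrow> x \<in> vector_fields X \<and> v \<in> vector_fields A \<and>
    (\<forall>q. tmap X s (v q) = x (s q) \<and> tmap X t (v q) = x (t q))"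

definition additive :: "('p \<Rightarrow> real) \<Rightarrow> bool"
  where "additive \<phi> \<longleftrightarrow> (\<forall>p q. s p = t q \<longrightarrow> \<phi> (mul P p q) = \<phi> p + \<phi> q)"

lemma additive_unt: "additive \<phi> \<Longrightarrow> \<phi> (unt P y) = 0"
  using mul_unt_unt[of y] unfolding additive_def by (metis add_cancel_right_right src_unt tgt_unt)

lemma vfA: "v \<in> vector_fields A \<Longrightarrow> v q \<in> tangent_space A q" and vfX: "x \<in> vector_fields X \<Longrightarrow> x y \<in> tangent_space X y"
  and vfM: "z \<in> vector_fields M \<Longrightarrow> z m \<in> tangent_space M m"
  by (simp_all add: vf_tangent A(2) X(2) M(2))

text \<open>Compatibility with units and products only has to be checked on the connection.\<close>

lemma multiplicative_iff:
  "(x, v) \<in> multiplicative_vfs P \<longleftrightarrow> related x v \<and> additive (\<lambda>q. \<gamma> q [v q])"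
proof (intro iffI conjI)
  assume m: "(x, v) \<in> multiplicative_vfs P"
  then show r: "related x v" by (simp add: multiplicative_vfs_def related_def)
  show "additive (\<lambda>q. \<gamma> q [v q])"
    unfolding additive_def
  proof (intro allI impI)
    fix p q assume pq: "s p = t q"
    have "tangent_mul P p q (v p) (v q) = v (mul P p q)" using m pq by (simp add: multiplicative_vfs_def)
    moreover have "tmap X s (v p) = tmap X t (v q)" "v \<in> vector_fields A" using r pq by (simp_all add: related_def)
    ultimately show "\<gamma> (mul P p q) [v (mul P p q)] = \<gamma> p [v p] + \<gamma> q [v q]"
      using tangent_mul(4)[OF pq vfA vfA, of v v] by simp
  qed
next
  assume rf: "related x v \<and> additive (\<lambda>q. \<gamma> q [v q])"
  then have x: "x \<in> vector_fields X" and v: "v \<in> vector_fields A"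
    and r: "tmap X s (v q) = x (s q)" "tmap X t (v q) = x (t q)" and f: "additive (\<lambda>q. \<gamma> q [v q])" for q
    by (auto simp: related_def)
  have "tmap A (unt P) (x y) = v (unt P y)" for y
  proof (rule tangent_unique)
    show "tmap A (unt P) (x y) \<in> tangent_space A (unt P y)" by (rule tmap_tangent[OF X(1) A(1) smooth_unt vfX[OF x]])
    show "v (unt P y) \<in> tangent_space A (unt P y)" by (rule vfA[OF v])
    show "tmap X t (tmap A (unt P) (x y)) = tmap X t (v (unt P y))"
      by (simp add: tmap_compose[OF A(1) X(1) smooth_tgt] tgt_unt tmap_id[OF vfX[OF x]] r)
    show "tmap X s (tmap A (unt P) (x y)) = tmap X s (v (unt P y))"
      by (simp add: tmap_compose[OF A(1) X(1) smooth_src] src_unt tmap_id[OF vfX[OF x]] r)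
    show "\<gamma> (unt P y) [tmap A (unt P) (x y)] = \<gamma> (unt P y) [v (unt P y)]"
      using \<gamma>_unt[OF vfX[OF x]] additive_unt[OF f, of y] by simp
  qed
  moreover have "tangent_mul P p q (v p) (v q) = v (mul P p q)" if pq: "s p = t q" for p q
  proof -
    have "tmap X s (v p) = tmap X t (v q)" using r pq by simp
    note m = tangent_mul[OF pq vfA[OF v] vfA[OF v] this]
    show ?thesis
      by (rule tangent_unique[OF m(1) vfA[OF v]])
        (use m pq f r in \<open>simp_all add: tgt_mul src_mul additive_def\<close>)
  qed
  ultimately show "(x, v) \<in> multiplicative_vfs P" using x v r by (simp add: multiplicative_vfs_def)
qed

text \<open>On the isotropy circles an additive function is a continuous homomorphism from a compact group
  to the reals, hence zero.\<close>

lemma additive_isotropy: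
  assumes \<phi>: "\<phi> \<in> cinf A" "additive \<phi>" and z: "norm z = 1"
  shows "\<phi> (act z (unt P y)) = 0"
proof -
  let ?f = "\<lambda>z. \<phi> (act z (unt P y))"
  have mult: "?f (z * w) = ?f z + ?f w" if "norm z = 1" "norm w = 1" for z w
  proof -
    have "s (act z (unt P y)) = t (act w (unt P y))" using that by (simp add: src_act tgt_act src_unt tgt_unt)
    moreover have "mul P (act z (unt P y)) (act w (unt P y)) = act (z * w) (unt P y)"
      using act_mul[OF that, of "unt P y" "unt P y"] by (simp add: src_unt tgt_unt mul_unt_unt)
    ultimately show ?thesis using \<phi>(2) unfolding additive_def by metis
  qed
  have pow: "?f (w ^ n) = real n * ?f w" if "norm w = 1" for w n
  proof (induction n)
    case 0
    then show ?case using additive_unt[OF \<phi>(2)] by (simp add: act_one)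
  next
    case (Suc n)
    then show ?case using mult[of w "w ^ n"] that by (simp add: norm_power algebra_simps)
  qed
  have pc: "restr (prod_space circle A) ({z. norm z = 1} \<times> UNIV) = prod_space circle A"
    using restr_pts[of "prod_space circle A"] A(2) by simp
  have "smooth_map circle (prod_space circle A) (\<lambda>z. (z, unt P y))"
    using smooth_map_Pair[OF atlas_circle atlas_circle A(1) smooth_map_id[OF atlas_circle] smooth_map_const[OF atlas_circle A(1)],
        of "unt P y" "{z. norm z = 1} \<times> UNIV"] A(2) unfolding pc by simp
  from smooth_map_compose[OF atlas_circle atlas_prod[OF atlas_circle A(1)] A(1) this act_smooth]
  have "?f \<in> cinf circle" using cinf_compose[OF atlas_circle A(1) _ \<phi>(1)] by simp
  then have "continuous_on {z. norm z = 1} ?f" using smooth_map_continuous[of circle eucl ?f] by (simp add: cinf_def)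
  moreover have "{z::complex. norm z = 1} = sphere 0 1" by auto
  ultimately have "compact (?f ` {z. norm z = 1})" by (intro compact_continuous_image) simp_all
  then have "bounded (?f ` {z. norm z = 1})" by (rule compact_imp_bounded)
  then obtain K where K: "\<And>w. norm w = 1 \<Longrightarrow> \<bar>?f w\<bar> \<le> K" unfolding bounded_iff by auto
  show ?thesis
  proof (rule ccontr)
    assume nz: "?f z \<noteq> 0"
    obtain n :: nat where "K < real n * \<bar>?f z\<bar>" using nz reals_Archimedean3[of "\<bar>?f z\<bar>"] by auto
    moreover have "\<bar>?f (z ^ n)\<bar> \<le> K" by (rule K) (simp add: norm_power z)
    ultimately show False using pow[OF z, of n] by (simp add: abs_mult)
  qed
qed

text \<open>Arrows with the same ends differ by left multiplication with some
  \<open>act z (unt P (t q))\<close>, on which \<phi> is zero.\<close>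

lemma additive_\<Phi>:
  assumes \<phi>: "\<phi> \<in> cinf A" "additive \<phi>" and "\<Phi> q = \<Phi> q'"
  shows "\<phi> q = \<phi> q'"
proof -
  obtain z where z: "norm z = 1" "q' = act z q" by (rule fibre_transitive[OF assms(3)])
  have "mul P (act z (unt P (t q))) (act 1 q) = q'"
    using act_mul[OF z(1), of 1 "unt P (t q)" q] z(2) by (simp add: src_unt mul_unt_left)
  moreover have "s (act z (unt P (t q))) = t q" using z(1) by (simp add: src_act src_unt)
  ultimately show ?thesis
    using \<phi>(2) additive_isotropy[OF \<phi> z(1)] unfolding additive_def by (metis act_one add_0)
qed

text \<open>For a section \<sigma> of \<pi>, let g(y) be the value of \<phi> on an arrow from y to
  \<sigma>(\<pi> y). Composing such an arrow for t q with q gives one for s q, hence \<phi> q = g (s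
  q) - g (t q). Sections are only local; averaging their functions with weights pulled back from M
  keeps the relation, since \<pi> \<circ> s = \<pi> \<circ> t.\<close>

lemma additive_exact:
  assumes \<phi>: "\<phi> \<in> cinf A" "additive \<phi>"
  obtains g where "g \<in> cinf X" "\<And>q. \<phi> q = g (s q) - g (t q)"
proof -
  have "\<exists>L \<sigma>. open L \<and> m \<in> L \<and> smooth_map (restr M L) X \<sigma> \<and> (\<forall>m\<in>L. \<pi> (\<sigma> m) = m)" for m
  proof -
    obtain L \<sigma> where "open L" "m \<in> L" "smooth_map (restr M L) X \<sigma>" "\<And>m. m \<in> L \<Longrightarrow> \<pi> (\<sigma> m) = m"
      by (rule submersion_local_section[OF X M submersions(3)]) (rule that)
    then show ?thesis by (intro exI[of _ L] exI[of _ \<sigma>]) simp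
  qed
  then obtain L \<sigma> where L: "\<And>m. open (L m) \<and> m \<in> L m \<and> smooth_map (restr M (L m)) X (\<sigma> m) \<and> (\<forall>m'\<in>L m. \<pi> (\<sigma> m m') = m')"
    by metis
  have L1: "open (L m)" and L2: "m \<in> L m" and L3: "smooth_map (restr M (L m)) X (\<sigma> m)"
    and L4: "m' \<in> L m \<Longrightarrow> \<pi> (\<sigma> m m') = m'" for m m'
    using L[of m] by auto
  obtain c :: "nat \<Rightarrow> 'm" and b C V where pou: "\<And>i. b i \<in> cinf M" "\<And>i. closed (C i)" "\<And>i. C i \<subseteq> L (c i)"
    "\<And>i x. x \<notin> C i \<Longrightarrow> b i x = 0" "\<And>i. open (V i)" "\<And>x. \<exists>i. x \<in> V i"
    "\<And>i j x. x \<in> V j \<Longrightarrow> j < i \<Longrightarrow> b i x = 0" "\<And>j x. x \<in> V j \<Longrightarrow> (\<Sum>i\<le>j. b i x) = 1"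
    by (rule partition_of_unity[OF M L1 L2]) (rule that)
  define ar where "ar y1 y2 = (SOME q. t q = y1 \<and> s q = y2)" for y1 y2
  have ar: "t (ar y1 y2) = y1" "s (ar y1 y2) = y2" if "\<pi> y1 = \<pi> y2" for y1 y2
    using someI_ex[OF \<pi>_connected[OF that]] unfolding ar_def by auto
  define g where "g i y = \<phi> (ar (\<sigma> (c i) (\<pi> y)) y)" for i y
  have openL: "open (\<pi> -` L m)" for m
    using continuous_open_preimage[OF smooth_map_continuous[OF smooth_\<pi>] _ L1[of m]] X(2) by simp
  have closedC: "closed (\<pi> -` C i)" for i
    using continuous_closed_preimage[OF smooth_map_continuous[OF smooth_\<pi>] _ pou(2)[of i]] X(2) by simp
  have openV: "open (\<pi> -` V i)" for i
    using continuous_open_preimage[OF smooth_map_continuous[OF smooth_\<pi>] _ pou(5)[of i]] X(2) by simp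
  have g: "g i \<in> cinf (restr X (\<pi> -` L (c i)))" for i
  proof (rule cinf_local)
    let ?L = "\<pi> -` L (c i)"
    fix y0 assume "y0 \<in> pts (restr X ?L)"
    then have y0: "\<pi> y0 \<in> L (c i)" by simp
    obtain U \<tau> \<tau>' where tr: "triv U \<tau> \<tau>'" "(\<sigma> (c i) (\<pi> y0), y0) \<in> U"
      using trivialization[of "(\<sigma> (c i) (\<pi> y0), y0)"] L4[OF y0] by auto
    have aXL: "atlas (restr X ?L) hX" and aML: "atlas (restr M (L (c i))) hM" using X(1) M(1) by simp_all
    have p: "smooth_map (restr X ?L) (restr M (L (c i))) \<pi>"
      by (rule smooth_map_into[OF smooth_map_restr[OF smooth_\<pi>]]) (auto simp: X(2))
    have idL: "smooth_map (restr X ?L) X (\<lambda>y. y)"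
      using smooth_map_restr[OF smooth_map_id[OF X(1)], of ?L] X(2) by simp
    have j0: "smooth_map (restr X ?L) XX (\<lambda>y. (\<sigma> (c i) (\<pi> y), y))"
      using smooth_map_Pair[OF aXL X(1) X(1) smooth_map_compose[OF aXL aML X(1) p L3] idL, of UNIV] by (simp add: full)
    define W where "W = ?L \<inter> (\<lambda>y. (\<sigma> (c i) (\<pi> y), y)) -` U"
    have W: "open W"
      unfolding W_def using continuous_open_preimage[OF smooth_map_continuous[OF j0] _ triv_open[OF tr(1)]] openL by simp
    have aW: "atlas (restr X W) hX" using X(1) by simp
    have jW: "smooth_map (restr X W) XX (\<lambda>y. (\<sigma> (c i) (\<pi> y), y))"
      using smooth_map_restr[OF j0, of W] by (simp add: W_def)
    have j: "smooth_map (restr X W) (restr Z (cyl U)) (\<lambda>y. ((\<sigma> (c i) (\<pi> y), y), 1))"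
      by (rule smooth_map_Pair[OF aW XX(1) atlas_eucl jW smooth_map_const[OF aW atlas_eucl]])
        (use L4 in \<open>auto simp: cyl_def W_def\<close>)
    have "(\<lambda>y. \<phi> (\<tau>' ((\<sigma> (c i) (\<pi> y), y), 1))) \<in> cinf (restr X W)"
      by (rule cinf_compose[OF aW A(1) smooth_map_compose[OF aW atlas_cyl[OF tr(1)] A(1) j triv_smooth_inv_A[OF tr(1)]] \<phi>(1)])
    \<comment> \<open>The choice in \<open>ar\<close> is arbitrary, but \<phi> depends only on the
      ends of an arrow. It may thus be evaluated on the arrow with fibre coordinate 1, which varies
      smoothly.\<close>
    moreover have "g i y = \<phi> (\<tau>' ((\<sigma> (c i) (\<pi> y), y), 1))" if y: "y \<in> W" for y
    proof -
      have e: "\<pi> (\<sigma> (c i) (\<pi> y)) = \<pi> y" using L4 y by (simp add: W_def)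
      then have "((\<sigma> (c i) (\<pi> y), y), 1) \<in> cyl U" using y by (simp add: cyl_def W_def)
      from triv_inv_\<Phi>[OF tr(1) this] show ?thesis
        unfolding g_def by (intro additive_\<Phi>[OF \<phi>]) (simp add: \<Phi>_eq ar[OF e])
    qed
    moreover have "W \<inter> ?L = W" by (auto simp: W_def)
    ultimately show "\<exists>N g'. open N \<and> y0 \<in> N \<and> g' \<in> cinf (restr (restr X ?L) (N \<inter> pts (restr X ?L))) \<and>
        (\<forall>y\<in>N \<inter> pts (restr X ?L). g i y = g' y)"
      using W y0 tr(2)
      by (intro exI[of _ W] exI[of _ "\<lambda>y. \<phi> (\<tau>' ((\<sigma> (c i) (\<pi> y), y), 1))"]) (simp add: W_def)
  qed
  define J where "J m = (LEAST j. m \<in> V j)" for m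
  define G where "G y = (\<Sum>i\<le>J (\<pi> y). b i (\<pi> y) * g i y)" for y
  have G: "G y = (\<Sum>i\<le>j. b i (\<pi> y) * g i y)" if "\<pi> y \<in> V j" for y j
    unfolding G_def
  proof (rule sum.mono_neutral_left)
    show "{..J (\<pi> y)} \<subseteq> {..j}" unfolding J_def using Least_le[of "\<lambda>j. \<pi> y \<in> V j" j, OF that] by auto
    have "\<pi> y \<in> V (J (\<pi> y))" unfolding J_def using LeastI_ex[OF pou(6)] .
    then show "\<forall>i\<in>{..j} - {..J (\<pi> y)}. b i (\<pi> y) * g i y = 0" using pou(7) by auto
  qed simp
  have bg: "(\<lambda>y. b i (\<pi> y) * g i y) \<in> cinf X" for i
  proof -
    have "(\<lambda>y. b i (\<pi> y)) \<in> cinf X" by (rule cinf_compose[OF X(1) M(1) smooth_\<pi> pou(1)])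
    then have bX: "(\<lambda>y. b i (\<pi> y)) \<in> cinf (restr X UNIV)" by (simp add: full)
    have gX: "g i \<in> cinf (restr X (\<pi> -` L (c i) \<inter> UNIV))" using g by simp
    have "(\<lambda>y. b i (\<pi> y) * g i y) \<in> cinf (restr X UNIV)"
      by (rule cinf_extend_zero[OF X(1) openL gX bX closedC[of i]]) (use pou(3,4) in auto)
    then show ?thesis by (simp add: full)
  qed
  have "G \<in> cinf X"
  proof (rule cinf_local)
    fix y
    obtain j where "\<pi> y \<in> V j" using pou(6) by blast
    moreover have "(\<lambda>y. \<Sum>i\<le>j. b i (\<pi> y) * g i y) \<in> cinf (restr X (\<pi> -` V j \<inter> pts X))"
      by (rule cinf_restr[OF cinf_sum[OF X(1) bg]]) simp
    ultimately show "\<exists>N g. open N \<and> y \<in> N \<and> g \<in> cinf (restr X (N \<inter> pts X)) \<and> (\<forall>y\<in>N \<inter> pts X. G y = g y)"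
      using openV G by (intro exI[of _ "\<pi> -` V j"] exI[of _ "\<lambda>y. \<Sum>i\<le>j. b i (\<pi> y) * g i y"]) auto
  qed
  moreover have "\<phi> q = G (s q) - G (t q)" for q
  proof -
    obtain j where j: "\<pi> (s q) \<in> V j" using pou(6) by blast
    have tm: "b i (\<pi> (s q)) * g i (s q) - b i (\<pi> (s q)) * g i (t q) = b i (\<pi> (s q)) * \<phi> q" for i
    proof (cases "\<pi> (s q) \<in> C i")
      case True
      then have "\<pi> (s q) \<in> L (c i)" using pou(3) by blast
      then have e: "\<pi> (\<sigma> (c i) (\<pi> (s q))) = \<pi> (s q)" "\<pi> (\<sigma> (c i) (\<pi> (s q))) = \<pi> (t q)" using L4 \<pi>_arrow by auto
      let ?y = "\<sigma> (c i) (\<pi> (s q))"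
      have "s (ar ?y (t q)) = t q" using ar[OF e(2)] by simp
      then have "\<phi> (mul P (ar ?y (t q)) q) = \<phi> (ar ?y (t q)) + \<phi> q" using \<phi>(2) unfolding additive_def by blast
      moreover have "\<phi> (ar ?y (s q)) = \<phi> (mul P (ar ?y (t q)) q)"
        by (rule additive_\<Phi>[OF \<phi>]) (simp add: \<Phi>_eq ar[OF e(1)] ar[OF e(2)] tgt_mul src_mul)
      ultimately have "g i (s q) - g i (t q) = \<phi> q" by (simp add: g_def \<pi>_arrow)
      then show ?thesis by (simp flip: right_diff_distrib)
    qed (simp add: pou(4))
    have "G (s q) - G (t q) = (\<Sum>i\<le>j. b i (\<pi> (s q)) * g i (s q) - b i (\<pi> (s q)) * g i (t q))"
      using G[OF j] G[of "t q" j] j by (simp add: \<pi>_arrow sum_subtractf)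
    also have "\<dots> = (\<Sum>i\<le>j. b i (\<pi> (s q))) * \<phi> q" by (simp add: tm sum_distrib_right)
    finally show ?thesis using pou(8)[OF j] by simp
  qed
  ultimately show thesis by (rule that)
qed

end

section \<open>Lie brackets\<close>

context
  fixes N :: "('a::t2_space, 'e::euclidean_space) space" and h
  assumes N: "atlas N h" "pts N = UNIV"
begin

lemma vf_at: "x \<in> vector_fields N \<Longrightarrow> x p \<in> tangent_space N p"
  by (rule vf_tangent) (simp_all add: N)

lemma vf_eqI:
  assumes "x \<in> vector_fields N" "y \<in> vector_fields N" "\<And>p f. f \<in> cinf N \<Longrightarrow> x p f = y p f"
  shows "x = y"
  using tangent_eqI[OF vf_at[OF assms(1)] vf_at[OF assms(2)]] assms(3) by blast

lemma lie_bracket_apply: "lie_bracket x y p f = x p (\<lambda>q. y q f) - y p (\<lambda>q. x q f)"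
  by (simp add: lie_bracket_def lie_deriv_def)

lemma lie_bracket_skew: "lie_bracket x y = - lie_bracket y x"
  by (simp add: lie_bracket_def fun_eq_iff)

lemma vf_comb: "x \<in> vector_fields N \<Longrightarrow> y \<in> vector_fields N \<Longrightarrow> a *\<^sub>R x + b *\<^sub>R y \<in> vector_fields N"
  by (intro subspace_add subspace_scale subspace_vector_fields[OF N(1)])

lemma comb_apply: "(a *\<^sub>R x + b *\<^sub>R y) p f = a * x p f + b * y p f" for x y :: "'a \<Rightarrow> 'a tvec"
  by (simp add: scaleR_fun_def)

lemma lie_bracket_lin:
  assumes x: "x \<in> vector_fields N" and y: "y \<in> vector_fields N" and z: "z \<in> vector_fields N"
  shows "lie_bracket (a *\<^sub>R x + b *\<^sub>R y) z = a *\<^sub>R lie_bracket x z + b *\<^sub>R lie_bracket y z"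
proof (rule vf_eqI)
  show "lie_bracket (a *\<^sub>R x + b *\<^sub>R y) z \<in> vector_fields N"
    by (rule lie_bracket_vector_fields[OF N vf_comb[OF x y] z])
  show "a *\<^sub>R lie_bracket x z + b *\<^sub>R lie_bracket y z \<in> vector_fields N"
    by (rule vf_comb; rule lie_bracket_vector_fields[OF N]; fact)
  fix p f assume f: "f \<in> cinf N"
  show "lie_bracket (a *\<^sub>R x + b *\<^sub>R y) z p f = (a *\<^sub>R lie_bracket x z + b *\<^sub>R lie_bracket y z) p f"
    unfolding comb_apply lie_bracket_apply
    using tangent_lin[OF vf_at[OF z] vf_cinf[OF x f] vf_cinf[OF y f], of p a b] by (simp add: algebra_simps)
qed

lemma lie_bracket_0: "x \<in> vector_fields N \<Longrightarrow> lie_bracket x 0 = 0" "x \<in> vector_fields N \<Longrightarrow> lie_bracket 0 x = 0"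
  using tangent_const[OF N(1) vf_at] by (auto simp: fun_eq_iff lie_bracket_apply)

lemma jacobi:
  assumes x: "x \<in> vector_fields N" and y: "y \<in> vector_fields N" and z: "z \<in> vector_fields N"
  shows "lie_bracket x (lie_bracket y z) + lie_bracket y (lie_bracket z x) + lie_bracket z (lie_bracket x y) = 0"
proof (rule vf_eqI)
  note b = lie_bracket_vector_fields[OF N]
  show "lie_bracket x (lie_bracket y z) + lie_bracket y (lie_bracket z x) + lie_bracket z (lie_bracket x y) \<in> vector_fields N"
    by (intro subspace_add subspace_vector_fields[OF N(1)] b x y z)
  show "0 \<in> vector_fields N" by (rule subspace_0[OF subspace_vector_fields[OF N(1)]])
  fix p f assume f: "f \<in> cinf N"
  note c = vf_cinf[OF x f] vf_cinf[OF y f] vf_cinf[OF z f]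
  have d: "u p (\<lambda>q. lie_bracket v w q f) = u p (\<lambda>q. v q (\<lambda>q. w q f)) - u p (\<lambda>q. w q (\<lambda>q. v q f))"
    if "u \<in> vector_fields N" "v \<in> vector_fields N" "w \<in> vector_fields N" for u v w
    unfolding lie_bracket_apply
    by (rule tangent_diff[OF N(1) vf_at[OF that(1)] vf_cinf[OF that(2) vf_cinf[OF that(3) f]] vf_cinf[OF that(3) vf_cinf[OF that(2) f]]])
  show "(lie_bracket x (lie_bracket y z) + lie_bracket y (lie_bracket z x) + lie_bracket z (lie_bracket x y)) p f = 0 p f"
    unfolding plus_fun_apply zero_fun_apply lie_bracket_apply[of x "lie_bracket y z"] lie_bracket_apply[of y "lie_bracket z x"]
      lie_bracket_apply[of z "lie_bracket x y"] d[OF x y z] d[OF y z x] d[OF z x y]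
    by (simp add: lie_bracket_apply)
qed

lemma related_bracket:
  fixes Y :: "('b::t2_space, 'f::euclidean_space) space"
  assumes Y: "atlas Y k" "pts Y = UNIV" and f: "smooth_map N Y f"
    and v: "v \<in> vector_fields N" "w \<in> vector_fields N" and x: "x \<in> vector_fields Y" "y \<in> vector_fields Y"
    and r: "\<And>q. tmap Y f (v q) = x (f q)" "\<And>q. tmap Y f (w q) = y (f q)"
  shows "tmap Y f (lie_bracket v w q) = lie_bracket x y (f q)"
proof (rule tangent_eqI)
  show "tmap Y f (lie_bracket v w q) \<in> tangent_space Y (f q)"
    by (rule tmap_tangent[OF N(1) Y(1) f vf_at[OF lie_bracket_vector_fields[OF N v]]])
  show "lie_bracket x y (f q) \<in> tangent_space Y (f q)"
    using vf_tangent[OF lie_bracket_vector_fields[OF Y x]] Y(2) by simp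
  fix u assume u: "u \<in> cinf Y"
  have e: "v q (\<lambda>p. u (f p)) = x (f q) u" "w q (\<lambda>p. u (f p)) = y (f q) u" if "u \<in> cinf Y" for q u
    using fun_cong[OF r(1)[of q], of u] fun_cong[OF r(2)[of q], of u] that by (simp_all add: tmap_apply)
  show "tmap Y f (lie_bracket v w q) u = lie_bracket x y (f q) u"
    by (simp add: tmap_apply[OF u] lie_bracket_apply e[OF u] e[OF vf_cinf[OF x(1) u]] e[OF vf_cinf[OF x(2) u]])
qed

end

context gerbe
begin

section \<open>The forms \<gamma>, B and \<Omega> evaluated on vector fields\<close>

lemma B_forms: "B \<in> forms X 2" using curving by (simp add: curving_def)

lemma B_props:
  assumes v: "v \<in> tangent_space X y" "v' \<in> tangent_space X y" "w \<in> tangent_space X y"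
  shows B_lin1: "B y [a *\<^sub>R v + b *\<^sub>R v', w] = a * B y [v, w] + b * B y [v', w]"
    and B_lin2: "B y [w, a *\<^sub>R v + b *\<^sub>R v'] = a * B y [w, v] + b * B y [w, v']"
    and B_alt: "B y [v, v] = 0"
proof -
  have *: "\<forall>p\<in>pts X. \<forall>vs. length vs = 2 \<and> set vs \<subseteq> tangent_space X p \<longrightarrow>
       (\<forall>i<2. \<forall>v\<in>tangent_space X p. \<forall>w\<in>tangent_space X p. \<forall>a b.
          B p (vs[i := a *\<^sub>R v + b *\<^sub>R w]) = a * B p (vs[i := v]) + b * B p (vs[i := w])) \<and>
       (\<not> distinct vs \<longrightarrow> B p vs = 0)"
    using B_forms unfolding forms_def mem_Collect_eq by (elim conjE)
  have y: "y \<in> pts X" using X(2) by simp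
  have 1: "(\<forall>i<2. \<forall>v\<in>tangent_space X y. \<forall>w\<in>tangent_space X y. \<forall>a b.
          B y (vs[i := a *\<^sub>R v + b *\<^sub>R w]) = a * B y (vs[i := v]) + b * B y (vs[i := w])) \<and>
       (\<not> distinct vs \<longrightarrow> B y vs = 0)" if "length vs = 2 \<and> set vs \<subseteq> tangent_space X y" for vs
    using *[rule_format, OF y that] by simp
  show "B y [a *\<^sub>R v + b *\<^sub>R v', w] = a * B y [v, w] + b * B y [v', w]"
    using 1[of "[v, w]", THEN conjunct1, rule_format, of 0 v v' a b] v by simp
  show "B y [w, a *\<^sub>R v + b *\<^sub>R v'] = a * B y [w, v] + b * B y [w, v']"
    using 1[of "[w, v]", THEN conjunct1, rule_format, of 1 v v' a b] v by simp
  show "B y [v, v] = 0" using 1[of "[v, v]"] v by simp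
qed

lemma B_skew:
  assumes "v \<in> tangent_space X y" "w \<in> tangent_space X y" shows "B y [v, w] = - B y [w, v]"
proof -
  have s: "v + w \<in> tangent_space X y" using assms by (rule subspace_add[OF subspace_tangent_space])
  have "0 = B y [v + w, v + w]" using B_alt[OF s s s] by simp
  also have "\<dots> = B y [v, v + w] + B y [w, v + w]" using B_lin1[OF assms s, of 1 1] by (simp only: scaleR_one mult_1)
  also have "\<dots> = B y [v, v] + B y [v, w] + (B y [w, v] + B y [w, w])"
    using B_lin2[OF assms assms(1), of 1 1] B_lin2[OF assms assms(2), of 1 1] by (simp only: scaleR_one mult_1)
  finally show ?thesis using B_alt[OF assms(1) assms(1) assms(1)] B_alt[OF assms(2) assms(2) assms(2)] by simp
qed

lemma B_0: "v \<in> tangent_space X y \<Longrightarrow> B y [v, 0] = 0" "v \<in> tangent_space X y \<Longrightarrow> B y [0, v] = 0"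
  using B_lin2[of v y v v 0 0] B_lin1[of v y v v 0 0] by (simp_all only: scaleR_zero_left mult_zero_left add_0_right)

lemma B_cinf: "x \<in> vector_fields X \<Longrightarrow> z \<in> vector_fields X \<Longrightarrow> (\<lambda>y. B y [x y, z y]) \<in> cinf X"
proof -
  assume x: "x \<in> vector_fields X" "z \<in> vector_fields X"
  have "\<forall>xs. length xs = 2 \<and> set xs \<subseteq> vector_fields X \<longrightarrow> (\<lambda>p. B p (map (\<lambda>x. x p) xs)) \<in> cinf X"
    using B_forms unfolding forms_def mem_Collect_eq by (elim conjE)
  from spec[OF this, of "[x, z]"] x show ?thesis by simp
qed

lemma d\<gamma>:
  assumes v: "v \<in> vector_fields A" "w \<in> vector_fields A"
  shows "B (s q) [tmap X s (v q), tmap X s (w q)] - B (t q) [tmap X t (v q), tmap X t (w q)] =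
    v q (\<lambda>q. \<gamma> q [w q]) - w q (\<lambda>q. \<gamma> q [v q]) - \<gamma> q [lie_bracket v w q]"
proof -
  have "ext_deriv A 1 \<gamma> (simplicial_diff0 P B)" using curving by (simp add: curving_def)
  then have "\<forall>xs. length xs = Suc 1 \<and> set xs \<subseteq> vector_fields A \<longrightarrow> (\<forall>p\<in>pts A.
       simplicial_diff0 P B p (map (\<lambda>x. x p) xs) =
         (\<Sum>i\<le>1. (-1) ^ i * (xs ! i) p (\<lambda>q. \<gamma> q (map (\<lambda>x. x q) (nths xs (- {i}))))) +
         (\<Sum>j\<le>1. \<Sum>i<j. (-1) ^ (i + j) *
            \<gamma> p (lie_bracket (xs ! i) (xs ! j) p # map (\<lambda>x. x p) (nths xs (- {i, j})))))"
    unfolding ext_deriv_def by (elim conjE)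
  from this[rule_format, of "[v, w]" q] v A(2)
  show ?thesis by (simp add: simplicial_diff0_def pullback_def nths_Cons)
qed

lemma dB:
  assumes x: "x1 \<in> vector_fields X" "x2 \<in> vector_fields X" "x3 \<in> vector_fields X"
  shows "\<Omega> (\<pi> y) [tmap M \<pi> (x1 y), tmap M \<pi> (x2 y), tmap M \<pi> (x3 y)] =
    x1 y (\<lambda>y. B y [x2 y, x3 y]) - x2 y (\<lambda>y. B y [x1 y, x3 y]) + x3 y (\<lambda>y. B y [x1 y, x2 y])
    - B y [lie_bracket x1 x2 y, x3 y] + B y [lie_bracket x1 x3 y, x2 y] - B y [lie_bracket x2 x3 y, x1 y]"
proof -
  have "ext_deriv X 2 B (pullback M \<pi> \<Omega>)" using three_curvature by (simp add: three_curvature_def)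
  then have "\<forall>xs. length xs = Suc 2 \<and> set xs \<subseteq> vector_fields X \<longrightarrow> (\<forall>p\<in>pts X.
       pullback M \<pi> \<Omega> p (map (\<lambda>x. x p) xs) =
         (\<Sum>i\<le>2. (-1) ^ i * (xs ! i) p (\<lambda>q. B q (map (\<lambda>x. x q) (nths xs (- {i}))))) +
         (\<Sum>j\<le>2. \<Sum>i<j. (-1) ^ (i + j) *
            B p (lie_bracket (xs ! i) (xs ! j) p # map (\<lambda>x. x p) (nths xs (- {i, j})))))"
    unfolding ext_deriv_def by (elim conjE)
  from this[rule_format, of "[x1, x2, x3]" y] x X(2)
  show ?thesis by (simp add: pullback_def nths_Cons numeral_2_eq_2)
qed

text \<open>\<open>rel x v g\<close> says that \<open>(x, v, g)\<close> belongs to the space \<open>G\<close> of the theorem; multiplicativity of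
  \<open>(x, v)\<close> is a consequence of \<open>\<delta>g = \<iota>\<^sub>v \<gamma>\<close>.\<close>

definition rel :: "('x \<Rightarrow> 'x tvec) \<Rightarrow> ('p \<Rightarrow> 'p tvec) \<Rightarrow> ('x \<Rightarrow> real) \<Rightarrow> bool"
  where "rel x v g \<longleftrightarrow> related x v \<and> g \<in> cinf X \<and> (\<forall>q. \<gamma> q [v q] = g (s q) - g (t q))"

lemma relD:
  assumes "rel x v g"
  shows rel_x: "x \<in> vector_fields X" and rel_v: "v \<in> vector_fields A" and rel_g: "g \<in> cinf X"
    and rel_src: "tmap X s (v q) = x (s q)" and rel_tgt: "tmap X t (v q) = x (t q)"
    and rel_\<gamma>: "\<gamma> q [v q] = g (s q) - g (t q)"
  using assms by (auto simp: rel_def related_def)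

lemma relI:
  assumes "x \<in> vector_fields X" "v \<in> vector_fields A" "g \<in> cinf X" "\<And>q. tmap X s (v q) = x (s q)"
    "\<And>q. tmap X t (v q) = x (t q)" "\<And>q. \<gamma> q [v q] = g (s q) - g (t q)"
  shows "rel x v g"
  using assms by (auto simp: rel_def related_def)

text \<open>Surjectivity of \<sigma> in advance: \<open>additive_exact\<close> provides the
  function. Henceforth a multiplicative field is always handled with a primitive \<open>g\<close> of
  its connection component.\<close>

lemma multiplicative_rel: "(x, v) \<in> multiplicative_vfs P \<longleftrightarrow> (\<exists>g. rel x v g)"
proof
  assume "(x, v) \<in> multiplicative_vfs P"
  then have m: "related x v" "additive (\<lambda>q. \<gamma> q [v q])" by (simp_all add: multiplicative_iff)
  then have "(\<lambda>q. \<gamma> q [v q]) \<in> cinf A" using \<gamma>_cinf by (simp add: related_def)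
  from additive_exact[OF this m(2)] obtain g where "g \<in> cinf X" "\<And>q. \<gamma> q [v q] = g (s q) - g (t q)" by blast
  then show "\<exists>g. rel x v g" using m(1) by (auto simp: rel_def)
next
  assume "\<exists>g. rel x v g"
  then obtain g where g: "rel x v g" by blast
  then have "additive (\<lambda>q. \<gamma> q [v q])" by (auto simp: additive_def rel_\<gamma> src_mul tgt_mul)
  then show "(x, v) \<in> multiplicative_vfs P" using g by (simp add: multiplicative_iff rel_def)
qed

text \<open>\<open>x\<close> and \<open>g\<close> fix all three data of
  \<open>tangent_unique\<close>. Equations between fields on P can thus be verified on
  \<open>x\<close> and \<open>g\<close> alone.\<close>

lemma rel_unique: "rel x v g \<Longrightarrow> rel x w g \<Longrightarrow> v = w"
  by (rule ext, rule tangent_unique[OF vfA vfA]) (simp_all add: relD)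

lemma rel_comb:
  assumes r: "rel x v g" "rel z w h" shows "rel (a *\<^sub>R x + b *\<^sub>R z) (a *\<^sub>R v + b *\<^sub>R w) (a *\<^sub>R g + b *\<^sub>R h)"
proof (rule relI)
  show "a *\<^sub>R x + b *\<^sub>R z \<in> vector_fields X" by (rule vf_comb[OF X rel_x[OF r(1)] rel_x[OF r(2)]])
  show "a *\<^sub>R v + b *\<^sub>R w \<in> vector_fields A" by (rule vf_comb[OF A rel_v[OF r(1)] rel_v[OF r(2)]])
  show "a *\<^sub>R g + b *\<^sub>R h \<in> cinf X"
    by (intro subspace_add subspace_scale subspace_cinf[OF X(1)] rel_g[OF r(1)] rel_g[OF r(2)])
  have at: "(a *\<^sub>R u + b *\<^sub>R u') p = a *\<^sub>R u p + b *\<^sub>R u' p" for u u' :: "'q \<Rightarrow> 'q tvec" and p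
    by (simp add: scaleR_fun_def)
  show "tmap X s ((a *\<^sub>R v + b *\<^sub>R w) q) = (a *\<^sub>R x + b *\<^sub>R z) (s q)"
    "tmap X t ((a *\<^sub>R v + b *\<^sub>R w) q) = (a *\<^sub>R x + b *\<^sub>R z) (t q)" for q
    by (simp_all only: at tmap_add tmap_scaleR rel_src[OF r(1)] rel_src[OF r(2)] rel_tgt[OF r(1)] rel_tgt[OF r(2)])
  show "\<gamma> q [(a *\<^sub>R v + b *\<^sub>R w) q] = (a *\<^sub>R g + b *\<^sub>R h) (s q) - (a *\<^sub>R g + b *\<^sub>R h) (t q)" for q
    unfolding at \<gamma>_lin[OF vfA[OF rel_v[OF r(1)]] vfA[OF rel_v[OF r(2)]]] rel_\<gamma>[OF r(1)] rel_\<gamma>[OF r(2)]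
    by (simp add: scaleR_fun_def algebra_simps)
qed

text \<open>The function component of the bracket on \<open>G\<close>.\<close>

definition third :: "('x \<Rightarrow> 'x tvec) \<Rightarrow> ('x \<Rightarrow> real) \<Rightarrow> ('x \<Rightarrow> 'x tvec) \<Rightarrow> ('x \<Rightarrow> real) \<Rightarrow> 'x \<Rightarrow> real"
  where "third x g z h = (\<lambda>y. x y h - z y g - B y [x y, z y])"

text \<open>The curving makes \<open>third\<close> a primitive of \<open>\<gamma> [v, w]\<close>, so the bracket of multiplicative vector fields
  is multiplicative.\<close>

lemma rel_bracket:
  assumes r: "rel x v g" "rel z w h" shows "rel (lie_bracket x z) (lie_bracket v w) (third x g z h)"
proof (rule relI)
  note x = rel_x[OF r(1)] rel_x[OF r(2)] and v = rel_v[OF r(1)] rel_v[OF r(2)]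
  show "lie_bracket x z \<in> vector_fields X" by (rule lie_bracket_vector_fields[OF X x])
  show "lie_bracket v w \<in> vector_fields A" by (rule lie_bracket_vector_fields[OF A v])
  show "third x g z h \<in> cinf X"
    unfolding third_def
    by (intro cinf_diff[OF X(1)] vf_cinf[OF x(1)] vf_cinf[OF x(2)] rel_g[OF r(1)] rel_g[OF r(2)] B_cinf x)
  fix q
  show "tmap X s (lie_bracket v w q) = lie_bracket x z (s q)"
    by (rule related_bracket[OF A X smooth_src v x]) (simp_all add: rel_src[OF r(1)] rel_src[OF r(2)])
  show "tmap X t (lie_bracket v w q) = lie_bracket x z (t q)"
    by (rule related_bracket[OF A X smooth_tgt v x]) (simp_all add: rel_tgt[OF r(1)] rel_tgt[OF r(2)])
  \<comment> \<open>As \<open>u\<close> projects to \<open>y\<close> along both source and target,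
    the derivative of \<delta>k along \<open>u\<close> is \<delta> of the derivative of
    \<open>k\<close> along \<open>y\<close>.\<close>
  have app: "u q (\<lambda>q. \<gamma> q [u' q]) = y (s q) k - y (t q) k" if u: "rel y u l" and u': "rel y' u' k" for u u' y y' k l
  proof -
    note c = cinf_compose[OF A(1) X(1) smooth_src rel_g[OF u']] cinf_compose[OF A(1) X(1) smooth_tgt rel_g[OF u']]
    have "u q (\<lambda>q. \<gamma> q [u' q]) = u q (\<lambda>q. k (s q)) - u q (\<lambda>q. k (t q))"
      unfolding rel_\<gamma>[OF u'] by (rule tangent_diff[OF A(1) vfA[OF rel_v[OF u]] c])
    then show ?thesis
      using fun_cong[OF rel_src[OF u, of q], of k] fun_cong[OF rel_tgt[OF u, of q], of k] rel_g[OF u']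
      by (simp add: tmap_apply)
  qed
  show "\<gamma> q [lie_bracket v w q] = third x g z h (s q) - third x g z h (t q)"
    using d\<gamma>[OF v, of q] app[OF r] app[OF r(2) r(1)]
    by (simp add: rel_src[OF r(1)] rel_src[OF r(2)] rel_tgt[OF r(1)] rel_tgt[OF r(2)] third_def)
qed

section \<open>Sections of the Lie algebroid\<close>

definition "\<Gamma> = algebroid_sections P"

lemma \<Gamma>D:
  assumes "a \<in> \<Gamma>"
  shows \<Gamma>_tangent: "a y \<in> tangent_space A (unt P y)" and \<Gamma>_src: "tmap X s (a y) = 0"
    and \<Gamma>_cinf: "f \<in> cinf A \<Longrightarrow> (\<lambda>y. a y f) \<in> cinf X"
  using assms by (auto simp: \<Gamma>_def algebroid_sections_def)

text \<open>Agrees with \<open>v_fun\<close> on sections by \<open>v_fun_eq\<close>, but is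
  available before the right-invariant field has been studied.\<close>

definition vv :: "('x \<Rightarrow> 'p tvec) \<Rightarrow> 'x \<Rightarrow> real" where "vv a y = \<gamma> (unt P y) [a y]"

lemma anchor_apply: "anchor P a y = tmap X t (a y)"
  by (simp add: anchor_def)

lemma anchor_field: "a \<in> \<Gamma> \<Longrightarrow> anchor P a \<in> vector_fields X"
proof (rule vector_fieldsI)
  assume a: "a \<in> \<Gamma>"
  show "anchor P a y \<in> tangent_space X y" for y
    using tmap_tangent[OF A(1) X(1) smooth_tgt \<Gamma>_tangent[OF a, of y]] by (simp add: anchor_apply tgt_unt)
  show "(\<lambda>y. anchor P a y f) \<in> cinf X" if "f \<in> cinf X" for f
    using \<Gamma>_cinf[OF a cinf_compose[OF A(1) X(1) smooth_tgt that]] that by (simp add: anchor_apply tmap_apply)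
qed

text \<open>Since \<pi> \<circ> t = \<pi> \<circ> s, the projection to M can be computed through the
  source, where \<open>a\<close> vanishes.\<close>

lemma anchor_vertical:
  assumes a: "a \<in> \<Gamma>" shows "tmap M \<pi> (anchor P a y) = 0"
proof -
  have "tmap M \<pi> (anchor P a y) = tmap M (\<lambda>q. \<pi> (s q)) (a y)"
    unfolding anchor_apply tmap_compose[OF X(1) M(1) smooth_\<pi>] by (simp add: \<pi>_arrow)
  also have "\<dots> = tmap M \<pi> (tmap X s (a y))" unfolding tmap_compose[OF X(1) M(1) smooth_\<pi>] ..
  also have "\<dots> = 0" unfolding \<Gamma>_src[OF a] by (rule tmap_0)
  finally show ?thesis .
qed

lemma X0: "0 \<in> vector_fields X" by (rule subspace_0[OF subspace_vector_fields[OF X(1)]])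

lemma pcompat_0: "pcompat x 0 \<longleftrightarrow> (\<forall>y. tmap M \<pi> (x y) = 0)" "pcompat 0 x \<longleftrightarrow> (\<forall>y. tmap M \<pi> (x y) = 0)"
  unfolding pcompat_def zero_fun_apply tmap_0 by (blast, metis)

lemma \<Gamma>_eqI:
  assumes "a \<in> \<Gamma>" "b \<in> \<Gamma>" "anchor P a = anchor P b" "vv a = vv b" shows "a = b"
proof
  fix y
  show "a y = b y"
  proof (rule tangent_unique[OF \<Gamma>_tangent[OF assms(1)] \<Gamma>_tangent[OF assms(2)]])
    show "tmap X t (a y) = tmap X t (b y)" using fun_cong[OF assms(3), of y] by (simp add: anchor_apply)
    show "tmap X s (a y) = tmap X s (b y)" unfolding \<Gamma>_src[OF assms(1)] \<Gamma>_src[OF assms(2)] ..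
    show "\<gamma> (unt P y) [a y] = \<gamma> (unt P y) [b y]" using fun_cong[OF assms(4), of y] by (simp add: vv_def)
  qed
qed

lemma gen_nonzero: obtains f where "f \<in> cinf A" "gen q f \<noteq> 0"
proof -
  have "gen q \<noteq> 0" using \<gamma>_gen[of q] \<gamma>_0[of q] by fastforce
  then have "\<exists>f\<in>cinf A. gen q f \<noteq> 0"
    using tangent_eqI[OF gen_tangent[of q] subspace_0[OF subspace_tangent_space]] by (metis zero_fun_apply)
  then show thesis using that by blast
qed

text \<open>A section is given only along the units, whereas smoothness of \<gamma> is tested on
  fields of P. A field \<open>v\<close> with the target component of \<open>a\<close>, source
  component 0 and \<gamma> = 0 differs from \<open>a\<close> along the units by \<open>vv a\<close>
  times the generator. Where the generator does not kill \<open>f\<close>, this exhibits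
  \<open>vv a\<close> as a quotient of smooth functions.\<close>

lemma vv_cinf: assumes a: "a \<in> \<Gamma>" shows "vv a \<in> cinf X"
proof (rule cinf_local)
  fix y0
  have "pcompat (anchor P a) 0" using anchor_vertical[OF a] pcompat_0 by blast
  from field_exists[OF anchor_field[OF a] X0 this cinf_const[OF A(1), of 0]]
  obtain v where v: "v \<in> vector_fields A" "\<And>q. tmap X t (v q) = anchor P a (t q)"
    "\<And>q. tmap X s (v q) = 0" "\<And>q. \<gamma> q [v q] = 0" by auto
  have eq: "a y = v (unt P y) + vv a y *\<^sub>R gen (unt P y)" for y
  proof (rule tangent_unique[OF \<Gamma>_tangent[OF a]])
    show "v (unt P y) + vv a y *\<^sub>R gen (unt P y) \<in> tangent_space A (unt P y)"
      by (intro subspace_add[OF subspace_tangent_space] subspace_scale[OF subspace_tangent_space] vfA v(1) gen_tangent)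
    show "tmap X t (a y) = tmap X t (v (unt P y) + vv a y *\<^sub>R gen (unt P y))"
      by (simp only: tmap_add tmap_scaleR tmap_tgt_gen scaleR_zero_right add_0_right v(2) tgt_unt anchor_apply)
    show "tmap X s (a y) = tmap X s (v (unt P y) + vv a y *\<^sub>R gen (unt P y))"
      by (simp only: tmap_add tmap_scaleR tmap_src_gen scaleR_zero_right add_0_right v(3) \<Gamma>_src[OF a])
    show "\<gamma> (unt P y) [a y] = \<gamma> (unt P y) [v (unt P y) + vv a y *\<^sub>R gen (unt P y)]"
      unfolding \<gamma>_add[OF vfA[OF v(1)] subspace_scale[OF subspace_tangent_space gen_tangent]] \<gamma>_scale[OF gen_tangent]
      by (simp add: \<gamma>_gen v(4) vv_def)
  qed
  obtain f where f: "f \<in> cinf A" "gen (unt P y0) f \<noteq> 0" by (rule gen_nonzero)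
  have D: "(\<lambda>y. gen (unt P y) f) \<in> cinf X" by (rule cinf_compose[OF X(1) A(1) smooth_unt vf_cinf[OF gen_field f(1)]])
  have n: "(\<lambda>y. a y f - v (unt P y) f) \<in> cinf X"
    by (rule cinf_diff[OF X(1) \<Gamma>_cinf[OF a f(1)] cinf_compose[OF X(1) A(1) smooth_unt vf_cinf[OF v(1) f(1)]]])
  define W where "W = {y. gen (unt P y) f \<noteq> 0}"
  have "open W"
  proof -
    have "continuous_on (pts X) (\<lambda>y. gen (unt P y) f)"
      using smooth_map_continuous[of X eucl] D by (simp add: cinf_def)
    then have "open ((\<lambda>y. gen (unt P y) f) -` (- {0}))"
      using continuous_open_preimage[of UNIV "\<lambda>y. gen (unt P y) f" "- {0}"] X(2) open_Compl[OF closed_singleton[of "0::real"]] by simp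
    moreover have "W = (\<lambda>y. gen (unt P y) f) -` (- {0})" by (auto simp: W_def)
    ultimately show ?thesis by simp
  qed
  moreover have "(\<lambda>y. (a y f - v (unt P y) f) / gen (unt P y) f) \<in> cinf (restr X W)"
    by (rule cinf_divide[of _ hX]) (use X n D cinf_restr[of _ X W] in \<open>auto simp: W_def\<close>)
  moreover have "vv a y = (a y f - v (unt P y) f) / gen (unt P y) f" if "y \<in> W" for y
  proof -
    have "a y f = v (unt P y) f + vv a y * gen (unt P y) f"
      using fun_cong[OF eq[of y], of f] by (simp add: scaleR_fun_def)
    then show ?thesis using that by (simp add: W_def)
  qed
  ultimately show "\<exists>N g. open N \<and> y0 \<in> N \<and> g \<in> cinf (restr X (N \<inter> pts X)) \<and> (\<forall>y\<in>N \<inter> pts X. vv a y = g y)"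
    using f(2) X(2) by (intro exI[of _ W] exI[of _ "\<lambda>y. (a y f - v (unt P y) f) / gen (unt P y) f"]) (simp add: W_def)
qed

section \<open>Source fibres and the right and left fields of a section\<close>

abbreviation "fib y \<equiv> source_fibre P y"

lemma fib_eq: "fib y = restr A {q. s q = y}" by (simp add: source_fibre_def A(2))

lemma fib_atlas: "atlas (fib y) hA" using A(1) by (simp add: fib_eq)

lemma fib_incl: "smooth_map (fib y) A (\<lambda>q. q)"
  unfolding fib_eq using smooth_map_restr[OF smooth_map_id[OF A(1)]] A(2) by simp

text \<open>The source fibre is handled as a fibre product with a constant map.\<close>

lemma tangent_to_fibre:
  assumes v: "v \<in> tangent_space A p" and vert: "tmap X s v = 0" and p: "s p = y"
  shows "tangent_to (fib y) p v \<in> tangent_space (fib y) p"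
    and "tmap A (\<lambda>q. q) (tangent_to (fib y) p v) = v"
proof -
  let ?E = "eucl :: (real, real) space"
  have c: "smooth_map ?E X (\<lambda>_. y)" by (rule smooth_map_const[OF atlas_eucl X(1)]) (simp add: X(2))
  have 0: "0 \<in> tangent_space ?E 0" by (rule subspace_0[OF subspace_tangent_space])
  have eq: "tmap X s v = tmap X (\<lambda>_. y) (0 :: real tvec)" unfolding vert tmap_0 ..
  obtain u where u: "u \<in> tangent_space (fibre_prod A ?E s (\<lambda>_. y)) (p, 0)" "tmap A fst u = v"
    by (rule fibre_prod_tangent[OF A atlas_eucl pts_eucl X submersions(1) c p v 0 eq]) (rule that)
  have F: "fibre_prod A ?E s (\<lambda>_. y) = restr (prod_space A ?E) {(q, r). s q = y}"
    by (simp add: fibre_prod_def A(2))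
  have aF: "atlas (fibre_prod A ?E s (\<lambda>_. y)) (map_prod hA (\<lambda>x. x))"
    unfolding F using atlas_prod[OF A(1) atlas_eucl] by simp
  have fA: "smooth_map (fibre_prod A ?E s (\<lambda>_. y)) A fst"
    unfolding F by (rule smooth_map_fst[OF A(1) atlas_eucl]) (simp add: A(2))
  have f: "smooth_map (fibre_prod A ?E s (\<lambda>_. y)) (fib y) fst"
    unfolding fib_eq by (rule smooth_map_into[OF fA]) (auto simp: F)
  define w where "w = tmap (fib y) fst u"
  have w: "w \<in> tangent_space (fib y) p"
    unfolding w_def using tmap_tangent[OF aF fib_atlas f u(1)] by simp
  have wA: "tmap A (\<lambda>q. q) w = v"
    unfolding w_def tmap_compose[OF fib_atlas A(1) fib_incl] by (rule u(2))
  have full': "(fib y)\<lparr>pts := UNIV\<rparr> = A" using full by (simp add: fib_eq)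
  have "tangent_to (fib y) p v = w"
    unfolding tangent_to_def full'
  proof (rule the_equality)
    show "w \<in> tangent_space (fib y) p \<and> (\<forall>f\<in>cinf A. w f = v f)"
      using w tmap_apply[of _ A "\<lambda>q. q" w] wA by auto
    fix w' assume w': "w' \<in> tangent_space (fib y) p \<and> (\<forall>f\<in>cinf A. w' f = v f)"
    show "w' = w"
    proof (rule tangent_eqI_ambient[OF A(1), of _ "{q. s q = y}" p])
      show "w' \<in> tangent_space (restr A {q. s q = y}) p" "w \<in> tangent_space (restr A {q. s q = y}) p"
        using w w' by (simp_all add: fib_eq)
      fix f assume "f \<in> cinf (restr A UNIV)"
      then have "f \<in> cinf A" by (simp add: full)
      then show "w' f = w f" using w' tmap_apply[of f A "\<lambda>q. q" w] wA by simp
    qed (simp add: p)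
  qed
  then show "tangent_to (fib y) p v \<in> tangent_space (fib y) p" "tmap A (\<lambda>q. q) (tangent_to (fib y) p v) = v"
    using w wA by simp_all
qed

text \<open>For \<gamma>, the curve of pairs (q, p) with \<open>p\<close> fixed is used: by
  \<delta>\<gamma> = 0 the value splits into that of \<open>a\<close> at the unit and that of the
  zero vector at \<open>p\<close>.\<close>

lemma right_vf_props:
  assumes a: "a \<in> \<Gamma>"
  shows "right_vf P a p \<in> tangent_space A p" and "tmap X t (right_vf P a p) = anchor P a (t p)"
    and "tmap X s (right_vf P a p) = 0" and "\<gamma> p [right_vf P a p] = vv a (t p)"
proof -
  let ?y = "t p"
  define w where "w = tangent_to (fib ?y) (unt P ?y) (a ?y)"
  have w: "w \<in> tangent_space (fib ?y) (unt P ?y)" "tmap A (\<lambda>q. q) w = a ?y"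
    unfolding w_def using tangent_to_fibre[OF \<Gamma>_tangent[OF a] \<Gamma>_src[OF a] src_unt] by auto
  have cn: "smooth_map (fib ?y) A (\<lambda>q. p)" by (rule smooth_map_const[OF fib_atlas A(1)]) (simp add: A(2))
  have j: "smooth_map (fib ?y) CP (\<lambda>q. (q, p))"
    by (rule comp_Pair[OF fib_atlas fib_incl cn]) (simp add: fib_eq)
  note u = tmap_tangent[OF fib_atlas comp_atlas j w(1)]
  have R: "right_vf P a p = tmap A mu (tmap CP (\<lambda>q. (q, p)) w)"
    unfolding tmap_compose[OF comp_atlas A(1) smooth_mul] by (simp add: right_vf_def w_def)
  have m: "smooth_map (fib ?y) A (\<lambda>q. mul P q p)"
    using smooth_map_compose[OF fib_atlas comp_atlas A(1) j smooth_mul] by simp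
  have up: "unt P ?y \<in> pts (fib ?y)" by (simp add: fib_eq src_unt)
  have R': "right_vf P a p = tmap A (\<lambda>q. mul P q p) w" by (simp add: right_vf_def w_def)
  show "right_vf P a p \<in> tangent_space A p"
    unfolding R' using tmap_tangent[OF fib_atlas A(1) m w(1)] by (simp add: mul_unt_left)
  note cX = smooth_map_compose[OF fib_atlas A(1) X(1)]
  have "tmap X t (right_vf P a p) = tmap X (\<lambda>q. t (mul P q p)) w" unfolding R' by (rule tmap_compose[OF A(1) X(1) smooth_tgt])
  also have "\<dots> = tmap X t w"
    by (rule tmap_cong[OF fib_atlas X(1) cX[OF m smooth_tgt] cX[OF fib_incl smooth_tgt] w(1) up]) (simp add: fib_eq tgt_mul)
  also have "\<dots> = tmap X t (tmap A (\<lambda>q. q) w)" unfolding tmap_compose[OF A(1) X(1) smooth_tgt] ..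
  finally show "tmap X t (right_vf P a p) = anchor P a ?y" by (simp add: w(2) anchor_apply)
  have "tmap X s (right_vf P a p) = tmap X (\<lambda>q. s (mul P q p)) w" unfolding R' by (rule tmap_compose[OF A(1) X(1) smooth_src])
  also have "\<dots> = tmap X (\<lambda>q. s p) w"
    by (rule tmap_cong[OF fib_atlas X(1) cX[OF m smooth_src] cX[OF cn smooth_src] w(1) up]) (simp add: fib_eq src_mul)
  also have "\<dots> = 0" by (rule tmap_const[OF fib_atlas w(1)])
  finally show "tmap X s (right_vf P a p) = 0" .
  have "\<gamma> (mul P (unt P ?y) p) [right_vf P a p] = \<gamma> (unt P ?y) [tmap A fst (tmap CP (\<lambda>q. (q, p)) w)] + \<gamma> p [tmap A snd (tmap CP (\<lambda>q. (q, p)) w)]"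
    unfolding R by (rule \<gamma>_mul[OF u src_unt])
  also have "tmap A fst (tmap CP (\<lambda>q. (q, p)) w) = a ?y"
    unfolding tmap_compose[OF comp_atlas A(1) comp_fst] by (simp add: w(2))
  also have "tmap A snd (tmap CP (\<lambda>q. (q, p)) w) = 0"
    unfolding tmap_compose[OF comp_atlas A(1) comp_snd] snd_conv by (rule tmap_const[OF fib_atlas w(1)])
  finally show "\<gamma> p [right_vf P a p] = vv a ?y" by (simp add: mul_unt_left \<gamma>_0 vv_def del: zero_fun_apply)
qed

text \<open>The new point is the value of \<gamma> on the inverse of \<open>a\<close>. The products
  of q with its inverse are units, where \<gamma> vanishes, so the inversion changes the sign of the
  value.\<close>

lemma left_vf_props:
  assumes a: "a \<in> \<Gamma>"
  shows "left_vf P a p \<in> tangent_space A p" and "tmap X t (left_vf P a p) = 0"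
    and "tmap X s (left_vf P a p) = anchor P a (s p)" and "\<gamma> p [left_vf P a p] = - vv a (s p)"
proof -
  let ?y = "s p"
  define w where "w = tangent_to (fib ?y) (unt P ?y) (a ?y)"
  have w: "w \<in> tangent_space (fib ?y) (unt P ?y)" "tmap A (\<lambda>q. q) w = a ?y"
    unfolding w_def using tangent_to_fibre[OF \<Gamma>_tangent[OF a] \<Gamma>_src[OF a] src_unt] by auto
  have cn: "smooth_map (fib ?y) A (\<lambda>q. p)" by (rule smooth_map_const[OF fib_atlas A(1)]) (simp add: A(2))
  have iv: "smooth_map (fib ?y) A (ivs P)" by (rule smooth_map_compose[OF fib_atlas A(1) A(1) fib_incl smooth_ivs])
  have j: "smooth_map (fib ?y) CP (\<lambda>q. (p, ivs P q))"
    by (rule comp_Pair[OF fib_atlas cn iv]) (simp add: fib_eq tgt_ivs)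
  have j2: "smooth_map (fib ?y) CP (\<lambda>q. (q, ivs P q))"
    by (rule comp_Pair[OF fib_atlas fib_incl iv]) (simp add: tgt_ivs)
  have up: "unt P ?y \<in> pts (fib ?y)" by (simp add: fib_eq src_unt)
  have R: "left_vf P a p = tmap A mu (tmap CP (\<lambda>q. (p, ivs P q)) w)"
    unfolding tmap_compose[OF comp_atlas A(1) smooth_mul] by (simp add: left_vf_def w_def)
  have m: "smooth_map (fib ?y) A (\<lambda>q. mul P p (ivs P q))"
    using smooth_map_compose[OF fib_atlas comp_atlas A(1) j smooth_mul] by simp
  have R': "left_vf P a p = tmap A (\<lambda>q. mul P p (ivs P q)) w" by (simp add: left_vf_def w_def)
  show "left_vf P a p \<in> tangent_space A p"
    unfolding R' using tmap_tangent[OF fib_atlas A(1) m w(1)] by (simp add: ivs_unt mul_unt_right)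
  note cX = smooth_map_compose[OF fib_atlas A(1) X(1)]
  have "tmap X t (left_vf P a p) = tmap X (\<lambda>q. t (mul P p (ivs P q))) w" unfolding R' by (rule tmap_compose[OF A(1) X(1) smooth_tgt])
  also have "\<dots> = tmap X (\<lambda>q. t p) w"
    by (rule tmap_cong[OF fib_atlas X(1) cX[OF m smooth_tgt] cX[OF cn smooth_tgt] w(1) up]) (simp add: fib_eq tgt_mul tgt_ivs)
  also have "\<dots> = 0" by (rule tmap_const[OF fib_atlas w(1)])
  finally show "tmap X t (left_vf P a p) = 0" .
  have "tmap X s (left_vf P a p) = tmap X (\<lambda>q. s (mul P p (ivs P q))) w" unfolding R' by (rule tmap_compose[OF A(1) X(1) smooth_src])
  also have "\<dots> = tmap X t w"
    by (rule tmap_cong[OF fib_atlas X(1) cX[OF m smooth_src] cX[OF fib_incl smooth_tgt] w(1) up])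
      (simp add: fib_eq src_mul tgt_ivs src_ivs)
  also have "\<dots> = tmap X t (tmap A (\<lambda>q. q) w)" unfolding tmap_compose[OF A(1) X(1) smooth_tgt] ..
  finally show "tmap X s (left_vf P a p) = anchor P a ?y" by (simp add: w(2) anchor_apply)
  define i where "i = tmap A (ivs P) w"
  have "\<gamma> (mul P p (ivs P (unt P ?y))) [left_vf P a p]
      = \<gamma> p [tmap A fst (tmap CP (\<lambda>q. (p, ivs P q)) w)] + \<gamma> (ivs P (unt P ?y)) [tmap A snd (tmap CP (\<lambda>q. (p, ivs P q)) w)]"
    unfolding R by (rule \<gamma>_mul[OF tmap_tangent[OF fib_atlas comp_atlas j w(1)]]) (simp add: tgt_ivs src_unt)
  also have "tmap A fst (tmap CP (\<lambda>q. (p, ivs P q)) w) = 0"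
    unfolding tmap_compose[OF comp_atlas A(1) comp_fst] fst_conv by (rule tmap_const[OF fib_atlas w(1)])
  also have "tmap A snd (tmap CP (\<lambda>q. (p, ivs P q)) w) = i"
    unfolding tmap_compose[OF comp_atlas A(1) comp_snd] by (simp add: i_def)
  finally have 1: "\<gamma> p [left_vf P a p] = \<gamma> (unt P ?y) [i]"
    by (simp add: ivs_unt mul_unt_right \<gamma>_0 del: zero_fun_apply)
  have "\<gamma> (mul P (unt P ?y) (ivs P (unt P ?y))) [tmap A mu (tmap CP (\<lambda>q. (q, ivs P q)) w)]
      = \<gamma> (unt P ?y) [tmap A fst (tmap CP (\<lambda>q. (q, ivs P q)) w)] + \<gamma> (ivs P (unt P ?y)) [tmap A snd (tmap CP (\<lambda>q. (q, ivs P q)) w)]"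
    by (rule \<gamma>_mul[OF tmap_tangent[OF fib_atlas comp_atlas j2 w(1)]]) (simp add: tgt_ivs src_unt)
  also have "tmap A mu (tmap CP (\<lambda>q. (q, ivs P q)) w) = tmap A (unt P) (anchor P a ?y)"
    unfolding tmap_compose[OF comp_atlas A(1) smooth_mul] anchor_apply w(2)[symmetric]
      tmap_compose[OF A(1) X(1) smooth_tgt] tmap_compose[OF X(1) A(1) smooth_unt] by (simp add: mul_ivs)
  also have "tmap A fst (tmap CP (\<lambda>q. (q, ivs P q)) w) = a ?y"
    unfolding tmap_compose[OF comp_atlas A(1) comp_fst] by (simp add: w(2))
  also have "tmap A snd (tmap CP (\<lambda>q. (q, ivs P q)) w) = i"
    unfolding tmap_compose[OF comp_atlas A(1) comp_snd] by (simp add: i_def)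
  finally have "0 = vv a ?y + \<gamma> (unt P ?y) [i]"
    using \<gamma>_unt[OF vfX[OF anchor_field[OF a]], of ?y] by (simp add: ivs_unt mul_unt_unt vv_def)
  with 1 show "\<gamma> p [left_vf P a p] = - vv a ?y" by simp
qed

end

section \<open>Linear maps on subspaces\<close>

lemma skew_bilinear_onI:
  assumes V: "subspace V" and closed: "\<And>x y. x \<in> V \<Longrightarrow> y \<in> V \<Longrightarrow> f x y \<in> V"
    and skew: "\<And>x y. x \<in> V \<Longrightarrow> y \<in> V \<Longrightarrow> f x y = - f y x"
    and lin: "\<And>x y z a b. x \<in> V \<Longrightarrow> y \<in> V \<Longrightarrow> z \<in> V \<Longrightarrow> f (a *\<^sub>R x + b *\<^sub>R y) z = a *\<^sub>R f x z + b *\<^sub>R f y z"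
  shows "skew_bilinear_on V f"
proof -
  have lin_right: "f z (a *\<^sub>R x + b *\<^sub>R y) = a *\<^sub>R f z x + b *\<^sub>R f z y" if "x \<in> V" "y \<in> V" "z \<in> V" for x y z a b
  proof -
    have c: "a *\<^sub>R x + b *\<^sub>R y \<in> V" by (intro subspace_add subspace_scale V that)
    show ?thesis
      unfolding skew[OF that(3) c] skew[OF that(3,1)] skew[OF that(3,2)] lin[OF that] by simp
  qed
  show ?thesis
    unfolding skew_bilinear_on_def bilinear_on_def linear_on_def
    by (intro conjI ballI allI image_subsetI) (rule closed skew lin lin_right; assumption)+
qed

lemma skew_bilinear_onD:
  assumes "skew_bilinear_on V f"
  shows "x \<in> V \<Longrightarrow> y \<in> V \<Longrightarrow> f x y \<in> V" and "x \<in> V \<Longrightarrow> y \<in> V \<Longrightarrow> f x y = - f y x"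
    and "x \<in> V \<Longrightarrow> y \<in> V \<Longrightarrow> z \<in> V \<Longrightarrow> f z (a *\<^sub>R x + b *\<^sub>R y) = a *\<^sub>R f z x + b *\<^sub>R f z y"
proof -
  note * = assms[unfolded skew_bilinear_on_def bilinear_on_def linear_on_def]
  note 1 = *[THEN conjunct1, THEN conjunct1, THEN bspec]
  show "x \<in> V \<Longrightarrow> y \<in> V \<Longrightarrow> f x y \<in> V" by (rule subsetD[OF 1[THEN conjunct1]], assumption, rule imageI)
  show "x \<in> V \<Longrightarrow> y \<in> V \<Longrightarrow> f x y = - f y x" by (rule *[THEN conjunct2, rule_format])
  show "x \<in> V \<Longrightarrow> y \<in> V \<Longrightarrow> z \<in> V \<Longrightarrow> f z (a *\<^sub>R x + b *\<^sub>R y) = a *\<^sub>R f z x + b *\<^sub>R f z y"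
    by (rule 1[THEN conjunct2, rule_format])
qed

lemma linear_on_0:
  assumes "linear_on V W f" "0 \<in> V" shows "f 0 = 0"
proof -
  have "\<forall>u\<in>V. \<forall>v\<in>V. \<forall>a b. f (a *\<^sub>R u + b *\<^sub>R v) = a *\<^sub>R f u + b *\<^sub>R f v"
    using assms(1) by (simp add: linear_on_def)
  from this[rule_format, OF assms(2) assms(2), of 0 0] show ?thesis by simp
qed

text \<open>The Jacobiator of any skew bracket is a cocycle: \<open>J\<close> and \<open>K\<close>
  expand every term into twice nested brackets, the rewritings by \<open>sk\<close> and
  \<open>sk3\<close> orient these uniformly, and the terms cancel.\<close>

lemma skew_bracket_cancel:
  assumes V: "subspace V" and b: "skew_bilinear_on V b" and e: "x1 \<in> V" "x2 \<in> V" "x3 \<in> V" "x4 \<in> V"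
    and j: "\<And>x y z. x \<in> V \<Longrightarrow> y \<in> V \<Longrightarrow> z \<in> V \<Longrightarrow> j x y z = b x (b y z) + b y (b z x) + b z (b x y)"
  shows "b x1 (j x2 x3 x4) - b x2 (j x1 x3 x4) + b x3 (j x1 x2 x4) - b x4 (j x1 x2 x3)
    - j (b x1 x2) x3 x4 + j (b x1 x3) x2 x4 - j (b x1 x4) x2 x3
    - j (b x2 x3) x1 x4 + j (b x2 x4) x1 x3 - j (b x3 x4) x1 x2 = 0"
proof -
  note c = skew_bilinear_onD(1)[OF b] and sk = skew_bilinear_onD(2)[OF b] and lin = skew_bilinear_onD(3)[OF b]
  have add: "b u (v + w) = b u v + b u w" if "u \<in> V" "v \<in> V" "w \<in> V" for u v w
    using lin[OF that(2,3,1), of 1 1] by simp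
  have neg: "b u (- v) = - b u v" if "u \<in> V" "v \<in> V" for u v
    using lin[OF that(2,2,1), of "-1" 0] by simp
  have J: "b u (j x y z) = b u (b x (b y z)) + b u (b y (b z x)) + b u (b z (b x y))"
    if "u \<in> V" "x \<in> V" "y \<in> V" "z \<in> V" for u x y z
    unfolding j[OF that(2-4)] using that by (simp add: add c subspace_add[OF V])
  have sk2: "b u (b v w) = - b u (b w v)" if "u \<in> V" "v \<in> V" "w \<in> V" for u v w
    unfolding sk[OF that(2,3)] neg[OF that(1) c[OF that(3,2)]] ..
  have sk3: "b t (b u (b v w)) = - b t (b u (b w v))" if "t \<in> V" "u \<in> V" "v \<in> V" "w \<in> V" for t u v w
    unfolding sk2[OF that(2-4)] neg[OF that(1) c[OF that(2) c[OF that(4,3)]]] ..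
  have K: "j (b u v) w z = b (b u v) (b w z) + b w (b z (b u v)) - b z (b w (b u v))"
    if "u \<in> V" "v \<in> V" "w \<in> V" "z \<in> V" for u v w z
    unfolding j[OF c[OF that(1,2)] that(3,4)] sk2[OF that(4) c[OF that(1,2)] that(3)] by simp
  show ?thesis
    unfolding J[OF e(1) e(2) e(3) e(4)] J[OF e(2) e(1) e(3) e(4)] J[OF e(3) e(1) e(2) e(4)] J[OF e(4) e(1) e(2) e(3)]
      K[OF e(1) e(2) e(3) e(4)] K[OF e(1) e(3) e(2) e(4)] K[OF e(1) e(4) e(2) e(3)]
      K[OF e(2) e(3) e(1) e(4)] K[OF e(2) e(4) e(1) e(3)] K[OF e(3) e(4) e(1) e(2)]
      sk[OF c[OF e(3) e(4)] c[OF e(1) e(2)]] sk[OF c[OF e(2) e(4)] c[OF e(1) e(3)]] sk[OF c[OF e(2) e(3)] c[OF e(1) e(4)]]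
      sk3[OF e(1) e(2) e(4) e(3)] sk3[OF e(1) e(3) e(4) e(2)] sk3[OF e(1) e(4) e(3) e(2)]
      sk3[OF e(2) e(1) e(4) e(3)] sk3[OF e(2) e(3) e(4) e(1)] sk3[OF e(2) e(4) e(3) e(1)]
      sk3[OF e(3) e(1) e(4) e(2)] sk3[OF e(3) e(2) e(4) e(1)] sk3[OF e(3) e(4) e(2) e(1)]
      sk3[OF e(4) e(1) e(3) e(2)] sk3[OF e(4) e(2) e(3) e(1)] sk3[OF e(4) e(3) e(2) e(1)]
    by (simp add: algebra_simps)
qed

context
  fixes N :: "('a::t2_space, 'e::euclidean_space) space" and h
  assumes N: "atlas N h" "pts N = UNIV"
begin

lemma skew_bilinear_lie_bracket: "skew_bilinear_on (vector_fields N) lie_bracket"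
  by (rule skew_bilinear_onI[OF subspace_vector_fields[OF N(1)] lie_bracket_vector_fields[OF N] lie_bracket_skew[OF N]
      lie_bracket_lin[OF N]])

lemma lie_bracket_lin_right:
  "x \<in> vector_fields N \<Longrightarrow> y \<in> vector_fields N \<Longrightarrow> z \<in> vector_fields N \<Longrightarrow>
    lie_bracket z (a *\<^sub>R x + b *\<^sub>R y) = a *\<^sub>R lie_bracket z x + b *\<^sub>R lie_bracket z y"
  by (rule skew_bilinear_onD(3)[OF skew_bilinear_lie_bracket])

lemma lie_bracket_minus_right: "x \<in> vector_fields N \<Longrightarrow> y \<in> vector_fields N \<Longrightarrow> lie_bracket x (- y) = - lie_bracket x y"
  using lie_bracket_lin_right[of y y x "-1" 0] by simp

end

context gerbe
begin

section \<open>The Lie 2-algebra of multiplicative vector fields\<close>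

lemma \<Gamma>_subspace: "subspace \<Gamma>"
proof (rule subspaceI)
  note T = subspace_tangent_space and C = subspace_cinf[OF X(1)]
  have at: "(a + b) y = a y + b y" "(c *\<^sub>R a) y = c *\<^sub>R a y" "(0 :: 'x \<Rightarrow> 'p tvec) y = 0" for a b :: "'x \<Rightarrow> 'p tvec" and c y
    by (simp_all add: scaleR_fun_def)
  have f: "(\<lambda>y. (a + b) y f) = (\<lambda>y. a y f) + (\<lambda>y. b y f)" "(\<lambda>y. (c *\<^sub>R a) y f) = c *\<^sub>R (\<lambda>y. a y f)" for a b :: "'x \<Rightarrow> 'p tvec" and c f
    by (simp_all add: scaleR_fun_def fun_eq_iff)
  have 1: "a \<in> \<Gamma>" if "\<And>y. a y \<in> tangent_space A (unt P y)" "\<And>y. tmap X s (a y) = 0" "\<And>f. f \<in> cinf A \<Longrightarrow> (\<lambda>y. a y f) \<in> cinf X" for a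
    using that by (simp add: \<Gamma>_def algebroid_sections_def)
  show "0 \<in> \<Gamma>"
  proof (rule 1)
    fix y f
    show "(0 :: 'x \<Rightarrow> 'p tvec) y \<in> tangent_space A (unt P y)" unfolding at by (rule subspace_0[OF T])
    show "tmap X s ((0 :: 'x \<Rightarrow> 'p tvec) y) = 0" unfolding at by (rule tmap_0)
    show "(\<lambda>y. (0 :: 'x \<Rightarrow> 'p tvec) y f) \<in> cinf X" using cinf_const[OF X(1), of 0] by simp
  qed
  show "a + b \<in> \<Gamma>" if "a \<in> \<Gamma>" "b \<in> \<Gamma>" for a b
  proof (rule 1)
    fix y
    show "(a + b) y \<in> tangent_space A (unt P y)"
      unfolding at by (rule subspace_add[OF T \<Gamma>_tangent[OF that(1)] \<Gamma>_tangent[OF that(2)]])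
    show "tmap X s ((a + b) y) = 0"
      by (simp only: at tmap_add \<Gamma>_src[OF that(1)] \<Gamma>_src[OF that(2)] add_0_left)
  next
    fix f assume g: "f \<in> cinf A"
    show "(\<lambda>y. (a + b) y f) \<in> cinf X"
      unfolding f by (rule subspace_add[OF C \<Gamma>_cinf[OF that(1) g] \<Gamma>_cinf[OF that(2) g]])
  qed
  show "c *\<^sub>R a \<in> \<Gamma>" if "a \<in> \<Gamma>" for c a
  proof (rule 1)
    fix y
    show "(c *\<^sub>R a) y \<in> tangent_space A (unt P y)" unfolding at by (rule subspace_scale[OF T \<Gamma>_tangent[OF that]])
    show "tmap X s ((c *\<^sub>R a) y) = 0" by (simp only: at tmap_scaleR \<Gamma>_src[OF that] scaleR_zero_right)
  next
    fix f assume g: "f \<in> cinf A"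
    show "(\<lambda>y. (c *\<^sub>R a) y f) \<in> cinf X" unfolding f by (rule subspace_scale[OF C \<Gamma>_cinf[OF that g]])
  qed
qed

lemma \<Gamma>_comb: "a \<in> \<Gamma> \<Longrightarrow> b \<in> \<Gamma> \<Longrightarrow> c *\<^sub>R a + d *\<^sub>R b \<in> \<Gamma>"
  by (intro subspace_add subspace_scale \<Gamma>_subspace)

lemma field_comb_apply: "(c *\<^sub>R a + d *\<^sub>R b) y = c *\<^sub>R a y + d *\<^sub>R b y" for a b :: "'q \<Rightarrow> 'r tvec"
  by (simp add: scaleR_fun_def)

lemma anchor_lin: "anchor P (c *\<^sub>R a + d *\<^sub>R b) = c *\<^sub>R anchor P a + d *\<^sub>R anchor P b"
  by (rule ext) (simp only: anchor_apply field_comb_apply tmap_add tmap_scaleR)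

lemma vv_lin: "a \<in> \<Gamma> \<Longrightarrow> b \<in> \<Gamma> \<Longrightarrow> vv (c *\<^sub>R a + d *\<^sub>R b) = c *\<^sub>R vv a + d *\<^sub>R vv b"
proof
  fix y
  assume a: "a \<in> \<Gamma>" and b: "b \<in> \<Gamma>"
  show "vv (c *\<^sub>R a + d *\<^sub>R b) y = (c *\<^sub>R vv a + d *\<^sub>R vv b) y"
    unfolding vv_def field_comb_apply \<gamma>_lin[OF \<Gamma>_tangent[OF a] \<Gamma>_tangent[OF b]] by (simp add: scaleR_fun_def vv_def)
qed

text \<open>Recognises a right field by its data: zero along the source, with target component and
  \<gamma> depending on the target only. It both produces sections and identifies brackets with
  right fields.\<close>

lemma right_invariant:
  assumes v: "v \<in> vector_fields A" "\<And>q. tmap X t (v q) = x (t q)" "\<And>q. tmap X s (v q) = 0" "\<And>q. \<gamma> q [v q] = k (t q)"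
  defines "a \<equiv> \<lambda>y. v (unt P y)"
  shows "a \<in> \<Gamma>" and "anchor P a = x" and "vv a = k" and "right_vf P a = v"
proof -
  show a: "a \<in> \<Gamma>"
    unfolding \<Gamma>_def algebroid_sections_def a_def using vfA[OF v(1)] v(3) cinf_compose[OF X(1) A(1) smooth_unt vf_cinf[OF v(1)]]
    by blast
  show 1: "anchor P a = x" by (rule ext) (simp add: anchor_apply a_def v(2) tgt_unt)
  show 2: "vv a = k" by (rule ext) (simp add: vv_def a_def v(4) tgt_unt)
  show "right_vf P a = v"
    by (rule ext, rule tangent_unique[OF right_vf_props(1)[OF a] vfA[OF v(1)]])
      (simp_all add: right_vf_props[OF a] v(2-4) 1 2)
qed

lemma right_vf_lin:
  assumes b: "b \<in> \<Gamma>" and c: "c \<in> \<Gamma>"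
  shows "right_vf P (r *\<^sub>R b + u *\<^sub>R c) = r *\<^sub>R right_vf P b + u *\<^sub>R right_vf P c"
proof (rule ext, rule tangent_unique)
  fix p
  note R = right_vf_props and a = \<Gamma>_comb[OF b c, of r u]
  show "right_vf P (r *\<^sub>R b + u *\<^sub>R c) p \<in> tangent_space A p" by (rule R(1)[OF a])
  show "(r *\<^sub>R right_vf P b + u *\<^sub>R right_vf P c) p \<in> tangent_space A p"
    unfolding field_comb_apply by (intro subspace_add subspace_scale subspace_tangent_space R(1) b c)
  show "tmap X t (right_vf P (r *\<^sub>R b + u *\<^sub>R c) p) = tmap X t ((r *\<^sub>R right_vf P b + u *\<^sub>R right_vf P c) p)"
    by (simp only: field_comb_apply tmap_add tmap_scaleR R(2)[OF a] R(2)[OF b] R(2)[OF c] anchor_lin)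
  show "tmap X s (right_vf P (r *\<^sub>R b + u *\<^sub>R c) p) = tmap X s ((r *\<^sub>R right_vf P b + u *\<^sub>R right_vf P c) p)"
    by (simp only: field_comb_apply tmap_add tmap_scaleR R(3)[OF a] R(3)[OF b] R(3)[OF c] scaleR_zero_right add_0_left)
  show "\<gamma> p [right_vf P (r *\<^sub>R b + u *\<^sub>R c) p] = \<gamma> p [(r *\<^sub>R right_vf P b + u *\<^sub>R right_vf P c) p]"
    unfolding field_comb_apply \<gamma>_lin[OF R(1)[OF b] R(1)[OF c]] R(4)[OF a] R(4)[OF b] R(4)[OF c] vv_lin[OF b c]
    by (simp add: scaleR_fun_def)
qed

text \<open>\<open>right_vf\<close> is defined point by point. Its smoothness follows because
  \<open>field_exists\<close> yields a smooth field with the same three data.\<close>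

lemma right_vf_field: assumes a: "a \<in> \<Gamma>" shows "right_vf P a \<in> vector_fields A"
proof -
  have "pcompat (anchor P a) 0" using anchor_vertical[OF a] pcompat_0 by blast
  from field_exists[OF anchor_field[OF a] X0 this cinf_compose[OF A(1) X(1) smooth_tgt vv_cinf[OF a]]]
  obtain v where v: "v \<in> vector_fields A" "\<And>q. tmap X t (v q) = anchor P a (t q)"
    "\<And>q. tmap X s (v q) = 0" "\<And>q. \<gamma> q [v q] = vv a (t q)" by auto
  have "right_vf P a = v"
    by (rule ext, rule tangent_unique[OF right_vf_props(1)[OF a] vfA[OF v(1)]])
      (simp_all add: right_vf_props[OF a] v(2-4))
  then show ?thesis using v(1) by simp
qed

lemma left_vf_field: assumes a: "a \<in> \<Gamma>" shows "left_vf P a \<in> vector_fields A"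
proof -
  have "pcompat 0 (anchor P a)" using anchor_vertical[OF a] pcompat_0 by blast
  from field_exists[OF X0 anchor_field[OF a] this cinf_uminus[OF A(1) cinf_compose[OF A(1) X(1) smooth_src vv_cinf[OF a]]]]
  obtain v where v: "v \<in> vector_fields A" "\<And>q. tmap X t (v q) = 0"
    "\<And>q. tmap X s (v q) = anchor P a (s q)" "\<And>q. \<gamma> q [v q] = - vv a (s q)" by auto
  have "left_vf P a = v"
    by (rule ext, rule tangent_unique[OF left_vf_props(1)[OF a] vfA[OF v(1)]])
      (simp_all add: left_vf_props[OF a] v(2-4))
  then show ?thesis using v(1) by simp
qed

text \<open>Verticality of \<open>x\<close> is exactly compatibility with the zero field along the
  source, so \<open>field_exists\<close> gives a right-invariant field with the prescribed
  data.\<close>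

lemma \<Gamma>_exists:
  assumes x: "x \<in> vector_fields X" "\<And>y. tmap M \<pi> (x y) = 0" and k: "k \<in> cinf X"
  obtains a where "a \<in> \<Gamma>" "anchor P a = x" "vv a = k"
proof -
  have "pcompat x 0" using x(2) pcompat_0 by blast
  from field_exists[OF x(1) X0 this cinf_compose[OF A(1) X(1) smooth_tgt k]]
  obtain v where v: "v \<in> vector_fields A" "\<And>q. tmap X t (v q) = x (t q)"
    "\<And>q. tmap X s (v q) = 0" "\<And>q. \<gamma> q [v q] = k (t q)" by auto
  from right_invariant[of v x k, OF v] show thesis using that by blast
qed

lemma v_fun_eq: "a \<in> \<Gamma> \<Longrightarrow> v_fun P \<gamma> a = vv a"
  by (rule ext) (simp add: v_fun_def form_fun_def interior_prod_def right_vf_props(4) tgt_unt)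

text \<open>The right field contributes v_a \<circ> t and the left field - v_a \<circ> s to
  \<gamma>. With \<delta>g = g \<circ> s - g \<circ> t the primitive is - v_a, which is the sign in
  \<kappa>.\<close>

lemma rel_bar: assumes a: "a \<in> \<Gamma>" shows "rel (anchor P a) (bar_vf P a) (- vv a)"
proof (rule relI)
  show "anchor P a \<in> vector_fields X" by (rule anchor_field[OF a])
  show "bar_vf P a \<in> vector_fields A"
    unfolding bar_vf_def by (rule subspace_add[OF subspace_vector_fields[OF A(1)] right_vf_field[OF a] left_vf_field[OF a]])
  show "- vv a \<in> cinf X" by (rule subspace_neg[OF subspace_cinf[OF X(1)] vv_cinf[OF a]])
  have at: "bar_vf P a q = right_vf P a q + left_vf P a q" for q by (simp add: bar_vf_def)
  note R = right_vf_props[OF a] and L = left_vf_props[OF a]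
  fix q
  show "tmap X s (bar_vf P a q) = anchor P a (s q)"
    by (simp only: at tmap_add R(3) L(3) add_0_left)
  show "tmap X t (bar_vf P a q) = anchor P a (t q)"
    by (simp only: at tmap_add R(2) L(2) add_0_right)
  show "\<gamma> q [bar_vf P a q] = (- vv a) (s q) - (- vv a) (t q)"
    unfolding at \<gamma>_add[OF R(1) L(1)] R(4) L(4) by simp
qed

text \<open>\<open>bra\<close> of \<open>mult_vf_lie2\<close> depends on the multiplicative pair
  only through its field on P.\<close>

definition bracket :: "('p \<Rightarrow> 'p tvec) \<Rightarrow> ('x \<Rightarrow> 'p tvec) \<Rightarrow> 'x \<Rightarrow> 'p tvec"
  where "bracket v a = (\<lambda>y. lie_bracket v (right_vf P a) (unt P y))"

text \<open>The right field is zero along the source, so the term of \<delta>B at the source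
  vanishes and \<gamma> of the Lie bracket depends on the target only.
  \<open>right_invariant\<close> then identifies the Lie bracket with the right field of its
  restriction to the units.\<close>

lemma bracket_props:
  assumes r: "rel x v g" and a: "a \<in> \<Gamma>"
  shows bracket_\<Gamma>: "bracket v a \<in> \<Gamma>" and anchor_bracket: "anchor P (bracket v a) = lie_bracket x (anchor P a)"
    and vv_bracket: "vv (bracket v a) = - third x g (anchor P a) (- vv a)"
    and right_vf_bracket: "right_vf P (bracket v a) = lie_bracket v (right_vf P a)"
proof -
  let ?R = "right_vf P a" and ?z = "anchor P a"
  note R = right_vf_props[OF a] and x = rel_x[OF r] and v = rel_v[OF r] and g = rel_g[OF r]
  note Rf = right_vf_field[OF a] and z = anchor_field[OF a]
  have 1: "lie_bracket v ?R \<in> vector_fields A" by (rule lie_bracket_vector_fields[OF A v Rf])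
  have 2: "tmap X t (lie_bracket v ?R q) = lie_bracket x ?z (t q)" for q
    by (rule related_bracket[OF A X smooth_tgt v Rf x z]) (simp_all add: rel_tgt[OF r] R(2))
  have "tmap X s (lie_bracket v ?R q) = lie_bracket x 0 (s q)" for q
    by (rule related_bracket[OF A X smooth_src v Rf x X0]) (simp_all add: rel_src[OF r] R(3))
  then have 3: "tmap X s (lie_bracket v ?R q) = 0" for q by (simp add: lie_bracket_0(1)[OF X x])
  have 4: "\<gamma> q [lie_bracket v ?R q] = (- third x g ?z (- vv a)) (t q)" for q
  proof -
    have t': "u q (\<lambda>q. k (t q)) = tmap X t (u q) k" "u q (\<lambda>q. k (s q)) = tmap X s (u q) k" if "k \<in> cinf X" for u k
      using that by (simp_all add: tmap_apply)
    note gc = cinf_compose[OF A(1) X(1) smooth_src g] cinf_compose[OF A(1) X(1) smooth_tgt g]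
    have i: "v q (\<lambda>q. \<gamma> q [?R q]) = x (t q) (vv a)"
      unfolding R(4) t'[OF vv_cinf[OF a]] rel_tgt[OF r] ..
    have ii: "?R q (\<lambda>q. \<gamma> q [v q]) = - ?z (t q) g"
      unfolding rel_\<gamma>[OF r] tangent_diff[OF A(1) R(1) gc] t'[OF g] R(2,3) by simp
    have iii: "B (s q) [tmap X s (v q), tmap X s (?R q)] = 0"
      unfolding R(3) rel_src[OF r] by (rule B_0(1)[OF vfX[OF x]])
    have iv: "x (t q) (- vv a) = - x (t q) (vv a)"
      using tangent_cmult[OF X(1) vfX[OF x] vv_cinf[OF a], of "t q" "-1"] by (simp add: fun_Compl_def)
    show ?thesis
      using d\<gamma>[OF v Rf, of q] unfolding i ii iii by (simp add: third_def rel_tgt[OF r] R(2) iv)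
  qed
  note * = right_invariant[where v="lie_bracket v ?R" and x="lie_bracket x ?z" and k="- third x g ?z (- vv a)", OF 1 2 3 4,
      folded bracket_def]
  show "bracket v a \<in> \<Gamma>" "anchor P (bracket v a) = lie_bracket x ?z" "vv (bracket v a) = - third x g ?z (- vv a)"
    "right_vf P (bracket v a) = lie_bracket v ?R"
    by (fact *)+
qed

end

lemma lie_2_algebraI:
  assumes "subspace (V0 L)" "subspace (V1 L)" "linear_on (V1 L) (V0 L) (dd L)" "skew_bilinear_on (V0 L) (br L)"
    "bilinear_on (V0 L) (V1 L) (V1 L) (bra L)" "alternating_trilinear_on (V0 L) (V1 L) (jac L)"
    "\<And>x a. x \<in> V0 L \<Longrightarrow> a \<in> V1 L \<Longrightarrow> dd L (bra L x a) = br L x (dd L a)"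
    "\<And>a b. a \<in> V1 L \<Longrightarrow> b \<in> V1 L \<Longrightarrow> bra L (dd L a) b = - bra L (dd L b) a"
    "\<And>x y z. x \<in> V0 L \<Longrightarrow> y \<in> V0 L \<Longrightarrow> z \<in> V0 L \<Longrightarrow>
       dd L (jac L x y z) = br L x (br L y z) + br L y (br L z x) + br L z (br L x y)"
    "\<And>x y a. x \<in> V0 L \<Longrightarrow> y \<in> V0 L \<Longrightarrow> a \<in> V1 L \<Longrightarrow>
       jac L x y (dd L a) = bra L x (bra L y a) + bra L y (- bra L x a) + (- bra L (br L x y) a)"
    "\<And>x1 x2 x3 x4. x1 \<in> V0 L \<Longrightarrow> x2 \<in> V0 L \<Longrightarrow> x3 \<in> V0 L \<Longrightarrow> x4 \<in> V0 L \<Longrightarrow>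
       bra L x1 (jac L x2 x3 x4) - bra L x2 (jac L x1 x3 x4)
       + bra L x3 (jac L x1 x2 x4) - bra L x4 (jac L x1 x2 x3)
       - jac L (br L x1 x2) x3 x4 + jac L (br L x1 x3) x2 x4 - jac L (br L x1 x4) x2 x3
       - jac L (br L x2 x3) x1 x4 + jac L (br L x2 x4) x1 x3 - jac L (br L x3 x4) x1 x2 = 0"
  shows "lie_2_algebra L"
  unfolding lie_2_algebra_def by (intro conjI ballI) (rule assms; assumption?)+

context gerbe
begin

section \<open>The axioms of the strict Lie 2-algebra\<close>

lemma rel_0: "rel 0 0 0"
proof -
  note r = rel_bar[OF subspace_0[OF \<Gamma>_subspace]]
  from rel_comb[OF r r, of 0 0] show ?thesis by simp
qed

lemma rel_unique_third: "rel x v g \<Longrightarrow> rel x' v' g' \<Longrightarrow> x = x' \<Longrightarrow> g = g' \<Longrightarrow> v = v'"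
  using rel_unique by blast

lemma bar_lin:
  assumes "a \<in> \<Gamma>" "b \<in> \<Gamma>" shows "bar_vf P (c *\<^sub>R a + d *\<^sub>R b) = c *\<^sub>R bar_vf P a + d *\<^sub>R bar_vf P b"
  by (rule rel_unique_third[OF rel_bar[OF \<Gamma>_comb[OF assms]] rel_comb[OF rel_bar[OF assms(1)] rel_bar[OF assms(2)]] anchor_lin])
    (simp add: vv_lin[OF assms])

lemma bracket_lin_right:
  assumes r: "rel x v g" and a: "a \<in> \<Gamma>" "b \<in> \<Gamma>"
  shows "bracket v (c *\<^sub>R a + d *\<^sub>R b) = c *\<^sub>R bracket v a + d *\<^sub>R bracket v b"
  by (rule ext) (simp only: bracket_def right_vf_lin[OF a] field_comb_apply
      lie_bracket_lin_right[OF A right_vf_field[OF a(1)] right_vf_field[OF a(2)] rel_v[OF r]])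

lemma bracket_lin_left:
  assumes r: "rel x v g" "rel z w h" and a: "a \<in> \<Gamma>"
  shows "bracket (c *\<^sub>R v + d *\<^sub>R w) a = c *\<^sub>R bracket v a + d *\<^sub>R bracket w a"
  by (rule ext) (simp only: bracket_def field_comb_apply
      lie_bracket_lin[OF A rel_v[OF r(1)] rel_v[OF r(2)] right_vf_field[OF a]])

lemma anchor_minus: "anchor P (- a) = - anchor P a"
  using anchor_lin[of "-1" a 0 a] by simp

lemma vv_minus: "a \<in> \<Gamma> \<Longrightarrow> vv (- a) = - vv a"
  using vv_lin[of a a "-1" 0] by simp

lemma third_skew: "x \<in> vector_fields X \<Longrightarrow> z \<in> vector_fields X \<Longrightarrow> third x g z h = - third z h x g"
proof
  fix y assume "x \<in> vector_fields X" "z \<in> vector_fields X"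
  from B_skew[OF vfX[OF this(1)] vfX[OF this(2)], of y] show "third x g z h y = (- third z h x g) y"
    by (simp add: third_def)
qed

text \<open>Sections are compared through anchor and \<open>vv\<close>, which reduces the claim to
  skew-symmetry of the Lie bracket on X and of \<open>third\<close>.\<close>

lemma bracket_skew:
  assumes a: "a \<in> \<Gamma>" and b: "b \<in> \<Gamma>" shows "bracket (bar_vf P a) b = - bracket (bar_vf P b) a"
proof (rule \<Gamma>_eqI)
  note ra = rel_bar[OF a] and rb = rel_bar[OF b]
  show "bracket (bar_vf P a) b \<in> \<Gamma>" by (rule bracket_\<Gamma>[OF ra b])
  have c: "bracket (bar_vf P b) a \<in> \<Gamma>" by (rule bracket_\<Gamma>[OF rb a])
  then show "- bracket (bar_vf P b) a \<in> \<Gamma>" by (rule subspace_neg[OF \<Gamma>_subspace])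
  show "anchor P (bracket (bar_vf P a) b) = anchor P (- bracket (bar_vf P b) a)"
    unfolding anchor_minus anchor_bracket[OF ra b] anchor_bracket[OF rb a] by (rule lie_bracket_skew[OF X])
  show "vv (bracket (bar_vf P a) b) = vv (- bracket (bar_vf P b) a)"
    unfolding vv_minus[OF c] vv_bracket[OF ra b] vv_bracket[OF rb a]
    by (rule arg_cong[OF third_skew[OF anchor_field[OF a] anchor_field[OF b]]])
qed

text \<open>Both sides are fields on P with the same \<open>x\<close> and the same function, hence
  equal.\<close>

lemma bar_bracket:
  assumes r: "rel x v g" and a: "a \<in> \<Gamma>" shows "bar_vf P (bracket v a) = lie_bracket v (bar_vf P a)"
  by (rule rel_unique_third[OF rel_bar[OF bracket_\<Gamma>[OF r a]] rel_bracket[OF r rel_bar[OF a]] anchor_bracket[OF r a]])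
    (simp add: vv_bracket[OF r a] del: fun_Compl_def)

text \<open>The Jacobi identity on P for \<open>v\<close>, \<open>w\<close> and the right field of
  \<open>a\<close>; \<open>right_vf_bracket\<close> allows the inner bracket to be replaced by a
  right field.\<close>

lemma bracket_bracket:
  assumes r: "rel x v g" "rel z w h" and a: "a \<in> \<Gamma>"
  shows "bracket (lie_bracket v w) a = bracket v (bracket w a) - bracket w (bracket v a)"
proof
  fix y
  let ?R = "right_vf P a"
  note v = rel_v[OF r(1)] and w = rel_v[OF r(2)] and R = right_vf_field[OF a]
  note l = lie_bracket_vector_fields[OF A]
  have 1: "lie_bracket w (lie_bracket ?R v) = - lie_bracket w (lie_bracket v ?R)"
    unfolding lie_bracket_skew[OF A, of ?R v] by (rule lie_bracket_minus_right[OF A w l[OF v R]])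
  have 2: "lie_bracket ?R (lie_bracket v w) = - lie_bracket (lie_bracket v w) ?R" by (rule lie_bracket_skew[OF A])
  have "lie_bracket (lie_bracket v w) ?R = lie_bracket v (lie_bracket w ?R) - lie_bracket w (lie_bracket v ?R)"
    using jacobi[OF A v w R] unfolding 1 2 by (simp add: algebra_simps)
  then show "bracket (lie_bracket v w) a y = (bracket v (bracket w a) - bracket w (bracket v a)) y"
    by (simp add: bracket_def right_vf_bracket[OF r(1) a, unfolded bracket_def] right_vf_bracket[OF r(2) a, unfolded bracket_def])
qed

abbreviation "L \<equiv> mult_vf_lie2 P"

lemma L_simps:
  shows V0_L: "V0 L = multiplicative_vfs P" and V1_L: "V1 L = \<Gamma>" and dd_L: "dd L a = (anchor P a, bar_vf P a)"
    and br_L: "br L (x, v) (z, w) = (lie_bracket x z, lie_bracket v w)"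
    and bra_L: "bra L (x, v) a = bracket v a" and jac_L: "jac L e1 e2 e3 = 0"
  by (simp_all add: mult_vf_lie2_def \<Gamma>_def bracket_def)

lemma V0_E:
  assumes "e \<in> V0 L" obtains x v g where "e = (x, v)" "rel x v g"
  using assms multiplicative_rel by (cases e) (auto simp: V0_L)

lemma V0_I: "rel x v g \<Longrightarrow> (x, v) \<in> V0 L"
  using multiplicative_rel by (auto simp: V0_L)

lemma dd_L_linear: "linear_on (V1 L) (V0 L) (dd L)"
  unfolding linear_on_def V1_L dd_L
  by (intro conjI image_subsetI ballI allI) (simp_all add: V0_I[OF rel_bar] anchor_lin bar_lin)

lemma V0_subspace: "subspace (V0 L)"
proof (rule subspaceI)
  show "0 \<in> V0 L" using V0_I[OF rel_0] by (simp add: zero_prod_def)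
  show "e + e' \<in> V0 L" if e: "e \<in> V0 L" and e': "e' \<in> V0 L" for e e'
  proof -
    obtain x v g where 1: "e = (x, v)" "rel x v g" by (rule V0_E[OF e])
    obtain z w h where 2: "e' = (z, w)" "rel z w h" by (rule V0_E[OF e'])
    show ?thesis using V0_I[OF rel_comb[OF 1(2) 2(2), of 1 1]] by (simp add: 1(1) 2(1))
  qed
  show "c *\<^sub>R e \<in> V0 L" if e: "e \<in> V0 L" for c e
  proof -
    obtain x v g where 1: "e = (x, v)" "rel x v g" by (rule V0_E[OF e])
    show ?thesis using V0_I[OF rel_comb[OF 1(2) 1(2), of c 0]] by (simp add: 1(1))
  qed
qed

lemma br_L_skew_bilinear: "skew_bilinear_on (V0 L) (br L)"
proof (rule skew_bilinear_onI[OF V0_subspace])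
  fix e e' assume e: "e \<in> V0 L" and e': "e' \<in> V0 L"
  obtain x v g where 1: "e = (x, v)" "rel x v g" by (rule V0_E[OF e])
  obtain z w h where 2: "e' = (z, w)" "rel z w h" by (rule V0_E[OF e'])
  show "br L e e' \<in> V0 L" unfolding 1(1) 2(1) br_L by (rule V0_I[OF rel_bracket[OF 1(2) 2(2)]])
  show "br L e e' = - br L e' e"
    unfolding 1(1) 2(1) br_L using lie_bracket_skew[OF X, of x z] lie_bracket_skew[OF A, of v w] by simp
next
  fix e e' f c d assume e: "e \<in> V0 L" and e': "e' \<in> V0 L" and f: "f \<in> V0 L"
  obtain x v g where 1: "e = (x, v)" "rel x v g" by (rule V0_E[OF e])
  obtain z w h where 2: "e' = (z, w)" "rel z w h" by (rule V0_E[OF e'])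
  obtain y u k where 3: "f = (y, u)" "rel y u k" by (rule V0_E[OF f])
  show "br L (c *\<^sub>R e + d *\<^sub>R e') f = c *\<^sub>R br L e f + d *\<^sub>R br L e' f"
    unfolding 1(1) 2(1) 3(1)
    by (simp only: scaleR_Pair add_Pair br_L lie_bracket_lin[OF X rel_x[OF 1(2)] rel_x[OF 2(2)] rel_x[OF 3(2)]]
        lie_bracket_lin[OF A rel_v[OF 1(2)] rel_v[OF 2(2)] rel_v[OF 3(2)]])
qed

lemma bra_L_bilinear: "bilinear_on (V0 L) (V1 L) (V1 L) (bra L)"
  unfolding bilinear_on_def linear_on_def V1_L
proof (intro conjI ballI allI image_subsetI)
  fix e a assume e: "e \<in> V0 L" and a: "a \<in> \<Gamma>"
  obtain x v g where 1: "e = (x, v)" "rel x v g" by (rule V0_E[OF e])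
  show "bra L e a \<in> \<Gamma>" unfolding 1(1) bra_L by (rule bracket_\<Gamma>[OF 1(2) a])
  then show "bra L e a \<in> \<Gamma>" .
  fix b c d assume b: "b \<in> \<Gamma>"
  show "bra L e (c *\<^sub>R a + d *\<^sub>R b) = c *\<^sub>R bra L e a + d *\<^sub>R bra L e b"
    unfolding 1(1) bra_L by (rule bracket_lin_right[OF 1(2) a b])
next
  fix e e' a c d assume e: "e \<in> V0 L" and e': "e' \<in> V0 L" and a: "a \<in> \<Gamma>"
  obtain x v g where 1: "e = (x, v)" "rel x v g" by (rule V0_E[OF e])
  obtain z w h where 2: "e' = (z, w)" "rel z w h" by (rule V0_E[OF e'])
  show "bra L (c *\<^sub>R e + d *\<^sub>R e') a = c *\<^sub>R bra L e a + d *\<^sub>R bra L e' a"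
    unfolding 1(1) 2(1) by (simp only: scaleR_Pair add_Pair bra_L bracket_lin_left[OF 1(2) 2(2) a])
qed

lemma lie_2_algebra_L: "lie_2_algebra L"
proof (rule lie_2_algebraI[OF V0_subspace _ dd_L_linear br_L_skew_bilinear bra_L_bilinear])
  show s: "subspace (V1 L)" unfolding V1_L by (rule \<Gamma>_subspace)
  show "alternating_trilinear_on (V0 L) (V1 L) (jac L)"
    using subspace_0[OF s] by (auto simp: alternating_trilinear_on_def linear_on_def jac_L)
  show "dd L (bra L e a) = br L e (dd L a)" if e: "e \<in> V0 L" and a: "a \<in> V1 L" for e a
  proof -
    obtain x v g where 1: "e = (x, v)" "rel x v g" by (rule V0_E[OF e])
    show ?thesis
      unfolding 1(1) dd_L bra_L br_L anchor_bracket[OF 1(2) a[unfolded V1_L]] bar_bracket[OF 1(2) a[unfolded V1_L]] ..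
  qed
  show "bra L (dd L a) b = - bra L (dd L b) a" if "a \<in> V1 L" "b \<in> V1 L" for a b
    unfolding dd_L bra_L by (rule bracket_skew) (use that in \<open>simp_all add: V1_L\<close>)
  have d0: "dd L 0 = 0" by (rule linear_on_0[OF dd_L_linear subspace_0[OF s]])
  show "dd L (jac L e e' f) = br L e (br L e' f) + br L e' (br L f e) + br L f (br L e e')"
    if e: "e \<in> V0 L" and e': "e' \<in> V0 L" and f: "f \<in> V0 L" for e e' f
  proof -
    obtain x v g where 1: "e = (x, v)" "rel x v g" by (rule V0_E[OF e])
    obtain z w h where 2: "e' = (z, w)" "rel z w h" by (rule V0_E[OF e'])
    obtain y u k where 3: "f = (y, u)" "rel y u k" by (rule V0_E[OF f])
    show ?thesis
      unfolding jac_L d0 1(1) 2(1) 3(1) br_L add_Pair jacobi[OF X rel_x[OF 1(2)] rel_x[OF 2(2)] rel_x[OF 3(2)]]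
        jacobi[OF A rel_v[OF 1(2)] rel_v[OF 2(2)] rel_v[OF 3(2)]] zero_prod_def ..
  qed
  show "jac L e e' (dd L a) = bra L e (bra L e' a) + bra L e' (- bra L e a) + - bra L (br L e e') a"
    if e: "e \<in> V0 L" and e': "e' \<in> V0 L" and "a \<in> V1 L" for e e' a
  proof -
    have a: "a \<in> \<Gamma>" using that(3) by (simp add: V1_L)
    obtain x v g where 1: "e = (x, v)" "rel x v g" by (rule V0_E[OF e])
    obtain z w h where 2: "e' = (z, w)" "rel z w h" by (rule V0_E[OF e'])
    have m: "bracket w (- b) = - bracket w b" if "b \<in> \<Gamma>" for b
      using bracket_lin_right[OF 2(2) that that, of "-1" 0] by simp
    show ?thesis
      unfolding 1(1) 2(1) br_L bra_L jac_L m[OF bracket_\<Gamma>[OF 1(2) a]] bracket_bracket[OF 1(2) 2(2) a] by simp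
  qed
  have b0: "bra L e 0 = 0" if "e \<in> V0 L" for e
    by (rule linear_on_0[OF bspec[OF bra_L_bilinear[unfolded bilinear_on_def, THEN conjunct1] that] subspace_0[OF s]])
  show "bra L x1 (jac L x2 x3 x4) - bra L x2 (jac L x1 x3 x4)
       + bra L x3 (jac L x1 x2 x4) - bra L x4 (jac L x1 x2 x3)
       - jac L (br L x1 x2) x3 x4 + jac L (br L x1 x3) x2 x4 - jac L (br L x1 x4) x2 x3
       - jac L (br L x2 x3) x1 x4 + jac L (br L x2 x4) x1 x3 - jac L (br L x3 x4) x1 x2 = 0"
    if "x1 \<in> V0 L" "x2 \<in> V0 L" "x3 \<in> V0 L" "x4 \<in> V0 L" for x1 x2 x3 x4
    unfolding jac_L b0[OF that(1)] b0[OF that(2)] b0[OF that(3)] b0[OF that(4)] by simp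
qed

section \<open>Projection to the base\<close>

abbreviation "pr \<equiv> projected_vf M \<pi>"

lemma pr_eq:
  assumes z: "z \<in> vector_fields M" and x: "\<And>y. tmap M \<pi> (x y) = z (\<pi> y)" shows "pr x = z"
  unfolding projected_vf_def
proof (rule the_equality)
  show "projects_to M \<pi> x z" using z x by (simp add: projects_to_def)
  fix w assume w: "projects_to M \<pi> x w"
  show "w = z"
  proof
    fix m
    obtain y where "\<pi> y = m" using submersion_surj[OF X M submersions(3)] by blast
    then show "w m = z m" using w x[of y] unfolding projects_to_def by metis
  qed
qed

text \<open>Two points of a fibre of \<pi> are joined by an arrow \<open>q\<close>. Pushing
  \<open>v q\<close> to M through target and through source gives the same vector, so the projection
  is constant on fibres.\<close>

lemma rel_project:
  assumes r: "rel x v g"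
  shows pr_field: "pr x \<in> vector_fields M" and pr_apply: "tmap M \<pi> (x y) = pr x (\<pi> y)"
proof -
  have "tmap M \<pi> (x y) = tmap M \<pi> (x z)" if yz: "\<pi> y = \<pi> z" for y z
  proof -
    obtain q where q: "t q = y" "s q = z" using \<pi>_connected[OF yz] by blast
    have "tmap M \<pi> (tmap X t (v q)) = tmap M \<pi> (tmap X s (v q))"
      unfolding tmap_compose[OF X(1) M(1) smooth_\<pi>] by (simp add: \<pi>_arrow)
    then show ?thesis unfolding rel_tgt[OF r] rel_src[OF r] q .
  qed
  then obtain z where z: "z \<in> vector_fields M" "\<And>y. tmap M \<pi> (x y) = z (\<pi> y)"
    using vector_field_descend[OF X M submersions(3) rel_x[OF r]] by blast
  have "pr x = z" by (rule pr_eq[OF z])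
  then show "pr x \<in> vector_fields M" "tmap M \<pi> (x y) = pr x (\<pi> y)" for y using z by simp_all
qed

lemma pr_comb:
  assumes r: "rel x v g" "rel z w h" shows "pr (c *\<^sub>R x + d *\<^sub>R z) = c *\<^sub>R pr x + d *\<^sub>R pr z"
  by (rule pr_eq[OF vf_comb[OF M pr_field[OF r(1)] pr_field[OF r(2)]]])
    (simp only: field_comb_apply tmap_add tmap_scaleR pr_apply[OF r(1)] pr_apply[OF r(2)])

lemma pr_bracket:
  assumes r: "rel x v g" "rel z w h" shows "pr (lie_bracket x z) = lie_bracket (pr x) (pr z)"
  by (rule pr_eq[OF lie_bracket_vector_fields[OF M pr_field[OF r(1)] pr_field[OF r(2)]]],
      rule related_bracket[OF X M smooth_\<pi> rel_x[OF r(1)] rel_x[OF r(2)] pr_field[OF r(1)] pr_field[OF r(2)]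
        pr_apply[OF r(1)] pr_apply[OF r(2)]])

lemma pr_vertical: "(\<And>y. tmap M \<pi> (x y) = 0) \<Longrightarrow> pr x = 0"
  by (rule pr_eq[OF subspace_0[OF subspace_vector_fields[OF M(1)]]]) simp

text \<open>Surjectivity of \<rho>: a lift of \<open>z\<close> to X is lifted further to P with
  \<gamma> = 0, so that the zero function is a primitive.\<close>

lemma rel_lift:
  assumes z: "z \<in> vector_fields M" obtains x v where "rel x v 0" "pr x = z"
proof -
  obtain x where x: "x \<in> vector_fields X" "\<And>y. tmap M \<pi> (x y) = z (\<pi> y)"
    using vector_field_lift[OF X M submersions(3) z] by blast
  have "pcompat x x" by (simp add: pcompat_def x(2))
  from field_exists[OF x(1) x(1) this cinf_const[OF A(1), of 0]]
  obtain v where v: "v \<in> vector_fields A" "\<And>q. tmap X t (v q) = x (t q)" "\<And>q. tmap X s (v q) = x (s q)"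
    "\<And>q. \<gamma> q [v q] = 0" by auto
  have "rel x v 0"
    by (rule relI[OF x(1) v(1) subspace_0[OF subspace_cinf[OF X(1)]]]) (simp_all only: v zero_fun_apply diff_self)
  then show thesis using that pr_eq[OF z x(2)] by blast
qed

section \<open>The bracket on \<open>G\<close>\<close>

text \<open>\<open>G\<close>, \<open>bG\<close>, \<open>pull\<close> and \<open>prG\<close> are the
  space, the bracket, \<lambda> and \<rho> of the theorem. Membership is phrased by
  \<open>rel\<close>; \<open>G_eq\<close> recovers the original description.\<close>

definition "G = {(x, v, g). rel x v g}"

definition "bG = (\<lambda>(x, pv, g) (z, rv, h). (lie_bracket x z, lie_bracket pv rv,
  lie_deriv x h - lie_deriv z g - form_fun (interior_prod z (interior_prod x B))))"

definition pull :: "('m \<Rightarrow> real) \<Rightarrow> ('x \<Rightarrow> 'x tvec) \<times> ('p \<Rightarrow> 'p tvec) \<times> ('x \<Rightarrow> real)"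
  where "pull f = (0, 0, f \<circ> \<pi>)"

definition "prG = (\<lambda>(x :: 'x \<Rightarrow> 'x tvec, pv :: 'p \<Rightarrow> 'p tvec, g :: 'x \<Rightarrow> real). pr x)"

lemma bG_simp: "bG (x, v, g) (z, w, h) = (lie_bracket x z, lie_bracket v w, third x g z h)"
  by (simp add: bG_def third_def lie_deriv_def form_fun_def interior_prod_def fun_eq_iff)

lemma prG_simp: "prG (x, v, g) = pr x"
  by (simp add: prG_def)

lemma G_I: "rel x v g \<Longrightarrow> (x, v, g) \<in> G" by (simp add: G_def)

lemma G_E: assumes "e \<in> G" obtains x v g where "e = (x, v, g)" "rel x v g"
  using assms by (auto simp: G_def)

lemma G_subspace: "subspace G"
proof (rule subspaceI)
  show "0 \<in> G" using G_I[OF rel_0] by (simp add: zero_prod_def)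
  show "e + e' \<in> G" if e: "e \<in> G" and e': "e' \<in> G" for e e'
  proof -
    obtain x v g where 1: "e = (x, v, g)" "rel x v g" by (rule G_E[OF e])
    obtain z w h where 2: "e' = (z, w, h)" "rel z w h" by (rule G_E[OF e'])
    show ?thesis using G_I[OF rel_comb[OF 1(2) 2(2), of 1 1]] by (simp add: 1(1) 2(1))
  qed
  show "c *\<^sub>R e \<in> G" if e: "e \<in> G" for c e
  proof -
    obtain x v g where 1: "e = (x, v, g)" "rel x v g" by (rule G_E[OF e])
    show ?thesis using G_I[OF rel_comb[OF 1(2) 1(2), of c 0]] by (simp add: 1(1))
  qed
qed

lemma third_lin:
  assumes r: "rel x v g" "rel z w h" "rel y u k"
  shows "third (c *\<^sub>R x + d *\<^sub>R z) (c *\<^sub>R g + d *\<^sub>R h) y k = c *\<^sub>R third x g y k + d *\<^sub>R third z h y k"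
proof
  fix p
  have 1: "c *\<^sub>R g + d *\<^sub>R h = (\<lambda>q. c * g q + d * h q)" by (simp add: fun_eq_iff scaleR_fun_def)
  have 2: "y p (c *\<^sub>R g + d *\<^sub>R h) = c * y p g + d * y p h"
    unfolding 1 by (rule tangent_lin[OF vfX[OF rel_x[OF r(3)]] rel_g[OF r(1)] rel_g[OF r(2)]])
  show "third (c *\<^sub>R x + d *\<^sub>R z) (c *\<^sub>R g + d *\<^sub>R h) y k p = (c *\<^sub>R third x g y k + d *\<^sub>R third z h y k) p"
    unfolding third_def 2 comb_apply
      field_comb_apply B_lin1[OF vfX[OF rel_x[OF r(1)]] vfX[OF rel_x[OF r(2)]] vfX[OF rel_x[OF r(3)]]]
    by (simp add: scaleR_fun_def algebra_simps)
qed

lemma bG_skew_bilinear: "skew_bilinear_on G bG"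
proof (rule skew_bilinear_onI[OF G_subspace])
  fix e e' assume e: "e \<in> G" and e': "e' \<in> G"
  obtain x v g where 1: "e = (x, v, g)" "rel x v g" by (rule G_E[OF e])
  obtain z w h where 2: "e' = (z, w, h)" "rel z w h" by (rule G_E[OF e'])
  show "bG e e' \<in> G" unfolding 1(1) 2(1) bG_simp by (rule G_I[OF rel_bracket[OF 1(2) 2(2)]])
  show "bG e e' = - bG e' e"
    unfolding 1(1) 2(1) bG_simp using lie_bracket_skew[OF X, of x z] lie_bracket_skew[OF A, of v w]
      third_skew[OF rel_x[OF 1(2)] rel_x[OF 2(2)], of g h] by (simp del: fun_Compl_def)
next
  fix e e' f c d assume e: "e \<in> G" and e': "e' \<in> G" and f: "f \<in> G"
  obtain x v g where 1: "e = (x, v, g)" "rel x v g" by (rule G_E[OF e])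
  obtain z w h where 2: "e' = (z, w, h)" "rel z w h" by (rule G_E[OF e'])
  obtain y u k where 3: "f = (y, u, k)" "rel y u k" by (rule G_E[OF f])
  show "bG (c *\<^sub>R e + d *\<^sub>R e') f = c *\<^sub>R bG e f + d *\<^sub>R bG e' f"
    unfolding 1(1) 2(1) 3(1)
    by (simp only: scaleR_Pair add_Pair bG_simp lie_bracket_lin[OF X rel_x[OF 1(2)] rel_x[OF 2(2)] rel_x[OF 3(2)]]
        lie_bracket_lin[OF A rel_v[OF 1(2)] rel_v[OF 2(2)] rel_v[OF 3(2)]] third_lin[OF 1(2) 2(2) 3(2)])
qed

lemma prG_props:
  assumes e: "e \<in> G" and e': "e' \<in> G"
  shows prG_field: "prG e \<in> vector_fields M" and prG_bracket: "prG (bG e e') = lie_bracket (prG e) (prG e')"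
    and prG_lin: "prG (c *\<^sub>R e + d *\<^sub>R e') = c *\<^sub>R prG e + d *\<^sub>R prG e'"
proof -
  obtain x v g where 1: "e = (x, v, g)" "rel x v g" by (rule G_E[OF e])
  obtain z w h where 2: "e' = (z, w, h)" "rel z w h" by (rule G_E[OF e'])
  show "prG e \<in> vector_fields M" unfolding 1(1) prG_simp by (rule pr_field[OF 1(2)])
  show "prG (bG e e') = lie_bracket (prG e) (prG e')"
    unfolding 1(1) 2(1) bG_simp prG_simp by (rule pr_bracket[OF 1(2) 2(2)])
  show "prG (c *\<^sub>R e + d *\<^sub>R e') = c *\<^sub>R prG e + d *\<^sub>R prG e'"
    unfolding 1(1) 2(1) by (simp only: scaleR_Pair add_Pair prG_simp pr_comb[OF 1(2) 2(2)])
qed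

lemma prG_surj: assumes "z \<in> vector_fields M" obtains e where "e \<in> G" "prG e = z"
proof -
  obtain x v where "rel x v 0" "pr x = z" by (rule rel_lift[OF assms])
  then show thesis using that[of "(x, v, 0)"] by (simp add: G_I prG_simp)
qed

lemma pull_G: assumes f: "f \<in> cinf M" shows "pull f \<in> G"
  unfolding pull_def
proof (rule G_I, rule relI)
  show "f \<circ> \<pi> \<in> cinf X" using cinf_compose[OF X(1) M(1) smooth_\<pi> f] by (simp add: comp_def)
  show "(0 :: 'p \<Rightarrow> 'p tvec) \<in> vector_fields A" by (rule subspace_0[OF subspace_vector_fields[OF A(1)]])
qed (simp_all only: X0 zero_fun_apply tmap_0 \<gamma>_0 comp_def \<pi>_arrow diff_self)

lemma pull_lin: "pull (c *\<^sub>R f + d *\<^sub>R g) = c *\<^sub>R pull f + d *\<^sub>R pull g"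
  by (simp add: pull_def scaleR_fun_def fun_eq_iff)

lemma pull_add: "pull f + pull g = pull (f + g)" and pull_diff: "pull f - pull g = pull (f - g)"
  by (simp_all add: pull_def fun_eq_iff)

lemma pull_inj: assumes "pull f = pull g" shows "f = g"
proof
  fix m
  obtain y where y: "\<pi> y = m" using submersion_surj[OF X M submersions(3)] by blast
  have "f \<circ> \<pi> = g \<circ> \<pi>" using assms by (simp add: pull_def)
  from fun_cong[OF this, of y] show "f m = g m" by (simp add: y)
qed

text \<open>\<open>pull f\<close> has zero fields, so only the derivative along \<open>x\<close>
  survives, and \<open>x\<close> acts on f \<circ> \<pi> through its projection.\<close>

lemma bG_pull:
  assumes e: "e \<in> G" and f: "f \<in> cinf M" shows "bG e (pull f) = pull (lie_deriv (prG e) f)"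
proof -
  obtain x v g where 1: "e = (x, v, g)" "rel x v g" by (rule G_E[OF e])
  have "x y (f \<circ> \<pi>) = pr x (\<pi> y) f" for y
    using fun_cong[OF pr_apply[OF 1(2), of y], of f] f by (simp add: tmap_apply comp_def)
  then have "third x g 0 (f \<circ> \<pi>) = lie_deriv (pr x) f \<circ> \<pi>"
    using B_0(1)[OF vfX[OF rel_x[OF 1(2)]]] by (simp add: third_def fun_eq_iff lie_deriv_def del: zero_fun_apply) simp
  then show ?thesis
    unfolding 1(1) pull_def bG_simp prG_simp lie_bracket_0(1)[OF X rel_x[OF 1(2)]] lie_bracket_0(1)[OF A rel_v[OF 1(2)]] by simp
qed

section \<open>The Atiyah Lie 2-algebra\<close>

abbreviation "W \<equiv> atiyah_lie2 M \<Omega>"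

lemma W_simps:
  shows V0_W: "V0 W = vector_fields M" and V1_W: "V1 W = cinf M" and dd_W: "dd W f = 0"
    and br_W: "br W x z = lie_bracket x z" and bra_W: "bra W x f = lie_deriv x f"
    and jac_W: "jac W x1 x2 x3 = (\<lambda>m. - \<Omega> m [x1 m, x2 m, x3 m])"
  by (simp_all add: atiyah_lie2_def form_fun_def interior_prod_def fun_eq_iff)

lemma \<Omega>_forms: "\<Omega> \<in> forms M 3" using three_curvature by (simp add: three_curvature_def)

lemma \<Omega>_props:
  assumes v: "v \<in> tangent_space M m" "v' \<in> tangent_space M m" "u \<in> tangent_space M m" "w \<in> tangent_space M m"
  shows \<Omega>_lin1: "\<Omega> m [a *\<^sub>R v + b *\<^sub>R v', u, w] = a * \<Omega> m [v, u, w] + b * \<Omega> m [v', u, w]"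
    and \<Omega>_lin2: "\<Omega> m [u, a *\<^sub>R v + b *\<^sub>R v', w] = a * \<Omega> m [u, v, w] + b * \<Omega> m [u, v', w]"
    and \<Omega>_lin3: "\<Omega> m [u, w, a *\<^sub>R v + b *\<^sub>R v'] = a * \<Omega> m [u, w, v] + b * \<Omega> m [u, w, v']"
    and \<Omega>_alt1: "\<Omega> m [v, v, w] = 0" and \<Omega>_alt2: "\<Omega> m [v, w, v] = 0" and \<Omega>_alt3: "\<Omega> m [w, v, v] = 0"
proof -
  have *: "\<forall>p\<in>pts M. \<forall>vs. length vs = 3 \<and> set vs \<subseteq> tangent_space M p \<longrightarrow>
       (\<forall>i<3. \<forall>v\<in>tangent_space M p. \<forall>w\<in>tangent_space M p. \<forall>a b.
          \<Omega> p (vs[i := a *\<^sub>R v + b *\<^sub>R w]) = a * \<Omega> p (vs[i := v]) + b * \<Omega> p (vs[i := w])) \<and>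
       (\<not> distinct vs \<longrightarrow> \<Omega> p vs = 0)"
    using \<Omega>_forms unfolding forms_def mem_Collect_eq by (elim conjE)
  have m: "m \<in> pts M" using M(2) by simp
  have 1: "(\<forall>i<3. \<forall>v\<in>tangent_space M m. \<forall>w\<in>tangent_space M m. \<forall>a b.
          \<Omega> m (vs[i := a *\<^sub>R v + b *\<^sub>R w]) = a * \<Omega> m (vs[i := v]) + b * \<Omega> m (vs[i := w])) \<and>
       (\<not> distinct vs \<longrightarrow> \<Omega> m vs = 0)" if "length vs = 3 \<and> set vs \<subseteq> tangent_space M m" for vs
    using *[rule_format, OF m that] by simp
  show "\<Omega> m [a *\<^sub>R v + b *\<^sub>R v', u, w] = a * \<Omega> m [v, u, w] + b * \<Omega> m [v', u, w]"
    using 1[of "[v, u, w]", THEN conjunct1, rule_format, of 0 v v' a b] v by simp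
  show "\<Omega> m [u, a *\<^sub>R v + b *\<^sub>R v', w] = a * \<Omega> m [u, v, w] + b * \<Omega> m [u, v', w]"
    using 1[of "[u, v, w]", THEN conjunct1, rule_format, of 1 v v' a b] v by simp
  show "\<Omega> m [u, w, a *\<^sub>R v + b *\<^sub>R v'] = a * \<Omega> m [u, w, v] + b * \<Omega> m [u, w, v']"
    using 1[of "[u, w, v]", THEN conjunct1, rule_format, of 2 v v' a b] v by (simp add: numeral_2_eq_2)
  show "\<Omega> m [v, v, w] = 0" "\<Omega> m [v, w, v] = 0" "\<Omega> m [w, v, v] = 0"
    using 1[of "[v, v, w]"] 1[of "[v, w, v]"] 1[of "[w, v, v]"] v by simp_all
qed

lemma jac_W_cinf:
  assumes x: "x1 \<in> vector_fields M" "x2 \<in> vector_fields M" "x3 \<in> vector_fields M" shows "jac W x1 x2 x3 \<in> cinf M"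
proof -
  have "\<forall>xs. length xs = 3 \<and> set xs \<subseteq> vector_fields M \<longrightarrow> (\<lambda>p. \<Omega> p (map (\<lambda>x. x p) xs)) \<in> cinf M"
    using \<Omega>_forms unfolding forms_def mem_Collect_eq by (elim conjE)
  from spec[OF this, of "[x1, x2, x3]"] x have "(\<lambda>p. \<Omega> p [x1 p, x2 p, x3 p]) \<in> cinf M" by simp
  then show ?thesis unfolding jac_W by (rule cinf_uminus[OF M(1)])
qed

lemma jac_W_alternating: "alternating_trilinear_on (V0 W) (V1 W) (jac W)"
  unfolding alternating_trilinear_on_def linear_on_def V0_W V1_W
proof (intro conjI ballI allI image_subsetI)
  fix x y z assume x: "x \<in> vector_fields M" and y: "y \<in> vector_fields M" and z: "z \<in> vector_fields M"
  show "jac W x y z \<in> cinf M" "jac W x z y \<in> cinf M" "jac W z x y \<in> cinf M" by (intro jac_W_cinf x y z)+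
  fix w a b assume w: "w \<in> vector_fields M"
  note l = \<Omega>_lin1[OF vfM[OF z] vfM[OF w] vfM[OF x] vfM[OF y]] \<Omega>_lin2[OF vfM[OF z] vfM[OF w] vfM[OF x] vfM[OF y]]
    \<Omega>_lin3[OF vfM[OF z] vfM[OF w] vfM[OF x] vfM[OF y]]
  show "jac W x y (a *\<^sub>R z + b *\<^sub>R w) = a *\<^sub>R jac W x y z + b *\<^sub>R jac W x y w"
    "jac W x (a *\<^sub>R z + b *\<^sub>R w) y = a *\<^sub>R jac W x z y + b *\<^sub>R jac W x w y"
    "jac W (a *\<^sub>R z + b *\<^sub>R w) x y = a *\<^sub>R jac W z x y + b *\<^sub>R jac W w x y"
    unfolding jac_W field_comb_apply l by (simp_all add: scaleR_fun_def fun_eq_iff)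
next
  fix x y assume x: "x \<in> vector_fields M" and y: "y \<in> vector_fields M"
  note a = \<Omega>_alt1[OF vfM[OF x] vfM[OF x] vfM[OF x] vfM[OF y]] \<Omega>_alt2[OF vfM[OF x] vfM[OF x] vfM[OF x] vfM[OF y]]
    \<Omega>_alt3[OF vfM[OF x] vfM[OF x] vfM[OF x] vfM[OF y]]
  show "jac W x x y = 0" "jac W x y x = 0" "jac W y x x = 0" unfolding jac_W a by (simp_all add: fun_eq_iff)
qed

text \<open>The two field components vanish by the Jacobi identity. In the function component the
  iterated derivatives of each function cancel against its derivative along a Lie bracket, and the
  terms in B left over form minus the Koszul formula for dB.\<close>

lemma jacobi_G:
  assumes "e1 \<in> G" "e2 \<in> G" "e3 \<in> G"
  shows "bG e1 (bG e2 e3) + bG e2 (bG e3 e1) + bG e3 (bG e1 e2) = pull (jac W (prG e1) (prG e2) (prG e3))"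
proof -
  obtain x1 v1 g1 where 1: "e1 = (x1, v1, g1)" "rel x1 v1 g1" by (rule G_E[OF assms(1)])
  obtain x2 v2 g2 where 2: "e2 = (x2, v2, g2)" "rel x2 v2 g2" by (rule G_E[OF assms(2)])
  obtain x3 v3 g3 where 3: "e3 = (x3, v3, g3)" "rel x3 v3 g3" by (rule G_E[OF assms(3)])
  note x = rel_x[OF 1(2)] rel_x[OF 2(2)] rel_x[OF 3(2)] and g = rel_g[OF 1(2)] rel_g[OF 2(2)] rel_g[OF 3(2)]
  note l = lie_bracket_vector_fields[OF X]
  have "third x1 g1 (lie_bracket x2 x3) (third x2 g2 x3 g3) + third x2 g2 (lie_bracket x3 x1) (third x3 g3 x1 g1)
     + third x3 g3 (lie_bracket x1 x2) (third x1 g1 x2 g2) = jac W (pr x1) (pr x2) (pr x3) \<circ> \<pi>"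
  proof
    fix y
    have D: "x y (third z k w m) = x y (\<lambda>y. z y m) - x y (\<lambda>y. w y k) - x y (\<lambda>y. B y [z y, w y])"
      if "x \<in> vector_fields X" "z \<in> vector_fields X" "w \<in> vector_fields X" "k \<in> cinf X" "m \<in> cinf X" for x z k w m
    proof -
      note c = vf_cinf[OF that(2,5)] vf_cinf[OF that(3,4)] B_cinf[OF that(2,3)]
      show ?thesis
        unfolding third_def tangent_diff[OF X(1) vfX[OF that(1)] cinf_diff[OF X(1) c(1,2)] c(3)]
          tangent_diff[OF X(1) vfX[OF that(1)] c(1,2)] ..
    qed
    \<comment> \<open>\<open>S\<close>, \<open>N\<close> and \<open>N'\<close> bring the Koszul
      formula for dB into the cyclic form in which the brackets of \<open>G\<close> produce
      it.\<close>
    have S: "B y [lie_bracket u v y, w y] = - B y [w y, lie_bracket u v y]"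
      if "u \<in> vector_fields X" "v \<in> vector_fields X" "w \<in> vector_fields X" for u v w
      by (rule B_skew[OF vfX[OF l[OF that(1,2)]] vfX[OF that(3)]])
    have N: "x2 y (\<lambda>y. B y [x1 y, x3 y]) = - x2 y (\<lambda>y. B y [x3 y, x1 y])"
      unfolding B_skew[OF vfX[OF x(1)] vfX[OF x(3)]] by (rule tangent_uminus[OF X(1) vfX[OF x(2)] B_cinf[OF x(3,1)]])
    have N': "B y [x2 y, lie_bracket x1 x3 y] = - B y [x2 y, lie_bracket x3 x1 y]"
    proof -
      have "lie_bracket x1 x3 y = - lie_bracket x3 x1 y" unfolding lie_bracket_skew[OF X, of x1 x3] by simp
      then show ?thesis
        using B_lin2[OF vfX[OF l[OF x(3,1)]] vfX[OF l[OF x(3,1)]] vfX[OF x(2)], of y "-1" 0] by simp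
    qed
    have J: "jac W (pr x1) (pr x2) (pr x3) (\<pi> y) = - (x1 y (\<lambda>y. B y [x2 y, x3 y]) + x2 y (\<lambda>y. B y [x3 y, x1 y]) + x3 y (\<lambda>y. B y [x1 y, x2 y])
      + B y [x3 y, lie_bracket x1 x2 y] + B y [x2 y, lie_bracket x3 x1 y] + B y [x1 y, lie_bracket x2 x3 y])"
      unfolding jac_W pr_apply[OF 1(2), symmetric] pr_apply[OF 2(2), symmetric] pr_apply[OF 3(2), symmetric] dB[OF x]
        S[OF x(1,2,3)] S[OF x(1,3,2)] S[OF x(2,3,1)] N N' by simp
    show "(third x1 g1 (lie_bracket x2 x3) (third x2 g2 x3 g3) + third x2 g2 (lie_bracket x3 x1) (third x3 g3 x1 g1)
      + third x3 g3 (lie_bracket x1 x2) (third x1 g1 x2 g2)) y = (jac W (pr x1) (pr x2) (pr x3) \<circ> \<pi>) y"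
      unfolding comp_apply J plus_fun_apply
        third_def[of x1 g1 "lie_bracket x2 x3"] third_def[of x2 g2 "lie_bracket x3 x1"] third_def[of x3 g3 "lie_bracket x1 x2"]
        D[OF x(1) x(2) x(3) g(2) g(3)] D[OF x(2) x(3) x(1) g(3) g(1)] D[OF x(3) x(1) x(2) g(1) g(2)] lie_bracket_apply[OF X]
      by simp
  qed
  then show ?thesis
    unfolding 1(1) 2(1) 3(1) bG_simp pull_def prG_simp add_Pair jacobi[OF X x]
      jacobi[OF A rel_v[OF 1(2)] rel_v[OF 2(2)] rel_v[OF 3(2)]] by simp
qed

text \<open>The cocycle identity of \<open>\<Omega>\<close> is inherited from \<open>G\<close>, where it holds for the Jacobiator of every
  skew bracket.\<close>

lemma jac_W_cocycle:
  assumes "x1 \<in> vector_fields M" "x2 \<in> vector_fields M" "x3 \<in> vector_fields M" "x4 \<in> vector_fields M"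
  shows "lie_deriv x1 (jac W x2 x3 x4) - lie_deriv x2 (jac W x1 x3 x4)
       + lie_deriv x3 (jac W x1 x2 x4) - lie_deriv x4 (jac W x1 x2 x3)
       - jac W (lie_bracket x1 x2) x3 x4 + jac W (lie_bracket x1 x3) x2 x4 - jac W (lie_bracket x1 x4) x2 x3
       - jac W (lie_bracket x2 x3) x1 x4 + jac W (lie_bracket x2 x4) x1 x3 - jac W (lie_bracket x3 x4) x1 x2 = 0"
    (is "?S = 0")
proof -
  obtain e1 where 1: "e1 \<in> G" "prG e1 = x1" by (rule prG_surj[OF assms(1)])
  obtain e2 where 2: "e2 \<in> G" "prG e2 = x2" by (rule prG_surj[OF assms(2)])
  obtain e3 where 3: "e3 \<in> G" "prG e3 = x3" by (rule prG_surj[OF assms(3)])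
  obtain e4 where 4: "e4 \<in> G" "prG e4 = x4" by (rule prG_surj[OF assms(4)])
  note b = bG_pull[OF _ jac_W_cinf]
  have "pull ?S = 0"
    using skew_bracket_cancel[OF G_subspace bG_skew_bilinear 1(1) 2(1) 3(1) 4(1),
        where j="\<lambda>a b c. pull (jac W (prG a) (prG b) (prG c))", OF jacobi_G[symmetric]]
    unfolding 1(2) 2(2) 3(2) 4(2) b[OF 1(1) assms(2,3,4)] b[OF 2(1) assms(1,3,4)] b[OF 3(1) assms(1,2,4)] b[OF 4(1) assms(1,2,3)]
      prG_bracket[OF 1(1) 2(1)] prG_bracket[OF 1(1) 3(1)] prG_bracket[OF 1(1) 4(1)]
      prG_bracket[OF 2(1) 3(1)] prG_bracket[OF 2(1) 4(1)] prG_bracket[OF 3(1) 4(1)] pull_add pull_diff .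
  moreover have "pull 0 = 0" by (simp add: pull_def fun_eq_iff zero_prod_def)
  ultimately show "?S = 0" by (intro pull_inj) (simp only:)
qed

lemma bra_W_bilinear: "bilinear_on (V0 W) (V1 W) (V1 W) (bra W)"
  unfolding bilinear_on_def linear_on_def V0_W V1_W bra_W
proof (intro conjI ballI allI image_subsetI)
  fix x f assume x: "x \<in> vector_fields M" and f: "f \<in> cinf M"
  show "lie_deriv x f \<in> cinf M" unfolding lie_deriv_def by (rule vf_cinf[OF x f])
  then show "lie_deriv x f \<in> cinf M" .
  fix g a b assume g: "g \<in> cinf M"
  have e: "a *\<^sub>R f + b *\<^sub>R g = (\<lambda>m. a * f m + b * g m)" by (simp add: fun_eq_iff scaleR_fun_def)
  show "lie_deriv x (a *\<^sub>R f + b *\<^sub>R g) = a *\<^sub>R lie_deriv x f + b *\<^sub>R lie_deriv x g"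
    unfolding lie_deriv_def e tangent_lin[OF vfM[OF x] f g] by (simp add: fun_eq_iff scaleR_fun_def)
next
  fix x z f a b
  show "lie_deriv (a *\<^sub>R x + b *\<^sub>R z) f = a *\<^sub>R lie_deriv x f + b *\<^sub>R lie_deriv z f"
    by (simp add: lie_deriv_def fun_eq_iff scaleR_fun_def)
qed

lemma lie_2_algebra_W: "lie_2_algebra W"
proof (rule lie_2_algebraI[OF _ _ _ _ bra_W_bilinear jac_W_alternating])
  show "subspace (V0 W)" "subspace (V1 W)"
    unfolding V0_W V1_W by (rule subspace_vector_fields[OF M(1)] subspace_cinf[OF M(1)])+
  note 0 = subspace_0[OF this(1)]
  show "linear_on (V1 W) (V0 W) (dd W)" using 0 by (auto simp: linear_on_def dd_W)
  show "skew_bilinear_on (V0 W) (br W)"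
    unfolding V0_W br_W using skew_bilinear_lie_bracket[OF M] .
  show "dd W (bra W x f) = br W x (dd W f)" if "x \<in> V0 W" "f \<in> V1 W" for x f
    unfolding dd_W br_W by (rule lie_bracket_0(1)[OF M that(1)[unfolded V0_W], symmetric])
  show "bra W (dd W f) g = - bra W (dd W g) f" for f g
    by (simp add: dd_W bra_W lie_deriv_def fun_eq_iff)
  show "dd W (jac W x y z) = br W x (br W y z) + br W y (br W z x) + br W z (br W x y)"
    if "x \<in> V0 W" "y \<in> V0 W" "z \<in> V0 W" for x y z
    unfolding dd_W br_W by (rule jacobi[OF M, symmetric]) (use that in \<open>simp_all only: V0_W\<close>)
  show "jac W x y (dd W f) = bra W x (bra W y f) + bra W y (- bra W x f) + - bra W (br W x y) f"
    if x: "x \<in> V0 W" and y: "y \<in> V0 W" and f: "f \<in> V1 W" for x y f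
  proof -
    have "linear_on (V0 W) (V1 W) (jac W x y)"
      using jac_W_alternating x y unfolding alternating_trilinear_on_def by blast
    then have "jac W x y (dd W f) = 0" unfolding dd_W by (rule linear_on_0[OF _ 0])
    moreover have "y m (- (\<lambda>m. x m f)) = - y m (\<lambda>m. x m f)" for m
      using tangent_uminus[OF M(1) vfM[OF y[unfolded V0_W]] vf_cinf[OF x[unfolded V0_W] f[unfolded V1_W]], of m]
      by (simp add: fun_Compl_def)
    ultimately show ?thesis
      by (simp add: bra_W br_W lie_deriv_def lie_bracket_apply[OF M] fun_eq_iff)
  qed
  show "bra W x1 (jac W x2 x3 x4) - bra W x2 (jac W x1 x3 x4)
       + bra W x3 (jac W x1 x2 x4) - bra W x4 (jac W x1 x2 x3)
       - jac W (br W x1 x2) x3 x4 + jac W (br W x1 x3) x2 x4 - jac W (br W x1 x4) x2 x3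
       - jac W (br W x2 x3) x1 x4 + jac W (br W x2 x4) x1 x3 - jac W (br W x3 x4) x1 x2 = 0"
    if "x1 \<in> V0 W" "x2 \<in> V0 W" "x3 \<in> V0 W" "x4 \<in> V0 W" for x1 x2 x3 x4
    unfolding bra_W br_W by (rule jac_W_cocycle) (use that in \<open>simp_all only: V0_W\<close>)
qed

section \<open>The butterfly\<close>

definition "kap a = (anchor P a, bar_vf P a, - v_fun P \<gamma> a)"

definition "sig = (\<lambda>(x :: 'x \<Rightarrow> 'x tvec, pv :: 'p \<Rightarrow> 'p tvec, g :: 'x \<Rightarrow> real). (x, pv))"

lemma sig_simp: "sig (x, v, g) = (x, v)" by (simp add: sig_def)

lemma kap_eq: "a \<in> \<Gamma> \<Longrightarrow> kap a = (anchor P a, bar_vf P a, - vv a)"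
  by (simp only: kap_def v_fun_eq)

lemma kap_G: "a \<in> \<Gamma> \<Longrightarrow> kap a \<in> G"
  by (simp only: kap_eq G_I[OF rel_bar])

lemma kap_linear: "linear_on \<Gamma> G kap"
  unfolding linear_on_def
proof (intro conjI ballI allI image_subsetI)
  show "kap a \<in> G" if "a \<in> \<Gamma>" for a by (rule kap_G[OF that])
  show "kap (c *\<^sub>R a + d *\<^sub>R b) = c *\<^sub>R kap a + d *\<^sub>R kap b" if "a \<in> \<Gamma>" "b \<in> \<Gamma>" for a b c d
    unfolding kap_eq[OF that(1)] kap_eq[OF that(2)] kap_eq[OF \<Gamma>_comb[OF that]] anchor_lin bar_lin[OF that] vv_lin[OF that]
    by (simp add: scaleR_fun_def fun_eq_iff)
qed

lemma bG_kap:
  assumes e: "e \<in> G" and a: "a \<in> \<Gamma>" shows "bG e (kap a) = kap (bra L (sig e) a)"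
proof -
  obtain x v g where 1: "e = (x, v, g)" "rel x v g" by (rule G_E[OF e])
  show ?thesis
    unfolding 1(1) sig_simp bra_L kap_eq[OF a] kap_eq[OF bracket_\<Gamma>[OF 1(2) a]] bG_simp
      anchor_bracket[OF 1(2) a] bar_bracket[OF 1(2) a] vv_bracket[OF 1(2) a] by (simp del: fun_Compl_def)
qed

lemma sig_surj: "sig ` G = V0 L"
proof
  show "sig ` G \<subseteq> V0 L" by (auto simp: G_def sig_simp intro: V0_I)
  show "V0 L \<subseteq> sig ` G"
  proof
    fix e assume e: "e \<in> V0 L"
    obtain x v g where 1: "e = (x, v)" "rel x v g" by (rule V0_E[OF e])
    then show "e \<in> sig ` G" using imageI[OF G_I[OF 1(2)], of sig] by (simp add: sig_simp)
  qed
qed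

lemma exact_pull_sig: "short_exact pull (cinf M) G sig (V0 L)"
  unfolding short_exact_def
proof (intro conjI sig_surj)
  show "inj_on pull (cinf M)" by (rule inj_onI) (rule pull_inj)
  show "pull ` cinf M = {e \<in> G. sig e = 0}"
  proof (intro equalityI subsetI)
    fix e assume "e \<in> pull ` cinf M"
    then show "e \<in> {e \<in> G. sig e = 0}" using pull_G by (auto simp: pull_def sig_simp zero_prod_def)
  next
    fix e assume "e \<in> {e \<in> G. sig e = 0}"
    then have e: "e \<in> G" "sig e = 0" by simp_all
    obtain x v g where 1: "e = (x, v, g)" "rel x v g" by (rule G_E[OF e(1)])
    have 0: "x = 0" "v = 0" using e(2) by (simp_all add: 1(1) sig_simp zero_prod_def)
    \<comment> \<open>With both fields zero, \<delta>g = 0. By \<open>\<pi>_connected\<close> the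
      function is then constant on the fibres of \<pi> and descends to M.\<close>
    have "g (s q) = g (t q)" for q using rel_\<gamma>[OF 1(2), of q] \<gamma>_0[of q] unfolding 0 zero_fun_apply by simp
    then have inv: "g y = g z" if "\<pi> y = \<pi> z" for y z using \<pi>_connected[OF that] by metis
    define f where "f m = g (SOME y. \<pi> y = m)" for m
    have f: "f (\<pi> y) = g y" for y
      unfolding f_def by (rule inv) (rule someI[of "\<lambda>z. \<pi> z = \<pi> y", OF refl])
    have "f \<in> cinf M"
      by (rule cinf_descend[OF X M submersions(3)]) (simp add: f rel_g[OF 1(2)])
    moreover have "e = pull f" by (simp add: 1(1) 0 pull_def fun_eq_iff f)
    ultimately show "e \<in> pull ` cinf M" by blast
  qed
qed

lemma exact_kap_prG: "short_exact kap \<Gamma> G prG (vector_fields M)"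
  unfolding short_exact_def
proof (intro conjI)
  show "inj_on kap \<Gamma>"
  proof (rule inj_onI)
    fix a b assume a: "a \<in> \<Gamma>" and b: "b \<in> \<Gamma>" and eq: "kap a = kap b"
    show "a = b"
      by (rule \<Gamma>_eqI[OF a b]) (use eq in \<open>simp_all add: kap_eq[OF a] kap_eq[OF b] fun_eq_iff\<close>)
  qed
  show "prG ` G = vector_fields M"
  proof (intro equalityI subsetI)
    fix z assume "z \<in> prG ` G" then show "z \<in> vector_fields M" using prG_field by blast
  next
    fix z assume "z \<in> vector_fields M"
    then obtain e where "e \<in> G" "prG e = z" by (rule prG_surj)
    then show "z \<in> prG ` G" by blast
  qed
  show "kap ` \<Gamma> = {e \<in> G. prG e = 0}"
  proof (intro equalityI subsetI)
    fix e assume "e \<in> kap ` \<Gamma>"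
    then obtain a where a: "a \<in> \<Gamma>" "e = kap a" by blast
    have "prG e = 0" unfolding a(2) kap_eq[OF a(1)] prG_simp by (rule pr_vertical[OF anchor_vertical[OF a(1)]])
    then show "e \<in> {e \<in> G. prG e = 0}" using kap_G[OF a(1)] a(2) by simp
  next
    fix e assume "e \<in> {e \<in> G. prG e = 0}"
    then have e: "e \<in> G" "prG e = 0" by simp_all
    obtain x v g where 1: "e = (x, v, g)" "rel x v g" by (rule G_E[OF e(1)])
    have "tmap M \<pi> (x y) = 0" for y
      using pr_apply[OF 1(2), of y] e(2) unfolding 1(1) prG_simp by simp
    \<comment> \<open>The section is chosen with anchor \<open>x\<close> and function - g; its image
      under \<kappa> has the same \<open>x\<close> and \<open>g\<close> as \<open>e\<close>, and
      these determine the field on P.\<close>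
    from \<Gamma>_exists[OF rel_x[OF 1(2)] this subspace_neg[OF subspace_cinf[OF X(1)] rel_g[OF 1(2)]]]
    obtain a where a: "a \<in> \<Gamma>" "anchor P a = x" "vv a = - g" .
    have g: "g = - vv a" unfolding a(3) by (simp add: fun_eq_iff)
    have "v = bar_vf P a" by (rule rel_unique_third[OF 1(2) rel_bar[OF a(1)] a(2)[symmetric] g])
    then have "e = kap a" unfolding kap_eq[OF a(1)] 1(1) a(2) using g by simp
    then show "e \<in> kap ` \<Gamma>" using a(1) by blast
  qed
qed

lemma butterfly_G: "butterfly L W G bG kap pull sig prG"
  unfolding butterfly_def V1_L V1_W V0_W
proof (intro conjI ballI)
  show "lie_2_algebra L" "lie_2_algebra W" "subspace G" "skew_bilinear_on G bG" "linear_on \<Gamma> G kap"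
    "short_exact pull (cinf M) G sig (V0 L)"
    by (fact lie_2_algebra_L lie_2_algebra_W G_subspace bG_skew_bilinear kap_linear exact_pull_sig)+
  show "linear_on (cinf M) G pull" using pull_G pull_lin by (auto simp: linear_on_def)
  show "linear_on G (V0 L) sig" using sig_surj by (auto simp: linear_on_def sig_def)
  show "linear_on G (vector_fields M) prG" using prG_field prG_lin by (auto simp: linear_on_def)
  show "sig (kap a) = dd L a" for a by (simp add: kap_def sig_simp dd_L)
  have p0: "pr 0 = 0" by (rule pr_vertical) (simp only: zero_fun_apply tmap_0)
  show "prG (pull f) = dd W f" for f unfolding pull_def prG_simp p0 dd_W ..
  show "sig (pull f) = 0" for f by (simp add: pull_def sig_simp zero_prod_def)
  show "prG (kap a) = 0" if "a \<in> \<Gamma>" for a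
    using exact_kap_prG that unfolding short_exact_def by blast
  show "bG e (pull f) = pull (bra W (prG e) f)" if "e \<in> G" "f \<in> cinf M" for e f
    unfolding bra_W by (rule bG_pull[OF that])
  show "bG e (kap a) = kap (bra L (sig e) a)" if "e \<in> G" "a \<in> \<Gamma>" for e a by (rule bG_kap[OF that])
next
  fix e e' assume e: "e \<in> G" "e' \<in> G"
  show "sig (bG e e') = br L (sig e) (sig e')"
    by (cases e; cases e') (simp add: bG_simp sig_simp br_L)
  show "prG (bG e e') = br W (prG e) (prG e')" unfolding br_W by (rule prG_bracket[OF e])
next
  fix e1 e2 e3 assume e: "e1 \<in> G" "e2 \<in> G" "e3 \<in> G"
  have "kap 0 = 0" by (rule linear_on_0[OF kap_linear subspace_0[OF \<Gamma>_subspace]])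
  then show "bG e1 (bG e2 e3) + bG e2 (bG e3 e1) + bG e3 (bG e1 e2) =
      pull (jac W (prG e1) (prG e2) (prG e3)) + kap (jac L (sig e1) (sig e2) (sig e3))"
    unfolding jac_L jacobi_G[OF e] by simp
qed

lemma G_eq: "G = {(x, pv, g). (x, pv) \<in> V0 L \<and> g \<in> cinf X \<and>
  simplicial_diff0_fun P g = form_fun (interior_prod pv \<gamma>)}"
proof -
  have "rel x v g \<longleftrightarrow> (x, v) \<in> V0 L \<and> g \<in> cinf X \<and> simplicial_diff0_fun P g = form_fun (interior_prod v \<gamma>)" for x v g
    unfolding V0_L multiplicative_rel rel_def simplicial_diff0_fun_def form_fun_def interior_prod_def fun_eq_iff by metis
  then show ?thesis by (simp add: G_def)
qed

lemma invertible_butterfly_G: "invertible_butterfly L W G bG kap pull sig prG"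
  unfolding invertible_butterfly_def V1_L V0_W by (intro conjI butterfly_G exact_kap_prG)

end

theorem theorem3p3:
  fixes M :: "('m::{t2_space, second_countable_topology}, 'd::euclidean_space) space"
    and P :: "('p::{t2_space, second_countable_topology}, 'e::euclidean_space,
               'x::{t2_space, second_countable_topology}, 'f::euclidean_space) groupoid"
    and \<pi> :: "'x \<Rightarrow> 'm"
    and \<Phi> :: "'p \<Rightarrow> 'x \<times> 'x"
    and act :: "complex \<Rightarrow> 'p \<Rightarrow> 'p"
    and \<gamma> :: "'p form"
    and B :: "'x form"
    and \<Omega> :: "'m form"
  assumes "bundle_gerbe M P \<pi> \<Phi> act"
    and "gerbe_connection P act \<gamma>"
    and "curving P \<gamma> B"
    and "three_curvature M P \<pi> B \<Omega>"
  shows "invertible_butterfly (mult_vf_lie2 P) (atiyah_lie2 M \<Omega>)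
     {(x, pv, g). (x, pv) \<in> V0 (mult_vf_lie2 P) \<and> g \<in> cinf (obj P) \<and>
        simplicial_diff0_fun P g = form_fun (interior_prod pv \<gamma>)}
     (\<lambda>(x, pv, g) (z, rv, h).
        (lie_bracket x z, lie_bracket pv rv,
         lie_deriv x h - lie_deriv z g - form_fun (interior_prod z (interior_prod x B))))
     (\<lambda>a. (anchor P a, bar_vf P a, - v_fun P \<gamma> a))
     (\<lambda>f. (0, 0, f \<circ> \<pi>))
     (\<lambda>(x, pv, g). (x, pv))
     (\<lambda>(x, pv, g). projected_vf M \<pi> x)"
proof -
  interpret gerbe M P \<pi> \<Phi> act \<gamma> B \<Omega> by unfold_locales (fact assms)+
  show ?thesis
    by (rule invertible_butterfly_G[unfolded G_eq bG_def kap_def[abs_def] pull_def[abs_def] sig_def prG_def])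
qed

end
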